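(* Let $k\ge 1$ and $r\ge 0$ be integers and set $m=2k+r+1$. Let $\mathcal A$ be an arrangement of $m$ distinct lines in the real projective plane $\mathbb P^2=\mathbb P^2_{\mathbb R}$ having - a point $x_0$ of multiplicity $k-1$, and - two points $x_1,x_2$, each of multiplicity at least $2$ in $\mathcal A$, with $x_0,x_1,x_2$ distinct, such that $\{x_0,x_1,x_2\}$ is contained in a line $H$ which is not in $\mathcal A$. Then $\mathcal A$ is free with exponents $(k,k+r)$ if and only if $c_2(\mathcal T_{\mathbb P^2}(-\log D_{\mathcal A}))=k(k+r)$.
   Context: For a line arrangement $\mathcal A=(H_1,\dots,H_m)$ (distinct lines of $\mathbb P^2_{\mathbb R}$), $D_{\mathcal A}=H_1\cup\dots\cup H_m$; let $f$ be the product of linear forms defining the $H_i$. The sheaf of logarithmic vector fields is $$\mathcal T_{\mathbb P^2}(-\log D_{\mathcal A})=\ker\Bigl((\partial_0 f,\partial_1 f,\partial_2 f):\mathcal O_{\mathbb P^2}^{3}\to\mathcal O_{\mathbb P^2}(m-1)\Bigr),$$ where $\partial_i=\partial/\partial x_i$ denotes the partial derivatives with respect to homogeneous coordinates of $\mathbb P^2$. It is a rank-2 vector bundle on $\mathbb P^2$. The arrangement $\mathcal A$ is free with exponents $(a,b)$ if $\mathcal T_{\mathbb P^2}(-\log D_{\mathcal A})\simeq\mathcal O_{\mathbb P^2}(-a)\oplus\mathcal O_{\mathbb P^2}(-b)$. A point has multiplicity $h$ in $\mathcal A$ if it lies on exactly $h$ lines of $\mathcal A$. Chern classes on $\mathbb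 P^2$ are written as integers. *)

theory Defs
  imports "HOL-Analysis.Analysis" "HOL-Computational_Algebra.Computational_Algebra"
begin

section \<open>The homogeneous coordinate ring of the real projective plane\<close>

text \<open>
  The ring \<open>\<real>[X0, X1, X2]\<close> is the iterated polynomial ring in which the outermost
  variable is \<open>X0\<close>, so that \<open>coeff (coeff (coeff p i) j) l\<close> is the coefficient of
  \<open>X0 ^ i * X1 ^ j * X2 ^ l\<close> in \<open>p\<close>.
\<close>

type_synonym S3 = "real poly poly poly"

definition cst :: "real \<Rightarrow> S3" where
  "cst c = [:[:[:c:]:]:]"

definition X0 :: S3 where "X0 = [:0, 1:]"
definition X1 :: S3 where "X1 = [:[:0, 1:]:]"
definition X2 :: S3 where "X2 = [:[:[:0, 1:]:]:]"

definition pdiff :: "nat \<Rightarrow> S3 \<Rightarrow> S3" where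
  "pdiff i p =
     (if i = 0 then pderiv p
      else if i = 1 then map_poly pderiv p
      else map_poly (map_poly pderiv) p)"

text \<open>The zero polynomial is homogeneous of every degree, and it is the only
  homogeneous element of negative degree.\<close>

definition homog :: "int \<Rightarrow> S3 \<Rightarrow> bool" where
  "homog d p \<longleftrightarrow>
     (\<forall>i j l. coeff (coeff (coeff p i) j) l \<noteq> 0 \<longrightarrow> int (i + j + l) = d)"


section \<open>The scheme \<open>Proj \<real>[X0, X1, X2]\<close>\<close>

definition prime_ideal_S3 :: "S3 set \<Rightarrow> bool" where
  "prime_ideal_S3 P \<longleftrightarrow>
     0 \<in> P \<and> (\<forall>g\<in>P. \<forall>h\<in>P. g + h \<in> P) \<and> (\<forall>g. \<forall>h\<in>P. g * h \<in> P) \<and>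
     1 \<notin> P \<and> (\<forall>g h. g * h \<in> P \<longrightarrow> g \<in> P \<or> h \<in> P)"

definition homogeneous_set :: "S3 set \<Rightarrow> bool" where
  "homogeneous_set P \<longleftrightarrow>
     (\<forall>g\<in>P. \<exists>n c. g = (\<Sum>e<n. c e) \<and> (\<forall>e<n. c e \<in> P \<and> homog (int e) (c e)))"

definition Proj :: "S3 set set" where
  "Proj = {P. prime_ideal_S3 P \<and> homogeneous_set P \<and> \<not> {X0, X1, X2} \<subseteq> P}"

text \<open>Only nonempty open sets are recorded: since \<open>Proj\<close> is irreducible, every
  nonempty open set contains the generic point, and a sheaf is determined by its values
  on them (its value on the empty set being zero).\<close>

definition opens :: "S3 set set set" where
  "opens = {U. U \<noteq> {} \<and>
     (\<exists>I. (\<forall>g\<in>I. \<exists>d. homog d g) \<and> U = {P \<in> Proj. \<not> I \<subseteq> P})}"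


section \<open>Sheaves of modules\<close>

text \<open>
  Let \<open>K\<close> be the field of fractions of the coordinate ring. As \<open>Proj\<close> is integral, the
  sections of \<open>\<O>(d)\<close> over a nonempty open set are the elements of \<open>K\<close> that near
  each point of the set are fractions of homogeneous elements with difference of degrees
  \<open>d\<close>, and restriction maps are inclusions. All sheaves below are presented as subsheaves of
  a constant sheaf of finite tuples over \<open>K\<close>; a tuple is a function on \<open>nat\<close> that vanishes
  from the length of the tuple on.
\<close>

type_synonym tup = "nat \<Rightarrow> S3 fract"
type_synonym sheaf = "S3 set set \<Rightarrow> tup set"

definition O_twist :: "int \<Rightarrow> S3 set set \<Rightarrow> S3 fract set" where
  "O_twist d U = {s. \<forall>P\<in>U. \<exists>a b e.
     homog (d + e) a \<and> homog e b \<and> b \<notin> P \<and> s = Fract a b}"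

text \<open>For \<open>ds = [d\<^sub>1, \<dots>, d\<^sub>n]\<close> this is the sheaf
  \<open>\<O>(d\<^sub>1) \<oplus> \<dots> \<oplus> \<O>(d\<^sub>n)\<close>; for the empty list it is the zero sheaf.\<close>

definition O_sum :: "int list \<Rightarrow> sheaf" where
  "O_sum ds U =
     {s. (\<forall>i<length ds. s i \<in> O_twist (ds ! i) U) \<and> (\<forall>i\<ge>length ds. s i = 0)}"

text \<open>\<open>\<phi> U\<close> is the component over \<open>U\<close> of a morphism of sheaves of
  \<open>\<O>\<close>-modules.\<close>

definition sheaf_hom :: "sheaf \<Rightarrow> sheaf \<Rightarrow> (S3 set set \<Rightarrow> tup \<Rightarrow> tup) \<Rightarrow> bool" where
  "sheaf_hom F G \<phi> \<longleftrightarrow> (\<forall>U\<in>opens.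
     (\<forall>s\<in>F U. \<phi> U s \<in> G U) \<and>
     (\<forall>s\<in>F U. \<forall>t\<in>F U. \<phi> U (\<lambda>i. s i + t i) = (\<lambda>i. \<phi> U s i + \<phi> U t i)) \<and>
     (\<forall>a\<in>O_twist 0 U. \<forall>s\<in>F U. \<phi> U (\<lambda>i. a * s i) = (\<lambda>i. a * \<phi> U s i)) \<and>
     (\<forall>V\<in>opens. V \<subseteq> U \<longrightarrow> (\<forall>s\<in>F U. \<phi> V s = \<phi> U s)))"

definition sheaf_iso :: "sheaf \<Rightarrow> sheaf \<Rightarrow> bool" where
  "sheaf_iso F G \<longleftrightarrow>
     (\<exists>\<phi>. sheaf_hom F G \<phi> \<and> (\<forall>U\<in>opens. bij_betw (\<phi> U) (F U) (G U)))"

text \<open>The section \<open>s\<close> over \<open>U\<close> lies in the image sheaf of \<open>\<phi>\<close>, that is, it has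
  preimages locally.\<close>

definition in_image_sheaf ::
  "sheaf \<Rightarrow> (S3 set set \<Rightarrow> tup \<Rightarrow> tup) \<Rightarrow> S3 set set \<Rightarrow> tup \<Rightarrow> bool" where
  "in_image_sheaf F \<phi> U s \<longleftrightarrow>
     (\<forall>P\<in>U. \<exists>V\<in>opens. P \<in> V \<and> V \<subseteq> U \<and> (\<exists>t\<in>F V. \<phi> V t = s))"


section \<open>Chern classes\<close>

text \<open>
  The list \<open>[ds\<^sub>0, \<dots>, ds\<^sub>n]\<close> of twists gives a resolution of \<open>E\<close> if there is an exact
  sequence of sheaves \<open>0 \<rightarrow> F\<^sub>n \<rightarrow> \<dots> \<rightarrow> F\<^sub>0 \<rightarrow> E \<rightarrow> 0\<close> with \<open>F\<^sub>j = O_sum ds\<^sub>j\<close>. The sequence is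
  continued to the left by zero sheaves, so that exactness at \<open>F\<^sub>n\<close> (injectivity)
  needs no separate clause.
\<close>

definition res_term :: "int list list \<Rightarrow> nat \<Rightarrow> sheaf" where
  "res_term dss j = O_sum (if j < length dss then dss ! j else [])"

definition is_resolution :: "sheaf \<Rightarrow> int list list \<Rightarrow> bool" where
  "is_resolution E dss \<longleftrightarrow> (\<exists>\<epsilon> \<delta>.
     sheaf_hom (res_term dss 0) E \<epsilon> \<and>
     (\<forall>j. sheaf_hom (res_term dss (Suc j)) (res_term dss j) (\<delta> j)) \<and>
     (\<forall>U\<in>opens. \<forall>s\<in>E U. in_image_sheaf (res_term dss 0) \<epsilon> U s) \<and>
     (\<forall>U\<in>opens. \<forall>s\<in>res_term dss 0 U.
        \<epsilon> U s = (\<lambda>_. 0) \<longleftrightarrow> in_image_sheaf (res_term dss 1) (\<delta> 0) U s) \<and>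
     (\<forall>j. \<forall>U\<in>opens. \<forall>s\<in>res_term dss (Suc j) U.
        \<delta> j U s = (\<lambda>_. 0) \<longleftrightarrow>
        in_image_sheaf (res_term dss (Suc (Suc j))) (\<delta> (Suc j)) U s))"

text \<open>
  The variable of the following polynomials is the class \<open>h\<close> of a line, and Chern classes
  live in \<open>\<int>[h] / h ^ 3\<close>. The total Chern class is the multiplicative invariant of
  exact sequences with \<open>c(\<O>(d)) = 1 + d h\<close>. Every coherent sheaf on the plane has a
  finite resolution by sums of line bundles \<open>\<O>(d)\<close>, and so
  \<open>c(E) = c(F\<^sub>0) c(F\<^sub>1)\<^sup>-\<^sup>1 c(F\<^sub>2) \<dots>\<close> modulo \<open>h ^ 3\<close>, independently of the
  resolution; the odd factors are moved to the other side.
\<close>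

definition chern_sum :: "int list \<Rightarrow> int poly" where
  "chern_sum ds = (\<Prod>d\<leftarrow>ds. [:1, d:])"

definition has_chern_classes :: "sheaf \<Rightarrow> int \<Rightarrow> int \<Rightarrow> bool" where
  "has_chern_classes E c1 c2 \<longleftrightarrow> (\<exists>dss. is_resolution E dss \<and>
     monom 1 3 dvd
       [:1, c1, c2:] * (\<Prod>j | j < length dss \<and> odd j. chern_sum (dss ! j)) -
       (\<Prod>j | j < length dss \<and> even j. chern_sum (dss ! j)))"

definition chern2 :: "sheaf \<Rightarrow> int" where
  "chern2 E = (THE c2. \<exists>c1. has_chern_classes E c1 c2)"


section \<open>Line arrangements and logarithmic vector fields\<close>

text \<open>Points and lines of the real projective plane are the linear subspaces of
  dimension 1 and 2 of \<open>real ^ 3\<close>; incidence is inclusion.\<close>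

definition proj_point :: "(real ^ 3) set \<Rightarrow> bool" where
  "proj_point p \<longleftrightarrow> subspace p \<and> dim p = 1"

definition proj_line :: "(real ^ 3) set \<Rightarrow> bool" where
  "proj_line L \<longleftrightarrow> subspace L \<and> dim L = 2"

definition line_arrangement :: "(real ^ 3) set set \<Rightarrow> bool" where
  "line_arrangement A \<longleftrightarrow> finite A \<and> (\<forall>L\<in>A. proj_line L)"

definition point_mult :: "(real ^ 3) set set \<Rightarrow> (real ^ 3) set \<Rightarrow> nat" where
  "point_mult A p = card {L \<in> A. p \<subseteq> L}"

definition linear_form :: "real ^ 3 \<Rightarrow> S3" where
  "linear_form v = cst (v $ 1) * X0 + cst (v $ 2) * X1 + cst (v $ 3) * X2"

text \<open>The coefficient vector of an equation of a line is determined up to a nonzero real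
  factor; rescaling the product of the equations does not change the kernel sheaf below.\<close>

definition line_coeffs :: "(real ^ 3) set \<Rightarrow> real ^ 3" where
  "line_coeffs L = (SOME v. v \<noteq> 0 \<and> L = {x. v \<bullet> x = 0})"

definition arr_poly :: "(real ^ 3) set set \<Rightarrow> S3" where
  "arr_poly A = (\<Prod>L\<in>A. linear_form (line_coeffs L))"

text \<open>The kernel of \<open>(\<partial>\<^sub>0 f, \<partial>\<^sub>1 f, \<partial>\<^sub>2 f) : \<O>\<^sup>3 \<rightarrow> \<O>(m - 1)\<close>.\<close>

definition log_sheaf :: "(real ^ 3) set set \<Rightarrow> sheaf" where
  "log_sheaf A U =
     {s \<in> O_sum [0, 0, 0] U. (\<Sum>i<3. Fract (pdiff i (arr_poly A)) 1 * s i) = 0}"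

definition free_with_exponents :: "(real ^ 3) set set \<Rightarrow> nat \<Rightarrow> nat \<Rightarrow> bool" where
  "free_with_exponents A a b \<longleftrightarrow> sheaf_iso (log_sheaf A) (O_sum [- int a, - int b])"

end

theory Submission
  imports Defs "HOL-Library.Function_Algebras"
begin

text \<open>
  The Chern classes of \<open>T\<close> are read off from the Hilbert polynomial of the module of derivations
  that annihilate \<open>f\<close>; together with the multiples of the Euler derivation \<open>E\<close> these form the module
  \<open>D\<close> of all logarithmic derivations. Restriction of \<open>D\<close> to the line \<open>H\<close>, which contains \<open>n\<close> points
  of the arrangement, bounds the growth of the Hilbert function and gives \<open>c\<^sub>2 \<ge> (n - 1) (m - n)\<close>,
  with equality only if all the restrictions are onto; in that case there are derivations \<open>s\<close>, \<open>t\<close> of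
  degrees \<open>n - 1\<close>, \<open>m - n\<close> with \<open>det (E, s, t)\<close> a nonzero multiple of \<open>f\<close>, and \<open>D\<close> is free by Saito's
  criterion. The multiplicities of the three points give \<open>m - n \<ge> k\<close>. If \<open>n \<ge> k + 1\<close>, then
  \<open>(n - 1) (m - n) \<ge> k (k + r)\<close>, so that \<open>c\<^sub>2 = k (k + r)\<close> is the case of equality, and
  \<open>{n - 1, m - n} = {k, k + r}\<close>.

  The case \<open>n \<le> k\<close> contradicts \<open>c\<^sub>2 = k (k + r)\<close>: adding the lines one at a time, beginning with those
  through \<open>x\<^sub>0\<close>, the same restriction argument shows that \<open>c\<^sub>2\<close> is at least \<open>1\<close> plus the sum of the
  numbers \<open>n\<^sub>i - 1\<close>, where \<open>n\<^sub>i\<close> counts the points of the earlier lines on the \<open>i\<close>-th line. It follows that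
  the \<open>N = k + r + 2\<close> lines off \<open>x\<^sub>0\<close> meet in points that lie on at most \<open>N - 1\<close> lines through
  \<open>x\<^sub>0\<close>. Dually, \<open>N\<close> points of an affine plane, not all on a line because of \<open>x\<^sub>1\<close> and \<open>x\<^sub>2\<close>,
  determine at most \<open>N - 1\<close> directions. By Ungar's theorem this is impossible if \<open>N\<close> is even. If \<open>N\<close> is
  odd, one can remove a point such that at most \<open>N - 2\<close> directions remain.
\<close>

text \<open>\<open>chern2\<close> is a definite description over resolutions, so it has a value only
  once a resolution exists and all of them agree. A two-term resolution is built from syzygies, and
  agreement holds because the alternating sum of the dimensions of the terms is, in large degrees,
  the Hilbert function of one and the same module. Rank and first Chern class are not given either:
  they are forced by squeezing this function between two quadratics that differ by a constant.
  Restriction to a line with \<open>n\<close> points bounds each growth step of the Hilbert function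
  by three terms. The deficits accumulate to \<open>2 (c2 - (n - 1) (m - n))\<close>; this is how a
  numerical equality can produce actual derivations. For \<open>n <= k\<close> that bound lies below
  \<open>k (k + r)\<close> and says nothing, which forces the detour through adding lines. Its gain
  consists of coincidences on lines through \<open>x0\<close>, and counting these turns the problem
  into one on directions of dual points. Ungar's theorem asks for an even number of points because a
  permutation is cut into two halves of equal size.\<close>

section \<open>Real vector space structures on polynomials and functions\<close>

instantiation poly :: (real_vector) real_vector
begin
definition scaleR_poly_def: "scaleR r p = map_poly (scaleR r) p"
instance
  by standard (auto simp: scaleR_poly_def poly_eq_iff coeff_map_poly scaleR_add_right scaleR_add_left)
end

lemma coeff_scaleR: "coeff (r *\<^sub>R p) i = r *\<^sub>R coeff p i"
  by (simp add: scaleR_poly_def coeff_map_poly)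

text \<open>With this the library notions of \<open>span\<close>, \<open>dim\<close> and
  \<open>linear\<close> apply to \<open>S3\<close>, where scalar multiplication is multiplication by
  \<open>cst\<close> (\<open>scaleR_S3\<close>).\<close>

instance poly :: ("{real_algebra_1, comm_ring_1}") real_algebra_1
  by standard (auto simp: poly_eq_iff coeff_scaleR coeff_mult scaleR_sum_right)

instantiation "fun" :: (type, real_vector) real_vector
begin
definition scaleR_fun_def: "scaleR r f = (\<lambda>x. r *\<^sub>R f x)"
instance
  by standard (auto simp: scaleR_fun_def scaleR_add_right scaleR_add_left)
end

lemma scaleR_fun_apply [simp]: "(r *\<^sub>R f) x = r *\<^sub>R f x"
  by (simp add: scaleR_fun_def)

lemma of_real_poly: "(of_real r :: 'a::{real_algebra_1,comm_ring_1} poly) = [:of_real r:]"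
  by (simp add: poly_eq_iff of_real_def coeff_scaleR one_pCons coeff_pCons split: nat.splits)

lemma cst_of_real: "cst r = of_real r"
  by (simp add: cst_def of_real_poly)

lemma scaleR_S3: "r *\<^sub>R p = cst r * p"
  by (simp add: cst_of_real scaleR_conv_of_real)

section \<open>Rank and nullity\<close>


text \<open>\<open>dim\<close> of a space without a finite basis is 0 by convention, so monotonicity
  and rank-nullity need finiteness as a separate hypothesis.\<close>

definition findim :: "'a::real_vector set \<Rightarrow> bool" where
  "findim V \<longleftrightarrow> (\<exists>W. finite W \<and> V \<subseteq> span W)"

lemma findim_subset: "findim W \<Longrightarrow> V \<subseteq> W \<Longrightarrow> findim V"
  unfolding findim_def by blast

lemma findim_independent:
  assumes "findim V" "independent B" "B \<subseteq> V"
  shows "finite B" "card B \<le> dim V"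
proof -
  obtain W where W: "finite W" "V \<subseteq> span W" using assms(1) findim_def by blast
  show fin: "finite B" using real_vector.independent_span_bound[OF W(1) assms(2)] W assms(3) by blast
  obtain C where C: "B \<subseteq> C" "C \<subseteq> V" "independent C" "V \<subseteq> span C"
    using real_vector.maximal_independent_subset_extend[OF assms(3,2)] by blast
  have "finite C" using real_vector.independent_span_bound[OF W(1) C(3)] C(2) W by blast
  with C show "card B \<le> dim V"
    using real_vector.basis_card_eq_dim[of C V] by (metis card_mono)
qed

lemma findim_basis:
  assumes "findim V"
  obtains B where "B \<subseteq> V" "independent B" "V \<subseteq> span B" "finite B" "card B = dim V"
  using real_vector.basis_exists[of V] findim_independent[OF assms] by metis

lemma dim_mono_findim:
  assumes "findim W" "V \<subseteq> W"
  shows "dim V \<le> dim W"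
proof -
  obtain B where B: "B \<subseteq> V" "independent B" "V \<subseteq> span B" "card B = dim V"
    using real_vector.basis_exists[of V] by metis
  show ?thesis using findim_independent(2)[OF assms(1) B(2)] B assms(2) by auto
qed

text \<open>A basis \<open>B\<close> of the kernel is extended to a basis \<open>C\<close> of
  \<open>V\<close>; then \<open>f\<close> maps \<open>C - B\<close> injectively onto a basis of the
  image.\<close>

lemma rank_nullity:
  fixes f :: "'a::real_vector \<Rightarrow> 'b::real_vector"
  assumes "linear f" "subspace V" "findim V"
  shows "dim V = dim {x \<in> V. f x = 0} + dim (f ` V)" and "findim (f ` V)"
proof -
  interpret f: linear f by fact
  let ?K = "{x \<in> V. f x = 0}"
  have fdK: "findim ?K" by (rule findim_subset[OF assms(3)]) auto
  obtain B where B: "B \<subseteq> ?K" "independent B" "?K \<subseteq> span B" "finite B" "card B = dim ?K"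
    by (rule findim_basis[OF fdK])
  obtain C where C: "B \<subseteq> C" "C \<subseteq> V" "independent C" "V \<subseteq> span C"
    using real_vector.maximal_independent_subset_extend[of B V] B by auto
  have finC: "finite C" using findim_independent(1)[OF assms(3)] C by blast
  have sC: "span C = V" using C assms(2) by (simp add: real_vector.span_subspace)
  have cC: "card C = dim V" using C real_vector.basis_card_eq_dim by blast
  have inj: "inj_on f (span (C - B))"
  proof (rule inj_onI)
    fix x y assume x: "x \<in> span (C - B)" and y: "y \<in> span (C - B)" and e: "f x = f y"
    have d: "x - y \<in> span (C - B)" using x y by (simp add: real_vector.span_diff)
    have "x - y \<in> V" using d sC real_vector.span_mono[of "C - B" C] by blast
    then have "x - y \<in> ?K" using e by (simp add: f.diff)
    then have "x - y \<in> span B" using B by blast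
    \<comment> \<open>The vector lies in \<open>span B\<close> and in \<open>span (C - B)\<close>,
      so its representation over the independent set \<open>C\<close> is supported on two disjoint
      sets.\<close>
    have "x - y = 0"
    proof -
      let ?r = "real_vector.representation C (x - y)"
      have "?r v = 0" for v
      proof (cases "v \<in> B")
        case True
        have "?r = real_vector.representation (C - B) (x - y)"
          by (rule real_vector.representation_extend[OF C(3) d]) auto
        then show ?thesis using True real_vector.representation_ne_zero by fastforce
      next
        case False
        have "?r = real_vector.representation B (x - y)"
          by (rule real_vector.representation_extend[OF C(3) \<open>x - y \<in> span B\<close> C(1)])
        then show ?thesis using False real_vector.representation_ne_zero by fastforce
      qed
      moreover have "(\<Sum>v | ?r v \<noteq> 0. ?r v *\<^sub>R v) = x - y"
        by (rule real_vector.sum_nonzero_representation_eq[OF C(3)]) (use sC \<open>x - y \<in> V\<close> in simp)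
      ultimately show ?thesis by simp
    qed
    then show "x = y" by simp
  qed
  have ind: "independent (f ` (C - B))"
    by (rule real_vector.linear_independent_injective_image[OF assms(1) _ inj])
      (use C(3) real_vector.independent_mono[of C "C - B"] in auto)
  have sp: "f ` V \<subseteq> span (f ` (C - B))"
  proof -
    have "f ` V = span (f ` C)" using linear_span_image[OF assms(1), of C] sC by simp
    also have "f ` C \<subseteq> span (f ` (C - B))"
      using B(1) real_vector.span_zero real_vector.span_base[of _ "f ` (C - B)"] by fastforce
    then have "span (f ` C) \<subseteq> span (f ` (C - B))"
      by (rule real_vector.span_minimal) simp
    finally show ?thesis .
  qed
  show "findim (f ` V)" unfolding findim_def
    by (intro exI[of _ "f ` (C - B)"] conjI sp) (use finC in simp)
  have "card (f ` (C - B)) = dim (f ` V)"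
    by (rule real_vector.basis_card_eq_dim[OF _ sp ind]) (use C in auto)
  moreover have "card (f ` (C - B)) = card (C - B)"
    by (rule card_image, rule inj_on_subset[OF inj]) (rule real_vector.span_superset)
  moreover have "card (C - B) = card C - card B" using C(1) B(4) by (intro card_Diff_subset)
  moreover have "card B \<le> card C" using C(1) finC by (intro card_mono)
  ultimately show "dim V = dim {x \<in> V. f x = 0} + dim (f ` V)" using cC B(5) by simp
qed

lemma dim_image_inj:
  assumes "linear f" "subspace V" "findim V" "\<And>x. x \<in> V \<Longrightarrow> f x = 0 \<Longrightarrow> x = 0"
  shows "dim (f ` V) = dim V"
proof -
  have "{x \<in> V. f x = 0} = {0}"
    using assms real_vector.subspace_0[OF assms(2)] linear_0[OF assms(1)] by auto
  moreover have "dim {0::'a} = 0" using real_vector.dim_le_card[of "{0::'a}" "{}"] by simp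
  ultimately show ?thesis using rank_nullity(1)[OF assms(1-3)] by simp
qed

text \<open>Generators of the kernel together with preimages of generators of the image span
  \<open>V\<close>.\<close>

lemma findim_preimage:
  fixes f :: "'a::real_vector \<Rightarrow> 'b::real_vector"
  assumes "linear f" "subspace V" "findim {x \<in> V. f x = 0}" "findim (f ` V)"
  shows "findim V"
proof -
  obtain A where A: "finite A" "{x \<in> V. f x = 0} \<subseteq> span A" using assms(3) findim_def by blast
  obtain B where B: "B \<subseteq> f ` V" "f ` V \<subseteq> span B" "finite B"
    using findim_basis[OF assms(4)] by metis
  obtain C where C: "C \<subseteq> V" "finite C" "B = f ` C" using B(1,3) by (meson finite_subset_image)
  interpret f: linear f by fact
  have "V \<subseteq> span (A \<union> C)"
  proof
    fix x assume x: "x \<in> V"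
    then have "f x \<in> span (f ` C)" using B C by blast
    then have "f x \<in> f ` span C" by (simp add: linear_span_image[OF assms(1)])
    then obtain y where y: "y \<in> span C" "f x = f y" by auto
    have "y \<in> V" using y(1) C(1) assms(2) real_vector.span_minimal by blast
    then have "x - y \<in> span A" using A x y assms(2) by (auto simp: f.diff real_vector.subspace_diff)
    then have "(x - y) + y \<in> span (A \<union> C)"
      using y real_vector.span_mono[of A "A \<union> C"] real_vector.span_mono[of C "A \<union> C"]
      by (intro real_vector.span_add) auto
    then show "x \<in> span (A \<union> C)" by simp
  qed
  then show ?thesis unfolding findim_def by (intro exI[of _ "A \<union> C"]) (use A C in simp)
qed

lemma dim_le_ker_im:
  assumes "linear f" "subspace V" "findim V" "findim W" "f ` V \<subseteq> W"
  shows "dim V \<le> dim {x \<in> V. f x = 0} + dim W"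
  using rank_nullity[OF assms(1-3)] dim_mono_findim[OF assms(4,5)] by simp

section \<open>Gradings\<close>

text \<open>The axioms are stable under adjoining a variable of degree 1, so that three applications
  of \<open>graded_lift\<close> to the reals give the grading of \<open>S3\<close>.
  \<open>hc_sum\<close> speaks of all large \<open>m\<close> so that the cut-offs of several
  elements can be replaced by a common one.\<close>

locale graded =
  fixes h :: "int \<Rightarrow> 'a::comm_ring_1 \<Rightarrow> bool" and hc :: "int \<Rightarrow> 'a \<Rightarrow> 'a"
  assumes h_zero [simp]: "h d 0"
    and h_add: "h d a \<Longrightarrow> h d b \<Longrightarrow> h d (a + b)"
    and h_uminus: "h d a \<Longrightarrow> h d (- a)"
    and h_mult: "h d a \<Longrightarrow> h e b \<Longrightarrow> h (d + e) (a * b)"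
    and h_neg: "h d a \<Longrightarrow> d < 0 \<Longrightarrow> a = 0"
    and h_one: "h 0 1"
    and h_hc: "h d (hc d a)"
    and hc_add: "hc d (a + b) = hc d a + hc d b"
    and hc_h: "h e a \<Longrightarrow> hc d a = (if d = e then a else 0)"
    and hc_sum: "\<exists>n. \<forall>m\<ge>n. a = (\<Sum>e<m. hc (int e) a)"
begin

lemma h_diff: "h d a \<Longrightarrow> h d b \<Longrightarrow> h d (a - b)"
  using h_add[of d a "- b"] h_uminus by simp

lemma h_sum: "(\<And>x. x \<in> A \<Longrightarrow> h d (f x)) \<Longrightarrow> h d (sum f A)"
  by (induct A rule: infinite_finite_induct) (auto intro: h_add)

lemma h_mult': "h d a \<Longrightarrow> h e b \<Longrightarrow> d + e = f \<Longrightarrow> h f (a * b)"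
  using h_mult by blast

lemma h_power: "h d a \<Longrightarrow> h (int n * d) (a ^ n)"
  by (induct n) (auto simp: h_one algebra_simps intro: h_mult')

lemma hc_0 [simp]: "hc d 0 = 0" using hc_h[of 0 0 d] by simp

lemma hc_neg: "d < 0 \<Longrightarrow> hc d a = 0" using h_neg[OF h_hc] .

lemma hc_sum_out: "hc d (sum f A) = (\<Sum>x\<in>A. hc d (f x))"
  by (induct A rule: infinite_finite_induct) (auto simp: hc_add)

text \<open>Multiplication by \<open>b\<close> shifts every component of \<open>a\<close> by
  \<open>e\<close>. The cut-off is enlarged so that the index \<open>d - e\<close> is among the
  summands.\<close>

lemma hc_mult: assumes "h e b" shows "hc d (a * b) = hc (d - e) a * b"
proof -
  obtain n where n0: "\<forall>m\<ge>n. a = (\<Sum>k<m. hc (int k) a)" using hc_sum[of a] ..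
  have n: "a = (\<Sum>k<m. hc (int k) a)" if "m \<ge> n" for m by (rule n0[rule_format, OF that])
  let ?m = "max n (nat (d - e) + 1)"
  have "a * b = (\<Sum>k<?m. hc (int k) a * b)" by (subst n[of ?m]) (simp_all add: sum_distrib_right)
  then have "hc d (a * b) = (\<Sum>k<?m. hc d (hc (int k) a * b))" by (simp add: hc_sum_out)
  also have "\<dots> = (\<Sum>k<?m. if int k = d - e then hc (d - e) a * b else 0)"
    by (rule sum.cong) (auto simp: hc_h[OF h_mult[OF h_hc assms]])
  also have "\<dots> = hc (d - e) a * b"
  proof (cases "d - e < 0")
    case True
    then show ?thesis by (simp add: hc_neg)
  next
    case False
    then have "(\<Sum>k<?m. if int k = d - e then hc (d - e) a * b else 0)
        = (\<Sum>k<?m. if k = nat (d - e) then hc (d - e) a * b else 0)"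
      by (intro sum.cong) auto
    then show ?thesis by simp
  qed
  finally show ?thesis .
qed

lemma hc_mult_left: assumes "h e b" shows "hc d (b * a) = b * hc (d - e) a"
  using hc_mult[OF assms] by (simp add: mult.commute)

lemma hc_all_zero: "(\<And>d. hc d a = 0) \<Longrightarrow> a = 0"
proof -
  assume z: "\<And>d. hc d a = 0"
  obtain n where "\<forall>m\<ge>n. a = (\<Sum>e<m. hc (int e) a)" using hc_sum[of a] ..
  then have "a = (\<Sum>e<n. hc (int e) a)" by (rule allE[of _ n]) (erule mp, rule order_refl)
  also have "\<dots> = 0" using z by simp
  finally show "a = 0" .
qed

text \<open>The sums up to \<open>nat e\<close> and up to its successor both equal \<open>a\<close>,
  so the last summand vanishes.\<close>

lemma hc_bound: "\<exists>n. \<forall>e\<ge>int n. hc e a = 0"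
proof -
  obtain n where n0: "\<forall>m\<ge>n. a = (\<Sum>k<m. hc (int k) a)" using hc_sum[of a] ..
  have n: "a = (\<Sum>k<m. hc (int k) a)" if "m \<ge> n" for m by (rule n0[rule_format, OF that])
  have "hc e a = 0" if "e \<ge> int n" for e
  proof -
    have "a = (\<Sum>k<nat e. hc (int k) a)" "a = (\<Sum>k<Suc (nat e). hc (int k) a)"
      using that by (intro n; linarith)+
    then have "hc (int (nat e)) a = 0" by simp
    then show ?thesis using that by simp
  qed
  then show ?thesis by blast
qed

end

text \<open>The outer variable has degree 1. Degrees are integers, so \<open>d - int i\<close> may
  be negative, and then \<open>h_neg\<close> makes the coefficient zero; no truncated subtraction
  occurs.\<close>

definition hl :: "(int \<Rightarrow> 'a::zero \<Rightarrow> bool) \<Rightarrow> int \<Rightarrow> 'a poly \<Rightarrow> bool" where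
  "hl h d p \<longleftrightarrow> (\<forall>i. h (d - int i) (coeff p i))"

definition hcl :: "(int \<Rightarrow> 'a::comm_ring_1 \<Rightarrow> 'a) \<Rightarrow> int \<Rightarrow> 'a poly \<Rightarrow> 'a poly" where
  "hcl hc d p = (\<Sum>i\<le>degree p. monom (hc (d - int i) (coeff p i)) i)"

context graded
begin

lemma coeff_hcl: "coeff (hcl hc d p) i = hc (d - int i) (coeff p i)"
proof (cases "i \<le> degree p")
  case True
  then show ?thesis by (simp add: hcl_def coeff_sum)
next
  case False
  then have "coeff p i = 0" by (simp add: coeff_eq_0)
  with False show ?thesis by (auto simp add: hcl_def coeff_sum intro!: sum.neutral)
qed

lemma graded_lift: "graded (hl h) (hcl hc)"
proof
  fix d e :: int and a b :: "'a poly"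
  show "hl h d 0" by (simp add: hl_def)
  show "hl h d a \<Longrightarrow> hl h d b \<Longrightarrow> hl h d (a + b)" by (simp add: hl_def h_add)
  show "hl h d a \<Longrightarrow> hl h d (- a)" by (simp add: hl_def h_uminus)
  show "hl h (d + e) (a * b)" if "hl h d a" "hl h e b"
    unfolding hl_def coeff_mult
  proof (intro allI h_sum)
    fix i j :: nat assume "j \<in> {..i}"
    then have e: "d + e - int i = (d - int j) + (e - int (i - j))" by simp
    show "h (d + e - int i) (coeff a j * coeff b (i - j))"
      unfolding e using that by (intro h_mult) (auto simp: hl_def)
  qed
  show "hl h d a \<Longrightarrow> d < 0 \<Longrightarrow> a = 0" unfolding hl_def poly_eq_iff by (auto intro: h_neg)
  show "hl h 0 1" by (simp add: hl_def one_pCons coeff_pCons h_one split: nat.split)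
  show "hl h d (hcl hc d a)" by (simp add: hl_def coeff_hcl h_hc)
  show "hcl hc d (a + b) = hcl hc d a + hcl hc d b" by (simp add: poly_eq_iff coeff_hcl hc_add)
  show "hl h e a \<Longrightarrow> hcl hc d a = (if d = e then a else 0)"
  proof (rule poly_eqI)
    fix i assume "hl h e a"
    then show "coeff (hcl hc d a) i = coeff (if d = e then a else 0) i"
      using hc_h[of "e - int i" "coeff a i" "d - int i"] by (simp add: coeff_hcl hl_def)
  qed
  have "\<forall>i. \<exists>n. \<forall>m\<ge>n. coeff a i = (\<Sum>e<m. hc (int e) (coeff a i))" by (intro allI hc_sum)
  then obtain n where n: "\<And>i m. m \<ge> n i \<Longrightarrow> coeff a i = (\<Sum>e<m. hc (int e) (coeff a i))" by metis
  \<comment> \<open>Degree \<open>d\<close> of \<open>a\<close> is degree \<open>d - i\<close> of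
    its \<open>i\<close>-th coefficient; the extra \<open>degree a\<close> compensates this
    shift.\<close>
  let ?n = "(\<Sum>i\<le>degree a. n i) + degree a"
  have "a = (\<Sum>e<m. hcl hc (int e) a)" if m: "m \<ge> ?n" for m
  proof (rule poly_eqI)
    fix i
    have c: "coeff (\<Sum>e<m. hcl hc (int e) a) i = (\<Sum>e<m. hc (int e - int i) (coeff a i))"
      by (simp add: coeff_sum coeff_hcl)
    show "coeff a i = coeff (\<Sum>e<m. hcl hc (int e) a) i"
    proof (cases "i \<le> degree a")
      case True
      then have "n i \<le> (\<Sum>i\<le>degree a. n i)" by (intro member_le_sum) auto
      then have ge: "m - i \<ge> n i" "m \<ge> i" using m True by linarith+
      have "(\<Sum>e<m. hc (int e - int i) (coeff a i)) = (\<Sum>e\<in>{i..<m}. hc (int e - int i) (coeff a i))"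
        by (rule sum.mono_neutral_right) (auto simp: hc_neg)
      also have "\<dots> = (\<Sum>e<m - i. hc (int e) (coeff a i))"
        by (rule sum.reindex_bij_witness[of _ "\<lambda>e. e + i" "\<lambda>e. e - i"]) auto
      finally show ?thesis using c n[OF ge(1)] by simp
    next
      case False
      then show ?thesis by (simp add: c coeff_eq_0)
    qed
  qed
  then show "\<exists>n. \<forall>m\<ge>n. a = (\<Sum>e<m. hcl hc (int e) a)" by (intro exI[of _ ?n] allI impI)
qed

end

definition h0 :: "int \<Rightarrow> real \<Rightarrow> bool" where "h0 d c \<longleftrightarrow> (c \<noteq> 0 \<longrightarrow> d = 0)"
definition hc0 :: "int \<Rightarrow> real \<Rightarrow> real" where "hc0 d c = (if d = 0 then c else 0)"

lemma graded_real: "graded h0 hc0"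
proof
  fix a :: real
  have "a = (\<Sum>e<m. hc0 (int e) a)" if "m \<ge> 1" for m
    using that by (subst sum.mono_neutral_right[of _ "{0}"]) (auto simp: hc0_def)
  then show "\<exists>n. \<forall>m\<ge>n. a = (\<Sum>e<m. hc0 (int e) a)" by (intro exI[of _ 1] allI impI)
qed (auto simp: h0_def hc0_def)

abbreviation "h1 \<equiv> hl h0"
abbreviation "h2 \<equiv> hl h1"
abbreviation "hcm \<equiv> hcl (hcl (hcl hc0))"

interpretation g1: graded h1 "hcl hc0" by (rule graded.graded_lift[OF graded_real])
interpretation g2: graded h2 "hcl (hcl hc0)" by (rule g1.graded_lift)

lemma homog_hl: "homog = hl h2"
proof (intro ext)
  fix d and p :: S3
  have e: "(int (i + j + l) = d) = (d - int i - int j - int l = 0)" for i j l by auto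
  show "homog d p = hl h2 d p"
    unfolding homog_def hl_def h0_def e by (rule refl)
qed

interpretation g3: graded homog hcm unfolding homog_hl by (rule g2.graded_lift)

section \<open>Noetherian rings\<close>

text \<open>The ring as a module over itself: ideals become \<open>rng.subspace\<close> and
  generated ideals \<open>rng.span\<close>, with the library facts about modules.\<close>

definition rsm :: "'a::comm_ring_1 \<Rightarrow> 'a \<Rightarrow> 'a" where
  "rsm a b = a * b"

interpretation rng: module "rsm :: 'a::comm_ring_1 \<Rightarrow> _"
  by standard (simp_all add: rsm_def distrib_left distrib_right mult.assoc)

lemma rng_subspaceI:
  "\<lbrakk>0 \<in> S; \<And>x y. x \<in> S \<Longrightarrow> y \<in> S \<Longrightarrow> x + y \<in> S; \<And>c x. x \<in> S \<Longrightarrow> c * x \<in> S\<rbrakk> \<Longrightarrow> rng.subspace S"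
  unfolding rng.subspace_def rsm_def by blast

lemma rng_subspace_scale: "rng.subspace S \<Longrightarrow> x \<in> S \<Longrightarrow> c * x \<in> S"
  using rng.subspace_scale[of S x c] by (simp add: rsm_def)

lemma rng_span_scale: "x \<in> rng.span S \<Longrightarrow> c * x \<in> rng.span S"
  using rng.span_scale[of x S c] by (simp add: rsm_def)

definition vsm :: "'a::comm_ring_1 \<Rightarrow> (nat \<Rightarrow> 'a) \<Rightarrow> nat \<Rightarrow> 'a" where
  "vsm c v = (\<lambda>i. c * v i)"

lemma module_vsm: "module (vsm :: 'a::comm_ring_1 \<Rightarrow> _)"
proof (rule module.intro)
  fix a b :: 'a and x y :: "nat \<Rightarrow> 'a"
  show "vsm a (x + y) = vsm a x + vsm a y" "vsm (a + b) x = vsm a x + vsm b x"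
    "vsm a (vsm b x) = vsm (a * b) x" "vsm 1 x = x"
    by (simp_all add: fun_eq_iff vsm_def distrib_left distrib_right mult.assoc)
qed

interpretation vec: module "vsm :: 'a::comm_ring_1 \<Rightarrow> _"
  by (rule module_vsm)

lemma vec_subspaceI:
  "\<lbrakk>0 \<in> S; \<And>x y. x \<in> S \<Longrightarrow> y \<in> S \<Longrightarrow> x + y \<in> S; \<And>c x. x \<in> S \<Longrightarrow> (\<lambda>i. c * x i) \<in> S\<rbrakk> \<Longrightarrow> vec.subspace S"
  unfolding vec.subspace_def vsm_def by blast

lemma vec_subspace_scale: "vec.subspace S \<Longrightarrow> x \<in> S \<Longrightarrow> (\<lambda>i. c * x i) \<in> S"
  using vec.subspace_scale[of S x c] by (simp add: vsm_def)

lemma vec_span_scale: "x \<in> vec.span S \<Longrightarrow> (\<lambda>i. c * x i) \<in> vec.span S"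
  using vec.span_scale[of x S c] by (simp add: vsm_def)

definition noetherian :: "'a::comm_ring_1 itself \<Rightarrow> bool" where
  "noetherian _ \<longleftrightarrow> (\<forall>I::'a set. rng.subspace I \<longrightarrow> (\<exists>F. finite F \<and> F \<subseteq> I \<and> I \<subseteq> rng.span F))"

lemma noetherian_field: "noetherian TYPE('a::field)"
  unfolding noetherian_def
proof (intro allI impI)
  fix I :: "'a set" assume I: "rng.subspace I"
  show "\<exists>F. finite F \<and> F \<subseteq> I \<and> I \<subseteq> rng.span F"
  proof (cases "I \<subseteq> {0}")
    case True
    then have "I \<subseteq> rng.span {}" by auto
    then show ?thesis by (intro exI[of _ "{}"]) auto
  next
    case False
    then obtain a where a: "a \<in> I" "a \<noteq> 0" by auto
    have "x \<in> rng.span {a}" for x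
      using rng_span_scale[OF rng.span_base[of a "{a}"], of "x / a"] a by simp
    then show ?thesis using a by (intro exI[of _ "{a}"]) auto
  qed
qed

lemma rng_span_finite:
  "finite F \<Longrightarrow> x \<in> rng.span F \<Longrightarrow> \<exists>u. x = (\<Sum>b\<in>F. u b * b)"
  by (auto simp: rng.span_finite rsm_def)

text \<open>Hilbert's basis theorem. \<open>L n\<close> collects the coefficients at
  \<open>n\<close> of the members of \<open>I\<close> of degree at most \<open>n\<close>, zero
  included, so it is an ideal and grows with \<open>n\<close>.\<close>

lemma noetherian_poly:
  assumes "noetherian TYPE('a::comm_ring_1)"
  shows "noetherian TYPE('a poly)"
  unfolding noetherian_def
proof (intro allI impI)
  fix I :: "'a poly set" assume I: "rng.subspace I"
  have Iadd: "f + g \<in> I" if "f \<in> I" "g \<in> I" for f g using rng.subspace_add[OF I] that .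
  have Imul: "a * f \<in> I" if "f \<in> I" for a f using rng_subspace_scale[OF I] that .
  define L where "L n = {coeff f n | f. f \<in> I \<and> (\<forall>i>n. coeff f i = 0)}" for n
  have sub: "rng.subspace (L n)" for n
  proof (rule rng_subspaceI)
    show "0 \<in> L n" using rng.subspace_0[OF I] by (force simp: L_def)
    show "x + y \<in> L n" if "x \<in> L n" "y \<in> L n" for x y
    proof -
      obtain f g where "f \<in> I" "\<forall>i>n. coeff f i = 0" "x = coeff f n"
        "g \<in> I" "\<forall>i>n. coeff g i = 0" "y = coeff g n" using \<open>x \<in> L n\<close> \<open>y \<in> L n\<close> unfolding L_def by blast
      then show ?thesis unfolding L_def by (auto intro!: exI[of _ "f + g"] Iadd)
    qed
    show "c * x \<in> L n" if x: "x \<in> L n" for c x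
    proof -
      obtain f where "f \<in> I" "\<forall>i>n. coeff f i = 0" "x = coeff f n" using x unfolding L_def by blast
      then show ?thesis unfolding L_def using Imul[of f "[:c:]"] by (auto intro!: exI[of _ "smult c f"])
    qed
  qed
  have Lmono: "L n \<subseteq> L (n + k)" for n k
  proof
    fix x assume "x \<in> L n"
    then obtain f where f: "f \<in> I" "\<forall>i>n. coeff f i = 0" "x = coeff f n" unfolding L_def by blast
    have "coeff (monom 1 k * f) (n + k) = x" "\<forall>i>n+k. coeff (monom 1 k * f) i = 0"
      using f by (auto simp: coeff_monom_mult)
    then show "x \<in> L (n + k)" unfolding L_def using Imul[OF f(1)] by blast
  qed
  have Lmono': "n \<le> m \<Longrightarrow> L n \<subseteq> L m" for n m using Lmono[of n "m - n"] by simp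
  \<comment> \<open>Finitely many generators of the union lie in a single \<open>L N\<close>, so the
    chain is constant from \<open>N\<close> on.\<close>
  have subU: "rng.subspace (\<Union>n. L n)"
  proof (rule rng_subspaceI)
    show "0 \<in> (\<Union>n. L n)" using rng.subspace_0[OF sub] by blast
    show "x + y \<in> (\<Union>n. L n)" if x: "x \<in> (\<Union>n. L n)" and y: "y \<in> (\<Union>n. L n)" for x y
    proof -
      obtain n m where "x \<in> L n" "y \<in> L m" using x y by auto
      then have "x \<in> L (max n m)" "y \<in> L (max n m)" using Lmono'[of n "max n m"] Lmono'[of m "max n m"] by auto
      then show ?thesis using rng.subspace_add[OF sub] by blast
    qed
    show "c * x \<in> (\<Union>n. L n)" if "x \<in> (\<Union>n. L n)" for c x
      using that rng_subspace_scale[OF sub] by blast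
  qed
  obtain F where F: "finite F" "F \<subseteq> (\<Union>n. L n)" "(\<Union>n. L n) \<subseteq> rng.span F"
    using assms subU unfolding noetherian_def by blast
  have "\<exists>N. F \<subseteq> L N" using F(1,2)
  proof (induct F)
    case (insert x F)
    then obtain N n where "F \<subseteq> L N" "x \<in> L n" by auto
    then have "insert x F \<subseteq> L (max N n)" using Lmono'[of N "max N n"] Lmono'[of n "max N n"] by auto
    then show ?case by blast
  qed auto
  then obtain N where "F \<subseteq> L N" by blast
  then have "rng.span F \<subseteq> L N" using sub rng.span_minimal by blast
  then have LN: "L n \<subseteq> L N" for n using F(3) by blast
  have "\<exists>B. finite B \<and> B \<subseteq> L n \<and> L n \<subseteq> rng.span B" for n
    using assms sub unfolding noetherian_def by blast
  then obtain B where B: "\<And>n. finite (B n)" "\<And>n. B n \<subseteq> L n" "\<And>n. L n \<subseteq> rng.span (B n)" by metis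
  have "\<forall>n b. b \<in> B n \<longrightarrow> (\<exists>f. f \<in> I \<and> (\<forall>i>n. coeff f i = 0) \<and> coeff f n = b)"
    using B(2) by (force simp: L_def)
  then obtain g where g: "\<And>n b. b \<in> B n \<Longrightarrow> g n b \<in> I \<and> (\<forall>i>n. coeff (g n b) i = 0) \<and> coeff (g n b) n = b"
    by metis
  define G where "G = (\<Union>n\<le>N. g n ` B n)"
  have GI: "G \<subseteq> I" using g by (auto simp: G_def)
  have "\<forall>f\<in>I. (\<forall>i\<ge>d. coeff f i = 0) \<longrightarrow> f \<in> rng.span G" for d
  proof (induct d)
    case 0
    then show ?case by (auto simp: poly_eq_iff[of _ 0, symmetric] rng.span_zero) (metis coeff_0 poly_eqI rng.span_zero)
  next
    case (Suc d)
    show ?case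
    proof (intro ballI impI)
      fix f assume f: "f \<in> I" "\<forall>i\<ge>Suc d. coeff f i = 0"
      \<comment> \<open>Beyond \<open>N\<close> the generators of degree \<open>N\<close> are
        multiplied by a power of the variable, because \<open>L d\<close> is contained in
        \<open>L N\<close>.\<close>
      define n where "n = min d N"
      have "coeff f d \<in> L d" using f by (auto simp: L_def)
      then have "coeff f d \<in> L n" using LN by (auto simp: n_def min_def)
      then obtain u where u: "coeff f d = (\<Sum>b\<in>B n. u b * b)"
        using B(3) rng_span_finite[OF B(1)] by blast
      define h where "h = (\<Sum>b\<in>B n. monom (u b) (d - n) * g n b)"
      have hsp: "h \<in> rng.span G" unfolding h_def
        by (intro rng.span_sum rng_span_scale rng.span_base) (auto simp: G_def n_def)
      have c: "coeff h i = (if i > d then 0 else if i = d then coeff f d else coeff h i)" for i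
      proof -
        have "coeff h d = coeff f d" unfolding h_def coeff_sum u
          using g by (intro sum.cong) (auto simp: coeff_monom_mult n_def)
        moreover have "coeff h i = 0" if "i > d" unfolding h_def coeff_sum
          using g that by (intro sum.neutral) (auto simp: coeff_monom_mult n_def)
        ultimately show ?thesis by simp
      qed
      have hI: "h \<in> I" using hsp GI I rng.span_minimal by blast
      have "f - h \<in> I" using f hI I by (intro rng.subspace_diff)
      moreover have "\<forall>i\<ge>d. coeff (f - h) i = 0"
        using f(2) c by (metis Suc_leI coeff_diff diff_self le_neq_implies_less)
      ultimately have "f - h \<in> rng.span G" using Suc by blast
      then show "f \<in> rng.span G" using hsp rng.span_add by fastforce
    qed
  qed
  then have "I \<subseteq> rng.span G" by (meson MOST_coeff_eq_0 le_degree le_less_trans not_less subsetI Suc_le_eq less_le_not_le)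
  moreover have "finite G" using B by (simp add: G_def)
  ultimately show "\<exists>F. finite F \<and> F \<subseteq> I \<and> I \<subseteq> rng.span F" using GI by blast
qed

lemma noetherian_S3: "noetherian TYPE(S3)"
  by (intro noetherian_poly noetherian_field)

text \<open>Induction on the number of coordinates: the last coordinates of \<open>K\<close> form an
  ideal, and the vectors with last coordinate 0 fall under the induction hypothesis.\<close>

lemma noetherian_vec:
  assumes "noetherian TYPE('a::comm_ring_1)"
    and "vec.subspace (K :: (nat \<Rightarrow> 'a) set)" "\<And>v i. v \<in> K \<Longrightarrow> i \<ge> n \<Longrightarrow> v i = 0"
  shows "\<exists>F. finite F \<and> F \<subseteq> K \<and> K \<subseteq> vec.span F"
  using assms(2,3)
proof (induct n arbitrary: K)
  case 0
  then have "K \<subseteq> {0}" by (auto simp: fun_eq_iff)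
  then show ?case by (intro exI[of _ "{}"]) auto
next
  case (Suc n)
  note K = Suc.prems(1)
  let ?J = "(\<lambda>v. v n) ` K"
  have J: "rng.subspace ?J"
  proof (rule rng_subspaceI)
    show "0 \<in> ?J" using vec.subspace_0[OF K] by (intro image_eqI[of _ _ 0]) auto
    show "x + y \<in> ?J" if "x \<in> ?J" "y \<in> ?J" for x y
    proof -
      obtain v w where "v \<in> K" "x = v n" "w \<in> K" "y = w n" using \<open>x \<in> ?J\<close> \<open>y \<in> ?J\<close> by blast
      then show ?thesis by (intro image_eqI[of _ _ "v + w"] vec.subspace_add[OF K]) auto
    qed
    show "c * x \<in> ?J" if x: "x \<in> ?J" for x c
    proof -
      obtain v where "v \<in> K" "x = v n" using x by blast
      then show ?thesis by (intro image_eqI[of _ _ "\<lambda>i. c * v i"] vec_subspace_scale[OF K]) auto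
    qed
  qed
  obtain B where B: "finite B" "B \<subseteq> ?J" "?J \<subseteq> rng.span B"
    using assms(1) J unfolding noetherian_def by blast
  have "\<forall>b\<in>B. \<exists>v\<in>K. v n = b" using B(2) by auto
  then obtain g where g: "\<And>b. b \<in> B \<Longrightarrow> g b \<in> K \<and> g b n = b" by metis
  let ?K = "{v \<in> K. v n = 0}"
  have K0: "vec.subspace ?K"
    by (rule vec_subspaceI) (use vec.subspace_0[OF K] vec.subspace_add[OF K] vec_subspace_scale[OF K] in auto)
  have sup: "v i = 0" if "v \<in> ?K" "i \<ge> n" for v i
    using that Suc.prems(2)[of v i] by (cases "i = n") auto
  obtain F where F: "finite F" "F \<subseteq> ?K" "?K \<subseteq> vec.span F"
    using Suc.hyps[of ?K, OF K0] sup by blast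
  have "v \<in> vec.span (F \<union> g ` B)" if v: "v \<in> K" for v
  proof -
    obtain u where u: "v n = (\<Sum>b\<in>B. u b * b)"
      using B(3) rng_span_finite[OF B(1)] v by blast
    define w where "w = (\<Sum>b\<in>B. (\<lambda>i. u b * g b i))"
    have wsp: "w \<in> vec.span (F \<union> g ` B)" unfolding w_def
      by (intro vec.span_sum vec_span_scale vec.span_base) auto
    have "w n = (\<Sum>b\<in>B. u b * g b n)" unfolding w_def by (induct B rule: infinite_finite_induct) auto
    also have "\<dots> = v n" using u g by simp
    finally have wn: "w n = v n" .
    have "w \<in> K" unfolding w_def using g K by (intro vec.subspace_sum vec_subspace_scale) auto
    then have "v - w \<in> ?K" using v K wn by (auto simp: vec.subspace_diff)
    then have "v - w \<in> vec.span (F \<union> g ` B)" using F vec.span_mono[of F "F \<union> g ` B"] by blast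
    then show ?thesis using vec.span_add[OF _ wsp] by fastforce
  qed
  then show ?case using F B g by (intro exI[of _ "F \<union> g ` B"]) auto
qed

section \<open>Homogeneous generators and their syzygies\<close>

text \<open>The weights \<open>\<omega>\<close> encode the twists of a graded free module.\<close>

definition hv :: "(int \<Rightarrow> 'a \<Rightarrow> bool) \<Rightarrow> (nat \<Rightarrow> int) \<Rightarrow> int \<Rightarrow> (nat \<Rightarrow> 'a) \<Rightarrow> bool" where
  "hv h \<omega> d v \<longleftrightarrow> (\<forall>i. h (d + \<omega> i) (v i))"

definition comb :: "nat set \<Rightarrow> (nat \<Rightarrow> nat \<Rightarrow> 'a::comm_ring_1) \<Rightarrow> (nat \<Rightarrow> 'a) \<Rightarrow> nat \<Rightarrow> 'a" where
  "comb J e c = (\<lambda>i. \<Sum>j\<in>J. c j * e j i)"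

definition generates where
  "generates J e K \<longleftrightarrow> (\<forall>j\<in>J. e j \<in> K) \<and> (\<forall>v\<in>K. \<exists>c. v = comb J e c)"

definition irredundant where
  "irredundant J e \<longleftrightarrow> (\<forall>i\<in>J. \<forall>c. c i = 0 \<longrightarrow> e i \<noteq> comb J e c)"

definition lin_indep where
  "lin_indep J e \<longleftrightarrow> (\<forall>c. comb J e c = (\<lambda>_. 0) \<longrightarrow> (\<forall>j\<in>J. c j = 0))"

lemma comb_in:
  assumes "vec.subspace K" "\<And>j. j \<in> J \<Longrightarrow> e j \<in> K"
  shows "comb J e c \<in> K"
proof -
  have "comb J e c = (\<Sum>j\<in>J. (\<lambda>i. c j * e j i))"
    unfolding comb_def by (rule ext) (induct J rule: infinite_finite_induct, auto)
  then show ?thesis using assms by (auto intro!: vec.subspace_sum vec_subspace_scale)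
qed

lemma comb_scale: "comb J e (\<lambda>j. a * c j) i = a * comb J e c i"
  by (simp add: comb_def sum_distrib_left mult.assoc)

lemma comb_add: "comb J e (\<lambda>j. c j + d j) i = comb J e c i + comb J e d i"
  by (simp add: comb_def sum.distrib distrib_right)

lemma comb_unit: "finite J \<Longrightarrow> j \<in> J \<Longrightarrow> comb J e (\<lambda>k. if k = j then 1 else 0) = e j"
proof
  fix i assume *: "finite J" "j \<in> J"
  have "comb J e (\<lambda>k. if k = j then 1 else 0) i = (\<Sum>k\<in>J. if k = j then e k i else 0)"
    unfolding comb_def by (intro sum.cong) auto
  then show "comb J e (\<lambda>k. if k = j then 1 else 0) i = e j i" using * by simp
qed

lemma comb_remove: "finite J \<Longrightarrow> j \<in> J \<Longrightarrow> comb J e c i = c j * e j i + comb (J - {j}) e c i"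
  by (simp add: comb_def sum.remove)

lemma comb_cong: "(\<And>j. j \<in> J \<Longrightarrow> c j = d j) \<Longrightarrow> comb J e c i = comb J e d i"
  by (simp add: comb_def)

lemma subspace_range_comb: "vec.subspace (range (comb J e))"
proof (rule vec_subspaceI)
  show "0 \<in> range (comb J e)" by (rule range_eqI[of _ _ "\<lambda>_. 0"]) (auto simp: comb_def)
  show "x + y \<in> range (comb J e)" if xy: "x \<in> range (comb J e)" "y \<in> range (comb J e)" for x y
  proof -
    obtain c c' where "x = comb J e c" "y = comb J e c'" using xy by auto
    then show ?thesis by (intro range_eqI[of _ _ "\<lambda>j. c j + c' j"]) (auto simp: comb_add fun_eq_iff)
  qed
  show "(\<lambda>i. a * x i) \<in> range (comb J e)" if x: "x \<in> range (comb J e)" for a x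
  proof -
    obtain c where "x = comb J e c" using x by auto
    then show ?thesis by (intro range_eqI[of _ _ "\<lambda>j. a * c j"]) (auto simp: comb_scale fun_eq_iff)
  qed
qed

context graded
begin

lemma hv_comb:
  assumes "\<And>j. j \<in> J \<Longrightarrow> hv h \<omega> (\<delta> j) (e j)" "\<And>j. j \<in> J \<Longrightarrow> h (d - \<delta> j) (c j)"
  shows "hv h \<omega> d (comb J e c)"
  unfolding hv_def comb_def
proof (intro allI h_sum)
  fix i j assume "j \<in> J"
  then show "h (d + \<omega> i) (c j * e j i)"
    using assms[of j] by (intro h_mult'[of "d - \<delta> j" _ "\<delta> j + \<omega> i"]) (auto simp: hv_def)
qed

lemma comb_component:
  assumes "\<And>j. j \<in> J \<Longrightarrow> hv h \<omega> (\<delta> j) (e j)"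
  shows "hc (d + \<omega> i) (comb J e c i) = comb J e (\<lambda>j. hc (d - \<delta> j) (c j)) i"
  unfolding comb_def hc_sum_out
proof (intro sum.cong refl)
  fix j assume "j \<in> J"
  then have "h (\<delta> j + \<omega> i) (e j i)" using assms by (simp add: hv_def)
  from hc_mult[OF this, of "d + \<omega> i" "c j"]
  show "hc (d + \<omega> i) (c j * e j i) = hc (d - \<delta> j) (c j) * e j i" by simp
qed

lemma comb_homogeneous_coeffs:
  assumes "\<And>j. j \<in> J \<Longrightarrow> hv h \<omega> (\<delta> j) (e j)" "hv h \<omega> d (comb J e c)"
  shows "comb J e c = comb J e (\<lambda>j. hc (d - \<delta> j) (c j))"
proof
  fix i
  have "comb J e c i = hc (d + \<omega> i) (comb J e c i)"
    using assms(2) by (simp add: hv_def hc_h[of "d + \<omega> i"])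
  then show "comb J e c i = comb J e (\<lambda>j. hc (d - \<delta> j) (c j)) i"
    using comb_component[OF assms(1)] by simp
qed

lemma generates_homogeneous:
  assumes "generates J e K" "\<And>j. j \<in> J \<Longrightarrow> hv h \<omega> (\<delta> j) (e j)" "v \<in> K" "hv h \<omega> d v"
  obtains c where "v = comb J e c" "\<And>j. h (d - \<delta> j) (c j)"
proof -
  obtain c where c: "v = comb J e c" using assms(1,3) unfolding generates_def by blast
  show ?thesis
  proof (rule that)
    show "v = comb J e (\<lambda>j. hc (d - \<delta> j) (c j))"
      using comb_homogeneous_coeffs[OF assms(2), where d = d and c = c] assms(4) c by simp
  qed (rule h_hc)
qed

text \<open>The homogeneous components of finitely many generators again generate, since
  \<open>K\<close> is closed under taking components; among all homogeneous generating families one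
  with the fewest members is irredundant.\<close>

lemma homogeneous_generators:
  assumes "finite F" "F \<subseteq> K" "K \<subseteq> vec.span F" "vec.subspace K"
    and gr: "\<And>v d. v \<in> K \<Longrightarrow> (\<lambda>i. hc (d + \<omega> i) (v i)) \<in> K"
    and supp: "\<And>v i. v \<in> K \<Longrightarrow> i \<ge> n \<Longrightarrow> v i = 0"
  shows "\<exists>J e \<delta>. finite J \<and> generates J e K \<and> irredundant J e \<and> (\<forall>j\<in>J. hv h \<omega> (\<delta> j) (e j))"
proof -
  define vc where "vc d v = (\<lambda>i. hc (d + \<omega> i) (v i))" for d v
  have vcK: "vc d v \<in> K" if "v \<in> K" for d v using gr that by (simp add: vc_def)
  have hvc: "hv h \<omega> d (vc d v)" for d v by (simp add: hv_def vc_def h_hc)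
  have fin: "\<exists>D. finite D \<and> v = (\<lambda>i. \<Sum>d\<in>D. vc d v i)" if v: "v \<in> K" for v
  proof -
    have "\<forall>i. \<exists>m. \<forall>m'\<ge>m. v i = (\<Sum>e<m'. hc (int e) (v i))" by (intro allI hc_sum)
    from choice[OF this] obtain m where m0: "\<forall>i. \<forall>m'\<ge>m i. v i = (\<Sum>e<m'. hc (int e) (v i))" ..
    have m: "v i = (\<Sum>e<m'. hc (int e) (v i))" if "m' \<ge> m i" for i m' by (rule m0[rule_format, OF that])
    \<comment> \<open>The degrees \<open>d\<close> for which some coordinate \<open>i < n\<close>
      can have a nonzero component of degree \<open>d + \<omega> i\<close>.\<close>
    define D where "D = (\<Union>i<n. (\<lambda>e. int e - \<omega> i) ` {..<m i})"
    have "finite D" by (simp add: D_def)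
    have "v i = (\<Sum>d\<in>D. vc d v i)" for i
    proof (cases "i < n")
      case False
      then have "v i = 0" using supp[OF v] by simp
      then show ?thesis by (simp add: vc_def)
    next
      case True
      let ?D = "(\<lambda>e. int e - \<omega> i) ` {..<m i}"
      have z: "hc k (v i) = 0" if "k < 0 \<or> k \<ge> int (m i)" for k
      proof (cases "k < 0")
        case True
        then show ?thesis by (simp add: hc_neg)
      next
        case False
        have "hc k (v i) = hc k (\<Sum>e<m i. hc (int e) (v i))" using m[of i "m i"] by simp
        also have "\<dots> = (\<Sum>e<m i. hc k (hc (int e) (v i)))" by (rule hc_sum_out)
        also have "\<dots> = 0" using that False
          by (intro sum.neutral) (auto simp: hc_h[OF h_hc])
        finally show ?thesis .
      qed
      have "(\<Sum>d\<in>D. vc d v i) = (\<Sum>d\<in>?D. vc d v i)"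
      proof (rule sum.mono_neutral_right[OF \<open>finite D\<close>])
        show "?D \<subseteq> D" using True by (auto simp: D_def)
        show "\<forall>d\<in>D - ?D. vc d v i = 0"
        proof
          fix d assume d: "d \<in> D - ?D"
          have "d + \<omega> i < 0 \<or> d + \<omega> i \<ge> int (m i)"
          proof (rule ccontr)
            assume "\<not> ?thesis"
            then have "d = int (nat (d + \<omega> i)) - \<omega> i" "nat (d + \<omega> i) < m i" by linarith+
            then show False using d by blast
          qed
          then show "vc d v i = 0" by (simp add: vc_def z)
        qed
      qed
      also have "\<dots> = (\<Sum>e<m i. hc (int e) (v i))"
        by (subst sum.reindex) (auto simp: inj_on_def vc_def)
      finally show ?thesis using m[of i "m i"] by simp
    qed
    then show ?thesis using \<open>finite D\<close> by (intro exI[of _ D]) auto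
  qed
  then obtain D where D: "\<And>v. v \<in> K \<Longrightarrow> finite (D v)" "\<And>v. v \<in> K \<Longrightarrow> v = (\<lambda>i. \<Sum>d\<in>D v. vc d v i)"
    by metis
  define P where "P J e \<delta> \<longleftrightarrow> finite J \<and> generates J e K \<and> (\<forall>j\<in>J. hv h \<omega> (\<delta> j) (e j))"
    for J :: "nat set" and e and \<delta> :: "nat \<Rightarrow> int"
  define F' where "F' = (\<Union>v\<in>F. (\<lambda>d. (d, vc d v)) ` D v)"
  have finF': "finite F'" using assms(1,2) D by (auto simp: F'_def)
  obtain en where en: "bij_betw en {..<card F'} F'"
    using ex_bij_betw_nat_finite[OF finF'] atLeast0LessThan by metis
  define e where "e j = snd (en j)" for j
  define \<delta> where "\<delta> j = fst (en j)" for j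
  have enF: "en j \<in> F'" if "j < card F'" for j using en that by (auto simp: bij_betw_def)
  have eK: "e j \<in> K \<and> hv h \<omega> (\<delta> j) (e j)" if "j < card F'" for j
    using enF[OF that] assms(2) vcK hvc unfolding e_def \<delta>_def F'_def by auto
  define R where "R = range (comb {..<card F'} e)"
  have R: "vec.subspace R" unfolding R_def by (rule subspace_range_comb)
  have "F \<subseteq> R"
  proof
    fix v assume v: "v \<in> F"
    have "vc d v \<in> R" if d: "d \<in> D v" for d
    proof -
      have "(d, vc d v) \<in> F'" using v d by (auto simp: F'_def)
      then have "(d, vc d v) \<in> en ` {..<card F'}" using en by (simp add: bij_betw_def)
      then obtain j where j: "j < card F'" "en j = (d, vc d v)" by (elim imageE) auto
      then have "e j = vc d v" by (simp add: e_def)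
      then show ?thesis unfolding R_def using comb_unit[of "{..<card F'}" j e] j by (metis finite_lessThan lessThan_iff rangeI)
    qed
    then have "(\<Sum>d\<in>D v. vc d v) \<in> R" by (intro vec.subspace_sum[OF R])
    moreover have "v = (\<Sum>d\<in>D v. vc d v)"
    proof -
      have "(\<Sum>d\<in>A. vc d v) i = (\<Sum>d\<in>A. vc d v i)" for i A
        by (induct A rule: infinite_finite_induct) auto
      then show ?thesis using D(2)[of v] v assms(2) by (auto simp: fun_eq_iff)
    qed
    ultimately show "v \<in> R" by simp
  qed
  then have "K \<subseteq> R" using assms(3) R vec.span_minimal by blast
  then have "P {..<card F'} e \<delta>" using eK unfolding P_def generates_def R_def by auto
  then obtain J e' \<delta>' where J: "P J e' \<delta>'" "\<And>J' e \<delta>. P J' e \<delta> \<Longrightarrow> card J \<le> card J'"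
    using ex_has_least_nat[of "\<lambda>J. \<exists>e \<delta>. P J e \<delta>" "{..<card F'}" card] by metis
  have "irredundant J e'"
    unfolding irredundant_def
  proof (intro ballI allI impI notI)
    fix i c assume i: "i \<in> J" "c i = 0" "e' i = comb J e' c"
    have finJ: "finite J" using J(1) P_def by blast
    have "\<exists>c'. v = comb (J - {i}) e' c'" if v: "v \<in> K" for v
    proof -
      obtain b where b: "v = comb J e' b" using J(1) v unfolding P_def generates_def by blast
      have "v = comb (J - {i}) e' (\<lambda>j. b j + b i * c j)"
      proof
        fix k
        have "v k = b i * e' i k + comb (J - {i}) e' b k"
          unfolding b by (rule comb_remove[OF finJ i(1)])
        also have "e' i k = comb (J - {i}) e' c k"
          using comb_remove[OF finJ i(1), of e' c k] fun_cong[OF i(3), of k] i(2) by simp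
        finally show "v k = comb (J - {i}) e' (\<lambda>j. b j + b i * c j) k"
          by (simp add: comb_add comb_scale)
      qed
      then show ?thesis by blast
    qed
    then have "P (J - {i}) e' \<delta>'" using J(1) by (auto simp: P_def generates_def)
    then have "card J \<le> card (J - {i})" by (rule J(2))
    then show False using i finJ by (metis card_Diff1_less not_less)
  qed
  then show ?thesis using J(1) unfolding P_def by blast
qed

text \<open>Graded Nakayama. If \<open>e i\<close> is a combination of the others modulo the
  variable, the difference is the variable times some \<open>w\<close>, and \<open>w\<close> lies in
  \<open>K\<close> by saturation. As \<open>w\<close> has degree \<open>\<delta> i - 1\<close>, the
  generator \<open>e i\<close> can occur in it only with a coefficient of degree -1, that is,
  0.\<close>

lemma irredundant_reduce:
  fixes e :: "nat \<Rightarrow> nat \<Rightarrow> 'a poly"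
  assumes J: "finite J" and e: "\<And>j. j \<in> J \<Longrightarrow> hv (hl h) \<omega> (\<delta> j) (e j)"
    and K: "generates J e K" "vec.subspace K" and sat: "\<And>v. (\<lambda>i. [:0, 1:] * v i) \<in> K \<Longrightarrow> v \<in> K"
    and irr: "irredundant J e"
  shows "irredundant J (\<lambda>j i. coeff (e j i) 0)"
  unfolding irredundant_def
proof (intro ballI allI impI notI)
  interpret L: graded "hl h" "hcl hc" by (rule graded_lift)
  let ?e = "\<lambda>j i. coeff (e j i) 0"
  fix i c assume i: "i \<in> J" "c i = 0" "?e i = comb J ?e c"
  have he: "hv h \<omega> (\<delta> j) (?e j)" if "j \<in> J" for j
    using e[OF that] by (auto simp: hv_def hl_def) (metis diff_zero of_nat_0)
  \<comment> \<open>The parts of degree \<open>\<delta> i - \<delta> j\<close> still express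
    \<open>e i\<close> modulo the variable, and with them \<open>v\<close> is homogeneous.\<close>
  define c' where "c' j = hc (\<delta> i - \<delta> j) (c j)" for j
  have c': "?e i = comb J ?e c'" "\<And>j. h (\<delta> i - \<delta> j) (c' j)" "c' i = 0"
    using comb_homogeneous_coeffs[OF he, where d = "\<delta> i" and c = c] i he[OF i(1)] unfolding c'_def by (auto simp: h_hc)
  define v where "v k = e i k - comb J e (\<lambda>j. [:c' j:]) k" for k
  have hvv: "hv (hl h) \<omega> (\<delta> i) v"
  proof -
    have "hv (hl h) \<omega> (\<delta> i) (comb J e (\<lambda>j. [:c' j:]))"
      using e c'(2) by (intro L.hv_comb) (auto simp: hl_def coeff_pCons split: nat.splits)
    then show ?thesis using e[OF i(1)] unfolding hv_def v_def by (auto intro: L.h_diff)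
  qed
  have "coeff (v k) 0 = 0" for k
    using c'(1) by (auto simp: v_def comb_def coeff_sum coeff_mult fun_eq_iff)
  then have "\<forall>k. \<exists>w. v k = [:0, 1:] * w"
    by (metis dvdE poly_0_coeff_0 poly_eq_0_iff_dvd minus_zero)
  then obtain w where w: "\<And>k. v k = [:0, 1:] * w k" by metis
  have vK: "v \<in> K"
  proof -
    have "e i - comb J e (\<lambda>j. [:c' j:]) \<in> K"
      using K i by (intro vec.subspace_diff comb_in) (auto simp: generates_def)
    moreover have "v = e i - comb J e (\<lambda>j. [:c' j:])" by (auto simp: v_def fun_eq_iff)
    ultimately show ?thesis by simp
  qed
  then have wK: "w \<in> K" using sat[of w] w by (simp add: fun_eq_iff[symmetric]) (metis (no_types, lifting) ext sat vK w)
  have hw: "hv (hl h) \<omega> (\<delta> i - 1) w"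
    unfolding hv_def hl_def
  proof (intro allI)
    fix k n
    have "h (\<delta> i + \<omega> k - int (Suc n)) (coeff (v k) (Suc n))" using hvv unfolding hv_def hl_def by blast
    moreover have "coeff (v k) (Suc n) = coeff (w k) n" using w[of k] by simp
    ultimately show "h (\<delta> i - 1 + \<omega> k - int n) (coeff (w k) n)" by (simp add: algebra_simps)
  qed
  obtain b where b: "w = comb J e b" "\<And>j. hl h (\<delta> i - 1 - \<delta> j) (b j)"
    using L.generates_homogeneous[OF K(1) e wK hw] by blast
  have "b i = 0" using L.h_neg[OF b(2)[of i]] by simp
  define c'' where "c'' j = [:c' j:] + [:0, 1:] * b j" for j
  have "c'' i = 0" using \<open>b i = 0\<close> c'(3) by (simp add: c''_def)
  moreover have "e i = comb J e c''"
  proof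
    fix k
    have "e i k = comb J e (\<lambda>j. [:c' j:]) k + [:0, 1:] * comb J e b k"
      using w[of k] b(1) by (simp add: v_def algebra_simps)
    then show "e i k = comb J e c'' k"
      by (simp add: comb_def c''_def sum.distrib sum_distrib_left distrib_right mult.assoc)
  qed
  ultimately show False using irr i(1) by (auto simp: irredundant_def)
qed

end

text \<open>Modulo the variable a relation has zero coefficients; hence it can be divided by the
  variable, and this is repeated.\<close>

lemma lin_indep_lift:
  fixes e :: "nat \<Rightarrow> nat \<Rightarrow> 'a::comm_ring_1 poly"
  assumes "lin_indep J (\<lambda>j i. coeff (e j i) 0)"
  shows "lin_indep J e"
proof -
  have "\<forall>j\<in>J. coeff (c j) n = 0" if "comb J e c = (\<lambda>_. 0)" for c n
    using that
  proof (induct n arbitrary: c rule: less_induct)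
    case (less n)
    have "comb J (\<lambda>j i. coeff (e j i) 0) (\<lambda>j. coeff (c j) 0) = (\<lambda>_. 0)"
    proof
      fix i
      have "coeff (comb J e c i) 0 = 0" using less by simp
      then show "comb J (\<lambda>j i. coeff (e j i) 0) (\<lambda>j. coeff (c j) 0) i = 0"
        by (simp add: comb_def coeff_sum coeff_mult)
    qed
    then have c0: "\<forall>j\<in>J. coeff (c j) 0 = 0" using assms unfolding lin_indep_def by blast
    show ?case
    proof (cases n)
      case 0
      then show ?thesis using c0 by simp
    next
      case (Suc m)
      have "\<forall>j\<in>J. \<exists>b. c j = [:0, 1:] * b" using c0
        by (metis dvdE poly_0_coeff_0 poly_eq_0_iff_dvd minus_zero)
      then obtain b where b: "\<And>j. j \<in> J \<Longrightarrow> c j = [:0, 1:] * b j" by metis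
      have "comb J e b = (\<lambda>_. 0)"
      proof
        fix i
        have "[:0, 1:] * comb J e b i = comb J e c i"
          unfolding comb_scale[symmetric] by (rule comb_cong) (simp add: b)
        then have "[:0, 1:] * comb J e b i = 0" using less by simp
        then show "comb J e b i = 0" by simp
      qed
      then have "\<forall>j\<in>J. coeff (b j) m = 0" using less(1)[of m b] Suc by simp
      then show ?thesis using b Suc by simp
    qed
  qed
  then show ?thesis unfolding lin_indep_def by (metis coeff_0 poly_eqI)
qed

lemma h1_monom: "h1 d p \<Longrightarrow> \<exists>a. p = monom a (nat d) \<and> (p \<noteq> 0 \<longrightarrow> d \<ge> 0)"
proof -
  assume h: "h1 d p"
  have "p = monom (coeff p (nat d)) (nat d)"
    using h by (auto simp: poly_eq_iff hl_def h0_def)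
  moreover have "p \<noteq> 0 \<Longrightarrow> d \<ge> 0" using h by (metis g1.h_neg not_less)
  ultimately show ?thesis by blast
qed

text \<open>In one variable homogeneous coefficients are monomials. Dividing a homogeneous relation
  by its lowest power makes one coefficient a nonzero constant, and that generator becomes
  redundant.\<close>

lemma irredundant_independent:
  fixes e :: "nat \<Rightarrow> nat \<Rightarrow> real poly"
  assumes J: "finite J" and e: "\<And>j. j \<in> J \<Longrightarrow> hv h1 \<omega> (\<delta> j) (e j)" and irr: "irredundant J e"
  shows "lin_indep J e"
proof (rule ccontr)
  assume "\<not> lin_indep J e"
  then obtain b k where b: "comb J e b = (\<lambda>_. 0)" "k \<in> J" "b k \<noteq> 0" unfolding lin_indep_def by blast
  obtain d0 where d0: "hcl hc0 d0 (b k) \<noteq> 0" using g1.hc_all_zero b by blast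
  define d where "d = d0 + \<delta> k"
  define c where "c j = hcl hc0 (d - \<delta> j) (b j)" for j
  have ck: "c k \<noteq> 0" using d0 by (simp add: c_def d_def)
  have hc: "h1 (d - \<delta> j) (c j)" for j by (simp add: c_def g1.h_hc)
  have cz: "comb J e c = (\<lambda>_. 0)"
  proof
    fix i
    have "comb J e c i = hcl hc0 (d + \<omega> i) (comb J e b i)"
      unfolding c_def by (rule g1.comb_component[symmetric]) (rule e)
    then show "comb J e c i = 0" using b by simp
  qed
  let ?N = "{j \<in> J. c j \<noteq> 0}"
  have N: "finite ?N" "?N \<noteq> {}" using J ck b(2) by auto
  \<comment> \<open>The largest \<open>\<delta> i\<close> belongs to the coefficient of least degree
    \<open>d - \<delta> i\<close>.\<close>
  obtain i where i: "i \<in> J" "c i \<noteq> 0" "\<And>j. j \<in> J \<Longrightarrow> c j \<noteq> 0 \<Longrightarrow> \<delta> j \<le> \<delta> i"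
  proof -
    have "Max (\<delta> ` ?N) \<in> \<delta> ` ?N" using N by (intro Max_in) auto
    then obtain i where "i \<in> ?N" "Max (\<delta> ` ?N) = \<delta> i" by blast
    then show ?thesis using that[of i] N by (metis (mono_tags, lifting) Max_ge finite_imageI image_eqI mem_Collect_eq)
  qed
  define n where "n = nat (d - \<delta> i)"
  have "\<exists>c'. c j = monom 1 n * c'" if j: "j \<in> J" for j
  proof (cases "c j = 0")
    case False
    obtain a where a: "c j = monom a (nat (d - \<delta> j))" "d - \<delta> j \<ge> 0" using h1_monom[OF hc[of j]] False by blast
    have "nat (d - \<delta> j) = n + nat (\<delta> i - \<delta> j)" using i(3)[OF j False] a h1_monom[OF hc[of i]] i(2) by (auto simp: n_def)
    then show ?thesis using a by (intro exI[of _ "monom a (nat (\<delta> i - \<delta> j))"]) (simp add: mult_monom)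
  qed auto
  then obtain c' where c': "\<And>j. j \<in> J \<Longrightarrow> c j = monom 1 n * c' j" by metis
  have "comb J e c' = (\<lambda>_. 0)"
  proof
    fix l
    have "monom 1 n * comb J e c' l = comb J e c l"
      unfolding comb_scale[symmetric] by (rule comb_cong) (simp add: c')
    then have "monom 1 n * comb J e c' l = 0" using cz by simp
    then show "comb J e c' l = 0" by (simp add: monom_eq_0_iff)
  qed
  obtain a where a: "c i = monom a n" using h1_monom[OF hc[of i]] n_def by blast
  then have a0: "a \<noteq> 0" using i(2) by auto
  have "monom 1 n * c' i = monom 1 n * [:a:]" using a c'[OF i(1)] by (simp add: mult_monom flip: monom_0)
  then have ci: "c' i = [:a:]" by (subst (asm) mult_left_cancel) (auto simp: monom_eq_0_iff)
  have "e i = comb J e (\<lambda>j. if j = i then 0 else [:- 1 / a:] * c' j)"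
  proof
    fix l
    have "0 = comb J e c' l" using \<open>comb J e c' = (\<lambda>_. 0)\<close> by simp
    also have "\<dots> = [:a:] * e i l + comb (J - {i}) e c' l"
      using comb_remove[OF J i(1), of e c' l] ci by simp
    finally have *: "[:a:] * e i l = - comb (J - {i}) e c' l" by (simp add: eq_neg_iff_add_eq_0)
    have "e i l = [:1/a:] * ([:a:] * e i l)" using a0 by simp
    also have "\<dots> = [:- 1 / a:] * comb (J - {i}) e c' l" unfolding * by simp
    also have "\<dots> = comb (J - {i}) e (\<lambda>j. [:- 1 / a:] * c' j) l" by (rule comb_scale[symmetric])
    also have "\<dots> = comb J e (\<lambda>j. if j = i then 0 else [:- 1 / a:] * c' j) l"
      unfolding comb_remove[OF J i(1)] by (simp add: comb_def)
    finally show "e i l = comb J e (\<lambda>j. if j = i then 0 else [:- 1 / a:] * c' j) l" .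
  qed
  then show False using irr i(1) unfolding irredundant_def by fastforce
qed

definition syz :: "nat \<Rightarrow> (nat \<Rightarrow> nat \<Rightarrow> 'a::comm_ring_1) \<Rightarrow> (nat \<Rightarrow> 'a) set" where
  "syz q g = {c. (\<forall>j\<ge>q. c j = 0) \<and> comb {..<q} g c = (\<lambda>_. 0)}"

lemma subspace_syz: "vec.subspace (syz q g)"
proof (rule vec_subspaceI)
  show "0 \<in> syz q g" by (auto simp: syz_def comb_def)
  show "x + y \<in> syz q g" if "x \<in> syz q g" "y \<in> syz q g" for x y
    using that comb_add[of "{..<q}" g x y] by (auto simp: syz_def fun_eq_iff plus_fun_def)
  show "(\<lambda>i. c * x i) \<in> syz q g" if "x \<in> syz q g" for c x
    using that by (auto simp: syz_def comb_scale)
qed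

text \<open>Syzygies are a kernel into a torsion-free module, so the variable can be
  cancelled.\<close>

lemma syz_saturated:
  assumes "(\<lambda>i. [:0, 1:] * v i) \<in> syz q g"
  shows "v \<in> syz q (g :: nat \<Rightarrow> nat \<Rightarrow> 'a::idom poly)"
proof -
  have "[:0, 1:] * comb {..<q} g v k = comb {..<q} g (\<lambda>i. [:0, 1:] * v i) k" for k
    by (rule comb_scale[symmetric])
  then have "[:0, 1:] * comb {..<q} g v k = 0" for k using assms by (simp add: syz_def)
  then have "comb {..<q} g v k = 0" for k by (metis mult_eq_0_iff pCons_eq_0_iff zero_neq_one)
  moreover have "v j = 0" if "j \<ge> q" for j
  proof -
    have "[:0, 1:] * v j = 0" using assms that by (simp add: syz_def)
    then show ?thesis by simp
  qed
  ultimately show ?thesis by (auto simp: syz_def)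
qed

text \<open>Dividing by one variable after the other turns the third syzygies into first ones over a
  polynomial ring in one variable, where irredundant homogeneous generators are independent.\<close>

theorem syzygies_free:
  fixes g :: "nat \<Rightarrow> nat \<Rightarrow> S3"
  assumes g: "\<And>j. j < q \<Longrightarrow> hv homog (\<lambda>_. 0) (\<delta> j) (g j)"
    and sat: "\<And>w. (\<lambda>i. X0 * w i) \<in> range (comb {..<q} g) \<Longrightarrow> w \<in> range (comb {..<q} g)"
  shows "\<exists>J e \<epsilon>. finite J \<and> generates J e (syz q g) \<and> lin_indep J e \<and>
    (\<forall>j\<in>J. hv homog (\<lambda>i. - \<delta> i) (\<epsilon> j) (e j))"
proof -
  let ?K = "syz q g" and ?w = "\<lambda>i. - \<delta> i"
  have gr: "(\<lambda>i. hcm (d + ?w i) (v i)) \<in> ?K" if "v \<in> ?K" for v d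
  proof -
    have "comb {..<q} g (\<lambda>i. hcm (d - \<delta> i) (v i)) k = hcm (d + 0) (comb {..<q} g v k)" for k
      by (rule g3.comb_component[symmetric, where \<omega> = "\<lambda>_. 0"]) (use g in simp)
    then show ?thesis using that by (auto simp: syz_def)
  qed
  have supp: "v i = 0" if "v \<in> ?K" "i \<ge> q" for v i using that by (simp add: syz_def)
  obtain F where F: "finite F" "F \<subseteq> ?K" "?K \<subseteq> vec.span F"
    using noetherian_vec[OF noetherian_S3 subspace_syz[of q g], of q] supp by blast
  obtain J e \<epsilon> where J: "finite J" "generates J e ?K" "irredundant J e" "\<And>j. j \<in> J \<Longrightarrow> hv homog ?w (\<epsilon> j) (e j)"
    using g3.homogeneous_generators[OF F subspace_syz gr, of q] supp by blast
  let ?e = "\<lambda>j i. coeff (e j i) 0" and ?g = "\<lambda>j i. coeff (g j i) 0"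
  have c0: "coeff (comb A x y k) 0 = comb A (\<lambda>j i. coeff (x j i) 0) (\<lambda>j. coeff (y j) 0) k"
    for A k and x :: "nat \<Rightarrow> nat \<Rightarrow> 'b::comm_ring_1 poly" and y
    by (simp add: comb_def coeff_sum coeff_mult)
  have irr1: "irredundant J ?e"
    using J syz_saturated subspace_syz unfolding homog_hl by (intro g2.irredundant_reduce[where K = ?K and \<delta> = \<epsilon> and \<omega> = ?w]) auto
  have gen1: "generates J ?e (syz q ?g)"
    unfolding generates_def
  proof (intro conjI ballI)
    fix j assume "j \<in> J"
    then have ej: "e j \<in> ?K" using J(2) by (simp add: generates_def)
    then have "comb {..<q} ?g (?e j) k = 0" for k
      using c0[of "{..<q}" g "e j" k] by (simp add: syz_def)
    then show "?e j \<in> syz q ?g" using ej by (auto simp: syz_def)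
  next
    \<comment> \<open>A syzygy \<open>c\<close> modulo \<open>X0\<close> lifts: its combination of
      the \<open>g j\<close> is \<open>X0 * w\<close>, the hypothesis \<open>sat\<close> writes
      \<open>w\<close> as a combination with coefficients \<open>b\<close>, and
      \<open>c - X0 * b\<close> is a syzygy of \<open>g\<close> that reduces to
      \<open>c\<close>.\<close>
    fix c assume c: "c \<in> syz q ?g"
    have "coeff (comb {..<q} g (\<lambda>j. [:c j:]) k) 0 = 0" for k
      using c by (simp add: c0 syz_def)
    then have "\<forall>k. \<exists>w. comb {..<q} g (\<lambda>j. [:c j:]) k = X0 * w"
      unfolding X0_def by (metis dvdE poly_0_coeff_0 poly_eq_0_iff_dvd minus_zero)
    then obtain w where w: "\<And>k. comb {..<q} g (\<lambda>j. [:c j:]) k = X0 * w k" by metis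
    then have "(\<lambda>i. X0 * w i) = comb {..<q} g (\<lambda>j. [:c j:])" by auto
    then have "w \<in> range (comb {..<q} g)" using sat by blast
    then obtain b where b: "w = comb {..<q} g b" by blast
    define a where "a j = (if j < q then [:c j:] - X0 * b j else 0)" for j
    have "comb {..<q} g a k = comb {..<q} g (\<lambda>j. [:c j:]) k - X0 * comb {..<q} g b k" for k
      by (simp add: comb_def a_def left_diff_distrib sum_subtractf sum_distrib_left mult.assoc)
    then have "a \<in> ?K" using w b by (auto simp: syz_def a_def)
    then obtain u where u: "a = comb J e u" using J(2) by (auto simp: generates_def)
    have "c j = comb J ?e (\<lambda>j. coeff (u j) 0) j" for j
    proof -
      have "coeff (a j) 0 = c j" using c by (auto simp: a_def X0_def syz_def coeff_mult)
      then show ?thesis unfolding u c0 by simp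
    qed
    then show "\<exists>b. c = comb J ?e b" by blast
  qed
  have h1e: "hv h2 ?w (\<epsilon> j) (?e j)" if "j \<in> J" for j
    using J(4)[OF that] unfolding homog_hl hv_def hl_def[of h2] by (metis diff_zero of_nat_0)
  \<comment> \<open>\<open>gen1\<close> presents the reduced module as a syzygy module over the
    smaller ring, so \<open>syz_saturated\<close> applies to the next variable.\<close>
  have irr2: "irredundant J (\<lambda>j i. coeff (?e j i) 0)"
    by (rule g1.irredundant_reduce[OF J(1) h1e gen1 subspace_syz syz_saturated irr1])
  have h2e: "hv h1 ?w (\<epsilon> j) (\<lambda>i. coeff (?e j i) 0)" if "j \<in> J" for j
    using h1e[OF that] unfolding hv_def hl_def[of h1] by (metis diff_zero of_nat_0)
  have "lin_indep J (\<lambda>j i. coeff (?e j i) 0)"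
    by (rule irredundant_independent[OF J(1) h2e irr2])
  then have "lin_indep J e" by (rule lin_indep_lift[OF lin_indep_lift])
  then show ?thesis using J by blast
qed

section \<open>Dimensions of graded pieces\<close>

lemma findim_zero: "V \<subseteq> {0} \<Longrightarrow> findim V"
  unfolding findim_def by (intro exI[of _ "{}"]) auto

lemma dim_zero_set: "V \<subseteq> {0} \<Longrightarrow> dim V = 0"
  using real_vector.dim_le_card[of V "{}"] by simp

lemma linear_coeff: "linear (\<lambda>p :: 'a::real_vector poly. coeff p n)"
  by (rule linearI) (simp_all add: coeff_scaleR)

lemma linear_pCons0: "linear (\<lambda>p :: 'a::real_vector poly. pCons 0 p)"
  by (rule linearI) (auto simp: poly_eq_iff coeff_scaleR coeff_pCons split: nat.splits)

lemma subspace_hl: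
  assumes "\<And>d. subspace {a. h d a}"
  shows "subspace {p. hl h d p}"
proof -
  have "h d 0" "h d a \<Longrightarrow> h d b \<Longrightarrow> h d (a + b)" "h d a \<Longrightarrow> h d (r *\<^sub>R a)" for d a b r
    using real_vector.subspace_0[OF assms[of d]] real_vector.subspace_add[OF assms[of d]]
      real_vector.subspace_scale[OF assms[of d]] by auto
  then show ?thesis by (intro real_vector.subspaceI) (auto simp: hl_def coeff_scaleR)
qed

text \<open>Setting the outer variable to 0 maps onto degree \<open>d\<close> of the coefficient
  ring, and the kernel, the multiples of the variable, is a copy of degree
  \<open>d - 1\<close>.\<close>

lemma dim_hl_step:
  fixes h :: "int \<Rightarrow> 'a::real_vector \<Rightarrow> bool"
  assumes sub: "\<And>d. subspace {a. h d a}" and fd: "\<And>d. findim {a. h d a}"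
    and neg: "\<And>d a. d < 0 \<Longrightarrow> h d a \<Longrightarrow> a = 0"
  shows "findim {p. hl h d p}" and "dim {p. hl h d p} = dim {p. hl h (d - 1) p} + dim {a. h d a}"
proof -
  have ker: "{p \<in> {p. hl h d p}. coeff p 0 = 0} = pCons 0 ` {p. hl h (d - 1) p}" for d
  proof (intro set_eqI iffI)
    fix p assume p: "p \<in> {p \<in> {p. hl h d p}. coeff p 0 = 0}"
    obtain a q where q: "p = pCons a q" by (cases p)
    then have "p = pCons 0 q" using p by simp
    moreover have "hl h (d - 1) q" unfolding hl_def
    proof
      fix i
      have "h (d - int (Suc i)) (coeff p (Suc i))" using p unfolding hl_def by blast
      then show "h (d - 1 - int i) (coeff q i)" using q by (simp add: algebra_simps)
    qed
    ultimately show "p \<in> pCons 0 ` {p. hl h (d - 1) p}" by blast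
  next
    fix p assume "p \<in> pCons 0 ` {p. hl h (d - 1) p}"
    then obtain q where q: "p = pCons 0 q" "hl h (d - 1) q" by auto
    have "h (d - int i) (coeff p i)" for i
    proof (cases i)
      case 0
      then show ?thesis using real_vector.subspace_0[OF sub] q by simp
    next
      case (Suc j)
      have "h (d - 1 - int j) (coeff q j)" using q(2) unfolding hl_def by blast
      then show ?thesis using Suc q by (simp add: algebra_simps)
    qed
    then show "p \<in> {p \<in> {p. hl h d p}. coeff p 0 = 0}" using q by (simp add: hl_def)
  qed
  have im: "(\<lambda>p. coeff p 0) ` {p. hl h d p} = {a. h d a}" for d
  proof (intro set_eqI iffI)
    fix a assume "a \<in> (\<lambda>p. coeff p 0) ` {p. hl h d p}"
    then show "a \<in> {a. h d a}" unfolding hl_def using diff_zero of_nat_0 by (auto) (metis diff_zero of_nat_0)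
  next
    fix a assume "a \<in> {a. h d a}"
    then have "hl h d [:a:]" using real_vector.subspace_0[OF sub]
      by (auto simp: hl_def coeff_pCons split: nat.splits)
    then show "a \<in> (\<lambda>p. coeff p 0) ` {p. hl h d p}" by (intro image_eqI[of _ _ "[:a:]"]) auto
  qed
  have neg0: "{p. hl h d p} \<subseteq> {0}" if "d < 0" for d
  proof
    fix p assume "p \<in> {p. hl h d p}"
    then have "coeff p i = 0" for i using neg[of "d - int i"] that unfolding hl_def by simp
    then show "p \<in> {0}" by (simp add: poly_eq_iff)
  qed
  have fin: "findim {p. hl h d p}" for d
  proof (cases "d < 0")
    case True
    then show ?thesis by (rule findim_zero[OF neg0])
  next
    case False
    have "findim {p. hl h (int n - 1) p}" for n
    proof (induct n)
      case 0
      show ?case by (rule findim_zero[OF neg0]) simp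
    next
      case (Suc n)
      have "findim {p. hl h (int n) p}"
      proof (rule findim_preimage[OF linear_coeff[of 0] subspace_hl[OF sub]])
        show "findim {x \<in> {p. hl h (int n) p}. coeff x 0 = 0}"
          unfolding ker using rank_nullity(2)[OF linear_pCons0 subspace_hl[OF sub] Suc] .
        show "findim ((\<lambda>p. coeff p 0) ` {p. hl h (int n) p})" unfolding im by (rule fd)
      qed
      then show ?case by simp
    qed
    from this[of "nat (d + 1)"] show ?thesis using False by simp
  qed
  then show "findim {p. hl h d p}" .
  have "dim (pCons 0 ` {p. hl h (d - 1) p}) = dim {p. hl h (d - 1) p}"
    by (rule dim_image_inj[OF linear_pCons0 subspace_hl[OF sub] fin]) simp
  then show "dim {p. hl h d p} = dim {p. hl h (d - 1) p} + dim {a. h d a}"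
    using rank_nullity(1)[OF linear_coeff[of 0] subspace_hl[OF sub] fin, of d] unfolding ker im by simp
qed

lemma dim_hl_neg: "d < 0 \<Longrightarrow> (\<And>d a. d < 0 \<Longrightarrow> h d a \<Longrightarrow> a = (0::'a::real_vector)) \<Longrightarrow> dim {p. hl h d p} = 0"
proof -
  assume d: "d < 0" and neg: "\<And>d a. d < 0 \<Longrightarrow> h d a \<Longrightarrow> a = (0::'a)"
  have "coeff p i = 0" if "hl h d p" for p i
    using neg[of "d - int i"] d that unfolding hl_def by simp
  then show ?thesis by (intro dim_zero_set) (auto simp: poly_eq_iff)
qed

lemma h0_space: "subspace {a. h0 d a}" "findim {a. h0 d a}" "dim {a. h0 d a} = (if d = 0 then 1 else 0)"
proof -
  have e: "{a. h0 d a} = (if d = 0 then UNIV else {0})" by (auto simp: h0_def)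
  show "subspace {a. h0 d a}" unfolding e by simp
  have "span {1::real} = UNIV" by (auto simp: real_vector.span_singleton)
  then show "findim {a. h0 d a}" unfolding findim_def by (intro exI[of _ "{1}"]) auto
  show "dim {a. h0 d a} = (if d = 0 then 1 else 0)" unfolding e by (simp add: dim_zero_set)
qed

text \<open>The recursion starts at degree -1, where the space is zero.\<close>

lemma dim_lift_int:
  fixes h :: "int \<Rightarrow> 'a::real_vector \<Rightarrow> bool"
  assumes sub: "\<And>d. subspace {a. h d a}" and fd: "\<And>d. findim {a. h d a}"
    and neg: "\<And>d a. d < 0 \<Longrightarrow> h d a \<Longrightarrow> a = 0"
    and f: "f (-1) = 0" "\<And>d. d \<ge> 0 \<Longrightarrow> f d = f (d - 1) + dim {a. h d a}"
  shows "d \<ge> -1 \<Longrightarrow> dim {p. hl h d p} = f d"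
proof -
  assume d: "d \<ge> -1"
  have "dim {p. hl h (int n - 1) p} = f (int n - 1)" for n
  proof (induct n)
    case 0
    show ?case using f(1) dim_hl_neg[of "-1" h] neg by simp
  next
    case (Suc n)
    then show ?case using dim_hl_step(2)[OF sub fd neg, where d = "int n"] f(2)[of "int n"] by simp
  qed
  from this[of "nat (d + 1)"] show ?thesis using d by simp
qed

lemma h1_space: "subspace {a. h1 d a}" "findim {a. h1 d a}" "dim {a. h1 d a} = (if d < 0 then 0 else 1)"
proof -
  show "subspace {a. h1 d a}" by (intro subspace_hl h0_space)
  show "findim {a. h1 d a}" by (intro dim_hl_step h0_space) (auto simp: h0_def)
  show "dim {a. h1 d a} = (if d < 0 then 0 else 1)"
  proof (cases "d < 0")
    case True
    then show ?thesis using dim_hl_neg[of d h0] by (auto simp: h0_def)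
  next
    case False
    have neg: "\<And>d a. d < 0 \<Longrightarrow> h0 d a \<Longrightarrow> a = 0" by (auto simp: h0_def)
    have "dim {a. h1 d a} = (\<lambda>d. if d < 0 then 0 else 1) d"
      by (rule dim_lift_int[OF h0_space(1,2) neg]) (use False in \<open>auto simp: h0_space(3)\<close>)
    then show ?thesis .
  qed
qed

lemma h2_space: "subspace {a. h2 d a}" "findim {a. h2 d a}" "dim {a. h2 d a} = nat (d + 1)"
proof -
  show "subspace {a. h2 d a}" by (intro subspace_hl h1_space)
  show "findim {a. h2 d a}" by (intro dim_hl_step h1_space) (auto dest: g1.h_neg)
  have neg: "\<And>d a. d < 0 \<Longrightarrow> h1 d a \<Longrightarrow> a = 0" using g1.h_neg by blast
  show "dim {a. h2 d a} = nat (d + 1)"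
    using dim_lift_int[OF h1_space(1,2) neg, where f = "\<lambda>d. nat (d + 1)" and d = d]
      dim_hl_neg[of d h1] neg by (cases "d < 0") (auto simp: h1_space(3))
qed

text \<open>The formula extends to degrees -1 and -2, where both sides are 0; \<open>dim_Gr\<close>
  uses it in that range.\<close>

lemma homog_space: "subspace {a. homog d a}" "findim {a. homog d a}"
  "d \<ge> -2 \<Longrightarrow> real (dim {a. homog d a}) = real_of_int ((d + 1) * (d + 2)) / 2"
  "d < 0 \<Longrightarrow> dim {a. homog d a} = 0"
proof -
  show "subspace {a. homog d a}" unfolding homog_hl by (intro subspace_hl h2_space)
  have neg: "\<And>d a. d < 0 \<Longrightarrow> h2 d a \<Longrightarrow> a = 0" using g2.h_neg by blast
  show "findim {a. homog d a}" unfolding homog_hl by (intro dim_hl_step h2_space neg)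
  have z: "dim {a. homog d a} = 0" if "d < 0" for d
    unfolding homog_hl using dim_hl_neg[of d h2] neg that by blast
  then show "d < 0 \<Longrightarrow> dim {a. homog d a} = 0" .
  have ev: "even (e * (e + 1))" for e :: int by simp
  have f: "nat ((d + 1) * (d + 2) div 2) = nat ((d - 1 + 1) * (d - 1 + 2) div 2) + dim {a. h2 d a}" if "d \<ge> 0" for d
  proof -
    have "(d + 1) * (d + 2) = (d - 1 + 1) * (d - 1 + 2) + 2 * (d + 1)" by (simp add: algebra_simps)
    then have "(d + 1) * (d + 2) div 2 = (d - 1 + 1) * (d - 1 + 2) div 2 + (d + 1)" by simp
    moreover have "(d - 1 + 1) * (d - 1 + 2) div 2 \<ge> 0" using that by simp
    ultimately show ?thesis using that by (simp add: h2_space(3) nat_add_distrib)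
  qed
  have *: "dim {a. homog d a} = nat ((d + 1) * (d + 2) div 2)" if "d \<ge> -1"
    unfolding homog_hl
    by (rule dim_lift_int[where f = "\<lambda>d. nat ((d + 1) * (d + 2) div 2)", OF h2_space(1,2) neg _ f that]) auto
  show "real (dim {a. homog d a}) = real_of_int ((d + 1) * (d + 2)) / 2" if "d \<ge> -2"
  proof (cases "d = -2")
    case True
    then show ?thesis using z[of d] by simp
  next
    case False
    then have d: "d \<ge> -1" using that by simp
    have "2 dvd (d + 1) * (d + 2)" using ev[of "d + 1"] by (simp add: add.assoc)
    then obtain k where k: "(d + 1) * (d + 2) = 2 * k" by (elim dvdE)
    have "real_of_int ((d + 1) * (d + 2) div 2) = real_of_int ((d + 1) * (d + 2)) / 2" unfolding k by simp
    moreover have "(d + 1) * (d + 2) div 2 \<ge> 0" using d by simp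
    ultimately show ?thesis using *[OF d] by simp
  qed
qed

text \<open>The piece of degree \<open>d\<close> of the graded module of global sections of \<open>O_sum ds\<close>.\<close>

definition Gr :: "int list \<Rightarrow> int \<Rightarrow> (nat \<Rightarrow> S3) set" where
  "Gr ds d = {v. (\<forall>i<length ds. homog (d + ds ! i) (v i)) \<and> (\<forall>i\<ge>length ds. v i = 0)}"

lemma linear_apply: "linear (\<lambda>v :: nat \<Rightarrow> 'a::real_vector. v n)"
  by (rule linearI) auto

lemma Gr_space: "subspace (Gr ds d)" "findim (Gr ds d)"
  "dim (Gr ds d) = (\<Sum>a\<leftarrow>ds. dim {p. homog (d + a) p})"
proof -
  have sub: "subspace (Gr ds d)" for ds
  proof (rule real_vector.subspaceI)
    show "x + y \<in> Gr ds d" if "x \<in> Gr ds d" "y \<in> Gr ds d" for x y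
      using that by (auto simp: Gr_def intro: g3.h_add)
    show "c *\<^sub>R x \<in> Gr ds d" if "x \<in> Gr ds d" for c x
    proof -
      have "homog (d + ds ! i) (c *\<^sub>R x i)" if "i < length ds" for i
        using real_vector.subspace_scale[OF homog_space(1)] \<open>x \<in> Gr ds d\<close> that by (auto simp: Gr_def)
      then show ?thesis using that by (auto simp: Gr_def)
    qed
  qed (auto simp: Gr_def)
  show "subspace (Gr ds d)" by (rule sub)
  have "findim (Gr ds d) \<and> dim (Gr ds d) = (\<Sum>a\<leftarrow>ds. dim {p. homog (d + a) p})"
  proof (induct ds rule: rev_induct)
    case Nil
    have "Gr [] d \<subseteq> {0}" by (auto simp: Gr_def)
    then show ?case by (simp add: findim_zero dim_zero_set)
  next
    case (snoc a ds)
    let ?n = "length ds"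
    have ker: "{v \<in> Gr (ds @ [a]) d. v ?n = 0} = Gr ds d"
    proof (intro set_eqI iffI)
      fix v assume "v \<in> {v \<in> Gr (ds @ [a]) d. v ?n = 0}"
      then have v: "\<And>i. i < Suc ?n \<Longrightarrow> homog (d + (ds @ [a]) ! i) (v i)" "\<And>i. i \<ge> Suc ?n \<Longrightarrow> v i = 0" "v ?n = 0"
        unfolding Gr_def by auto
      have "homog (d + ds ! i) (v i)" if "i < ?n" for i using v(1)[of i] that by (simp add: nth_append)
      moreover have "v i = 0" if "i \<ge> ?n" for i using v(2)[of i] v(3) that by (cases "i = ?n") auto
      ultimately show "v \<in> Gr ds d" by (simp add: Gr_def)
    next
      fix v assume "v \<in> Gr ds d"
      then show "v \<in> {v \<in> Gr (ds @ [a]) d. v ?n = 0}"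
        by (auto simp: Gr_def nth_append less_Suc_eq)
    qed
    have im: "(\<lambda>v. v ?n) ` Gr (ds @ [a]) d = {p. homog (d + a) p}"
    proof (intro set_eqI iffI)
      fix p assume "p \<in> (\<lambda>v. v ?n) ` Gr (ds @ [a]) d"
      then obtain v where v: "v \<in> Gr (ds @ [a]) d" "p = v ?n" by blast
      have "homog (d + (ds @ [a]) ! ?n) (v ?n)" using v(1) unfolding Gr_def by (simp del: nth_append_length)
      then show "p \<in> {p. homog (d + a) p}" using v by simp
    next
      fix p assume "p \<in> {p. homog (d + a) p}"
      then have "(\<lambda>i. if i = ?n then p else 0) \<in> Gr (ds @ [a]) d"
        by (auto simp: Gr_def nth_append)
      then show "p \<in> (\<lambda>v. v ?n) ` Gr (ds @ [a]) d"
        by (intro image_eqI[of _ _ "\<lambda>i. if i = ?n then p else 0"]) auto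
    qed
    have fin: "findim (Gr (ds @ [a]) d)"
      by (rule findim_preimage[OF linear_apply[of ?n] sub]) (unfold ker im, use snoc homog_space(2)[of "d + a"] in simp_all)
    then show ?case using rank_nullity(1)[OF linear_apply[of ?n] sub fin] snoc unfolding ker im by simp
  qed
  then show "findim (Gr ds d)" "dim (Gr ds d) = (\<Sum>a\<leftarrow>ds. dim {p. homog (d + a) p})" by auto
qed

section \<open>Homogeneous primes\<close>

lemma homog_X: "homog 1 X0" "homog 1 X1" "homog 1 X2"
  by (auto simp: homog_def X0_def X1_def X2_def coeff_pCons split: nat.splits if_splits)

lemma X_nonzero: "X0 \<noteq> 0" "X1 \<noteq> 0" "X2 \<noteq> 0"
  by (auto simp: X0_def X1_def X2_def)

lemma homog_cst: "homog 0 (cst c)"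
  by (auto simp: homog_def cst_def coeff_pCons split: nat.splits if_splits)

definition ideal_set :: "'a::comm_ring_1 set \<Rightarrow> bool" where
  "ideal_set I \<longleftrightarrow> 0 \<in> I \<and> (\<forall>g\<in>I. \<forall>h\<in>I. g + h \<in> I) \<and> (\<forall>g. \<forall>h\<in>I. g * h \<in> I)"

lemma ideal_sum: "ideal_set I \<Longrightarrow> (\<And>x. x \<in> A \<Longrightarrow> f x \<in> I) \<Longrightarrow> sum f A \<in> I"
  by (induct A rule: infinite_finite_induct) (auto simp: ideal_set_def)

context graded
begin

text \<open>For an ideal this is the largest homogeneous ideal inside it; it turns a prime into a
  homogeneous prime.\<close>

definition hpart :: "'a set \<Rightarrow> 'a set" where "hpart I = {a. \<forall>d. hc d a \<in> I}"

lemma hc_prod: "\<exists>n. \<forall>m\<ge>n. \<forall>d. hc d (g * a) = (\<Sum>k<m. hc (int k) g * hc (d - int k) a)"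
proof -
  obtain n where n: "\<forall>m\<ge>n. g = (\<Sum>k<m. hc (int k) g)" using hc_sum[of g] ..
  have "hc d (g * a) = (\<Sum>k<m. hc (int k) g * hc (d - int k) a)" if "m \<ge> n" for m d
  proof -
    have "g * a = (\<Sum>k<m. hc (int k) g * a)" unfolding sum_distrib_right[symmetric] using n that by auto
    then show ?thesis by (simp add: hc_sum_out hc_mult_left[OF h_hc])
  qed
  then show ?thesis by blast
qed

lemma ideal_hpart: assumes "ideal_set I" shows "ideal_set (hpart I)"
  unfolding ideal_set_def
proof (intro conjI ballI allI)
  show "0 \<in> hpart I" using assms by (simp add: hpart_def ideal_set_def)
  show "g + a \<in> hpart I" if "g \<in> hpart I" "a \<in> hpart I" for g a
    using assms that by (simp add: hpart_def ideal_set_def hc_add)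
  show "g * a \<in> hpart I" if "a \<in> hpart I" for g a
    unfolding hpart_def
  proof (intro CollectI allI)
    fix d
    obtain n where n: "\<forall>m\<ge>n. \<forall>d. hc d (g * a) = (\<Sum>k<m. hc (int k) g * hc (d - int k) a)" using hc_prod ..
    have "(\<Sum>k<n. hc (int k) g * hc (d - int k) a) \<in> I"
      using assms that by (intro ideal_sum) (auto simp: hpart_def ideal_set_def)
    then show "hc d (g * a) \<in> I" using n by auto
  qed
qed

text \<open>If neither factor is in \<open>hpart I\<close>, take in each the component of largest
  degree outside \<open>I\<close>. In degree \<open>e + f\<close> of the product every other term
  has a factor in \<open>I\<close>, so the product of these two components is in
  \<open>I\<close>.\<close>

lemma hpart_prime:
  assumes I: "ideal_set I" and prime: "\<And>g a. g * a \<in> I \<Longrightarrow> g \<in> I \<or> a \<in> I"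
    and ga: "g * a \<in> hpart I"
  shows "g \<in> hpart I \<or> a \<in> hpart I"
proof (rule ccontr)
  assume "\<not> ?thesis"
  then obtain e0 f0 where "hc e0 g \<notin> I" "hc f0 a \<notin> I" by (auto simp: hpart_def)
  moreover have "\<exists>e. hc e b \<notin> I \<and> (\<forall>k>e. hc k b \<in> I)" if "hc e0 b \<notin> I" for b e0
  proof -
    obtain n where n: "\<forall>k\<ge>int n. hc k b = 0" using hc_bound ..
    let ?S = "{k. hc k b \<notin> I}"
    have z: "0 \<in> I" using I ideal_set_def by blast
    have S: "?S \<subseteq> {0..int n}"
    proof
      fix k assume "k \<in> ?S"
      then have "hc k b \<noteq> 0" using z by auto
      then have "\<not> k < 0" "\<not> k \<ge> int n" using n hc_neg[of k b] by blast+
      then show "k \<in> {0..int n}" by simp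
    qed
    then have fin: "finite ?S" using finite_subset by blast
    then have "Max ?S \<in> ?S" "\<forall>k\<in>?S. k \<le> Max ?S" using that Max_in[OF fin] by auto
    then show ?thesis by (intro exI[of _ "Max ?S"]) (auto simp: not_le)
  qed
  ultimately obtain e f where e: "hc e g \<notin> I" "\<forall>k>e. hc k g \<in> I" and f: "hc f a \<notin> I" "\<forall>k>f. hc k a \<in> I"
    by metis
  have z: "0 \<in> I" using I ideal_set_def by blast
  have e0: "e \<ge> 0" using e(1) hc_neg[of e g] z by (cases "e < 0") auto
  obtain n where n: "\<forall>m\<ge>n. \<forall>d. hc d (g * a) = (\<Sum>k<m. hc (int k) g * hc (d - int k) a)" using hc_prod ..
  define m where "m = max n (nat e + 1)"
  have "hc (e + f) (g * a) = (\<Sum>k<m. hc (int k) g * hc (e + f - int k) a)" using n by (simp add: m_def)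
  also have "\<dots> = hc e g * hc f a + (\<Sum>k\<in>{..<m} - {nat e}. hc (int k) g * hc (e + f - int k) a)"
    using e0 by (subst sum.remove[of _ "nat e"]) (auto simp: m_def)
  finally have eq: "hc e g * hc f a = hc (e + f) (g * a) + (- 1) * (\<Sum>k\<in>{..<m} - {nat e}. hc (int k) g * hc (e + f - int k) a)"
    by simp
  have "(\<Sum>k\<in>{..<m} - {nat e}. hc (int k) g * hc (e + f - int k) a) \<in> I"
  proof (rule ideal_sum[OF I])
    fix k assume k: "k \<in> {..<m} - {nat e}"
    show "hc (int k) g * hc (e + f - int k) a \<in> I"
    proof (cases "int k > e")
      case True
      then have "hc (e + f - int k) a * hc (int k) g \<in> I" using e(2) I by (simp add: ideal_set_def)
      then show ?thesis by (simp add: mult.commute)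
    next
      case False
      then have "e + f - int k > f" using k e0 by auto
      then show ?thesis using f(2) I by (simp add: ideal_set_def)
    qed
  qed
  then have "(- 1) * (\<Sum>k\<in>{..<m} - {nat e}. hc (int k) g * hc (e + f - int k) a) \<in> I"
    using I unfolding ideal_set_def by blast
  moreover have "hc (e + f) (g * a) \<in> I" using ga by (simp add: hpart_def)
  ultimately have "hc e g * hc f a \<in> I" unfolding eq using I unfolding ideal_set_def by blast
  then show False using prime e(1) f(1) by blast
qed

end

text \<open>An ideal maximal among those that contain \<open>J\<close> and avoid the powers of
  \<open>X\<close> is prime: enlarging it by a non-member captures a power of \<open>X\<close>, and
  the product of two such powers would lie in the ideal itself.\<close>

lemma avoiding_prime:
  assumes J: "ideal_set J" and X: "\<And>n. X ^ n \<notin> J"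
  obtains P where "ideal_set P" "J \<subseteq> P" "\<And>g a. g * a \<in> P \<Longrightarrow> g \<in> P \<or> a \<in> P" "X \<notin> P" "1 \<notin> P"
proof -
  let ?F = "{I. ideal_set I \<and> J \<subseteq> I \<and> (\<forall>n. X ^ n \<notin> I)}"
  have "?F \<noteq> {}" using J X by blast
  moreover have "\<Union>C \<in> ?F" if C: "C \<noteq> {}" "subset.chain ?F C" for C
  proof -
    have CF: "C \<subseteq> ?F" using C(2) by (simp add: subset_chain_def)
    have "ideal_set (\<Union>C)"
      unfolding ideal_set_def
    proof (intro conjI ballI allI)
      show "0 \<in> \<Union>C" using C(1) CF by (auto simp: ideal_set_def)
      show "g + h \<in> \<Union>C" if gh: "g \<in> \<Union>C" "h \<in> \<Union>C" for g h
      proof -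
        obtain I I' where I: "I \<in> C" "I' \<in> C" "g \<in> I" "h \<in> I'" using gh by blast
        then have "I \<subseteq> I' \<or> I' \<subseteq> I" using C(2) by (auto simp: subset_chain_def)
        then obtain L where "L \<in> C" "g \<in> L" "h \<in> L" using I by blast
        moreover from \<open>L \<in> C\<close> have "ideal_set L" using CF by blast
        ultimately show ?thesis unfolding ideal_set_def by blast
      qed
      show "g * h \<in> \<Union>C" if h: "h \<in> \<Union>C" for g h
      proof -
        obtain L where L: "L \<in> C" "h \<in> L" using h by blast
        then have "ideal_set L" using CF by blast
        then show ?thesis using L unfolding ideal_set_def by blast
      qed
    qed
    then show ?thesis using C CF by auto
  qed
  ultimately obtain P where P: "P \<in> ?F" "\<forall>Q\<in>?F. P \<subseteq> Q \<longrightarrow> Q = P" using subset_Zorn_nonempty[of ?F] by blast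
  have id: "ideal_set P" using P by simp
  have ext: "\<exists>n p b. p \<in> P \<and> X ^ n = p + b * g" if "g \<notin> P" for g
  proof -
    let ?Q = "{p + b * g | p b. p \<in> P}"
    have "ideal_set ?Q"
      unfolding ideal_set_def
    proof (intro conjI ballI allI)
      have "0 = 0 + 0 * g" by simp
      then show "0 \<in> ?Q" using id unfolding ideal_set_def by blast
      show "x + y \<in> ?Q" if xy: "x \<in> ?Q" "y \<in> ?Q" for x y
      proof -
        obtain p b p' b' where "x = p + b * g" "y = p' + b' * g" "p \<in> P" "p' \<in> P" using xy by blast
        then have "x + y = (p + p') + (b + b') * g" "p + p' \<in> P" using id by (auto simp: algebra_simps ideal_set_def)
        then show ?thesis by blast
      qed
      show "a * y \<in> ?Q" if y: "y \<in> ?Q" for a y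
      proof -
        obtain p b where "y = p + b * g" "p \<in> P" using y by blast
        then have "a * y = a * p + (a * b) * g" "a * p \<in> P" using id by (auto simp: algebra_simps ideal_set_def)
        then show ?thesis by blast
      qed
    qed
    moreover have "P \<subseteq> ?Q"
    proof
      fix p assume "p \<in> P"
      moreover have "p = p + 0 * g" by simp
      ultimately show "p \<in> ?Q" by blast
    qed
    moreover have "g \<in> ?Q"
    proof -
      have "g = 0 + 1 * g" by simp
      then show ?thesis using id unfolding ideal_set_def by blast
    qed
    ultimately have "?Q \<notin> ?F" using P(2) that by blast
    then have "\<exists>n. X ^ n \<in> ?Q" using \<open>ideal_set ?Q\<close> \<open>P \<subseteq> ?Q\<close> P(1) by blast
    then show ?thesis by blast
  qed
  show thesis
  proof
    show "ideal_set P" "J \<subseteq> P" using P by auto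
    have "X ^ 1 \<notin> P" "X ^ 0 \<notin> P" using P(1) by blast+
    then show "X \<notin> P" "1 \<notin> P" by auto
    show "g \<in> P \<or> a \<in> P" if ga: "g * a \<in> P" for g a
    proof (rule ccontr)
      assume "\<not> ?thesis"
      then obtain n p b m p' b' where *: "p \<in> P" "X ^ n = p + b * g" "p' \<in> P" "X ^ m = p' + b' * a" using ext by metis
      have "X ^ (n + m) = (p' + b' * a) * p + (b * g) * p' + (b * b') * (g * a)"
        unfolding power_add * by (simp add: algebra_simps)
      moreover have "\<dots> \<in> P" using *(1,3) ga id unfolding ideal_set_def by blast
      ultimately have "X ^ (n + m) \<in> P" by (simp only:)
      then show False using P(1) by blast
    qed
  qed
qed

text \<open>The passage from local to global. If no power of \<open>X\<close> were in
  \<open>J\<close>, a prime containing the homogeneous part of \<open>J\<close> would avoid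
  \<open>X\<close>; its own homogeneous part is a point of \<open>Proj\<close>, and there the local
  hypothesis fails.\<close>

lemma relevant_prime_power:
  assumes J: "ideal_set J" and X: "X \<in> {X0, X1, X2}"
    and loc: "\<And>P. P \<in> Proj \<Longrightarrow> X \<notin> P \<Longrightarrow> \<exists>b\<in>J. b \<notin> P \<and> (\<exists>e. homog e b)"
  shows "\<exists>N. X ^ N \<in> J"
proof (rule ccontr)
  assume no: "\<nexists>N. X ^ N \<in> J"
  let ?J = "g3.hpart J"
  have JJ: "?J \<subseteq> J"
  proof
    fix a assume a: "a \<in> ?J"
    obtain n where n: "\<forall>m\<ge>n. a = (\<Sum>e<m. hcm (int e) a)" using g3.hc_sum[of a] ..
    have "(\<Sum>e<n. hcm (int e) a) \<in> J" using a by (intro ideal_sum J) (simp add: g3.hpart_def)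
    then show "a \<in> J" using n by auto
  qed
  obtain Q where Q: "ideal_set Q" "?J \<subseteq> Q" "\<And>g a. g * a \<in> Q \<Longrightarrow> g \<in> Q \<or> a \<in> Q" "X \<notin> Q" "1 \<notin> Q"
  proof (rule avoiding_prime[OF g3.ideal_hpart[OF J], of X])
    show "X ^ n \<notin> g3.hpart J" for n using JJ no by blast
  qed (rule that)
  let ?P = "g3.hpart Q"
  have hX: "homog 1 X" using X homog_X by auto
  have "hcm 1 X \<notin> Q" "hcm 0 1 \<notin> Q"
    unfolding g3.hc_h[OF hX] g3.hc_h[OF g3.h_one] using Q(4,5) by simp_all
  then have XP: "X \<notin> ?P" and "1 \<notin> ?P" unfolding g3.hpart_def by blast+
  then have "prime_ideal_S3 ?P"
    using g3.ideal_hpart[OF Q(1)] g3.hpart_prime[OF Q(1,3)]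
    unfolding prime_ideal_S3_def ideal_set_def by blast
  moreover have "homogeneous_set ?P"
    unfolding homogeneous_set_def
  proof
    fix a assume a: "a \<in> ?P"
    obtain n where n: "\<forall>m\<ge>n. a = (\<Sum>e<m. hcm (int e) a)" using g3.hc_sum[of a] ..
    have "hcm (int e) a \<in> ?P" for e
    proof -
      have z: "0 \<in> Q" using Q(1) ideal_set_def by blast
      have "hcm d (hcm (int e) a) \<in> Q" for d
        using a z g3.hc_h[OF g3.h_hc, of d "int e" a] by (auto simp: g3.hpart_def)
      then show ?thesis by (simp add: g3.hpart_def)
    qed
    then show "\<exists>n c. a = (\<Sum>e<n. c e) \<and> (\<forall>e<n. c e \<in> ?P \<and> homog (int e) (c e))"
      using n g3.h_hc by (intro exI[of _ n] exI[of _ "\<lambda>e. hcm (int e) a"]) auto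
  qed
  ultimately have "?P \<in> Proj" using XP X by (auto simp: Proj_def)
  then obtain b e where b: "b \<in> J" "b \<notin> ?P" "homog e b" using loc[of ?P] XP by blast
  have z: "0 \<in> J" using J ideal_set_def by blast
  have "b \<in> ?J" using b z by (simp add: g3.hpart_def g3.hc_h[OF b(3)])
  then have "b \<in> Q" using Q(2) by blast
  moreover have "0 \<in> Q" using Q(1) ideal_set_def by blast
  ultimately have "b \<in> ?P" by (simp add: g3.hpart_def g3.hc_h[OF b(3)])
  then show False using b by blast
qed

section \<open>Sections over open sets\<close>

definition emb :: "S3 \<Rightarrow> S3 fract" where "emb a = Fract a 1"

lemma emb_simps [simp]:
  "emb 0 = 0" "emb 1 = 1" "emb (a + b) = emb a + emb b" "emb (a * b) = emb a * emb b"
  "emb (- a) = - emb a" "emb (a - b) = emb a - emb b"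
  by (simp_all add: emb_def Zero_fract_def One_fract_def)

lemma emb_eq_iff [simp]: "emb a = emb b \<longleftrightarrow> a = b"
  by (simp add: emb_def eq_fract)

lemma emb_eq_0_iff [simp]: "emb a = 0 \<longleftrightarrow> a = 0"
  using emb_eq_iff[of a 0] by (simp del: emb_eq_iff)

lemma emb_sum: "emb (sum f A) = (\<Sum>x\<in>A. emb (f x))"
  by (induct A rule: infinite_finite_induct) auto

lemma emb_power: "emb (a ^ n) = emb a ^ n"
  by (induct n) auto

lemma Fract_emb: "b \<noteq> 0 \<Longrightarrow> Fract a b = s \<longleftrightarrow> emb a = emb b * s"
proof -
  assume b: "b \<noteq> 0"
  then have "Fract a b = emb a / emb b" by (simp add: emb_def)
  then show ?thesis using b by (auto simp: field_simps)
qed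

lemma opens_Proj: "U \<in> opens \<Longrightarrow> P \<in> U \<Longrightarrow> P \<in> Proj"
  by (auto simp: opens_def)

lemma Proj_zero: "P \<in> Proj \<Longrightarrow> 0 \<in> P"
  by (simp add: Proj_def prime_ideal_S3_def)

lemma Proj_mult: "P \<in> Proj \<Longrightarrow> a * b \<in> P \<longleftrightarrow> a \<in> P \<or> b \<in> P"
  unfolding Proj_def prime_ideal_S3_def by (metis (no_types, lifting) mem_Collect_eq mult.commute)

lemma Proj_one: "P \<in> Proj \<Longrightarrow> 1 \<notin> P"
  by (simp add: Proj_def prime_ideal_S3_def)

lemma Proj_power: "P \<in> Proj \<Longrightarrow> a \<notin> P \<Longrightarrow> a ^ n \<notin> P"
  by (induct n) (auto simp: Proj_mult Proj_one)

lemma Proj_prod: "P \<in> Proj \<Longrightarrow> finite A \<Longrightarrow> (\<And>x. x \<in> A \<Longrightarrow> f x \<notin> P) \<Longrightarrow> prod f A \<notin> P"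
proof (induct A rule: infinite_finite_induct)
  case (insert x A)
  then show ?case by (simp add: Proj_mult)
qed (simp_all add: Proj_one)

text \<open>The condition \<open>emb b * s = emb a\<close> replaces \<open>s = Fract a b\<close>, so
  that later arguments are polynomial identities under \<open>emb\<close>.\<close>

lemma O_twistI:
  assumes "U \<in> opens" "\<And>P. P \<in> U \<Longrightarrow> \<exists>a b e. homog (d + e) a \<and> homog e b \<and> b \<notin> P \<and> emb b * s = emb a"
  shows "s \<in> O_twist d U"
  unfolding O_twist_def
proof (intro CollectI ballI)
  fix P assume P: "P \<in> U"
  then obtain a b e where *: "homog (d + e) a" "homog e b" "b \<notin> P" "emb b * s = emb a" using assms(2) by blast
  then have "b \<noteq> 0" using Proj_zero[OF opens_Proj[OF assms(1) P]] by auto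
  then have "s = Fract a b" using *(4) Fract_emb by metis
  then show "\<exists>a b e. homog (d + e) a \<and> homog e b \<and> b \<notin> P \<and> s = Fract a b" using * by blast
qed

lemma O_twistE:
  assumes "U \<in> opens" "s \<in> O_twist d U" "P \<in> U"
  obtains a b e where "homog (d + e) a" "homog e b" "b \<notin> P" "b \<noteq> 0" "emb b * s = emb a"
proof -
  obtain a b e where *: "homog (d + e) a" "homog e b" "b \<notin> P" "s = Fract a b"
    using assms(2,3) unfolding O_twist_def by blast
  then have "b \<noteq> 0" using Proj_zero[OF opens_Proj[OF assms(1,3)]] by auto
  then show thesis using that[OF *(1-3)] *(4) Fract_emb by metis
qed

lemma O_restrict: "s \<in> O_twist d U \<Longrightarrow> V \<subseteq> U \<Longrightarrow> s \<in> O_twist d V"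
  by (auto simp: O_twist_def)

lemma O_emb: "U \<in> opens \<Longrightarrow> homog d a \<Longrightarrow> emb a \<in> O_twist d U"
proof (rule O_twistI)
  fix P assume *: "U \<in> opens" "homog d a" "P \<in> U"
  then have "1 \<notin> P" using Proj_one opens_Proj by blast
  then show "\<exists>a' b e. homog (d + e) a' \<and> homog e b \<and> b \<notin> P \<and> emb b * emb a = emb a'"
    using * g3.h_one by (intro exI[of _ a] exI[of _ 1] exI[of _ 0]) auto
qed

lemma O_zero: "U \<in> opens \<Longrightarrow> 0 \<in> O_twist d U"
  using O_emb[of U d 0] by simp

lemma O_mult:
  assumes U: "U \<in> opens" and s: "s \<in> O_twist d U" and t: "t \<in> O_twist e U" and k: "d + e = k"
  shows "s * t \<in> O_twist k U"
proof (rule O_twistI[OF U])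
  fix P assume P: "P \<in> U"
  obtain a b i where 1: "homog (d + i) a" "homog i b" "b \<notin> P" "b \<noteq> 0" "emb b * s = emb a" by (rule O_twistE[OF U s P])
  obtain a' b' i' where 2: "homog (e + i') a'" "homog i' b'" "b' \<notin> P" "b' \<noteq> 0" "emb b' * t = emb a'" by (rule O_twistE[OF U t P])
  have "emb (b * b') * (s * t) = (emb b * s) * (emb b' * t)" by (simp add: mult_ac)
  also have "\<dots> = emb (a * a')" by (simp add: 1 2)
  finally show "\<exists>a b e. homog (k + e) a \<and> homog e b \<and> b \<notin> P \<and> emb b * (s * t) = emb a"
    using 1 2 k Proj_mult[OF opens_Proj[OF U P], of b b']
    by (intro exI[of _ "a * a'"] exI[of _ "b * b'"] exI[of _ "i + i'"])
      (auto simp: algebra_simps intro: g3.h_mult' simp del: emb_simps)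
qed

lemma O_add:
  assumes U: "U \<in> opens" and s: "s \<in> O_twist d U" and t: "t \<in> O_twist d U"
  shows "s + t \<in> O_twist d U"
proof (rule O_twistI[OF U])
  fix P assume P: "P \<in> U"
  obtain a b i where 1: "homog (d + i) a" "homog i b" "b \<notin> P" "b \<noteq> 0" "emb b * s = emb a" by (rule O_twistE[OF U s P])
  obtain a' b' i' where 2: "homog (d + i') a'" "homog i' b'" "b' \<notin> P" "b' \<noteq> 0" "emb b' * t = emb a'" by (rule O_twistE[OF U t P])
  have "emb (b * b') * (s + t) = emb b' * (emb b * s) + emb b * (emb b' * t)" by (simp add: algebra_simps)
  also have "\<dots> = emb (b' * a + b * a')" by (simp add: 1 2)
  finally have *: "emb (b * b') * (s + t) = emb (b' * a + b * a')" .
  have "homog (d + (i + i')) (b' * a)" by (rule g3.h_mult'[OF 2(2) 1(1)]) simp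
  moreover have "homog (d + (i + i')) (b * a')" by (rule g3.h_mult'[OF 1(2) 2(1)]) simp
  ultimately have "homog (d + (i + i')) (b' * a + b * a')" by (rule g3.h_add)
  then show "\<exists>a b e. homog (d + e) a \<and> homog e b \<and> b \<notin> P \<and> emb b * (s + t) = emb a"
    using 1(3) 2(3) Proj_mult[OF opens_Proj[OF U P], of b b'] * g3.h_mult[OF 1(2) 2(2)]
    by (intro exI[of _ "b' * a + b * a'"] exI[of _ "b * b'"] exI[of _ "i + i'"] conjI) simp_all
qed

lemma O_sum_in: "U \<in> opens \<Longrightarrow> (\<And>x. x \<in> A \<Longrightarrow> f x \<in> O_twist d U) \<Longrightarrow> sum f A \<in> O_twist d U"
  by (induct A rule: infinite_finite_induct) (auto intro: O_add O_zero)

section \<open>Principal open sets and sections over them\<close>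

definition Dp :: "S3 \<Rightarrow> S3 set set" where "Dp b = {P \<in> Proj. b \<notin> P}"

lemma zero_in_Proj: "{0} \<in> Proj"
proof -
  have "homogeneous_set {0}" unfolding homogeneous_set_def by (auto intro!: exI[of _ 0])
  then show ?thesis using X_nonzero by (auto simp: Proj_def prime_ideal_S3_def)
qed

text \<open>The generic point serves wherever one local statement has to yield an identity in the
  fraction field.\<close>

lemma generic_in_opens: "U \<in> opens \<Longrightarrow> {0} \<in> U"
proof -
  assume "U \<in> opens"
  then obtain I where I: "U = {P \<in> Proj. \<not> I \<subseteq> P}" "U \<noteq> {}" by (auto simp: opens_def)
  then obtain P where P: "P \<in> Proj" "\<not> I \<subseteq> P" by blast
  then have "\<not> I \<subseteq> {0}" using Proj_zero by blast
  then show ?thesis using I zero_in_Proj by blast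
qed

lemma opens_inter_Dp:
  assumes U: "U \<in> opens" and b: "homog e b" "b \<noteq> 0"
  shows "U \<inter> Dp b \<in> opens"
proof -
  obtain I where I: "\<forall>g\<in>I. \<exists>d. homog d g" "U = {P \<in> Proj. \<not> I \<subseteq> P}" using U by (auto simp: opens_def)
  let ?I = "(\<lambda>g. g * b) ` I"
  have 1: "\<forall>g\<in>?I. \<exists>d. homog d g" using I(1) g3.h_mult b(1) by blast
  have 2: "U \<inter> Dp b = {P \<in> Proj. \<not> ?I \<subseteq> P}" using I(2) by (auto simp: Dp_def Proj_mult)
  have "{0} \<in> U \<inter> Dp b" using generic_in_opens[OF U] zero_in_Proj b(2) by (auto simp: Dp_def)
  then show ?thesis unfolding opens_def using 1 2 by blast
qed

lemma Proj_opens: "Proj \<in> opens"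
proof -
  have "Proj = {P \<in> Proj. \<not> {1} \<subseteq> P}" using Proj_one by auto
  then show ?thesis unfolding opens_def using zero_in_Proj g3.h_one by (intro CollectI conjI exI[of _ "{1}"]) auto
qed

lemma Dp_opens: "homog e b \<Longrightarrow> b \<noteq> 0 \<Longrightarrow> Dp b \<in> opens"
  using opens_inter_Dp[OF Proj_opens, of e b] by (simp add: Dp_def Int_def cong: conj_cong)

text \<open>Powers of \<open>b\<close>, also negative ones, trivialise the twists where
  \<open>b\<close> does not vanish.\<close>

lemma O_inverse_power:
  assumes U: "U \<in> opens" and "homog 1 b" "b \<noteq> 0" "U \<subseteq> Dp b"
  shows "emb b powi d \<in> O_twist d U"
proof (cases "d \<ge> 0")
  case True
  then have "emb b powi d = emb (b ^ nat d)" by (simp add: power_int_def emb_power)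
  moreover have "homog d (b ^ nat d)" using g3.h_power[OF assms(2), of "nat d"] True by simp
  ultimately show ?thesis using O_emb[OF U] by simp
next
  case False
  show ?thesis
  proof (rule O_twistI[OF U])
    fix P assume P: "P \<in> U"
    have "homog (- d) (b ^ nat (- d))" using g3.h_power[OF assms(2), of "nat (- d)"] False by simp
    moreover have "b ^ nat (- d) \<notin> P" using P assms(4) Proj_power by (auto simp: Dp_def)
    moreover have "emb (b ^ nat (- d)) * (emb b powi d) = emb 1"
      using False assms(3) by (simp add: power_int_def emb_power field_simps)
    ultimately show "\<exists>a b' e. homog (d + e) a \<and> homog e b' \<and> b' \<notin> P \<and> emb b' * (emb b powi d) = emb a"
      by (intro exI[of _ 1] exI[of _ "b ^ nat (- d)"] exI[of _ "- d"]) (auto intro: g3.h_one)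
  qed
qed

lemma prime_elem_monic_linear: "prime_elem [:- a, 1 :: 'a::idom:]"
  unfolding prime_elem_def
proof (intro conjI allI impI)
  have dvd: "[:- a, 1:] dvd p \<longleftrightarrow> poly p a = 0" for p by (simp add: poly_eq_0_iff_dvd)
  show "[:- a, 1:] \<noteq> 0" "\<not> [:- a, 1:] dvd 1" by (simp_all add: dvd)
  show "[:- a, 1:] dvd p \<or> [:- a, 1:] dvd q" if "[:- a, 1:] dvd p * q" for p q
    using that by (simp add: dvd)
qed

lemma prime_elem_X0: "prime_elem X0"
  using prime_elem_monic_linear[of 0] by (simp add: X0_def)

lemma prime_elem_power_cancel:
  assumes "prime_elem (p :: 'a::idom)" "\<not> p dvd b"
  shows "p ^ n dvd b * c \<Longrightarrow> p ^ n dvd c"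
proof (induct n arbitrary: c)
  case (Suc n)
  have "p dvd b * c" using Suc(2) by (metis dvd_mult_left power_Suc)
  then obtain c' where c': "c = p * c'" using assms prime_elem_dvd_multD by (metis dvdE)
  have e: "b * c = p * (b * c')" unfolding c' by (rule mult.left_commute)
  have d: "p * p ^ n dvd p * (b * c')" using Suc(2) unfolding e power_Suc .
  have "p \<noteq> 0" using assms(1) unfolding prime_elem_def by blast
  then have "p ^ n dvd b * c'" using d unfolding dvd_mult_cancel_left by blast
  then have "p ^ n dvd c'" by (rule Suc(1))
  then show ?case unfolding c' power_Suc by (rule mult_dvd_mono[OF dvd_refl])
qed simp

lemma X0_power_cancel:
  assumes "X0 ^ n dvd X1 ^ m * c"
  shows "X0 ^ n dvd c"
proof -
  have "\<not> X0 dvd X1" using poly_eq_0_iff_dvd[of X1 0] by (simp add: X0_def X1_def)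
  then have "\<not> X0 dvd X1 ^ m" using prime_elem_X0 prime_elem_dvd_power by blast
  then show ?thesis using prime_elem_power_cancel[OF prime_elem_X0] assms by blast
qed

lemma homog_cancel:
  assumes "homog e b" "b \<noteq> 0" "homog (d + e) (p * b)"
  shows "homog d p"
proof -
  have "hcm k p = 0" if "k \<noteq> d" for k
  proof -
    have "hcm (k + e) (p * b) = hcm k p * b" using g3.hc_mult[OF assms(1), of "k + e" p] by simp
    moreover have "hcm (k + e) (p * b) = 0" using g3.hc_h[OF assms(3), of "k + e"] that by simp
    ultimately show ?thesis using assms(2) by simp
  qed
  then have "hcm k (p - hcm d p) = 0" for k
    using g3.hc_add[of k p "- hcm d p"] g3.hc_h[OF g3.h_uminus[OF g3.h_hc], of k d p]
    by (cases "k = d") auto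
  then have "p - hcm d p = 0" by (rule g3.hc_all_zero)
  then show ?thesis using g3.h_hc[of d p] by simp
qed

text \<open>The denominators of \<open>a\<close> form an ideal that contains a power of
  \<open>X0\<close> and a power of \<open>X1\<close>; these are coprime, so \<open>a\<close> has
  denominator 1. Two charts suffice because they cover the plane up to a single closed
  point.\<close>

lemma regular_imp_polynomial:
  assumes 0: "a \<in> O_twist d (Dp X0)" and 1: "a \<in> O_twist d (Dp X1)"
  shows "\<exists>p. homog d p \<and> a = emb p"
proof -
  note o = Dp_opens[OF homog_X(1) X_nonzero(1)] Dp_opens[OF homog_X(2) X_nonzero(2)]
  let ?J = "{b. \<exists>c. emb b * a = emb c}"
  have J: "ideal_set ?J"
    unfolding ideal_set_def
  proof (intro conjI ballI allI)
    show "0 \<in> ?J" by (auto intro: exI[of _ 0])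
    show "g + h \<in> ?J" if gh: "g \<in> ?J" "h \<in> ?J" for g h
    proof -
      obtain c c' where "emb g * a = emb c" "emb h * a = emb c'" using gh by blast
      then have "emb (g + h) * a = emb (c + c')" by (simp add: distrib_right)
      then show ?thesis by blast
    qed
    show "g * h \<in> ?J" if h: "h \<in> ?J" for g h
    proof -
      obtain c where "emb h * a = emb c" using h by blast
      then have "emb (g * h) * a = emb (g * c)" by (simp add: mult.assoc)
      then show ?thesis by blast
    qed
  qed
  have "\<exists>N. X ^ N \<in> ?J" if X: "X \<in> {X0, X1, X2}" "Dp X \<in> opens" "a \<in> O_twist d (Dp X)" for X
  proof (rule relevant_prime_power[OF J X(1)])
    fix P assume P: "P \<in> Proj" "X \<notin> P"
    then have "P \<in> Dp X" by (simp add: Dp_def)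
    from O_twistE[OF X(2,3) this] show "\<exists>b\<in>?J. b \<notin> P \<and> (\<exists>e. homog e b)" by (metis (mono_tags, lifting) mem_Collect_eq)
  qed
  then obtain N M where "X0 ^ N \<in> ?J" "X1 ^ M \<in> ?J" using o 0 1 by blast
  then obtain c c' where c: "emb (X0 ^ N) * a = emb c" "emb (X1 ^ M) * a = emb c'" by blast
  have "emb (X1 ^ M * c) = emb (X0 ^ N * c')"
    unfolding emb_simps c(1)[symmetric] c(2)[symmetric] by (simp add: mult_ac)
  then have "X0 ^ N dvd X1 ^ M * c" by (simp del: emb_simps)
  then obtain p where p: "c = X0 ^ N * p" using X0_power_cancel by (metis dvdE)
  have "emb (X0 ^ N) \<noteq> 0" using X_nonzero by simp
  moreover have "emb (X0 ^ N) * a = emb (X0 ^ N) * emb p" using c(1) p by simp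
  ultimately have a: "a = emb p" by (simp del: emb_eq_0_iff)
  have "{0} \<in> Dp X0" using X_nonzero zero_in_Proj by (simp add: Dp_def)
  then obtain u b e where *: "homog (d + e) u" "homog e b" "b \<noteq> 0" "emb b * a = emb u" using O_twistE[OF o(1) 0] by metis
  have "emb (p * b) = emb u" using *(4) a by (simp add: mult.commute)
  then have "p * b = u" by (simp del: emb_simps)
  then have "homog d p" using homog_cancel *(1-3) by blast
  then show ?thesis using a by blast
qed

section \<open>Morphisms between sums of line bundles are matrices\<close>

definition mat_hom :: "nat \<Rightarrow> (nat \<Rightarrow> nat \<Rightarrow> S3) \<Rightarrow> tup \<Rightarrow> tup" where
  "mat_hom n B s = (\<lambda>i. \<Sum>j<n. s j * emb (B j i))"

lemma O_sum_restrict: "s \<in> O_sum ds U \<Longrightarrow> V \<subseteq> U \<Longrightarrow> s \<in> O_sum ds V"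
  by (auto simp: O_sum_def intro: O_restrict)

lemma O_sum_add: "U \<in> opens \<Longrightarrow> s \<in> O_sum ds U \<Longrightarrow> t \<in> O_sum ds U \<Longrightarrow> (\<lambda>i. s i + t i) \<in> O_sum ds U"
  by (auto simp: O_sum_def intro: O_add)

lemma O_sum_scale: "U \<in> opens \<Longrightarrow> a \<in> O_twist 0 U \<Longrightarrow> s \<in> O_sum ds U \<Longrightarrow> (\<lambda>i. a * s i) \<in> O_sum ds U"
  by (auto simp: O_sum_def intro: O_mult)

text \<open>A morphism commutes with restriction and all sections lie in a constant sheaf, so it is
  determined over \<open>Dp X0\<close>, where \<open>O_sum ds\<close> is free on powers of
  \<open>X0\<close>. Its entries are regular on two charts, hence forms. The target is only assumed
  to be contained in \<open>O_sum ds'\<close>, so that it may be a kernel sheaf.\<close>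

lemma sheaf_hom_matrix:
  assumes hom: "sheaf_hom (O_sum ds) G \<phi>" and G: "\<And>U. U \<in> opens \<Longrightarrow> G U \<subseteq> O_sum ds' U"
  shows "\<exists>B. (\<forall>j<length ds. \<forall>i<length ds'. homog (ds' ! i - ds ! j) (B j i)) \<and>
    (\<forall>j. \<forall>i\<ge>length ds'. B j i = 0) \<and>
    (\<forall>U\<in>opens. \<forall>s\<in>O_sum ds U. \<phi> U s = mat_hom (length ds) B s)"
proof -
  let ?n = "length ds" and ?x = "emb X0"
  let ?V = "Dp X0"
  have V: "?V \<in> opens" by (rule Dp_opens[OF homog_X(1) X_nonzero(1)])
  have x0: "?x \<noteq> 0" using X_nonzero by simp
  define u where "u j = (\<lambda>i::nat. if i = j then ?x powi (ds ! j) else 0)" for j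
  have u: "u j \<in> O_sum ds W" if "j < ?n" "W \<in> opens" "W \<subseteq> ?V" for j W
    using that O_inverse_power[OF that(2) homog_X(1) X_nonzero(1) that(3)]
    by (auto simp: O_sum_def u_def O_zero)
  define A where "A j i = \<phi> ?V (u j) i * ?x powi (- (ds ! j))" for j i
  have phi_in: "\<phi> U s \<in> G U" if "U \<in> opens" "s \<in> O_sum ds U" for U s
    using hom that unfolding sheaf_hom_def by blast
  have phi_add: "\<phi> U (\<lambda>i. s i + t i) = (\<lambda>i. \<phi> U s i + \<phi> U t i)"
    if "U \<in> opens" "s \<in> O_sum ds U" "t \<in> O_sum ds U" for U s t
    using hom that unfolding sheaf_hom_def by blast
  have phi_scale: "\<phi> U (\<lambda>i. a * s i) = (\<lambda>i. a * \<phi> U s i)"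
    if "U \<in> opens" "s \<in> O_sum ds U" "a \<in> O_twist 0 U" for U s a
    using hom that unfolding sheaf_hom_def by blast
  have phi_res: "\<phi> W s = \<phi> U s" if "U \<in> opens" "W \<in> opens" "W \<subseteq> U" "s \<in> O_sum ds U" for U W s
    using hom that unfolding sheaf_hom_def by blast
  have zs: "(\<lambda>_. 0) \<in> O_sum ds U" if "U \<in> opens" for U using that by (simp add: O_sum_def O_zero)
  have phi_zero: "\<phi> U (\<lambda>_. 0) = (\<lambda>_. 0)" if "U \<in> opens" for U
    using phi_scale[OF that zs[OF that] O_zero[OF that]] by simp
  have main: "\<phi> U s = (\<lambda>i. \<Sum>j<?n. s j * A j i)" if U: "U \<in> opens" and s: "s \<in> O_sum ds U" for U s
  proof -
    let ?W = "U \<inter> ?V"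
    have W: "?W \<in> opens" by (rule opens_inter_Dp[OF U homog_X(1) X_nonzero(1)])
    have sW: "s \<in> O_sum ds ?W" using s O_sum_restrict by blast
    define c where "c j = s j * ?x powi (- (ds ! j))" for j
    have c: "c j \<in> O_twist 0 ?W" if "j < ?n" for j
    proof -
      have "s j \<in> O_twist (ds ! j) ?W" using sW that by (simp add: O_sum_def)
      then show ?thesis unfolding c_def
        by (rule O_mult[OF W _ O_inverse_power[OF W homog_X(1) X_nonzero(1)]]) auto
    qed
    have part: "(\<lambda>i. \<Sum>j<k. c j * u j i) \<in> O_sum ds ?W \<and>
       \<phi> ?W (\<lambda>i. \<Sum>j<k. c j * u j i) = (\<lambda>i. \<Sum>j<k. c j * \<phi> ?V (u j) i)" if "k \<le> ?n" for k
      using that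
    proof (induct k)
      case 0
      then show ?case using zs[OF W] phi_zero[OF W] by simp
    next
      case (Suc k)
      have uk: "u k \<in> O_sum ds ?W" using u[of k ?W] Suc(2) W by simp
      have ck: "c k \<in> O_twist 0 ?W" using c Suc(2) by simp
      have "\<phi> ?W (u k) = \<phi> ?V (u k)" using phi_res[OF V W _ u[OF _ V]] Suc(2) by simp
      then have "\<phi> ?W (\<lambda>i. c k * u k i) = (\<lambda>i. c k * \<phi> ?V (u k) i)" using phi_scale[OF W uk ck] by simp
      moreover have "(\<lambda>i. c k * u k i) \<in> O_sum ds ?W" by (rule O_sum_scale[OF W ck uk])
      ultimately show ?case using Suc phi_add[OF W, of "\<lambda>i. \<Sum>j<k. c j * u j i" "\<lambda>i. c k * u k i"]
        O_sum_add[OF W, of "\<lambda>i. \<Sum>j<k. c j * u j i" ds "\<lambda>i. c k * u k i"] by simp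
    qed
    have "s i = (\<Sum>j<?n. c j * u j i)" for i
    proof (cases "i < ?n")
      case True
      have "(\<Sum>j<?n. c j * u j i) = (\<Sum>j<?n. if j = i then c i * ?x powi (ds ! i) else 0)"
        by (intro sum.cong) (auto simp: u_def)
      also have "\<dots> = s i" using True x0 by (simp add: c_def mult.assoc flip: power_int_add)
      finally show ?thesis by simp
    next
      case False
      then have "s i = 0" using s by (simp add: O_sum_def)
      moreover have "(\<Sum>j<?n. c j * u j i) = 0" using False by (intro sum.neutral) (auto simp: u_def)
      ultimately show ?thesis by simp
    qed
    then have se: "s = (\<lambda>i. \<Sum>j<?n. c j * u j i)" by auto
    have "\<phi> U s = \<phi> ?W s" using phi_res[OF U W _ s] by simp
    also have "\<dots> = (\<lambda>i. \<Sum>j<?n. c j * \<phi> ?V (u j) i)" using part[of ?n] se by simp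
    also have "\<dots> = (\<lambda>i. \<Sum>j<?n. s j * A j i)" by (simp add: c_def A_def mult_ac)
    finally show ?thesis .
  qed
  \<comment> \<open>\<open>main\<close> holds over every open set; evaluated on a unit vector over
    \<open>Dp X\<close> it shows that the entry, defined by means of \<open>Dp X0\<close>, is
    regular on \<open>Dp X\<close> too.\<close>
  have ent: "A j i \<in> O_twist (ds' ! i - ds ! j) (Dp X)"
    if X: "homog 1 X" "X \<noteq> 0" and ij: "j < ?n" "i < length ds'" for X j i
  proof -
    have D: "Dp X \<in> opens" by (rule Dp_opens[OF X])
    let ?s = "\<lambda>i. if i = j then emb X powi (ds ! j) else 0"
    have s: "?s \<in> O_sum ds (Dp X)" using O_inverse_power[OF D X] ij by (auto simp: O_sum_def O_zero[OF D])
    have "\<phi> (Dp X) ?s i \<in> O_twist (ds' ! i) (Dp X)" using phi_in[OF D s] G[OF D] ij by (auto simp: O_sum_def)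
    also have "\<phi> (Dp X) ?s i = (\<Sum>k<?n. if k = j then emb X powi (ds ! j) * A j i else 0)"
      unfolding main[OF D s] by (intro sum.cong) auto
    also have "\<dots> = emb X powi (ds ! j) * A j i" using ij by simp
    finally have "emb X powi (- (ds ! j)) * (emb X powi (ds ! j) * A j i) \<in> O_twist (ds' ! i - ds ! j) (Dp X)"
      by - (rule O_mult[OF D O_inverse_power[OF D X order_refl]], assumption, simp)
    moreover have "emb X powi (- (ds ! j)) * (emb X powi (ds ! j) * A j i) = A j i"
      using X by (simp add: mult.assoc[symmetric] flip: power_int_add)
    ultimately show ?thesis by simp
  qed
  have "\<exists>p. homog (ds' ! i - ds ! j) p \<and> A j i = emb p" if "j < ?n" "i < length ds'" for j i
    using ent[OF homog_X(1) X_nonzero(1) that] ent[OF homog_X(2) X_nonzero(2) that] by (rule regular_imp_polynomial)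
  then obtain B where B: "\<And>j i. j < ?n \<Longrightarrow> i < length ds' \<Longrightarrow> homog (ds' ! i - ds ! j) (B j i) \<and> A j i = emb (B j i)"
    by metis
  define B' where "B' j i = (if i < length ds' then B j i else 0)" for j i
  have Az: "A j i = 0" if "j < ?n" "i \<ge> length ds'" for j i
  proof -
    have "\<phi> ?V (u j) i = 0" using phi_in[OF V u[OF that(1) V]] G[OF V] that by (auto simp: O_sum_def)
    then show ?thesis by (simp add: A_def)
  qed
  have AB: "A j i = emb (B' j i)" if "j < ?n" for j i using B Az that by (auto simp: B'_def)
  show ?thesis
  proof (intro exI[of _ B'] conjI allI impI ballI)
    fix U s assume U: "U \<in> opens" and s: "s \<in> O_sum ds U"
    show "\<phi> U s = mat_hom ?n B' s" unfolding main[OF U s] mat_hom_def using AB by simp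
  qed (use B in \<open>auto simp: B'_def\<close>)
qed

section \<open>Exactness of sheaves and of graded modules\<close>

text \<open>The default 0 beyond the list makes the weights a total function; the vectors in
  \<open>Gr ds d\<close> vanish there.\<close>

definition wt :: "int list \<Rightarrow> nat \<Rightarrow> int" where
  "wt ds i = (if i < length ds then ds ! i else 0)"

lemma Gr_iff: "v \<in> Gr ds d \<longleftrightarrow> hv homog (wt ds) d v \<and> (\<forall>i\<ge>length ds. v i = 0)"
  unfolding Gr_def hv_def wt_def by (auto simp: not_less)

lemma common_denominator:
  fixes n :: nat
  assumes U: "U \<in> opens" and s: "\<And>j. j < n \<Longrightarrow> s j \<in> O_twist (w j) U" and P: "P \<in> U"
  shows "\<exists>b c e. homog e b \<and> b \<notin> P \<and> b \<noteq> 0 \<and> (\<forall>j<n. homog (w j + e) (c j) \<and> emb b * s j = emb (c j))"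
proof -
  have "\<exists>a b e. homog (w j + e) a \<and> homog e b \<and> b \<notin> P \<and> emb b * s j = emb a" if "j < n" for j
    by (rule O_twistE[OF U s[OF that] P]) blast
  then obtain a b e where *: "\<And>j. j < n \<Longrightarrow> homog (w j + e j) (a j) \<and> homog (e j) (b j) \<and> b j \<notin> P \<and> emb (b j) * s j = emb (a j)"
    by metis
  have hp: "homog (sum e S) (prod b S)" if "S \<subseteq> {..<n}" for S :: "nat set"
  proof -
    have "finite S" using that finite_subset by blast
    then show ?thesis using that
    proof (induct S rule: finite_induct)
      case (insert x S)
      then show ?case using *[of x] by (auto intro!: g3.h_mult)
    qed (simp add: g3.h_one)
  qed
  have rem: "sum e {..<n} = e j + sum e ({..<n} - {j})" "prod b {..<n} = b j * prod b ({..<n} - {j})" if "j < n" for j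
    using that by (simp_all add: sum.remove prod.remove)
  have nP: "prod b {..<n} \<notin> P" by (rule Proj_prod[OF opens_Proj[OF U P]]) (use * in auto)
  have "homog (w j + sum e {..<n}) (a j * prod b ({..<n} - {j})) \<and>
      emb (prod b {..<n}) * s j = emb (a j * prod b ({..<n} - {j}))" if j: "j < n" for j
  proof
    let ?c = "a j * prod b ({..<n} - {j})"
    show "homog (w j + sum e {..<n}) ?c"
      unfolding rem(1)[OF j]
      using j * hp[of "{..<n} - {j}"] by (intro g3.h_mult'[of "w j + e j" _ "sum e ({..<n} - {j})"]) auto
    have "emb (prod b {..<n}) * s j = (emb (b j) * s j) * emb (prod b ({..<n} - {j}))"
      unfolding rem(2)[OF j] by (simp add: mult_ac)
    then show "emb (prod b {..<n}) * s j = emb ?c" using * j by simp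
  qed
  moreover have "prod b {..<n} \<noteq> 0" using nP Proj_zero[OF opens_Proj[OF U P]] by metis
  ultimately show ?thesis using hp[of "{..<n}"] nP
    by (intro exI[of _ "prod b {..<n}"] exI[of _ "\<lambda>j. a j * prod b ({..<n} - {j})"] exI[of _ "sum e {..<n}"]) auto
qed

lemma mat_hom_emb:
  assumes "\<And>j. j < n \<Longrightarrow> x * t j = emb (c j)"
  shows "x * mat_hom n B t i = emb (comb {..<n} B c i)"
proof -
  have "x * mat_hom n B t i = (\<Sum>j<n. (x * t j) * emb (B j i))"
    by (simp add: mat_hom_def sum_distrib_left mult.assoc)
  also have "\<dots> = (\<Sum>j<n. emb (c j) * emb (B j i))" using assms by (intro sum.cong) auto
  finally show ?thesis by (simp add: comb_def emb_sum)
qed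

text \<open>The \<open>b\<close> for which \<open>b * v\<close> is a combination of the rows of
  \<open>B\<close> form an ideal. Local preimages of \<open>v / X ^ d\<close> provide members of it
  outside each prime of \<open>Dp X\<close>, and \<open>relevant_prime_power\<close> gives a power
  of \<open>X\<close>.\<close>

lemma image_imp_power:
  assumes X: "X \<in> {X0, X1, X2}" and \<phi>: "\<And>U s. U \<in> opens \<Longrightarrow> s \<in> O_sum ds U \<Longrightarrow> \<phi> U s = mat_hom (length ds) B s"
    and im: "in_image_sheaf (O_sum ds) \<phi> (Dp X) (\<lambda>i. emb (v i) * emb X powi (- d))"
  shows "\<exists>N w. (\<lambda>i. X ^ N * v i) = comb {..<length ds} B w"
proof -
  let ?n = "length ds"
  have hX: "homog 1 X" "X \<noteq> 0" using X homog_X X_nonzero by auto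
  let ?J = "{b. \<exists>w. (\<lambda>i. b * v i) = comb {..<?n} B w}"
  have J: "ideal_set ?J"
    unfolding ideal_set_def
  proof (intro conjI ballI allI)
    show "0 \<in> ?J" by (auto simp: comb_def intro!: exI[of _ "\<lambda>_. 0"])
    show "g + h \<in> ?J" if gh: "g \<in> ?J" "h \<in> ?J" for g h
    proof -
      obtain w w' where "(\<lambda>i. g * v i) = comb {..<?n} B w" "(\<lambda>i. h * v i) = comb {..<?n} B w'" using gh by blast
      then have "(\<lambda>i. (g + h) * v i) = comb {..<?n} B (\<lambda>j. w j + w' j)" by (auto simp: fun_eq_iff comb_add distrib_right)
      then show ?thesis by blast
    qed
    show "g * h \<in> ?J" if h: "h \<in> ?J" for g h
    proof -
      obtain w where "(\<lambda>i. h * v i) = comb {..<?n} B w" using h by blast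
      then have "(\<lambda>i. (g * h) * v i) = comb {..<?n} B (\<lambda>j. g * w j)" by (auto simp: fun_eq_iff comb_scale mult.assoc)
      then show ?thesis by blast
    qed
  qed
  have "\<exists>N. X ^ N \<in> ?J"
  proof (rule relevant_prime_power[OF J X])
    fix P assume P: "P \<in> Proj" "X \<notin> P"
    then have "P \<in> Dp X" by (simp add: Dp_def)
    then obtain V t where V: "V \<in> opens" "P \<in> V" "t \<in> O_sum ds V" "\<phi> V t = (\<lambda>i. emb (v i) * emb X powi (- d))"
      using im unfolding in_image_sheaf_def by blast
    have "t j \<in> O_twist (wt ds j) V" if "j < ?n" for j using V(3) that by (simp add: O_sum_def wt_def)
    then obtain b c e where b: "homog e b" "b \<notin> P" "b \<noteq> 0" "\<forall>j<?n. homog (wt ds j + e) (c j) \<and> emb b * t j = emb (c j)"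
      using common_denominator[OF V(1) _ V(2), where n = ?n and s = t and w = "wt ds"] by blast
    have "(\<lambda>i. (b * X ^ nat (- d)) * v i) = comb {..<?n} B (\<lambda>j. X ^ nat d * c j)"
    proof
      fix i
      \<comment> \<open>Both signs of \<open>d\<close> are treated at once: one of
        \<open>nat d\<close> and \<open>nat (- d)\<close> is 0.\<close>
      have p: "emb X powi (- d) * emb X ^ nat d = emb X ^ nat (- d)"
        using hX by (cases "d \<ge> 0") (auto simp: power_int_def field_simps)
      have "emb (comb {..<?n} B c i) = emb b * (emb (v i) * emb X powi (- d))"
        using mat_hom_emb[where x = "emb b" and n = ?n and B = B and i = i and t = t and c = c] b(4) V(4) \<phi>[OF V(1,3)] by (simp add: fun_eq_iff)
      then have "emb (X ^ nat d) * emb (comb {..<?n} B c i) = emb (b * X ^ nat (- d) * v i)"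
        by (simp add: emb_power p[symmetric] mult_ac)
      then show "b * X ^ nat (- d) * v i = comb {..<?n} B (\<lambda>j. X ^ nat d * c j) i"
        unfolding comb_scale by (metis emb_eq_iff emb_simps(4))
    qed
    moreover have "b * X ^ nat (- d) \<notin> P" using b(2) P Proj_mult Proj_power by blast
    moreover have "homog (e + int (nat (- d)) * 1) (b * X ^ nat (- d))"
      by (rule g3.h_mult[OF b(1) g3.h_power[OF hX(1)]])
    ultimately show "\<exists>b\<in>?J. b \<notin> P \<and> (\<exists>e. homog e b)" by blast
  qed
  then show ?thesis by blast
qed

lemma poly_expand: "(p :: 'a::comm_ring_1 poly) = (\<Sum>i\<le>degree p. [:coeff p i:] * [:0, 1:] ^ i)"
proof -
  have "[:coeff p i:] * [:0, 1:] ^ i = monom (coeff p i) i" for i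
    by (simp add: monom_altdef)
  then show ?thesis by (simp add: poly_as_sum_of_monoms)
qed

lemma const_poly_sum: "[:sum f A:] = (\<Sum>x\<in>A. [:f x :: 'a::comm_ring_1:])"
  by (induct A rule: infinite_finite_induct) (simp_all flip: add_pCons add: add_pCons[of _ 0 _ 0, simplified, symmetric])

lemma const_poly_mult: "[:a * b:] = [:a:] * [:b :: 'a::comm_ring_1:]"
  by simp

lemma const_poly_power: "[:a ^ n:] = [:a :: 'a::comm_ring_1:] ^ n"
  by (induct n) (simp_all only: power_0 power_Suc one_pCons const_poly_mult)

text \<open>In a monomial of degree at least \<open>3 N\<close> one of the three exponents is at
  least \<open>N\<close>.\<close>

lemma homog_large_in_ideal:
  assumes I: "ideal_set I" and X: "X0 ^ N \<in> I" "X1 ^ N \<in> I" "X2 ^ N \<in> I"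
    and c: "homog d c" and d: "d \<ge> 3 * int N"
  shows "c \<in> I"
proof -
  have mulI: "a * b \<in> I" "b * a \<in> I" if "b \<in> I" for a b
    using I that unfolding ideal_set_def by (auto simp: mult.commute)
  have pw: "X ^ k \<in> I" if "X ^ N \<in> I" "k \<ge> N" for X k
    using mulI[OF that(1), of "X ^ (k - N)"] that(2) by (simp flip: power_add)
  have 1: "[:[:coeff (coeff (coeff c i) j) l:]:] = 0 \<or> X0 ^ i * X1 ^ j * X2 ^ l \<in> I" for i j l
  proof (cases "coeff (coeff (coeff c i) j) l = 0")
    case False
    then have "int (i + j + l) = d" using c unfolding homog_def by blast
    then have "i \<ge> N \<or> j \<ge> N \<or> l \<ge> N" using d by linarith
    then show ?thesis using pw X mulI by meson
  qed simp
  have "[:[:[:coeff (coeff (coeff c i) j) l:]:]:] * X2 ^ l * X1 ^ j * X0 ^ i \<in> I" for i j l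
  proof -
    have "0 \<in> I" using I ideal_set_def by blast
    moreover have "a * X2 ^ l * X1 ^ j * X0 ^ i = a * (X0 ^ i * X1 ^ j * X2 ^ l)" for a :: S3 by (simp only: mult_ac)
    moreover have "[:[:[:coeff (coeff (coeff c i) j) l:]:]:] = 0 \<or> X0 ^ i * X1 ^ j * X2 ^ l \<in> I"
      using 1[of i j l] by auto
    ultimately show ?thesis using mulI(1) by (metis mult_zero_left)
  qed
  note 2 = this
  have 3: "[:[:r:]:] = (\<Sum>l\<le>degree r. [:[:[:coeff r l:]:]:] * X2 ^ l)" for r :: "real poly"
    by (subst poly_expand[of r]) (simp only: const_poly_sum const_poly_mult const_poly_power X2_def)
  have 4: "[:r:] = (\<Sum>j\<le>degree r. [:[:coeff r j:]:] * X1 ^ j)" for r :: "real poly poly"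
    by (subst poly_expand[of r]) (simp only: const_poly_sum const_poly_mult const_poly_power X1_def)
  have "[:[:coeff (coeff c i) j:]:] * X1 ^ j * X0 ^ i \<in> I" for i j
    unfolding 3[of "coeff (coeff c i) j"] sum_distrib_right by (intro ideal_sum I 2)
  then have "[:coeff c i:] * X0 ^ i \<in> I" for i
    unfolding 4[of "coeff c i"] sum_distrib_right by (intro ideal_sum I)
  then show ?thesis
    by (subst poly_expand[of c]) (simp only: X0_def[symmetric], intro ideal_sum I)
qed

text \<open>Exactness of sheaves gives exactness of graded modules in large degrees: finitely many
  generators of \<open>K\<close> are carried into the image by powers of the variables, and
  coefficients of large degree lie in every ideal that contains these powers.\<close>

lemma eventually_exact:
  assumes K: "vec.subspace K" and gr: "\<And>v d. v \<in> K \<Longrightarrow> (\<lambda>i. hcm (d + \<omega> i) (v i)) \<in> K"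
    and supp: "\<And>v i. v \<in> K \<Longrightarrow> i \<ge> n' \<Longrightarrow> v i = 0"
    and pw: "\<And>v d X. v \<in> K \<Longrightarrow> hv homog \<omega> d v \<Longrightarrow> X \<in> {X0, X1, X2} \<Longrightarrow>
      \<exists>N w. (\<lambda>i. X ^ N * v i) = comb {..<length ds} B w"
    and B: "\<And>j. j < length ds \<Longrightarrow> hv homog \<omega> (- (ds ! j)) (B j)"
  shows "\<exists>d0. \<forall>d\<ge>d0. \<forall>v\<in>K. hv homog \<omega> d v \<longrightarrow> (\<exists>w\<in>Gr ds d. v = comb {..<length ds} B w)"
proof -
  let ?n = "length ds"
  obtain F where F: "finite F" "F \<subseteq> K" "K \<subseteq> vec.span F"
    using noetherian_vec[OF noetherian_S3 K, of n'] supp by blast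
  obtain J e \<delta> where J: "finite J" "generates J e K" "\<And>j. j \<in> J \<Longrightarrow> hv homog \<omega> (\<delta> j) (e j)"
    using g3.homogeneous_generators[OF F K gr, of n'] supp by blast
  have eK: "e l \<in> K" if "l \<in> J" for l using J(2) that by (simp add: generates_def)
  let ?I = "\<lambda>l. {b. (\<lambda>i. b * e l i) \<in> range (comb {..<?n} B)}"
  have I: "ideal_set (?I l)" for l
    unfolding ideal_set_def
  proof (intro conjI ballI allI)
    have "0 = (\<lambda>i. 0 * e l i)" by auto
    then show "0 \<in> ?I l" using vec.subspace_0[OF subspace_range_comb] by (metis mem_Collect_eq)
    show "g + h \<in> ?I l" if "g \<in> ?I l" "h \<in> ?I l" for g h
      using vec.subspace_add[OF subspace_range_comb, of _ "{..<?n}" B] that by (auto simp: distrib_right plus_fun_def) 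
    show "g * h \<in> ?I l" if "h \<in> ?I l" for g h
      using vec_subspace_scale[OF subspace_range_comb, of _ "{..<?n}" B g] that by (auto simp: mult.assoc)
  qed
  have "\<exists>N. \<forall>X\<in>{X0, X1, X2}. X ^ N \<in> ?I l" if l: "l \<in> J" for l
  proof -
    have "\<exists>N. X ^ N \<in> ?I l" if "X \<in> {X0, X1, X2}" for X
    proof -
      obtain N w where "(\<lambda>i. X ^ N * e l i) = comb {..<?n} B w" using pw[OF eK[OF l] J(3)[OF l] \<open>X \<in> _\<close>] by blast
      then show ?thesis by (intro exI[of _ N]) simp
    qed
    then obtain N where N: "\<And>X. X \<in> {X0, X1, X2} \<Longrightarrow> X ^ N X \<in> ?I l" by metis
    have "X ^ (N X0 + N X1 + N X2) \<in> ?I l" if X: "X \<in> {X0, X1, X2}" for X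
    proof -
      have "N X \<le> N X0 + N X1 + N X2" using X by auto
      then have "X ^ (N X0 + N X1 + N X2) = X ^ (N X0 + N X1 + N X2 - N X) * X ^ N X" by (simp flip: power_add)
      then show ?thesis using N[OF X] I[of l] unfolding ideal_set_def by metis
    qed
    then show ?thesis by blast
  qed
  then obtain N where N: "\<And>l X. l \<in> J \<Longrightarrow> X \<in> {X0, X1, X2} \<Longrightarrow> X ^ N l \<in> ?I l" by metis
  \<comment> \<open>The absolute values make all summands nonnegative, so that the sum dominates
    each of them.\<close>
  define d0 where "d0 = (\<Sum>l\<in>J. \<bar>\<delta> l\<bar> + 3 * int (N l))"
  have d0: "\<delta> l + 3 * int (N l) \<le> d0" if "l \<in> J" for l
  proof -
    have "\<bar>\<delta> l\<bar> + 3 * int (N l) \<le> d0" unfolding d0_def by (rule member_le_sum[OF that]) (auto simp: J)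
    then show ?thesis by linarith
  qed
  have "\<exists>w\<in>Gr ds d. v = comb {..<?n} B w" if d: "d \<ge> d0" and v: "v \<in> K" "hv homog \<omega> d v" for d v
  proof -
    obtain c where c: "v = comb J e c" "\<And>j. homog (d - \<delta> j) (c j)"
      using g3.generates_homogeneous[OF J(2,3) v] by blast
    have "c l \<in> ?I l" if l: "l \<in> J" for l
      by (rule homog_large_in_ideal[OF I N[OF l] N[OF l] N[OF l] c(2)]) (use d0[OF l] d in auto)
    then have "(\<Sum>l\<in>J. (\<lambda>i. c l * e l i)) \<in> range (comb {..<?n} B)"
      by (intro vec.subspace_sum subspace_range_comb) auto
    moreover have "(\<Sum>l\<in>J. (\<lambda>i. c l * e l i)) = v"
    proof -
      have "(\<Sum>l\<in>A. (\<lambda>i. c l * e l i)) k = comb A e c k" for A k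
        unfolding comb_def by (induct A rule: infinite_finite_induct) auto
      then show ?thesis unfolding c(1) by (rule ext)
    qed
    ultimately obtain w where w: "v = comb {..<?n} B w" by auto
    have "v = comb {..<?n} B (\<lambda>j. hcm (d - - (ds ! j)) (w j))"
      unfolding w by (rule g3.comb_homogeneous_coeffs[of _ \<omega>]) (use B v w in auto)
    then have "v = comb {..<?n} B (\<lambda>j. if j < ?n then hcm (d + ds ! j) (w j) else 0)"
      by (simp add: comb_def)
    moreover have "(\<lambda>j. if j < ?n then hcm (d + ds ! j) (w j) else 0) \<in> Gr ds d"
      by (simp add: Gr_def g3.h_hc)
    ultimately show ?thesis by blast
  qed
  then show ?thesis by blast
qed

text \<open>A common denominator \<open>b\<close> near \<open>P\<close> turns \<open>s\<close> into
  a homogeneous vector of the module; its preimage divided by \<open>b\<close> is a preimage of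
  \<open>s\<close> on \<open>U \<inter> Dp b\<close>.\<close>

lemma module_exact_imp_image:
  assumes U: "U \<in> opens" and s: "s \<in> O_sum ds' U"
    and ex: "\<And>a e b. hv homog (wt ds') e a \<Longrightarrow> (\<forall>i\<ge>length ds'. a i = 0) \<Longrightarrow> b \<noteq> 0 \<Longrightarrow> (\<And>i. emb (a i) = emb b * s i) \<Longrightarrow>
      \<exists>c. a = comb {..<length ds} B c \<and> (\<forall>j<length ds. homog (e + ds ! j) (c j))"
  shows "in_image_sheaf (O_sum ds) (\<lambda>_. mat_hom (length ds) B) U s"
  unfolding in_image_sheaf_def
proof
  fix P assume P: "P \<in> U"
  let ?n = "length ds" and ?n' = "length ds'"
  have "s j \<in> O_twist (wt ds' j) U" if "j < ?n'" for j using s that by (simp add: O_sum_def wt_def)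
  then obtain b a0 e where b: "homog e b" "b \<notin> P" "b \<noteq> 0"
    and b4: "\<forall>j<?n'. homog (wt ds' j + e) (a0 j) \<and> emb b * s j = emb (a0 j)"
    using common_denominator[OF U _ P, where n = ?n' and s = s and w = "wt ds'"] by blast
  define a where "a j = (if j < ?n' then a0 j else 0)" for j
  have a1: "hv homog (wt ds') e a" using b4 by (auto simp: hv_def a_def add.commute)
  have a2: "emb (a i) = emb b * s i" for i
    using b4 s by (auto simp: a_def O_sum_def)
  obtain c where c: "a = comb {..<?n} B c" "\<forall>j<?n. homog (e + ds ! j) (c j)"
  proof -
    have "\<forall>i\<ge>?n'. a i = 0" by (simp add: a_def)
    from ex[OF a1 this b(3) a2] show ?thesis using that by blast
  qed
  let ?V = "U \<inter> Dp b"
  have V: "?V \<in> opens" by (rule opens_inter_Dp[OF U b(1,3)])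
  define t where "t j = (if j < ?n then emb (c j) / emb b else 0)" for j
  have "t \<in> O_sum ds ?V"
    unfolding O_sum_def
  proof (intro CollectI conjI allI impI)
    fix j assume j: "j < ?n"
    show "t j \<in> O_twist (ds ! j) ?V"
    proof (rule O_twistI[OF V])
      fix Q assume "Q \<in> ?V"
      then have "b \<notin> Q" by (simp add: Dp_def)
      moreover have "emb b * t j = emb (c j)" using j b(3) by (simp add: t_def)
      moreover have "homog (ds ! j + e) (c j)" using c(2) j by (simp add: add.commute)
      ultimately show "\<exists>a b e. homog (ds ! j + e) a \<and> homog e b \<and> b \<notin> Q \<and> emb b * t j = emb a" using b(1) by blast
    qed
  qed (simp add: t_def)
  moreover have "mat_hom ?n B t = s"
  proof
    fix i
    have "emb b * mat_hom ?n B t i = emb (comb {..<?n} B c i)"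
      by (rule mat_hom_emb) (use b(3) in \<open>simp add: t_def\<close>)
    also have "\<dots> = emb b * s i" using a2 c(1) by simp
    finally show "mat_hom ?n B t i = s i" using b(3) by simp
  qed
  moreover have "P \<in> ?V" using P b(2) opens_Proj[OF U] by (auto simp: Dp_def)
  ultimately show "\<exists>V\<in>opens. P \<in> V \<and> V \<subseteq> U \<and> (\<exists>t\<in>O_sum ds V. mat_hom ?n B t = s)"
    using V by (intro bexI[of _ ?V]) auto
qed

lemma mat_hom_O_sum:
  assumes U: "U \<in> opens" and s: "s \<in> O_sum ds U"
    and B: "\<And>j i. j < length ds \<Longrightarrow> i < length ds' \<Longrightarrow> homog (ds' ! i - ds ! j) (B j i)"
    and z: "\<And>j i. j < length ds \<Longrightarrow> i \<ge> length ds' \<Longrightarrow> B j i = 0"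
  shows "mat_hom (length ds) B s \<in> O_sum ds' U"
  unfolding O_sum_def
proof (intro CollectI conjI allI impI)
  fix i assume i: "i < length ds'"
  have "s j * emb (B j i) \<in> O_twist (ds' ! i) U" if "j < length ds" for j
    using s that B[OF that i] by (intro O_mult[OF U _ O_emb[OF U], of _ "ds ! j" "ds' ! i - ds ! j"]) (auto simp: O_sum_def)
  then show "mat_hom (length ds) B s i \<in> O_twist (ds' ! i) U" unfolding mat_hom_def by (intro O_sum_in U) auto
next
  fix i assume "i \<ge> length ds'"
  then show "mat_hom (length ds) B s i = 0" using z by (simp add: mat_hom_def)
qed

lemma mat_hom_sheaf_hom:
  assumes "\<And>U s. U \<in> opens \<Longrightarrow> s \<in> O_sum ds U \<Longrightarrow> mat_hom n B s \<in> G U"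
  shows "sheaf_hom (O_sum ds) G (\<lambda>_. mat_hom n B)"
  unfolding sheaf_hom_def
  using assms by (auto simp: distrib_right sum.distrib sum_distrib_left mult.assoc fun_eq_iff)
    (simp_all add: mat_hom_def distrib_right sum.distrib sum_distrib_left mult.assoc)

lemma mat_hom_mat_hom:
  assumes "\<And>l. l < n' \<Longrightarrow> comb {..<n} B (C l) = (\<lambda>_. 0)"
  shows "mat_hom n B (mat_hom n' C t) = (\<lambda>_. 0)"
proof
  fix i
  have "mat_hom n B (mat_hom n' C t) i = (\<Sum>j<n. \<Sum>l<n'. t l * (emb (C l j) * emb (B j i)))"
    by (simp add: mat_hom_def sum_distrib_right mult.assoc)
  also have "\<dots> = (\<Sum>l<n'. \<Sum>j<n. t l * (emb (C l j) * emb (B j i)))" by (rule sum.swap)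
  also have "\<dots> = (\<Sum>l<n'. t l * emb (comb {..<n} B (C l) i))"
    by (simp add: comb_def emb_sum sum_distrib_left)
  also have "\<dots> = 0" using assms by simp
  finally show "mat_hom n B (mat_hom n' C t) i = 0" .
qed

section \<open>Kernel sheaves of a triple of forms\<close>

definition ker_sheaf :: "(nat \<Rightarrow> S3) \<Rightarrow> sheaf" where
  "ker_sheaf g U = {s \<in> O_sum [0, 0, 0] U. (\<Sum>i<3. emb (g i) * s i) = 0}"

definition ker_module :: "(nat \<Rightarrow> S3) \<Rightarrow> (nat \<Rightarrow> S3) set" where
  "ker_module g = {v. (\<forall>i\<ge>3. v i = 0) \<and> (\<Sum>i<3. g i * v i) = 0}"

lemma subspace_ker_module: "vec.subspace (ker_module g)"
  by (rule vec_subspaceI)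
    (auto simp: ker_module_def distrib_left sum.distrib mult.left_commute simp flip: sum_distrib_left)

lemma hcm_ker_module:
  assumes "\<And>i. i < 3 \<Longrightarrow> homog D (g i)" "v \<in> ker_module g"
  shows "(\<lambda>i. hcm d (v i)) \<in> ker_module g"
proof -
  have "(\<Sum>i<3. g i * hcm d (v i)) = hcm (D + d) (\<Sum>i<3. g i * v i)"
    unfolding g3.hc_sum_out using g3.hc_mult_left[OF assms(1), of _ "D + d"] by (intro sum.cong) auto
  then show ?thesis using assms(2) by (simp add: ker_module_def)
qed

lemma wt_zeros: "wt [0, 0, 0] = (\<lambda>_. 0)"
  by (auto simp: wt_def nth_Cons split: nat.splits)

lemma list_reindex:
  fixes e :: "nat \<Rightarrow> nat \<Rightarrow> S3"
  assumes "finite J"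
  shows "\<exists>f. bij_betw f {..<card J} J \<and> (\<forall>c. comb {..<card J} (e \<circ> f) (c \<circ> f) = comb J e c)"
proof -
  obtain f where f: "bij_betw f {..<card J} J"
    using ex_bij_betw_nat_finite[OF assms] atLeast0LessThan by metis
  have "comb {..<card J} (e \<circ> f) (c \<circ> f) = comb J e c" for c
    unfolding comb_def by (rule ext) (simp add: sum.reindex_bij_betw[OF f, of "\<lambda>j. c j * e j _"] o_def)
  then show ?thesis using f by blast
qed

text \<open>Homogeneous generators of the kernel module give the first term. A kernel is saturated
  with respect to \<open>X0\<close>, so by \<open>syzygies_free\<close> the relations between these
  generators are already free, and the resolution stops there.\<close>

theorem ker_sheaf_resolution:
  assumes g: "\<And>i. i < 3 \<Longrightarrow> homog D (g i)"
  shows "\<exists>dss. is_resolution (ker_sheaf g) dss"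
proof -
  let ?M = "ker_module g"
  have suppM: "v i = 0" if "v \<in> ?M" "i \<ge> 3" for v i using that by (simp add: ker_module_def)
  have grM: "(\<lambda>i. hcm (d + (\<lambda>_. 0) i) (v i)) \<in> ?M" if "v \<in> ?M" for v d
    using hcm_ker_module[OF g that] by simp
  obtain F where F: "finite F" "F \<subseteq> ?M" "?M \<subseteq> vec.span F"
    using noetherian_vec[OF noetherian_S3 subspace_ker_module[of g], of 3] suppM by blast
  obtain J0 e0 \<delta>0 where J0: "finite J0" "generates J0 e0 ?M" "\<And>j. j \<in> J0 \<Longrightarrow> hv homog (\<lambda>_. 0) (\<delta>0 j) (e0 j)"
    using g3.homogeneous_generators[OF F subspace_ker_module grM, of 3] suppM by blast
  obtain f0 where f0: "bij_betw f0 {..<card J0} J0" "\<And>c. comb {..<card J0} (e0 \<circ> f0) (c \<circ> f0) = comb J0 e0 c"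
    using list_reindex[OF J0(1), of e0] by blast
  define q where "q = card J0"
  define G where "G = e0 \<circ> f0"
  define \<delta> where "\<delta> = \<delta>0 \<circ> f0"
  have fJ: "f0 j \<in> J0" if "j < q" for j using f0(1) that by (auto simp: q_def bij_betw_def)
  have hG: "hv homog (\<lambda>_. 0) (\<delta> j) (G j)" if "j < q" for j using J0(3)[OF fJ[OF that]] by (simp add: G_def \<delta>_def)
  have GM: "G j \<in> ?M" if "j < q" for j using J0(2) fJ[OF that] by (simp add: G_def generates_def)
  have gen: "\<exists>c. v = comb {..<q} G c" if "v \<in> ?M" for v
    using J0(2) that f0(2) unfolding generates_def G_def q_def by metis
  have genG: "generates {..<q} G ?M" using GM gen by (simp add: generates_def)
  have rG: "range (comb {..<q} G) = ?M"
  proof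
    show "range (comb {..<q} G) \<subseteq> ?M" using comb_in[OF subspace_ker_module, of "{..<q}" G] GM by blast
    show "?M \<subseteq> range (comb {..<q} G)" using gen by blast
  qed
  have sat: "w \<in> range (comb {..<q} G)" if "(\<lambda>i. X0 * w i) \<in> range (comb {..<q} G)" for w
  proof -
    have "X0 * (\<Sum>i<3. g i * w i) = (\<Sum>i<3. g i * (X0 * w i))" by (simp add: sum_distrib_left mult.left_commute)
    then show ?thesis using that X_nonzero(1) unfolding rG by (auto simp: ker_module_def)
  qed
  obtain J1 e1 \<epsilon>1 where J1: "finite J1" "generates J1 e1 (syz q G)" "lin_indep J1 e1"
    "\<And>j. j \<in> J1 \<Longrightarrow> hv homog (\<lambda>i. - \<delta> i) (\<epsilon>1 j) (e1 j)"
    using syzygies_free[of q \<delta> G] hG sat by blast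
  obtain f1 where f1: "bij_betw f1 {..<card J1} J1" "\<And>c. comb {..<card J1} (e1 \<circ> f1) (c \<circ> f1) = comb J1 e1 c"
    using list_reindex[OF J1(1), of e1] by blast
  define p where "p = card J1"
  define E where "E = e1 \<circ> f1"
  define \<epsilon> where "\<epsilon> = \<epsilon>1 \<circ> f1"
  have fJ1: "f1 j \<in> J1" if "j < p" for j using f1(1) that by (auto simp: p_def bij_betw_def)
  have hE: "hv homog (\<lambda>i. - \<delta> i) (\<epsilon> j) (E j)" if "j < p" for j using J1(4)[OF fJ1[OF that]] by (simp add: E_def \<epsilon>_def)
  have ES: "E j \<in> syz q G" if "j < p" for j using J1(2) fJ1[OF that] by (simp add: E_def generates_def)
  have genE: "generates {..<p} E (syz q G)"
    unfolding generates_def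
  proof (intro conjI ballI)
    show "E j \<in> syz q G" if "j \<in> {..<p}" for j using ES that by simp
    show "\<exists>c. v = comb {..<p} E c" if "v \<in> syz q G" for v
      using J1(2) that f1(2) unfolding generates_def E_def p_def by metis
  qed
  have indE: "c j = 0" if "comb {..<p} E c = (\<lambda>_. 0)" "j < p" for c j
  proof -
    define c' where "c' i = c (inv_into {..<p} f1 i)" for i
    have "comb {..<p} E (c' \<circ> f1) k = comb {..<p} E c k" for k
      using f1(1) by (intro comb_cong) (auto simp: c'_def p_def bij_betw_def)
    then have "comb J1 e1 c' = (\<lambda>_. 0)" using that(1) f1(2)[of c'] by (auto simp: E_def p_def fun_eq_iff)
    then have "c' (f1 j) = 0" using J1(3) fJ1[OF that(2)] unfolding lin_indep_def by blast
    then show ?thesis using f1(1) that(2) by (simp add: c'_def p_def bij_betw_def)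
  qed
  define ds0 where "ds0 = map (\<lambda>j. - \<delta> j) [0..<q]"
  define ds1 where "ds1 = map (\<lambda>j. - \<epsilon> j) [0..<p]"
  have len: "length ds0 = q" "length ds1 = p" by (simp_all add: ds0_def ds1_def)
  have nth: "j < q \<Longrightarrow> ds0 ! j = - \<delta> j" "i < p \<Longrightarrow> ds1 ! i = - \<epsilon> i" for i j by (simp_all add: ds0_def ds1_def)
  let ?T = "ker_sheaf g"
  let ?dss = "[ds0, ds1]"
  define \<epsilon>' where "\<epsilon>' = (\<lambda>U :: S3 set set. mat_hom q G)"
  define \<Delta> where "\<Delta> j = (\<lambda>U :: S3 set set. if j = 0 then mat_hom p E else (\<lambda>_ _. 0))" for j :: nat
  have res: "res_term ?dss 0 = O_sum ds0" "res_term ?dss (Suc 0) = O_sum ds1" "res_term ?dss (Suc (Suc j)) = O_sum []" for j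
    by (simp_all add: res_term_def)
  have Onil: "O_sum [] U = {\<lambda>_. 0}" for U by (auto simp: O_sum_def)
  have G3: "G j i = 0" if "j < q" "i \<ge> 3" for j i using GM[OF that(1)] that(2) by (simp add: ker_module_def)
  have hom0: "mat_hom q G s \<in> ?T U" if U: "U \<in> opens" and s: "s \<in> O_sum ds0 U" for U s
  proof -
    have "mat_hom q G s \<in> O_sum [0, 0, 0] U"
      unfolding len(1)[symmetric]
      by (rule mat_hom_O_sum[OF U s])
         (use hG G3 in \<open>auto simp: len nth hv_def nth_Cons less_Suc_eq numeral_3_eq_3 split: nat.splits\<close>)
    moreover have "(\<Sum>i<3. emb (g i) * mat_hom q G s i) = 0"
    proof -
      have "(\<Sum>i<3. emb (g i) * mat_hom q G s i) = (\<Sum>i<3. \<Sum>j<q. s j * emb (g i * G j i))"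
        by (simp add: mat_hom_def sum_distrib_left mult_ac)
      also have "\<dots> = (\<Sum>j<q. \<Sum>i<3. s j * emb (g i * G j i))" by (rule sum.swap)
      also have "\<dots> = (\<Sum>j<q. s j * emb (\<Sum>i<3. g i * G j i))" unfolding emb_sum sum_distrib_left ..
      also have "\<dots> = 0" using GM by (intro sum.neutral) (auto simp: ker_module_def)
      finally show ?thesis .
    qed
    ultimately show ?thesis by (simp add: ker_sheaf_def)
  qed
  have hom1: "mat_hom p E s \<in> O_sum ds0 U" if U: "U \<in> opens" and s: "s \<in> O_sum ds1 U" for U s
    unfolding len(2)[symmetric]
    by (rule mat_hom_O_sum[OF U s]) (use hE ES in \<open>auto simp: len nth hv_def syz_def algebra_simps\<close>)
  have GE: "comb {..<q} G (E l) = (\<lambda>_. 0)" if "l < p" for l using ES[OF that] by (simp add: syz_def)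
  have "is_resolution ?T ?dss"
    unfolding is_resolution_def
  proof (intro exI[of _ \<epsilon>'] exI[of _ \<Delta>] conjI allI ballI)
    show "sheaf_hom (res_term ?dss 0) ?T \<epsilon>'"
      unfolding res \<epsilon>'_def by (rule mat_hom_sheaf_hom) (rule hom0)
    show "sheaf_hom (res_term ?dss (Suc j)) (res_term ?dss j) (\<Delta> j)" for j
    proof (cases j)
      case 0
      then show ?thesis unfolding \<Delta>_def using mat_hom_sheaf_hom[of ds1 p E "O_sum ds0"] hom1 by (simp add: res)
    next
      case (Suc i)
      have "(\<lambda>_. 0) \<in> res_term ?dss (Suc i) U" if "U \<in> opens" for U
        unfolding res_term_def O_sum_def by (auto intro: O_zero[OF that])
      then show ?thesis using Suc by (simp add: sheaf_hom_def \<Delta>_def)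
    qed
    fix U assume U: "U \<in> opens"
    show "in_image_sheaf (res_term ?dss 0) \<epsilon>' U s" if s: "s \<in> ?T U" for s
      unfolding res \<epsilon>'_def len(1)[symmetric]
    proof (rule module_exact_imp_image[OF U, of s "[0,0,0]"])
      show "s \<in> O_sum [0, 0, 0] U" using s by (simp add: ker_sheaf_def)
      fix a e b assume a: "hv homog (wt [0, 0, 0]) e a" "\<forall>i\<ge>length [0::int, 0, 0]. a i = 0" "b \<noteq> 0" "\<And>i. emb (a i) = emb b * s i"
      have "emb (\<Sum>i<3. g i * a i) = emb b * (\<Sum>i<3. emb (g i) * s i)"
        by (simp add: emb_sum a(4) sum_distrib_left mult_ac)
      then have "(\<Sum>i<3. g i * a i) = 0" using s by (simp add: ker_sheaf_def)
      then have aM: "a \<in> ?M" using a(2) by (simp add: ker_module_def numeral_3_eq_3)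
      obtain c where "a = comb {..<q} G c" "\<And>j. homog (e - \<delta> j) (c j)"
        using g3.generates_homogeneous[OF genG, of "\<lambda>_. 0" \<delta> a e] hG aM a(1) by (auto simp: wt_zeros)
      then show "\<exists>c. a = comb {..<length ds0} G c \<and> (\<forall>j<length ds0. homog (e + ds0 ! j) (c j))"
        by (auto simp: len nth)
    qed
    show "(\<epsilon>' U s = (\<lambda>_. 0)) = in_image_sheaf (res_term ?dss 1) (\<Delta> 0) U s" if s: "s \<in> res_term ?dss 0 U" for s
    proof
      assume z: "\<epsilon>' U s = (\<lambda>_. 0)"
      have "in_image_sheaf (O_sum ds1) (\<lambda>_. mat_hom (length ds1) E) U s"
      proof (rule module_exact_imp_image[OF U, of s ds0])
        show "s \<in> O_sum ds0 U" using s by (simp add: res)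
        fix a e b assume a: "hv homog (wt ds0) e a" "\<forall>i\<ge>length ds0. a i = 0" "b \<noteq> 0" "\<And>i. emb (a i) = emb b * s i"
        have "emb (comb {..<q} G a i) = 0" for i
          using mat_hom_emb[of q "emb b" s a G i] a(4) z by (simp add: \<epsilon>'_def)
        then have aS: "a \<in> syz q G" using a(2) by (auto simp: syz_def len)
        have ha: "hv homog (\<lambda>i. - \<delta> i) e a"
          using a(1,2) unfolding hv_def wt_def len by (metis g3.h_zero nth(1) not_less)
        obtain c where "a = comb {..<p} E c" "\<And>j. homog (e - \<epsilon> j) (c j)"
          using g3.generates_homogeneous[OF genE, of "\<lambda>i. - \<delta> i" \<epsilon> a e] hE aS ha by auto
        then show "\<exists>c. a = comb {..<length ds1} E c \<and> (\<forall>j<length ds1. homog (e + ds1 ! j) (c j))"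
          by (auto simp: len nth)
      qed
      then show "in_image_sheaf (res_term ?dss 1) (\<Delta> 0) U s" by (simp add: res len \<Delta>_def)
    next
      assume "in_image_sheaf (res_term ?dss 1) (\<Delta> 0) U s"
      then obtain V t where "mat_hom p E t = s"
        using generic_in_opens[OF U] unfolding in_image_sheaf_def \<Delta>_def by auto
      then show "\<epsilon>' U s = (\<lambda>_. 0)" using mat_hom_mat_hom[of p q G E t] GE by (simp add: \<epsilon>'_def)
    qed
    show "(\<Delta> j U s = (\<lambda>_. 0)) = in_image_sheaf (res_term ?dss (Suc (Suc j))) (\<Delta> (Suc j)) U s"
      if s: "s \<in> res_term ?dss (Suc j) U" for j s
    proof -
      \<comment> \<open>All later terms are zero, so exactness at \<open>ds1\<close> means that
        \<open>mat_hom p E\<close> is injective, which is the independence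
        \<open>indE\<close>.\<close>
      have im: "in_image_sheaf (res_term ?dss (Suc (Suc j))) (\<Delta> (Suc j)) U s \<longleftrightarrow> s = (\<lambda>_. 0)"
        using U generic_in_opens[OF U] unfolding in_image_sheaf_def res Onil \<Delta>_def by auto
      show ?thesis
      proof (cases j)
        case 0
        then have s1: "s \<in> O_sum ds1 U" using s by (simp add: res)
        have "s = (\<lambda>_. 0)" if z: "mat_hom p E s = (\<lambda>_. 0)"
        proof -
          have "s j \<in> O_twist (wt ds1 j) U" if "j < p" for j using s1 that by (simp add: O_sum_def wt_def len)
          then obtain b a where b: "b \<noteq> 0" "\<forall>j<p. emb b * s j = emb (a j)"
            using common_denominator[OF U _ generic_in_opens[OF U], where n = p and s = s and w = "wt ds1"] by blast
          have "emb (comb {..<p} E a i) = 0" for i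
            using mat_hom_emb[where x = "emb b" and n = p and t = s and c = a and B = E and i = i] b(2) z by simp
          then have "a j = 0" if "j < p" for j using indE[of a j] that by auto
          then have "s j = 0" if "j < p" for j using b that by fastforce
          then show ?thesis using s1 len by (auto simp: O_sum_def fun_eq_iff) (metis not_less)
        qed
        moreover have "mat_hom p E (\<lambda>_. 0) = (\<lambda>_. 0)" by (simp add: mat_hom_def)
        ultimately show ?thesis unfolding im using 0 by (auto simp: \<Delta>_def)
      next
        case (Suc i)
        then have "s = (\<lambda>_. 0)" using s by (simp add: res Onil)
        then show ?thesis unfolding im using Suc by (simp add: \<Delta>_def)
      qed
    qed
  qed
  then show ?thesis by blast
qed

section \<open>Hilbert functions and Chern classes\<close>

lemma linear_comb: "linear (\<lambda>w. comb J B w :: nat \<Rightarrow> S3)"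
proof (rule linearI)
  show "comb J B (x + y) = comb J B x + comb J B y" for x y
    by (rule ext) (simp add: comb_add[of J B x y, symmetric] plus_fun_def)
  show "comb J B (r *\<^sub>R x) = r *\<^sub>R comb J B x" for r x
    by (rule ext) (simp add: comb_def scaleR_sum_right)
qed

lemma dim_Gr:
  assumes "\<And>a. a \<in> set ds \<Longrightarrow> d \<ge> - a - 2"
  shows "real (dim (Gr ds d)) = (\<Sum>a\<leftarrow>ds. real_of_int ((d + a + 1) * (d + a + 2)) / 2)"
proof -
  have "real (dim (Gr ds d)) = (\<Sum>a\<leftarrow>ds. real (dim {p. homog (d + a) p}))"
    unfolding Gr_space(3) by (induct ds) auto
  also have "\<dots> = (\<Sum>a\<leftarrow>ds. real_of_int ((d + a + 1) * (d + a + 2)) / 2)"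
  proof (intro arg_cong[of _ _ sum_list] map_cong refl)
    fix a assume "a \<in> set ds"
    then have "d + a \<ge> - 2" using assms[of a] by simp
    then show "real (dim {p. homog (d + a) p}) = real_of_int ((d + a + 1) * (d + a + 2)) / 2"
      by (rule homog_space(3))
  qed
  finally show ?thesis .
qed

lemma subspace_vec: "vec.subspace (K :: (nat \<Rightarrow> S3) set) \<Longrightarrow> subspace K"
proof (rule real_vector.subspaceI)
  assume K: "vec.subspace K"
  show "0 \<in> K" by (rule vec.subspace_0[OF K])
  show "x + y \<in> K" if "x \<in> K" "y \<in> K" for x y using vec.subspace_add[OF K that] .
  show "c *\<^sub>R x \<in> K" if "x \<in> K" for c x
  proof -
    have "c *\<^sub>R x = (\<lambda>i. cst c * x i)" by (rule ext) (simp add: scaleR_S3)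
    then show ?thesis using vec_subspace_scale[OF K that] by simp
  qed
qed

lemma hcm_syz:
  assumes G: "\<And>j. j < q \<Longrightarrow> hv homog \<omega> (- \<delta> j) (G j)" and v: "v \<in> syz q G"
  shows "(\<lambda>i. hcm (d + \<delta> i) (v i)) \<in> syz q G"
proof -
  have "comb {..<q} G (\<lambda>i. hcm (d - - \<delta> i) (v i)) k = hcm (d + \<omega> k) (comb {..<q} G v k)" for k
    by (rule g3.comb_component[symmetric]) (use G in simp)
  then show ?thesis using v by (auto simp: syz_def)
qed

definition alt_dim :: "int list list \<Rightarrow> nat \<Rightarrow> int \<Rightarrow> real" where
  "alt_dim dss n d = (\<Sum>j<n. (-1) ^ j * real (dim (Gr (dss ! j) d)))"

lemma sheaf_hom_in: "sheaf_hom F G \<phi> \<Longrightarrow> U \<in> opens \<Longrightarrow> s \<in> F U \<Longrightarrow> \<phi> U s \<in> G U"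
  unfolding sheaf_hom_def by blast

text \<open>By \<open>sheaf_hom_matrix\<close> the resolution consists of matrices of forms, and by
  \<open>eventually_exact\<close> it is exact on graded pieces of large degree; rank-nullity then
  telescopes with alternating signs.\<close>

lemma resolution_hilbert:
  assumes g: "\<And>i. i < 3 \<Longrightarrow> homog D (g i)" and res: "is_resolution (ker_sheaf g) dss"
  shows "\<exists>d0. \<forall>d\<ge>d0. real (dim (ker_module g \<inter> Gr [0,0,0] d)) = alt_dim dss (length dss) d"
proof -
  define L where "L j = (if j < length dss then dss ! j else [])" for j
  have rt: "res_term dss j = O_sum (L j)" for j by (simp add: res_term_def L_def)
  obtain \<epsilon> \<Delta> where eps: "sheaf_hom (O_sum (L 0)) (ker_sheaf g) \<epsilon>"
    and del: "\<And>j. sheaf_hom (O_sum (L (Suc j))) (O_sum (L j)) (\<Delta> j)"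
    and ex0: "\<And>U s. U \<in> opens \<Longrightarrow> s \<in> ker_sheaf g U \<Longrightarrow> in_image_sheaf (O_sum (L 0)) \<epsilon> U s"
    and ex1: "\<And>U s. U \<in> opens \<Longrightarrow> s \<in> O_sum (L 0) U \<Longrightarrow> \<epsilon> U s = (\<lambda>_. 0) \<longleftrightarrow> in_image_sheaf (O_sum (L 1)) (\<Delta> 0) U s"
    and ex2: "\<And>j U s. U \<in> opens \<Longrightarrow> s \<in> O_sum (L (Suc j)) U \<Longrightarrow>
       \<Delta> j U s = (\<lambda>_. 0) \<longleftrightarrow> in_image_sheaf (O_sum (L (Suc (Suc j)))) (\<Delta> (Suc j)) U s"
    using res unfolding is_resolution_def rt by blast
  \<comment> \<open>The shift of the index puts the augmentation and the differentials into one
    sequence: stage \<open>j\<close> maps \<open>O_sum (L j)\<close> into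
    \<open>O_sum (L' j)\<close>.\<close>
  define psi where "psi j = (if j = 0 then \<epsilon> else \<Delta> (j - 1))" for j
  define L' where "L' j = (if j = 0 then [0,0,0] else L (j - 1))" for j
  define n where "n j = length (L j)" for j
  have "\<exists>B. (\<forall>i<n j. \<forall>k<length (L' j). homog (L' j ! k - L j ! i) (B i k)) \<and>
    (\<forall>i. \<forall>k\<ge>length (L' j). B i k = 0) \<and>
    (\<forall>U\<in>opens. \<forall>s\<in>O_sum (L j) U. psi j U s = mat_hom (n j) B s)" for j
  proof (cases j)
    case 0
    show ?thesis unfolding 0 psi_def L'_def n_def
      using sheaf_hom_matrix[OF eps, of "[0,0,0]"] by (auto simp: ker_sheaf_def)
  next
    case (Suc i)
    show ?thesis unfolding Suc psi_def L'_def n_def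
      using sheaf_hom_matrix[OF del[of i], of "L i"] by auto
  qed
  then obtain B where B: "\<And>j i k. i < n j \<Longrightarrow> k < length (L' j) \<Longrightarrow> homog (L' j ! k - L j ! i) (B j i k)"
    "\<And>j i k. k \<ge> length (L' j) \<Longrightarrow> B j i k = 0"
    "\<And>j U s. U \<in> opens \<Longrightarrow> s \<in> O_sum (L j) U \<Longrightarrow> psi j U s = mat_hom (n j) (B j) s"
    by metis
  define T where "T j = (if j = 0 then ker_module g else syz (n (j - 1)) (B (j - 1)))" for j
  have hB: "hv homog (wt (L' j)) (- (L j ! i)) (B j i)" if "i < n j" for j i
    unfolding hv_def
  proof
    fix k show "homog (- (L j ! i) + wt (L' j) k) (B j i k)"
      using B(1)[OF that, of k] B(2)[of j k i] by (cases "k < length (L' j)") (auto simp: wt_def add.commute)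
  qed
  have subT: "vec.subspace (T j)" for j by (simp add: T_def subspace_syz subspace_ker_module)
  have suppT: "v i = 0" if "v \<in> T j" "i \<ge> length (L' j)" for v i j
    using that by (auto simp: T_def L'_def syz_def ker_module_def n_def split: if_splits)
  have grT: "(\<lambda>i. hcm (d + wt (L' j) i) (v i)) \<in> T j" if "v \<in> T j" for v d j
  proof (cases j)
    case 0
    then show ?thesis using hcm_ker_module[OF g, where v = v and d = d] that by (simp add: T_def L'_def wt_zeros)
  next
    case (Suc i)
    have "(\<lambda>k. hcm (d + L i ! k) (v k)) \<in> syz (n i) (B i)"
      by (rule hcm_syz[where \<omega> = "wt (L' i)"]) (use hB that Suc in \<open>auto simp: T_def\<close>)
    moreover have "(\<lambda>k. hcm (d + L i ! k) (v k)) = (\<lambda>k. hcm (d + wt (L i) k) (v k))"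
      using that Suc by (auto simp: wt_def T_def syz_def n_def fun_eq_iff)
    ultimately show ?thesis using Suc by (simp add: T_def L'_def)
  qed
  \<comment> \<open>a homogeneous vector of degree \<open>d\<close> becomes a section over \<open>Dp X\<close> after division by \<open>X ^ d\<close>\<close>
  have sec: "(\<lambda>i. emb (v i) * emb X powi (- d)) \<in> O_sum ds (Dp X)"
    if v: "hv homog (wt ds) d v" "\<And>i. i \<ge> length ds \<Longrightarrow> v i = 0" and X: "homog 1 X" "X \<noteq> 0" for v d ds X
  proof -
    have D: "Dp X \<in> opens" by (rule Dp_opens[OF X])
    have "emb (v i) * emb X powi (- d) \<in> O_twist (ds ! i) (Dp X)" if "i < length ds" for i
    proof (rule O_mult[OF D O_emb[OF D] O_inverse_power[OF D X order_refl]])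
      show "homog (d + ds ! i) (v i)" using v(1) that by (auto simp: hv_def wt_def dest: spec[of _ i])
    qed simp
    then show ?thesis using v(2) by (simp add: O_sum_def)
  qed
  have Xs: "homog 1 X" "X \<noteq> 0" if "X \<in> {X0, X1, X2}" for X using that homog_X X_nonzero by auto
  have mh: "mat_hom (n j) (B j) (\<lambda>i. emb (v i) * c) = (\<lambda>k. emb (comb {..<n j} (B j) v k) * c)" for j v c
    unfolding mat_hom_def comb_def emb_sum sum_distrib_right by (simp add: mult_ac)
  have exT: "\<exists>d0. \<forall>d\<ge>d0. \<forall>v\<in>T j. hv homog (wt (L' j)) d v \<longrightarrow> (\<exists>w\<in>Gr (L j) d. v = comb {..<length (L j)} (B j) w)" for j
  proof (rule eventually_exact[where K = "T j" and \<omega> = "wt (L' j)" and n' = "length (L' j)" and ds = "L j" and B = "B j"])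
    show "vec.subspace (T j)" by (rule subT)
    show "(\<lambda>i. hcm (d + wt (L' j) i) (v i)) \<in> T j" if "v \<in> T j" for v d using grT[OF that] .
    show "v i = 0" if "v \<in> T j" "i \<ge> length (L' j)" for v i using suppT[OF that] .
    fix v d X assume v: "v \<in> T j" "hv homog (wt (L' j)) d v" and X: "X \<in> {X0, X1, X2}"
    let ?s = "\<lambda>i. emb (v i) * emb X powi (- d)"
    have D: "Dp X \<in> opens" by (rule Dp_opens[OF Xs[OF X]])
    have s: "?s \<in> O_sum (L' j) (Dp X)" by (rule sec[OF v(2) _ Xs[OF X]]) (rule suppT[OF v(1)])
    have "in_image_sheaf (O_sum (L j)) (psi j) (Dp X) ?s"
    proof (cases j)
      case 0
      have "(\<Sum>i<3. emb (g i) * ?s i) = emb (\<Sum>i<3. g i * v i) * emb X powi (- d)"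
        by (simp add: emb_sum sum_distrib_right mult.assoc)
      then have "?s \<in> ker_sheaf g (Dp X)" using s v(1) 0 by (simp add: ker_sheaf_def T_def L'_def ker_module_def)
      then show ?thesis using ex0[OF D] 0 by (simp add: psi_def)
    next
      case (Suc i)
      have si: "?s \<in> O_sum (L i) (Dp X)" using s Suc by (simp add: L'_def)
      have "psi i (Dp X) ?s = (\<lambda>_. 0)"
        unfolding B(3)[OF D si] mh using v(1) Suc by (auto simp: T_def syz_def)
      then show ?thesis using ex1[OF D, of ?s] ex2[OF D, of ?s "i - 1"] si Suc
        by (cases i) (auto simp: psi_def)
    qed
    then show "\<exists>N w. (\<lambda>i. X ^ N * v i) = comb {..<length (L j)} (B j) w"
      using B(3) by (intro image_imp_power[OF X]) (auto simp: n_def)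
  qed (use hB in \<open>auto simp: n_def\<close>)
  then obtain d0 where d0: "\<And>j d v. d \<ge> d0 j \<Longrightarrow> v \<in> T j \<Longrightarrow> hv homog (wt (L' j)) d v \<Longrightarrow> \<exists>w\<in>Gr (L j) d. v = comb {..<length (L j)} (B j) w"
    by metis
  \<comment> \<open>Each row of \<open>B j\<close> is, up to a power of \<open>X0\<close>, the image
    of a unit vector over \<open>Dp X0\<close>; exactness of the sheaf sequence there gives the
    equations of \<open>T j\<close>.\<close>
  have BT: "comb {..<n j} (B j) w \<in> T j" for j w
  proof (rule comb_in[OF subT])
    fix i assume "i \<in> {..<n j}"
    then have i: "i < n j" by simp
    let ?u = "\<lambda>k. if k = i then 1 else 0 :: S3"
    let ?s = "\<lambda>k. emb (?u k) * emb X0 powi (- (- (L j ! i)))"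
    note X = homog_X(1) X_nonzero(1)
    have D: "Dp X0 \<in> opens" by (rule Dp_opens[OF X])
    have "hv homog (wt (L j)) (- (L j ! i)) ?u" using i by (auto simp: hv_def wt_def n_def g3.h_one)
    then have s: "?s \<in> O_sum (L j) (Dp X0)" by (rule sec[OF _ _ X]) (use i in \<open>simp add: n_def\<close>)
    have cu: "comb {..<n j} (B j) ?u = B j i" using i by (intro comb_unit) auto
    have ps: "psi j (Dp X0) ?s = (\<lambda>k. emb (B j i k) * emb X0 powi (- (- (L j ! i))))"
      unfolding B(3)[OF D s] mh cu ..
    have x0: "emb X0 powi e \<noteq> 0" for e using X by simp
    show "B j i \<in> T j"
    proof (cases j)
      case 0
      have "psi j (Dp X0) ?s \<in> ker_sheaf g (Dp X0)" using sheaf_hom_in[OF eps D] s 0 by (simp add: psi_def)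
      then have "(\<Sum>k<3. emb (g k) * (emb (B j i k) * emb X0 powi (- (- (L j ! i))))) = 0"
        unfolding ps by (simp add: ker_sheaf_def)
      moreover have "(\<Sum>k<3. emb (g k) * (emb (B j i k) * emb X0 powi (- (- (L j ! i))))) =
          emb (\<Sum>k<3. g k * B j i k) * emb X0 powi (- (- (L j ! i)))"
        unfolding emb_sum sum_distrib_right by (simp add: mult.assoc)
      ultimately have "(\<Sum>k<3. g k * B j i k) = 0" using X(2) by simp
      then show ?thesis using B(2)[of 0 _ i] 0 by (auto simp: T_def ker_module_def L'_def)
    next
      case (Suc l)
      have "in_image_sheaf (O_sum (L j)) (psi j) (Dp X0) (psi j (Dp X0) ?s)"
        unfolding in_image_sheaf_def using D s by blast
      moreover have pin: "psi j (Dp X0) ?s \<in> O_sum (L l) (Dp X0)"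
        using sheaf_hom_in[OF del[of l] D] s Suc by (simp add: psi_def)
      ultimately have "psi l (Dp X0) (psi j (Dp X0) ?s) = (\<lambda>_. 0)"
        using ex1[OF D, of "psi j (Dp X0) ?s"] ex2[OF D, of "psi j (Dp X0) ?s" "l - 1"] Suc
        by (cases l) (auto simp: psi_def)
      then have "mat_hom (n l) (B l) (psi j (Dp X0) ?s) = (\<lambda>_. 0)" using B(3)[OF D pin] by simp
      then have "emb (comb {..<n l} (B l) (B j i) k) * emb X0 powi (- (- (L j ! i))) = 0" for k
        unfolding ps mh by (rule fun_cong)
      then have "comb {..<n l} (B l) (B j i) k = 0" for k using X(2) by simp
      then show ?thesis using Suc B(2)[of j _ i] by (auto simp: T_def syz_def L'_def n_def)
    qed
  qed
  let ?N = "length dss"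
  define d1 where "d1 = (\<Sum>j\<le>?N. \<bar>d0 j\<bar>)"
  have d1: "d0 j \<le> d1" if "j \<le> ?N" for j
  proof -
    have "\<bar>d0 j\<bar> \<le> d1" unfolding d1_def using that by (intro member_le_sum) auto
    then show ?thesis by linarith
  qed
  define t where "t j d = T j \<inter> Gr (L' j) d" for j d
  have dims: "dim (Gr (L j) d) = dim (t (Suc j) d) + dim (t j d)" if "d \<ge> d1" "j \<le> ?N" for j d
  proof -
    let ?f = "comb {..<n j} (B j)"
    have "{w \<in> Gr (L j) d. ?f w = 0} = t (Suc j) d"
      by (auto simp: t_def T_def L'_def syz_def zero_fun_def Gr_def n_def)
    moreover have "?f ` Gr (L j) d = t j d"
    proof (intro set_eqI iffI)
      fix v assume "v \<in> ?f ` Gr (L j) d"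
      then obtain w where w: "w \<in> Gr (L j) d" "v = ?f w" by blast
      have vT: "v \<in> T j" using BT w by simp
      have "hv homog (wt (L' j)) d v" unfolding w(2)
        by (rule g3.hv_comb[where \<delta> = "\<lambda>i. - (L j ! i)"]) (use hB w(1) in \<open>auto simp: Gr_def n_def\<close>)
      then show "v \<in> t j d" using vT suppT[OF vT] by (simp add: t_def Gr_iff)
    next
      fix v assume "v \<in> t j d"
      then have "v \<in> T j" "hv homog (wt (L' j)) d v" by (auto simp: t_def Gr_iff)
      moreover have "d \<ge> d0 j" using d1[OF that(2)] that(1) by simp
      ultimately show "v \<in> ?f ` Gr (L j) d" using d0[of j d v] by (auto simp: n_def)
    qed
    ultimately show ?thesis using rank_nullity(1)[OF linear_comb[of "{..<n j}" "B j"] Gr_space(1,2)[of "L j" d]] by simp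
  qed
  have "real (dim (t 0 d)) = (\<Sum>j<k. (-1) ^ j * real (dim (Gr (L j) d))) + (-1) ^ k * real (dim (t k d))"
    if "d \<ge> d1" "k \<le> ?N" for d k
    using that(2)
  proof (induct k)
    case (Suc k)
    have "real (dim (t k d)) = real (dim (Gr (L k) d)) - real (dim (t (Suc k) d))" using dims[OF that(1), of k] Suc(2) by simp
    then have "(-1) ^ k * real (dim (t k d)) = (-1) ^ k * real (dim (Gr (L k) d)) + (-1) ^ Suc k * real (dim (t (Suc k) d))"
      by (simp add: right_diff_distrib)
    then show ?case using Suc by simp
  qed simp
  note main = this
  \<comment> \<open>The term after the last is the empty list, of dimension 0, and by
    \<open>dims\<close> it dominates \<open>t ?N d\<close>.\<close>
  have "dim (t ?N d) = 0" if "d \<ge> d1" for d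
    using dims[OF that order_refl] by (simp add: L_def Gr_space(3))
  moreover have "alt_dim dss ?N d = (\<Sum>j<?N. (-1) ^ j * real (dim (Gr (L j) d)))" for d
    by (simp add: alt_dim_def L_def)
  ultimately have "real (dim (t 0 d)) = alt_dim dss ?N d" if "d \<ge> d1" for d
    using main[OF that order_refl] that by simp
  then show ?thesis by (intro exI[of _ d1]) (simp add: t_def T_def L'_def)
qed

text \<open>\<open>s1\<close> and \<open>s2\<close> are the first two power sums of the Chern roots,
  and the last equation is Newton's identity. Power sums add where Chern polynomials multiply, which
  makes the alternating product linear.\<close>

definition chern_good :: "int poly \<Rightarrow> int \<Rightarrow> int \<Rightarrow> bool" where
  "chern_good p s1 s2 \<longleftrightarrow> coeff p 0 = 1 \<and> coeff p 1 = s1 \<and> 2 * coeff p 2 = s1\<^sup>2 - s2"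

lemma chern_good_mult:
  assumes "chern_good p s1 s2" "chern_good q t1 t2"
  shows "chern_good (p * q) (s1 + t1) (s2 + t2)"
proof -
  have "coeff (p * q) 2 = coeff p 0 * coeff q 2 + coeff p 1 * coeff q 1 + coeff p 2 * coeff q 0"
    by (simp add: coeff_mult numeral_2_eq_2)
  then have "2 * coeff (p * q) 2 = 2 * coeff q 2 + 2 * (s1 * t1) + 2 * coeff p 2" using assms by (simp add: chern_good_def)
  then show ?thesis using assms by (simp add: chern_good_def coeff_mult power2_sum)
qed

lemma chern_good_prod:
  "finite S \<Longrightarrow> (\<And>j. j \<in> S \<Longrightarrow> chern_good (f j) (s j) (t j)) \<Longrightarrow> chern_good (\<Prod>j\<in>S. f j) (\<Sum>j\<in>S. s j) (\<Sum>j\<in>S. t j)"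
proof (induct S rule: finite_induct)
  case empty
  show ?case by (simp add: chern_good_def)
next
  case (insert x S)
  then show ?case using chern_good_mult by simp
qed

lemma chern_good_chern_sum: "chern_good (chern_sum ds) (sum_list ds) (\<Sum>a\<leftarrow>ds. a\<^sup>2)"
proof (induct ds)
  case Nil
  show ?case by (simp add: chern_good_def chern_sum_def)
next
  case (Cons a ds)
  have "chern_good [:1, a:] a (a\<^sup>2)" by (simp add: chern_good_def numeral_2_eq_2)
  then show ?case using chern_good_mult[OF _ Cons, of "[:1, a:]" a "a\<^sup>2"] by (simp add: chern_sum_def)
qed

lemma chern_relation:
  assumes "monom 1 3 dvd [:1, c1, c2:] * (\<Prod>j | j < length dss \<and> odd j. chern_sum (dss ! j)) -
       (\<Prod>j | j < length dss \<and> even j. chern_sum (dss ! j))"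
  shows "(\<Sum>j<length dss. (-1) ^ j * sum_list (dss ! j)) = c1"
    and "(\<Sum>j<length dss. (-1) ^ j * (\<Sum>a\<leftarrow>dss ! j. a\<^sup>2)) = c1\<^sup>2 - 2 * c2"
proof -
  let ?O = "{j. j < length dss \<and> odd j}" and ?E = "{j. j < length dss \<and> even j}"
  let ?s = "\<lambda>j. sum_list (dss ! j)" and ?t = "\<lambda>j. \<Sum>a\<leftarrow>dss ! j. a\<^sup>2"
  let ?p = "[:1, c1, c2:] * (\<Prod>j\<in>?O. chern_sum (dss ! j))" and ?q = "\<Prod>j\<in>?E. chern_sum (dss ! j)"
  have "chern_good [:1, c1, c2:] c1 (c1\<^sup>2 - 2 * c2)" by (simp add: chern_good_def numeral_2_eq_2)
  then have p: "chern_good ?p (c1 + sum ?s ?O) (c1\<^sup>2 - 2 * c2 + sum ?t ?O)"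
    by (rule chern_good_mult) (intro chern_good_prod chern_good_chern_sum, simp)
  have q: "chern_good ?q (sum ?s ?E) (sum ?t ?E)" by (intro chern_good_prod chern_good_chern_sum) simp
  obtain u where u: "?p - ?q = monom 1 3 * u" using assms by (elim dvdE)
  have "coeff (?p - ?q) i = 0" if "i < 3" for i unfolding u using that by (simp add: coeff_monom_mult)
  then have eq: "coeff ?p i = coeff ?q i" if "i < 3" for i using that by simp
  have good_eq: "s1 = t1 \<and> s2 = t2" if "chern_good x s1 s2" "chern_good y t1 t2" "coeff x 1 = coeff y 1" "coeff x 2 = coeff y 2"
    for x y s1 s2 t1 t2 using that by (auto simp: chern_good_def)
  have "coeff ?p 1 = coeff ?q 1" "coeff ?p 2 = coeff ?q 2" by (rule eq, simp)+
  from good_eq[OF p q this] have 1: "c1 + sum ?s ?O = sum ?s ?E" and 2: "c1\<^sup>2 - 2 * c2 + sum ?t ?O = sum ?t ?E" by blast+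
  have alt: "(\<Sum>j<length dss. (-1) ^ j * f j) = sum f ?E - sum f ?O" for f :: "nat \<Rightarrow> int"
  proof -
    have "{..<length dss} = ?E \<union> ?O" by auto
    then have "(\<Sum>j<length dss. (-1) ^ j * f j) = (\<Sum>j\<in>?E. (-1) ^ j * f j) + (\<Sum>j\<in>?O. (-1) ^ j * f j)"
      by (simp only:) (rule sum.union_disjoint, auto)
    then show ?thesis by (simp add: sum_negf)
  qed
  show "(\<Sum>j<length dss. (-1) ^ j * ?s j) = c1" using alt[of ?s] 1 by simp
  show "(\<Sum>j<length dss. (-1) ^ j * ?t j) = c1\<^sup>2 - 2 * c2" using alt[of ?t] 2 by simp
qed

text \<open>Riemann-Roch on the plane: a twist \<open>a\<close> contributes
  \<open>(d + a + 1) * (d + a + 2)\<close> to twice the dimension, and expansion in \<open>a\<close>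
  leaves the rank \<open>\<rho>\<close>, the first power sum \<open>c1\<close> and the second one
  \<open>c1^2 - 2 c2\<close>.\<close>

theorem chern_hilbert:
  assumes g: "\<And>i. i < 3 \<Longrightarrow> homog D (g i)" and ch: "has_chern_classes (ker_sheaf g) c1 c2"
  shows "\<exists>\<rho>::int. \<exists>d0. \<forall>d\<ge>d0. 2 * real (dim (ker_module g \<inter> Gr [0,0,0] d)) =
    real_of_int (\<rho> * ((d + 1) * (d + 2)) + c1 * (2 * d + 3) + c1\<^sup>2 - 2 * c2)"
proof -
  obtain dss where res: "is_resolution (ker_sheaf g) dss" and
    dvd: "monom 1 3 dvd [:1, c1, c2:] * (\<Prod>j | j < length dss \<and> odd j. chern_sum (dss ! j)) -
       (\<Prod>j | j < length dss \<and> even j. chern_sum (dss ! j))"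
    using ch unfolding has_chern_classes_def by blast
  obtain d0 where d0: "\<And>d. d \<ge> d0 \<Longrightarrow> real (dim (ker_module g \<inter> Gr [0,0,0] d)) = alt_dim dss (length dss) d"
    using resolution_hilbert[OF g res] by blast
  define d1 where "d1 = (\<Sum>a\<in>set (concat dss). \<bar>a\<bar>)"
  have d1: "- a - 2 \<le> d" if "d \<ge> d1" "j < length dss" "a \<in> set (dss ! j)" for a j d
  proof -
    have "\<bar>a\<bar> \<le> d1" unfolding d1_def using that by (intro member_le_sum) (auto intro!: bexI[of _ "dss ! j"])
    then show ?thesis using that(1) by linarith
  qed
  define \<rho> where "\<rho> = (\<Sum>j<length dss. (-1) ^ j * int (length (dss ! j)))"
  have lin: "(\<Sum>a\<leftarrow>ds. (d + a + 1) * (d + a + 2)) = int (length ds) * ((d + 1) * (d + 2)) + sum_list ds * (2 * d + 3) + (\<Sum>a\<leftarrow>ds. a\<^sup>2)"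
    for ds and d :: int
    by (induct ds) (simp_all add: algebra_simps power2_eq_square)
  have "2 * alt_dim dss (length dss) d = real_of_int (\<rho> * ((d + 1) * (d + 2)) + c1 * (2 * d + 3) + c1\<^sup>2 - 2 * c2)"
    if d: "d \<ge> d1" for d
  proof -
    have "2 * real (dim (Gr (dss ! j) d)) = real_of_int (\<Sum>a\<leftarrow>dss ! j. (d + a + 1) * (d + a + 2))" if "j < length dss" for j
    proof -
      have "2 * (\<Sum>a\<leftarrow>ds. real_of_int ((d + a + 1) * (d + a + 2)) / 2) = real_of_int (\<Sum>a\<leftarrow>ds. (d + a + 1) * (d + a + 2))" for ds
        by (induct ds) auto
      then show ?thesis using dim_Gr[of "dss ! j" d] d1[OF d that] by simp
    qed
    then have "2 * alt_dim dss (length dss) d =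
        (\<Sum>j<length dss. (-1) ^ j * real_of_int (\<Sum>a\<leftarrow>dss ! j. (d + a + 1) * (d + a + 2)))"
      unfolding alt_dim_def sum_distrib_left by (intro sum.cong) (auto simp: mult.left_commute)
    also have "\<dots> = real_of_int (\<Sum>j<length dss. (-1) ^ j * (\<Sum>a\<leftarrow>dss ! j. (d + a + 1) * (d + a + 2)))" by simp
    also have "(\<Sum>j<length dss. (-1) ^ j * (\<Sum>a\<leftarrow>dss ! j. (d + a + 1) * (d + a + 2))) =
      \<rho> * ((d + 1) * (d + 2)) + (\<Sum>j<length dss. (-1) ^ j * sum_list (dss ! j)) * (2 * d + 3)
        + (\<Sum>j<length dss. (-1) ^ j * (\<Sum>a\<leftarrow>dss ! j. a\<^sup>2))"
      unfolding lin \<rho>_def by (simp only: distrib_left sum.distrib sum_distrib_right mult.assoc)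
    finally show ?thesis unfolding chern_relation[OF dvd] by (simp add: algebra_simps)
  qed
  then show ?thesis using d0 by (intro exI[of _ \<rho>] exI[of _ "max d0 d1"]) simp
qed

lemma quadratic_eventually_zero:
  fixes a b c :: real
  assumes "\<And>d :: int. d \<ge> d0 \<Longrightarrow> a * real_of_int d ^ 2 + b * real_of_int d + c = 0"
  shows "a = 0" "b = 0" "c = 0"
proof -
  let ?x = "real_of_int d0"
  have 0: "a * ?x ^ 2 + b * ?x + c = 0" using assms[of d0] by simp
  have 1: "a * (?x + 1) ^ 2 + b * (?x + 1) + c = 0" using assms[of "d0 + 1"] by simp
  have 2: "a * (?x + 2) ^ 2 + b * (?x + 2) + c = 0" using assms[of "d0 + 2"] by simp
  have "2 * a = 0" using 0 1 2 by (simp add: power2_eq_square algebra_simps)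
  then show a: "a = 0" by simp
  then show b: "b = 0" using 0 1 by (simp add: algebra_simps)
  show "c = 0" using 0 a b by simp
qed

text \<open>Both pairs of classes describe the Hilbert polynomial of the same module, whose
  coefficients determine the rank, then \<open>c1\<close>, then \<open>c2\<close>.\<close>

lemma chern_unique:
  assumes g: "\<And>i. i < 3 \<Longrightarrow> homog D (g i)"
    and 1: "has_chern_classes (ker_sheaf g) c1 c2" and 2: "has_chern_classes (ker_sheaf g) c1' c2'"
  shows "c1 = c1' \<and> c2 = c2'"
proof -
  obtain \<rho> d0 where A: "\<And>d. d \<ge> d0 \<Longrightarrow> 2 * real (dim (ker_module g \<inter> Gr [0,0,0] d)) =
    real_of_int (\<rho> * ((d + 1) * (d + 2)) + c1 * (2 * d + 3) + c1\<^sup>2 - 2 * c2)" using chern_hilbert[OF g 1] by blast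
  obtain \<rho>' d0' where A': "\<And>d. d \<ge> d0' \<Longrightarrow> 2 * real (dim (ker_module g \<inter> Gr [0,0,0] d)) =
    real_of_int (\<rho>' * ((d + 1) * (d + 2)) + c1' * (2 * d + 3) + c1'\<^sup>2 - 2 * c2')" using chern_hilbert[OF g 2] by blast
  have q: "(\<rho> - \<rho>') * real_of_int d ^ 2 + (3 * (\<rho> - \<rho>') + 2 * (c1 - c1')) * real_of_int d
     + (2 * (\<rho> - \<rho>') + 3 * (c1 - c1') + c1\<^sup>2 - c1'\<^sup>2 - 2 * (c2 - c2')) = 0" if "d \<ge> max d0 d0'" for d
    using A[of d] A'[of d] that by (simp add: algebra_simps power2_eq_square)
  have "real_of_int (\<rho> - \<rho>') = 0" "real_of_int (3 * (\<rho> - \<rho>') + 2 * (c1 - c1')) = 0"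
    "real_of_int (2 * (\<rho> - \<rho>') + 3 * (c1 - c1') + c1\<^sup>2 - c1'\<^sup>2 - 2 * (c2 - c2')) = 0"
    using quadratic_eventually_zero[of "max d0 d0'", OF q] by simp_all
  then show ?thesis by simp
qed

text \<open>Both products have constant term 1, so the quotient can be solved for coefficient by
  coefficient up to degree 2.\<close>

lemma chern_exists:
  assumes g: "\<And>i. i < 3 \<Longrightarrow> homog D (g i)"
  shows "\<exists>c1 c2. has_chern_classes (ker_sheaf g) c1 c2"
proof -
  obtain dss where res: "is_resolution (ker_sheaf g) dss" using ker_sheaf_resolution[of D g] g by blast
  let ?O = "{j. j < length dss \<and> odd j}" and ?E = "{j. j < length dss \<and> even j}"
  let ?p = "\<Prod>j\<in>?O. chern_sum (dss ! j)" and ?q = "\<Prod>j\<in>?E. chern_sum (dss ! j)"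
  have p0: "coeff ?p 0 = 1" using chern_good_prod[of ?O "\<lambda>j. chern_sum (dss ! j)"] chern_good_chern_sum by (force simp: chern_good_def)
  have q0: "coeff ?q 0 = 1" using chern_good_prod[of ?E "\<lambda>j. chern_sum (dss ! j)"] chern_good_chern_sum by (force simp: chern_good_def)
  define c1 where "c1 = coeff ?q 1 - coeff ?p 1"
  define c2 where "c2 = coeff ?q 2 - coeff ?p 2 - c1 * coeff ?p 1"
  have "coeff ([:1, c1, c2:] * ?p - ?q) i = 0" if "i < 3" for i
  proof -
    have "i = 0 \<or> i = 1 \<or> i = 2" using that by auto
    then show ?thesis using p0 q0 by (auto simp: coeff_mult c2_def c1_def numeral_2_eq_2 algebra_simps)
  qed
  then have "monom 1 3 dvd [:1, c1, c2:] * ?p - ?q" by (simp add: monom_1_dvd_iff')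
  then show ?thesis using res unfolding has_chern_classes_def by blast
qed

section \<open>Linear substitutions\<close>

definition peval :: "('a::comm_ring_1 \<Rightarrow> 'b::comm_ring_1) \<Rightarrow> 'b \<Rightarrow> 'a poly \<Rightarrow> 'b" where
  "peval \<phi> u p = poly (map_poly \<phi> p) u"

definition ring_map :: "('a::comm_ring_1 \<Rightarrow> 'b::comm_ring_1) \<Rightarrow> bool" where
  "ring_map \<phi> \<longleftrightarrow> \<phi> 1 = 1 \<and> (\<forall>x y. \<phi> (x + y) = \<phi> x + \<phi> y) \<and> (\<forall>x y. \<phi> (x * y) = \<phi> x * \<phi> y)"

lemma ring_map_0: "ring_map \<phi> \<Longrightarrow> \<phi> 0 = 0"
  unfolding ring_map_def by (metis add_cancel_left_right)

lemma peval_pCons: "ring_map \<phi> \<Longrightarrow> peval \<phi> u (pCons a p) = \<phi> a + u * peval \<phi> u p"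
  by (simp add: peval_def map_poly_pCons ring_map_0)

lemma peval_0: "ring_map \<phi> \<Longrightarrow> peval \<phi> u 0 = 0"
  by (simp add: peval_def)

lemma ring_map_peval:
  assumes \<phi>: "ring_map \<phi>"
  shows "ring_map (peval \<phi> u)"
proof -
  note c = peval_pCons[OF \<phi>] peval_0[OF \<phi>] ring_map_0[OF \<phi>]
  have \<phi>s: "\<phi> 1 = 1" "\<phi> (x + y) = \<phi> x + \<phi> y" "\<phi> (x * y) = \<phi> x * \<phi> y" for x y
    using \<phi> by (auto simp: ring_map_def)
  have add: "peval \<phi> u (p + q) = peval \<phi> u p + peval \<phi> u q" for p q
    by (induct p q rule: poly_induct2) (simp_all add: c \<phi>s algebra_simps)
  have sm: "peval \<phi> u (smult a q) = \<phi> a * peval \<phi> u q" for a q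
    by (induct q) (simp_all add: c \<phi>s algebra_simps)
  have mul: "peval \<phi> u (p * q) = peval \<phi> u p * peval \<phi> u q" for p q
    by (induct p) (simp_all add: c add sm algebra_simps)
  show ?thesis unfolding ring_map_def using add mul by (simp add: one_pCons c \<phi>s)
qed

definition subst3 :: "S3 \<Rightarrow> S3 \<Rightarrow> S3 \<Rightarrow> S3 \<Rightarrow> S3" where
  "subst3 u0 u1 u2 = peval (peval (peval cst u2) u1) u0"

lemma ring_map_cst: "ring_map cst"
  by (simp add: ring_map_def cst_def one_pCons)

lemma ring_map_subst3: "ring_map (subst3 u0 u1 u2)"
  unfolding subst3_def by (intro ring_map_peval ring_map_cst)

lemma subst3_simps: "subst3 u0 u1 u2 (cst c) = cst c" "subst3 u0 u1 u2 X0 = u0"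
  "subst3 u0 u1 u2 X1 = u1" "subst3 u0 u1 u2 X2 = u2"
proof -
  note r1 = ring_map_peval[OF ring_map_cst] note r2 = ring_map_peval[OF r1]
  note c = peval_pCons[OF r2] peval_pCons[OF r1] peval_pCons[OF ring_map_cst]
    peval_0[OF r2] peval_0[OF r1] peval_0[OF ring_map_cst] ring_map_0[OF r2] ring_map_0[OF r1]
  have [simp]: "cst 0 = 0" "cst 1 = 1" by (simp_all add: cst_def one_pCons)
  show "subst3 u0 u1 u2 (cst c) = cst c" "subst3 u0 u1 u2 X0 = u0"
    "subst3 u0 u1 u2 X1 = u1" "subst3 u0 u1 u2 X2 = u2"
    unfolding subst3_def by (simp_all add: cst_def[of c] X0_def X1_def X2_def c one_pCons[symmetric])
      (simp_all add: cst_def c one_pCons)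
qed

lemma cst_simps [simp]: "cst 0 = 0" "cst 1 = 1" "cst (a + b) = cst a + cst b" "cst (a * b) = cst a * cst b"
  "cst (- a) = - cst a" "cst (a - b) = cst a - cst b"
  by (simp_all add: cst_def one_pCons)

lemma cst_eq_0_iff [simp]: "cst a = 0 \<longleftrightarrow> a = 0"
  by (simp add: cst_def)

lemma S3_induct:
  assumes "\<And>c. P (cst c)" "P X0" "P X1" "P X2" "\<And>p q. P p \<Longrightarrow> P q \<Longrightarrow> P (p + q)" "\<And>p q. P p \<Longrightarrow> P q \<Longrightarrow> P (p * q)"
  shows "P p"
proof -
  have 1: "P [:[:r:]:]" for r
  proof (induct r)
    case 0
    then show ?case using assms(1)[of 0] by (simp add: cst_def)
  next
    case (pCons a r)
    have "[:[:pCons a r:]:] = cst a + X2 * [:[:r:]:]" by (simp add: cst_def X2_def)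
    then show ?case using pCons assms by metis
  qed
  have 2: "P [:r:]" for r
  proof (induct r)
    case 0
    then show ?case using assms(1)[of 0] by (simp add: cst_def)
  next
    case (pCons a r)
    have "[:pCons a r:] = [:[:a:]:] + X1 * [:r:]" by (simp add: X1_def)
    then show ?case using pCons 1 assms by metis
  qed
  show ?thesis
  proof (induct p)
    case 0
    then show ?case using assms(1)[of 0] by (simp add: cst_def)
  next
    case (pCons a r)
    have "pCons a r = [:a:] + X0 * r" by (simp add: X0_def)
    then show ?case using pCons 2 assms by metis
  qed
qed

lemma subst3_inverse:
  assumes "subst3 u0 u1 u2 v0 = X0" "subst3 u0 u1 u2 v1 = X1" "subst3 u0 u1 u2 v2 = X2"
  shows "subst3 u0 u1 u2 (subst3 v0 v1 v2 p) = p"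
  by (induct p rule: S3_induct)
    (use assms ring_map_subst3[of u0 u1 u2] ring_map_subst3[of v0 v1 v2] in \<open>simp_all add: subst3_simps ring_map_def\<close>)

lemma homog_subst3:
  assumes "homog 1 u0" "homog 1 u1" "homog 1 u2" "homog d p"
  shows "homog d (subst3 u0 u1 u2 p)"
proof -
  have z: "homog d 0" for d by simp
  note r1 = ring_map_peval[OF ring_map_cst] note r2 = ring_map_peval[OF r1]
  have gen: "homog d (peval \<phi> u p)"
    if \<phi>: "ring_map \<phi>" and u: "homog 1 u" and h: "\<And>d a. h d a \<Longrightarrow> homog d (\<phi> a)" and p: "hl h d p"
    for \<phi> :: "'x::comm_ring_1 \<Rightarrow> S3" and h d p u
    using p
  proof (induct p arbitrary: d)
    case 0
    then show ?case by (simp add: peval_0[OF \<phi>])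
  next
    case (pCons a p)
    have "h d a" using pCons(3) unfolding hl_def by (metis coeff_pCons_0 diff_zero of_nat_0)
    moreover have "hl h (d - 1) p" unfolding hl_def
    proof
      fix i have "h (d - int (Suc i)) (coeff (pCons a p) (Suc i))" using pCons(3) unfolding hl_def by blast
      then show "h (d - 1 - int i) (coeff p i)" by (simp add: algebra_simps)
    qed
    ultimately show ?case unfolding peval_pCons[OF \<phi>] using pCons(2)[of "d - 1"] h
      by (intro g3.h_add g3.h_mult'[OF u, of "d - 1"]) auto
  qed
  have "homog d (cst c)" if "h0 d c" for d c using that homog_cst[of c] by (cases "c = 0") (auto simp: h0_def)
  note 1 = gen[OF ring_map_cst assms(3) this]
  note 2 = gen[OF r1 assms(2) 1]
  show ?thesis unfolding subst3_def using gen[OF r2 assms(1) 2] assms(4) by (simp add: homog_hl)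
qed

section \<open>Linear forms\<close>

abbreviation "lf \<equiv> linear_form"

lemma lf_pCons: "lf a = [:[:[:0, a $ 3:], [:a $ 2:]:], [:[:a $ 1:]:]:]"
  by (simp add: linear_form_def cst_def X0_def X1_def X2_def)

lemma homog_lf: "homog 1 (lf a)"
  unfolding linear_form_def using homog_X homog_cst by (intro g3.h_add g3.h_mult'[where d = 0 and e = 1]) auto

lemma lf_add: "lf (a + b) = lf a + lf b" and lf_scale: "lf (c *\<^sub>R a) = cst c * lf a"
  by (simp_all add: linear_form_def algebra_simps)

lemma lf_eq_iff: "lf a = lf b \<longleftrightarrow> a = b"
  by (auto simp: lf_pCons vec_eq_iff forall_3)

lemma lf_0 [simp]: "lf 0 = 0" by (simp add: lf_pCons)

lemma lf_eq_0_iff: "lf a = 0 \<longleftrightarrow> a = 0" using lf_eq_iff[of a 0] by simp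

lemma prime_elem_linear_unit:
  fixes a b c :: "'a::idom_divide"
  assumes "b * c = 1"
  shows "prime_elem [:a, b:]"
proof -
  have "is_unit [:b:]" using assms by (intro dvdI[of _ _ "[:c:]"]) (simp add: one_pCons assms mult.commute)
  moreover have "b * (c * a) = a" using assms by (simp add: mult.assoc[symmetric])
  then have "[:a, b:] = [:b:] * [:- (- c * a), 1:]" using assms by (simp add: mult.commute[of c b])
  ultimately show ?thesis using prime_elem_monic_linear[of "- c * a"] prime_elem_mult_unit_left by metis
qed

text \<open>The first nonzero coefficient is a unit, so the form is linear with unit leading
  coefficient in that variable.\<close>

lemma prime_lf: assumes "a \<noteq> 0" shows "prime_elem (lf a)"
proof (cases "a $ 1 = 0")
  case False
  then show ?thesis unfolding lf_pCons
    by (intro prime_elem_linear_unit[where c = "[:[:1 / (a $ 1):]:]"]) (simp add: one_pCons)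
next
  case True
  then have *: "lf a = [:[:[:0, a $ 3:], [:a $ 2:]:]:]" by (simp add: lf_pCons)
  show ?thesis
  proof (cases "a $ 2 = 0")
    case False
    then show ?thesis unfolding * prime_elem_const_poly_iff
      by (intro prime_elem_linear_unit[where c = "[:1 / (a $ 2):]"]) (simp add: one_pCons)
  next
    case a2: True
    with True assms have "a $ 3 \<noteq> 0" by (auto simp: vec_eq_iff forall_3)
    then have "prime_elem [:0, a $ 3:]" by (intro prime_elem_linear_unit[where c = "1 / a $ 3"]) simp
    then show ?thesis unfolding * using a2 by (simp add: prime_elem_const_poly_iff)
  qed
qed

lemma homog_0_cst: "homog 0 q \<Longrightarrow> q = cst (coeff (coeff (coeff q 0) 0) 0)"
proof -
  assume h: "homog 0 q"
  have z: "coeff (coeff (coeff q i) j) l = 0" if "i \<noteq> 0 \<or> j \<noteq> 0 \<or> l \<noteq> 0" for i j l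
  proof (rule ccontr)
    assume "coeff (coeff (coeff q i) j) l \<noteq> 0"
    then have "int (i + j + l) = 0" using h unfolding homog_def by blast
    then show False using that by simp
  qed
  show ?thesis by (auto simp: cst_def poly_eq_iff coeff_pCons z split: nat.splits)
qed

text \<open>The quotient is homogeneous of degree 0, hence a constant.\<close>

lemma lf_dvd_lf: assumes "a \<noteq> 0" "lf a dvd lf b" shows "\<exists>c. b = c *\<^sub>R a"
proof -
  obtain q where q: "lf b = lf a * q" using assms(2) by (elim dvdE)
  have "homog (0 + 1) (q * lf a)" using homog_lf[of b] q by (simp add: mult.commute)
  then have "homog 0 q" using homog_cancel[OF homog_lf] assms(1) lf_eq_0_iff by blast
  then have "lf b = lf (coeff (coeff (coeff q 0) 0) 0 *\<^sub>R a)" using q homog_0_cst[of q] by (simp add: lf_scale mult.commute)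
  then show ?thesis using lf_eq_iff by blast
qed

lemma prod_primes_dvd:
  fixes f :: "'i \<Rightarrow> 'a::idom"
  assumes "finite A" "\<And>a. a \<in> A \<Longrightarrow> prime_elem (f a)" "\<And>a b. a \<in> A \<Longrightarrow> b \<in> A \<Longrightarrow> a \<noteq> b \<Longrightarrow> \<not> f a dvd f b"
    "\<And>a. a \<in> A \<Longrightarrow> f a dvd p"
  shows "prod f A dvd p"
  using assms
proof (induct A arbitrary: p rule: finite_induct)
  case (insert x A)
  obtain q where q: "p = f x * q" using insert(6)[of x] by (auto elim: dvdE)
  have "f a dvd q" if a: "a \<in> A" for a
  proof -
    have "f a dvd f x * q" using insert(6)[of a] a q by simp
    moreover have "\<not> f a dvd f x" using insert(2) a insert(5)[of a x] by auto
    ultimately show ?thesis using insert(4)[of a] a prime_elem_dvd_multD by blast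
  qed
  then have "prod f A dvd q" using insert by auto
  then show ?case using insert(1,2) q by simp
qed simp

text \<open>From here on lines are handled through one equation each; pairwise nonproportional
  vectors are distinct lines, so \<open>card\<close> counts lines.\<close>

definition simple_arr :: "(real^3) set \<Rightarrow> bool" where
  "simple_arr A \<longleftrightarrow> finite A \<and> (\<forall>a\<in>A. a \<noteq> 0) \<and> (\<forall>a\<in>A. \<forall>b\<in>A. \<forall>c. a \<noteq> b \<longrightarrow> b \<noteq> c *\<^sub>R a)"

lemma simple_arr_subset: "simple_arr A \<Longrightarrow> B \<subseteq> A \<Longrightarrow> simple_arr B"
  unfolding simple_arr_def by (meson finite_subset subsetD)

lemma simple_arr_prod_dvd:
  assumes "simple_arr A" "\<And>a. a \<in> A \<Longrightarrow> lf a dvd p"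
  shows "(\<Prod>a\<in>A. lf a) dvd p"
proof (rule prod_primes_dvd)
  show "finite A" "\<And>a. a \<in> A \<Longrightarrow> prime_elem (lf a)" using assms(1) prime_lf by (auto simp: simple_arr_def)
  show "\<not> lf a dvd lf b" if "a \<in> A" "b \<in> A" "a \<noteq> b" for a b
    using lf_dvd_lf[of a b] assms(1) that unfolding simple_arr_def by blast
qed (rule assms(2))

section \<open>Logarithmic derivations of a set of linear forms\<close>

text \<open>The value of the derivation with components \<open>\<theta>\<close> on the linear form
  with coefficients \<open>a\<close>.\<close>

definition dotS :: "real^3 \<Rightarrow> (nat \<Rightarrow> S3) \<Rightarrow> S3" where
  "dotS a \<theta> = cst (a $ 1) * \<theta> 0 + cst (a $ 2) * \<theta> 1 + cst (a $ 3) * \<theta> 2"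

text \<open>The module of logarithmic derivations, defined line by line and without the gradient, so
  that it can be compared for arrangements that differ by a line.\<close>

definition Dmod :: "(real^3) set \<Rightarrow> (nat \<Rightarrow> S3) set" where
  "Dmod A = {\<theta>. (\<forall>i\<ge>3. \<theta> i = 0) \<and> (\<forall>a\<in>A. lf a dvd dotS a \<theta>)}"

definition DA :: "(real^3) set \<Rightarrow> int \<Rightarrow> (nat \<Rightarrow> S3) set" where
  "DA A d = Dmod A \<inter> Gr [0,0,0] d"

lemma Gr3_iff: "\<theta> \<in> Gr [0,0,0] d \<longleftrightarrow> homog d (\<theta> 0) \<and> homog d (\<theta> 1) \<and> homog d (\<theta> 2) \<and> (\<forall>i\<ge>3. \<theta> i = 0)"
  by (auto simp: Gr_def nth_Cons less_Suc_eq numeral_3_eq_3 numeral_2_eq_2 split: nat.splits)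

lemma dotS_add: "dotS a (\<lambda>i. \<theta> i + \<eta> i) = dotS a \<theta> + dotS a \<eta>"
  and dotS_scale: "dotS a (\<lambda>i. p * \<theta> i) = p * dotS a \<theta>"
  by (simp_all add: dotS_def algebra_simps)

lemma subspace_Dmod: "vec.subspace (Dmod A)"
  by (rule vec_subspaceI) (auto simp: Dmod_def plus_fun_def dotS_add dotS_scale, simp add: dotS_def)

lemma DA_space: "subspace (DA A d)" "findim (DA A d)"
  unfolding DA_def using subspace_vec[OF subspace_Dmod] Gr_space(1)
  by (auto intro: real_vector.subspace_inter findim_subset[OF Gr_space(2)[of "[0,0,0]" d]])

definition sg :: "real^3^3 \<Rightarrow> S3 \<Rightarrow> S3" where
  "sg g = subst3 (lf (g $ 1)) (lf (g $ 2)) (lf (g $ 3))"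

text \<open>The derivation that corresponds to \<open>\<theta>\<close> under the substitution \<open>sg g\<close>.\<close>

definition Tg :: "real^3^3 \<Rightarrow> (nat \<Rightarrow> S3) \<Rightarrow> nat \<Rightarrow> S3" where
  "Tg g \<theta> = (\<lambda>i. if i = 0 then dotS (transpose g $ 1) (sg g \<circ> \<theta>) else if i = 1 then dotS (transpose g $ 2) (sg g \<circ> \<theta>)
     else if i = 2 then dotS (transpose g $ 3) (sg g \<circ> \<theta>) else 0)"

lemma ring_map_sg: "ring_map (sg g)" unfolding sg_def by (rule ring_map_subst3)

lemma sg_simps: "sg g (p + q) = sg g p + sg g q" "sg g (p * q) = sg g p * sg g q" "sg g (cst c) = cst c" "sg g 0 = 0"
  using ring_map_sg[of g] ring_map_0[OF ring_map_sg] by (auto simp: ring_map_def) (simp add: sg_def subst3_simps)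

lemma sg_diff: "sg g (p - q) = sg g p - sg g q"
  using sg_simps(1)[of g "p - q" q] by simp

lemma sg_lf: "sg g (lf a) = lf (a v* g)"
proof -
  have "sg g (lf a) = cst (a $ 1) * lf (g $ 1) + cst (a $ 2) * lf (g $ 2) + cst (a $ 3) * lf (g $ 3)"
    unfolding linear_form_def[of a] sg_simps by (simp add: sg_def subst3_simps)
  also have "\<dots> = lf (a v* g)"
    by (simp add: linear_form_def vector_matrix_mult_def sum_3 algebra_simps)
  finally show ?thesis .
qed

lemma vmul_orth: "orthogonal_matrix g \<Longrightarrow> (a v* g) v* transpose g = a" "orthogonal_matrix g \<Longrightarrow> (a v* transpose g) v* g = a"
  by (simp_all add: vector_matrix_mul_assoc orthogonal_matrix_def)

text \<open>The transpose of an orthogonal matrix is its inverse, so the matrix that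
  \<open>Tg\<close> applies to the components undoes the change of the form.\<close>

lemma dotS_Tg:
  assumes g: "orthogonal_matrix g"
  shows "dotS (a v* g) (Tg g \<theta>) = sg g (dotS a \<theta>)"
proof -
  have e: "a = (a v* g) v* transpose g" using vmul_orth(1)[OF g] by simp
  define b where "b = a v* g"
  have "a $ i = (b v* transpose g) $ i" for i using e by (simp add: b_def)
  then have a: "a $ i = b $ 1 * (g $ i) $ 1 + b $ 2 * (g $ i) $ 2 + b $ 3 * (g $ i) $ 3" for i
    by (simp add: vector_matrix_mult_def transpose_def sum_3 mult.commute)
  show ?thesis unfolding dotS_def sg_simps b_def[symmetric] a
    by (simp add: Tg_def dotS_def transpose_def algebra_simps)
qed

lemma sg_inverse:
  assumes g: "orthogonal_matrix g"
  shows "sg (transpose g) (sg g p) = p"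
proof -
  have "axis i 1 v* g = g $ i" for i
    using exhaust_3[of i] by (auto simp: vector_matrix_mult_def axis_def vec_eq_iff sum_3)
  then have *: "g $ i v* transpose g = axis i 1" for i using vmul_orth(1)[OF g] by metis
  have X: "lf (axis 1 1) = X0" "lf (axis 2 1) = X1" "lf (axis 3 1) = X2"
    by (simp_all add: linear_form_def axis_def)
  show ?thesis unfolding sg_def[of g]
    unfolding sg_def[of "transpose g"] by (rule subst3_inverse; unfold sg_def[symmetric] sg_lf * X; rule refl)
qed

lemma linear_Tg: "linear (Tg g)"
  by (rule linearI) (auto simp: Tg_def dotS_def fun_eq_iff sg_simps scaleR_S3 algebra_simps)

lemma Tg_inverse:
  assumes g: "orthogonal_matrix g" and \<theta>: "\<And>i. i \<ge> 3 \<Longrightarrow> \<theta> i = 0"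
  shows "Tg (transpose g) (Tg g \<theta>) = \<theta>"
proof -
  have gt: "orthogonal_matrix (transpose g)" using g by (simp add: orthogonal_matrix_transpose)
  have D: "dotS a (Tg (transpose g) (Tg g \<theta>)) = dotS a \<theta>" for a
  proof -
    have "dotS a (Tg (transpose g) (Tg g \<theta>)) = sg (transpose g) (dotS (a v* g) (Tg g \<theta>))"
      using dotS_Tg[OF gt, of "a v* g" "Tg g \<theta>"] vmul_orth(1)[OF g] by simp
    then show ?thesis using dotS_Tg[OF g] sg_inverse[OF g] by simp
  qed
  have ax: "dotS (axis 1 1) \<eta> = \<eta> 0" "dotS (axis 2 1) \<eta> = \<eta> 1" "dotS (axis 3 1) \<eta> = \<eta> 2" for \<eta>
    by (simp_all add: dotS_def axis_def)
  show ?thesis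
  proof
    fix i :: nat
    consider "i = 0" | "i = 1" | "i = 2" | "i \<ge> 3" by linarith
    then show "Tg (transpose g) (Tg g \<theta>) i = \<theta> i"
      using D[of "axis 1 1"] D[of "axis 2 1"] D[of "axis 3 1"] \<theta> unfolding ax by cases (auto simp: Tg_def)
  qed
qed

lemma Tg_DA:
  assumes g: "orthogonal_matrix g" and \<theta>: "\<theta> \<in> DA A d"
  shows "Tg g \<theta> \<in> DA ((\<lambda>a. a v* g) ` A) d"
proof -
  have "lf (a v* g) dvd dotS (a v* g) (Tg g \<theta>)" if "a \<in> A" for a
  proof -
    have "lf a dvd dotS a \<theta>" using \<theta> \<open>a \<in> A\<close> by (simp add: DA_def Dmod_def)
    then obtain q where "dotS a \<theta> = lf a * q" by (elim dvdE)
    then show ?thesis unfolding dotS_Tg[OF g] by (simp add: sg_simps sg_lf)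
  qed
  moreover have "homog d (sg g (\<theta> i))" if "i < 3" for i
  proof -
    have "homog d (\<theta> i)" using \<theta> that by (auto simp: DA_def Gr3_iff numeral_3_eq_3 less_Suc_eq numeral_2_eq_2)
    then show ?thesis unfolding sg_def by (intro homog_subst3 homog_lf)
  qed
  then have "homog d (dotS b (sg g \<circ> \<theta>))" for b
    unfolding dotS_def using homog_cst by (intro g3.h_add g3.h_mult'[where d = 0 and e = d]) auto
  ultimately show ?thesis by (auto simp: DA_def Dmod_def Gr3_iff Tg_def)
qed

text \<open>\<open>Tg g\<close> is injective, which gives one inequality; the other is the same
  statement for the transpose.\<close>

lemma dim_DA_orth:
  assumes g: "orthogonal_matrix g"
  shows "dim (DA ((\<lambda>a. a v* g) ` A) d) = dim (DA A d)"
proof -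
  have le: "dim (DA A d) \<le> dim (DA ((\<lambda>a. a v* g) ` A) d)" if g: "orthogonal_matrix g" for g A
  proof -
    have "dim (Tg g ` DA A d) = dim (DA A d)"
    proof (rule dim_image_inj[OF linear_Tg DA_space])
      fix x assume x: "x \<in> DA A d" "Tg g x = 0"
      have "Tg (transpose g) (Tg g x) = x" by (rule Tg_inverse[OF g]) (use x in \<open>simp add: DA_def Dmod_def\<close>)
      then show "x = 0" using x linear_0[OF linear_Tg] by simp
    qed
    moreover have "dim (Tg g ` DA A d) \<le> dim (DA ((\<lambda>a. a v* g) ` A) d)"
      by (rule dim_mono_findim[OF DA_space(2)]) (use Tg_DA[OF g] in blast)
    ultimately show ?thesis by simp
  qed
  have "(\<lambda>a. a v* transpose g) ` (\<lambda>a. a v* g) ` A = A"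
    using vmul_orth(1)[OF g] by (simp add: image_image)
  then show ?thesis using le[OF g, of A] le[of "transpose g" "(\<lambda>a. a v* g) ` A"] g by (simp add: orthogonal_matrix_transpose)
qed

section \<open>Restriction to a line\<close>

definition lf2 :: "real^3 \<Rightarrow> real poly poly" where "lf2 a = [:[:0, a $ 3:], [:a $ 2:]:]"

text \<open>The part of a form that survives restriction to \<open>X0 = 0\<close>; it vanishes
  exactly for the multiples of \<open>X0\<close>.\<close>

definition bv :: "real^3 \<Rightarrow> real^3" where "bv a = a - (a $ 1) *\<^sub>R axis 1 1"

lemma bv_nth: "bv a $ 1 = 0" "bv a $ 2 = a $ 2" "bv a $ 3 = a $ 3"
  by (simp_all add: bv_def axis_def)

lemma lf_bv: "lf (bv a) = [:lf2 a:]"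
  by (simp add: lf_pCons lf2_def bv_nth)

lemma coeff_lf: "coeff (lf a) 0 = lf2 a"
  by (simp add: lf_pCons lf2_def)

lemma bv_eq_0_iff: "bv a = 0 \<longleftrightarrow> (\<exists>t. a = t *\<^sub>R axis 1 1)"
  by (auto simp: bv_def axis_def vec_eq_iff forall_3)

lemma prime_lf2: "bv a \<noteq> 0 \<Longrightarrow> prime_elem (lf2 a)"
  using prime_lf[of "bv a"] by (simp add: lf_bv prime_elem_const_poly_iff)

text \<open>Proportional restrictions mean that the two lines meet \<open>X0 = 0\<close> in the same
  point.\<close>

lemma lf2_dvd:
  assumes "bv a \<noteq> 0" "lf2 a dvd lf2 b"
  shows "\<exists>s t. b = s *\<^sub>R a + t *\<^sub>R axis 1 1"
proof -
  have "lf (bv a) dvd lf (bv b)" using assms(2) by (simp add: lf_bv const_poly_dvd_const_poly_iff)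
  then obtain s where s: "bv b = s *\<^sub>R bv a" using lf_dvd_lf assms(1) by blast
  then have "b = s *\<^sub>R a + (b $ 1 - s * a $ 1) *\<^sub>R axis 1 1"
    by (simp add: bv_def algebra_simps)
  then show ?thesis by blast
qed

lemma coeff0_mult: "coeff (p * q) 0 = coeff p 0 * coeff q 0"
  by (simp add: coeff_mult)

lemma coeff0_prod: "coeff (prod f A) 0 = (\<Prod>a\<in>A. coeff (f a) 0)"
  by (induct A rule: infinite_finite_induct) (auto simp: coeff0_mult)

lemma coeff0_dvd: "p dvd q \<Longrightarrow> coeff p 0 dvd coeff q 0"
  by (auto simp: coeff0_mult elim!: dvdE)

lemma homog_const: "homog d [:q:] \<longleftrightarrow> h2 d q"
  by (auto simp: homog_hl hl_def[of h2] coeff_pCons split: nat.splits)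

lemma homog_coeff0: "homog d p \<Longrightarrow> h2 d (coeff p 0)"
  unfolding homog_hl hl_def[of h2] by (metis diff_zero of_nat_0)

lemma h2_cancel: "h2 e b \<Longrightarrow> b \<noteq> 0 \<Longrightarrow> h2 d (b * q) \<Longrightarrow> h2 (d - e) q"
  using homog_cancel[of e "[:b:]" "d - e" "[:q:]"] by (simp add: homog_const mult.commute)

lemma h2_lf2: "h2 1 (lf2 a)"
  using homog_lf[of "bv a"] by (simp add: lf_bv homog_const)

lemma prime_powers_dvd:
  fixes p :: "'i \<Rightarrow> 'a::idom"
  assumes "finite A" "\<And>a. a \<in> A \<Longrightarrow> prime_elem (p a)" "\<And>a b. a \<in> A \<Longrightarrow> b \<in> A \<Longrightarrow> a \<noteq> b \<Longrightarrow> \<not> p a dvd p b"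
    "\<And>a. a \<in> A \<Longrightarrow> p a ^ k a dvd x"
  shows "(\<Prod>a\<in>A. p a ^ k a) dvd x"
  using assms
proof (induct A arbitrary: x rule: finite_induct)
  case (insert a A)
  obtain y where y: "x = p a ^ k a * y" using insert(6)[of a] by (auto elim: dvdE)
  have "p b ^ k b dvd y" if b: "b \<in> A" for b
  proof -
    have "p b ^ k b dvd p a ^ k a * y" using insert(6)[of b] b y by simp
    moreover have "\<not> p b dvd p a ^ k a"
      using insert(2) b insert(5)[of b a] insert(4)[of b] prime_elem_dvd_power by blast
    ultimately show ?thesis using prime_elem_power_cancel insert(4)[of b] b by blast
  qed
  then have "(\<Prod>a\<in>A. p a ^ k a) dvd y" using insert by auto
  then show ?case using insert(1,2) y by (simp add: mult_dvd_mono)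
qed simp

text \<open>\<open>C\<close> contains one line through each of the points in which the lines of \<open>A\<close> meet the
  line with equation \<open>h\<close>.\<close>

definition reps :: "real^3 \<Rightarrow> (real^3) set \<Rightarrow> (real^3) set \<Rightarrow> bool" where
  "reps h A C \<longleftrightarrow> C \<subseteq> A \<and> (\<forall>a\<in>A. \<exists>c\<in>C. \<exists>s t. a = s *\<^sub>R c + t *\<^sub>R h) \<and>
     (\<forall>c\<in>C. \<forall>c'\<in>C. \<forall>s t. c \<noteq> c' \<longrightarrow> c \<noteq> s *\<^sub>R c' + t *\<^sub>R h) \<and> (\<forall>a\<in>A. \<forall>t. a \<noteq> t *\<^sub>R h)"

abbreviation "x1 \<equiv> [:0, 1:] :: real poly poly"
abbreviation "x2 \<equiv> [:[:0, 1:]:] :: real poly poly"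

text \<open>Restrictions to the line \<open>X0 = 0\<close>: \<open>rho0\<close> is the normal
  component, \<open>rho2\<close> the determinant with the Euler derivation of the line. If both
  vanish, the restricted derivation is a multiple of the Euler derivation, and \<open>rho1\<close>
  is \<open>x1\<close> times the factor.\<close>

definition rho0 :: "(nat \<Rightarrow> S3) \<Rightarrow> real poly poly" where "rho0 \<theta> = coeff (\<theta> 0) 0"
definition rho1 :: "(nat \<Rightarrow> S3) \<Rightarrow> real poly poly" where "rho1 \<theta> = coeff (\<theta> 1) 0"
definition rho2 :: "(nat \<Rightarrow> S3) \<Rightarrow> real poly poly" where
  "rho2 \<theta> = x2 * coeff (\<theta> 1) 0 - x1 * coeff (\<theta> 2) 0"

lemma linear_rho: "linear rho0" "linear rho1" "linear rho2"
  by (rule linearI; simp add: rho0_def rho1_def rho2_def coeff_scaleR distrib_left scaleR_diff_right)+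

lemma h2_X: "h2 1 x1" "h2 1 x2"
  using homog_X(2,3) by (simp_all add: X1_def X2_def homog_const)

lemma dim_multiples:
  "subspace ((*) b ` {q. h2 e q})" "findim ((*) b ` {q. h2 e q})" "dim ((*) b ` {q. h2 e q}) \<le> nat (e + 1)"
proof -
  have lin: "linear ((*) b)" for b :: "real poly poly" by (rule linearI) (simp_all add: distrib_left)
  show "subspace ((*) b ` {q. h2 e q})" by (rule linear_subspace_image[OF lin h2_space(1)])
  show "findim ((*) b ` {q. h2 e q})" by (rule rank_nullity(2)[OF lin h2_space(1,2)])
  show "dim ((*) b ` {q. h2 e q}) \<le> nat (e + 1)"
    using rank_nullity(1)[OF lin[of b] h2_space(1,2)[of e]] h2_space(3)[of e] by simp
qed

lemma subspace_kernel: "linear f \<Longrightarrow> subspace V \<Longrightarrow> subspace {x \<in> V. f x = 0}"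
  using real_vector.subspace_inter[of V "{x. f x = 0}"] linear_subspace_kernel[of f] by (simp add: Int_def)

locale restriction =
  fixes A C :: "(real^3) set"
  assumes simp_arr: "simple_arr A" and rep: "reps (axis 1 1) A C"
begin

lemma fin: "finite A" "finite C"
  using simp_arr rep finite_subset by (auto simp: simple_arr_def reps_def)

lemma not_axis: "a \<in> A \<Longrightarrow> a \<noteq> t *\<^sub>R axis 1 1"
  using rep unfolding reps_def by blast

lemma bvA: "a \<in> A \<Longrightarrow> bv a \<noteq> 0"
  using not_axis by (simp add: bv_eq_0_iff)

lemma repD: "\<lbrakk>c \<in> C; c' \<in> C; c \<noteq> c'\<rbrakk> \<Longrightarrow> c \<noteq> s *\<^sub>R c' + t *\<^sub>R axis 1 1"
proof -
  have R: "\<forall>c\<in>C. \<forall>c'\<in>C. \<forall>s t. c \<noteq> c' \<longrightarrow> c \<noteq> s *\<^sub>R c' + t *\<^sub>R axis 1 1"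
    using rep unfolding reps_def by (elim conjE)
  show "\<lbrakk>c \<in> C; c' \<in> C; c \<noteq> c'\<rbrakk> \<Longrightarrow> c \<noteq> s *\<^sub>R c' + t *\<^sub>R axis 1 1" by (rule R[rule_format])
qed

lemma C_sub: "C \<subseteq> A" using rep by (simp add: reps_def)

lemma lf2_C: "c \<in> C \<Longrightarrow> c' \<in> C \<Longrightarrow> c \<noteq> c' \<Longrightarrow> \<not> lf2 c dvd lf2 c'"
proof
  assume c: "c \<in> C" "c' \<in> C" "c \<noteq> c'" and "lf2 c dvd lf2 c'"
  moreover from c C_sub have "bv c \<noteq> 0" using bvA by blast
  ultimately obtain s t where "c' = s *\<^sub>R c + t *\<^sub>R axis 1 1" using lf2_dvd[of c c'] by blast
  then show False using c repD[of c' c s t] by metis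
qed

text \<open>The lines of \<open>A\<close> through the point in which \<open>c\<close> meets
  \<open>X0 = 0\<close>.\<close>

definition cls :: "real^3 \<Rightarrow> (real^3) set" where
  "cls c = {a \<in> A. \<exists>s t. a = s *\<^sub>R c + t *\<^sub>R axis 1 1}"

text \<open>\<open>Q\<close> is the reduced equation of the points of \<open>A\<close> on the line
  and \<open>B\<close> carries the remaining multiplicities; with \<open>n\<close> points and
  \<open>m\<close> lines the degrees are \<open>n\<close> and \<open>m - n\<close>.\<close>

definition Q where "Q = (\<Prod>c\<in>C. lf2 c)"
definition B where "B = (\<Prod>c\<in>C. lf2 c ^ (card (cls c) - 1))"

lemma cls_self: "c \<in> C \<Longrightarrow> c \<in> cls c"
proof -
  assume "c \<in> C"
  moreover have "c = 1 *\<^sub>R c + 0 *\<^sub>R axis 1 1" by simp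
  ultimately show ?thesis unfolding cls_def using C_sub by blast
qed

lemma sum_cls: "(\<Sum>c\<in>C. card (cls c)) = card A"
proof -
  have "(\<Union>c\<in>C. cls c) = A" using rep by (auto simp: cls_def reps_def)
  moreover have "cls c \<inter> cls c' = {}" if c: "c \<in> C" "c' \<in> C" "c \<noteq> c'" for c c'
  proof (rule ccontr)
    assume "cls c \<inter> cls c' \<noteq> {}"
    then obtain a s t s' t' where a: "a \<in> A" "a = s *\<^sub>R c + t *\<^sub>R axis 1 1" "a = s' *\<^sub>R c' + t' *\<^sub>R axis 1 1"
      unfolding cls_def by blast
    have "s \<noteq> 0" using a(1,2) not_axis[of a t] by auto
    have "s *\<^sub>R c = s' *\<^sub>R c' + (t' - t) *\<^sub>R axis 1 1" using a(2,3) by (simp add: algebra_simps)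
    then have "(1/s) *\<^sub>R (s *\<^sub>R c) = (1/s) *\<^sub>R (s' *\<^sub>R c' + (t' - t) *\<^sub>R axis 1 1)" by simp
    then have "c = (s'/s) *\<^sub>R c' + ((t' - t)/s) *\<^sub>R axis 1 1" using \<open>s \<noteq> 0\<close> by (simp add: scaleR_add_right)
    then show False using repD[OF c] by blast
  qed
  ultimately show ?thesis using fin card_UN_disjoint[of C cls] by (simp add: cls_def)
qed

lemma card_cls: "c \<in> C \<Longrightarrow> card (cls c) \<ge> 1"
proof -
  assume "c \<in> C"
  then have "cls c \<noteq> {}" using cls_self by blast
  moreover have "finite (cls c)" using fin by (simp add: cls_def)
  ultimately show ?thesis by (simp add: Suc_le_eq card_gt_0_iff)
qed

lemma degrees: "h2 (int (card C)) Q" "h2 (int (card A) - int (card C)) B" "Q \<noteq> 0" "B \<noteq> 0"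
proof -
  have nz: "lf2 c \<noteq> 0" if "c \<in> C" for c using prime_lf2[OF bvA] C_sub that by (auto simp: prime_elem_def)
  then show "Q \<noteq> 0" "B \<noteq> 0" using fin by (auto simp: Q_def B_def)
  have pr: "h2 (\<Sum>c\<in>S. int (k c)) (\<Prod>c\<in>S. lf2 c ^ k c)" if "finite S" for S :: "(real^3) set" and k
    using that
  proof (induct S rule: finite_induct)
    case (insert x S)
    then show ?case using g2.h_mult[OF g2.h_power[OF h2_lf2, of "k x" x]] by simp
  qed (simp add: g2.h_one)
  show "h2 (int (card C)) Q" using pr[OF fin(2), of "\<lambda>_. 1"] by (simp add: Q_def)
  have "(\<Sum>c\<in>C. int (card (cls c) - 1)) = (\<Sum>c\<in>C. int (card (cls c)) - 1)"
    using card_cls by (intro sum.cong) auto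
  also have "\<dots> = int (card A) - int (card C)" by (simp add: sum_subtractf flip: sum_cls)
  finally show "h2 (int (card A) - int (card C)) B" using pr[OF fin(2), of "\<lambda>c. card (cls c) - 1"] by (simp add: B_def)
qed

text \<open>Each line \<open>a\<close> through the point of \<open>c\<close> on the line \<open>X0 = 0\<close> has an equation \<open>s \<gamma> + t X0\<close>,
  and \<open>s (X0 (\<gamma> \<cdot> \<theta>) - \<gamma> \<theta>\<^sub>0) = X0 (a \<cdot> \<theta>) - a \<theta>\<^sub>0\<close> is divisible by it.\<close>

lemma B_dvd_rho0:
  assumes \<theta>: "\<theta> \<in> Dmod A"
  shows "B dvd rho0 \<theta>"
  unfolding B_def
proof (rule prime_powers_dvd[OF fin(2)])
  show "prime_elem (lf2 c)" if "c \<in> C" for c using prime_lf2[OF bvA] C_sub that by blast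
  show "\<not> lf2 a dvd lf2 b" if "a \<in> C" "b \<in> C" "a \<noteq> b" for a b using lf2_C that by blast
  fix c assume c: "c \<in> C"
  let ?w = "X0 * dotS (bv c) \<theta> - lf (bv c) * \<theta> 0"
  have st: "\<exists>s. s \<noteq> 0 \<and> a = s *\<^sub>R bv c + (a $ 1) *\<^sub>R axis 1 1" if a: "a \<in> cls c" for a
  proof -
    obtain s t where st: "a = s *\<^sub>R c + t *\<^sub>R axis 1 1" "a \<in> A" using a by (auto simp: cls_def)
    have "s \<noteq> 0" using st not_axis[of a t] by auto
    moreover have "a = s *\<^sub>R bv c + (a $ 1) *\<^sub>R axis 1 1"
      using st(1) by (auto simp: bv_def axis_def vec_eq_iff forall_3)
    ultimately show ?thesis by blast
  qed
  have e1: "lf (axis 1 1) = X0" "dotS (axis 1 1) \<theta> = \<theta> 0"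
    by (simp_all add: linear_form_def dotS_def axis_def)
  have dots: "dotS (s *\<^sub>R u + t *\<^sub>R v) \<theta> = cst s * dotS u \<theta> + cst t * dotS v \<theta>" for s t u v
    by (simp add: dotS_def algebra_simps)
  have "(\<Prod>a\<in>cls c. lf a) dvd ?w"
  proof (rule simple_arr_prod_dvd)
    show "simple_arr (cls c)" by (rule simple_arr_subset[OF simp_arr]) (auto simp: cls_def)
    fix a assume a: "a \<in> cls c"
    obtain s where s: "s \<noteq> 0" "a = s *\<^sub>R bv c + (a $ 1) *\<^sub>R axis 1 1" using st[OF a] by blast
    define t where "t = a $ 1"
    have a': "a = s *\<^sub>R bv c + t *\<^sub>R axis 1 1" using s t_def by simp
    have "X0 * dotS a \<theta> - lf a * \<theta> 0 = cst s * ?w"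
      unfolding a' dots lf_add lf_scale e1 by (simp add: algebra_simps)
    moreover have "lf a dvd dotS a \<theta>" using \<theta> a by (auto simp: Dmod_def cls_def)
    then have "lf a dvd X0 * dotS a \<theta> - lf a * \<theta> 0" by (intro dvd_diff dvd_mult dvd_triv_left)
    ultimately have "lf a dvd cst (1/s) * (cst s * ?w)" by simp
    moreover have "cst (1/s) * (cst s * ?w) = ?w" using s(1) by (simp add: mult.assoc[symmetric] flip: cst_simps(4))
    ultimately show "lf a dvd ?w" by simp
  qed
  then have "(\<Prod>a\<in>cls c. lf2 a) dvd lf2 c * rho0 \<theta>"
    using coeff0_dvd[of "\<Prod>a\<in>cls c. lf a" ?w] by (simp add: coeff0_prod coeff_lf coeff0_mult X0_def lf_bv rho0_def)
  moreover have "lf2 c ^ card (cls c) dvd (\<Prod>a\<in>cls c. lf2 a)"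
  proof -
    have "(\<Prod>a\<in>cls c. lf2 c) dvd (\<Prod>a\<in>cls c. lf2 a)"
    proof (rule prod_dvd_prod)
      fix a assume "a \<in> cls c"
      then obtain s where "a = s *\<^sub>R bv c + (a $ 1) *\<^sub>R axis 1 1" using st by blast
      then have "bv a = s *\<^sub>R bv c" by (auto simp: bv_def axis_def vec_eq_iff forall_3)
      then have "[:lf2 a:] = cst s * [:lf2 c:]" by (simp add: lf_scale flip: lf_bv)
      then have "lf2 a = [:[:s:]:] * lf2 c" by (simp add: cst_def)
      then show "lf2 c dvd lf2 a" by (metis dvd_triv_right)
    qed
    then show ?thesis by simp
  qed
  \<comment> \<open>One factor \<open>lf2 c\<close> cancels, which is why a point on
    \<open>j\<close> lines contributes only the power \<open>j - 1\<close> to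
    \<open>B\<close>.\<close>
  ultimately have "lf2 c ^ Suc (card (cls c) - 1) dvd lf2 c * rho0 \<theta>"
    using card_cls[OF c] dvd_trans by (simp del: power_Suc)
  then show "lf2 c ^ (card (cls c) - 1) dvd rho0 \<theta>"
    using prime_lf2[OF bvA] C_sub c by (auto simp: prime_elem_def)
qed

text \<open>With vanishing normal component the restriction is a derivation of the line, logarithmic
  along the points. Multiplying \<open>rho2\<close> by either coefficient of \<open>lf2 c\<close>
  gives a multiple of \<open>lf2 c\<close>, and one of the two is not 0.\<close>

lemma Q_dvd_rho2:
  assumes \<theta>: "\<theta> \<in> Dmod A" and z: "rho0 \<theta> = 0"
  shows "Q dvd rho2 \<theta>"
  unfolding Q_def
proof (rule prod_primes_dvd[OF fin(2)])
  show "prime_elem (lf2 c)" if "c \<in> C" for c using prime_lf2[OF bvA] C_sub that by blast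
  show "\<not> lf2 a dvd lf2 b" if "a \<in> C" "b \<in> C" "a \<noteq> b" for a b using lf2_C that by blast
  fix c assume c: "c \<in> C"
  let ?\<phi> = "coeff (\<theta> 1) 0" and ?\<psi> = "coeff (\<theta> 2) 0"
  have "lf c dvd dotS c \<theta>" using \<theta> c C_sub by (auto simp: Dmod_def)
  then have "lf2 c dvd coeff (dotS c \<theta>) 0" using coeff0_dvd coeff_lf by metis
  also have "coeff (dotS c \<theta>) 0 = [:[:c $ 2:]:] * ?\<phi> + [:[:c $ 3:]:] * ?\<psi>"
    using z by (simp add: dotS_def coeff0_mult cst_def rho0_def)
  finally have d: "lf2 c dvd [:[:c $ 2:]:] * ?\<phi> + [:[:c $ 3:]:] * ?\<psi>" .
  have l: "lf2 c = [:[:c $ 2:]:] * x1 + [:[:c $ 3:]:] * x2" by (simp add: lf2_def)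
  have k2: "[:[:c $ 2:]:] * rho2 \<theta> = x2 * ([:[:c $ 2:]:] * ?\<phi> + [:[:c $ 3:]:] * ?\<psi>) - lf2 c * ?\<psi>"
    unfolding rho2_def l by (simp only: algebra_simps)
  have k3: "[:[:c $ 3:]:] * rho2 \<theta> = lf2 c * ?\<phi> - x1 * ([:[:c $ 2:]:] * ?\<phi> + [:[:c $ 3:]:] * ?\<psi>)"
    unfolding rho2_def l by (simp only: algebra_simps)
  have kd: "lf2 c dvd [:[:c $ 2:]:] * rho2 \<theta>" "lf2 c dvd [:[:c $ 3:]:] * rho2 \<theta>"
    unfolding k2 k3 using d by (intro dvd_diff dvd_mult dvd_triv_left; simp)+
  have un: "lf2 c dvd r" if "lf2 c dvd [:[:k:]:] * r" "k \<noteq> 0" for k r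
  proof -
    have "lf2 c dvd [:[:1/k:]:] * ([:[:k:]:] * r)" by (intro dvd_mult that(1))
    moreover have "[:[:1/k:]:] * ([:[:k:]:] * r) = r" using that(2) by (simp add: smult_smult flip: one_pCons)
    ultimately show ?thesis by simp
  qed
  have "c $ 2 \<noteq> 0 \<or> c $ 3 \<noteq> 0" using bvA[of c] c C_sub by (auto simp: vec_eq_iff forall_3 bv_nth)
  then show "lf2 c dvd rho2 \<theta>" using un kd by blast
qed

text \<open>If the three restrictions vanish, every component is divisible by \<open>X0\<close>; the
  quotient stays logarithmic because no form of \<open>A\<close> divides \<open>X0\<close>.\<close>

lemma kernel_restriction:
  "{\<theta> \<in> DA A d. rho0 \<theta> = 0 \<and> rho2 \<theta> = 0 \<and> rho1 \<theta> = 0} = (\<lambda>\<theta> i. X0 * \<theta> i) ` DA A (d - 1)"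
proof (intro set_eqI iffI)
  fix \<theta> assume "\<theta> \<in> {\<theta> \<in> DA A d. rho0 \<theta> = 0 \<and> rho2 \<theta> = 0 \<and> rho1 \<theta> = 0}"
  then have \<theta>: "\<theta> \<in> DA A d" "coeff (\<theta> 0) 0 = 0" "coeff (\<theta> 1) 0 = 0" "coeff (\<theta> 2) 0 = 0"
    by (auto simp: rho0_def rho1_def rho2_def)
  have "\<exists>q. \<theta> i = X0 * q" for i
  proof -
    have "coeff (\<theta> i) 0 = 0"
      using \<theta> by (cases "i \<ge> 3") (auto simp: DA_def Dmod_def not_le less_Suc_eq numeral_3_eq_3 numeral_2_eq_2)
    then show ?thesis unfolding X0_def by (metis dvdE poly_0_coeff_0 poly_eq_0_iff_dvd minus_zero)
  qed
  then obtain \<eta> where \<eta>: "\<And>i. \<theta> i = X0 * \<eta> i" by metis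
  have "lf a dvd dotS a \<eta>" if a: "a \<in> A" for a
  proof -
    have "lf a dvd X0 * dotS a \<eta>" using \<theta>(1) a \<eta> by (simp add: DA_def Dmod_def dotS_def algebra_simps)
    moreover have "\<not> lf a dvd X0"
    proof
      assume "lf a dvd X0"
      then have "lf a dvd lf (axis 1 1)" by (simp add: linear_form_def axis_def)
      moreover have "a \<noteq> 0" using simp_arr a by (simp add: simple_arr_def)
      ultimately obtain c where "axis 1 1 = c *\<^sub>R a" using lf_dvd_lf by blast
      then have "(1/c) *\<^sub>R (axis 1 1 :: real^3) = (1/c) *\<^sub>R (c *\<^sub>R a)" by simp
      moreover have "c \<noteq> 0" using \<open>axis 1 1 = c *\<^sub>R a\<close> by (auto simp: axis_eq_0_iff)
      ultimately have "a = (1/c) *\<^sub>R axis 1 1" by simp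
      then show False using not_axis[OF a] by blast
    qed
    moreover have "prime_elem (lf a)" using simp_arr a prime_lf by (auto simp: simple_arr_def)
    ultimately show ?thesis using prime_elem_dvd_multD by blast
  qed
  moreover have "\<eta> i = 0" if "i \<ge> 3" for i using \<eta>[of i] \<theta>(1) that X_nonzero by (simp add: DA_def Dmod_def)
  moreover have "homog (d - 1) (\<eta> i)" if "homog d (\<theta> i)" for i
    using homog_cancel[OF homog_X(1) X_nonzero(1), of "d - 1" "\<eta> i"] that \<eta>[of i] by (simp add: mult.commute)
  ultimately have "\<eta> \<in> DA A (d - 1)" using \<theta>(1) by (auto simp: DA_def Dmod_def Gr3_iff)
  then show "\<theta> \<in> (\<lambda>\<theta> i. X0 * \<theta> i) ` DA A (d - 1)" using \<eta> by (intro image_eqI[of _ _ \<eta>]) auto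
next
  fix \<theta> assume "\<theta> \<in> (\<lambda>\<theta> i. X0 * \<theta> i) ` DA A (d - 1)"
  then obtain \<eta> where \<eta>: "\<eta> \<in> DA A (d - 1)" "\<theta> = (\<lambda>i. X0 * \<eta> i)" by blast
  have "homog d (X0 * p)" if "homog (d - 1) p" for p using g3.h_mult'[OF homog_X(1) that] by simp
  then show "\<theta> \<in> {\<theta> \<in> DA A d. rho0 \<theta> = 0 \<and> rho2 \<theta> = 0 \<and> rho1 \<theta> = 0}"
  proof -
    have "\<forall>a\<in>A. lf a dvd dotS a \<theta>" using \<eta> by (simp add: DA_def Dmod_def dotS_scale)
    moreover have "rho0 \<theta> = 0" "rho1 \<theta> = 0" "rho2 \<theta> = 0"
      by (simp_all add: \<eta>(2) rho0_def rho1_def rho2_def X0_def)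
    ultimately show ?thesis using \<eta> \<open>\<And>p. homog (d - 1) p \<Longrightarrow> homog d (X0 * p)\<close> by (auto simp: DA_def Dmod_def Gr3_iff)
  qed
qed

text \<open>The successive images under \<open>rho0\<close>, \<open>rho2\<close>,
  \<open>rho1\<close> consist of multiples of \<open>B\<close>, \<open>Q\<close> and
  \<open>x1\<close>. A subspace \<open>V\<close> is allowed so that the chain serves both for
  \<open>A\<close> and for \<open>A\<close> with the line \<open>X0 = 0\<close> added.\<close>

lemma restriction_chain:
  assumes V: "V \<subseteq> DA A d" "subspace V" and ker: "{\<theta> \<in> DA A d. rho0 \<theta> = 0 \<and> rho2 \<theta> = 0 \<and> rho1 \<theta> = 0} \<subseteq> V"
  defines "V1 \<equiv> {\<theta> \<in> V. rho0 \<theta> = 0}"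
  shows "rho2 ` V1 \<subseteq> (*) Q ` {q. h2 (d + 1 - int (card C)) q}"
    "rho0 ` V \<subseteq> (*) B ` {q. h2 (d - (int (card A) - int (card C))) q}"
    "dim V \<le> dim (DA A (d - 1)) + nat d + dim (rho2 ` V1) + dim (rho0 ` V)"
proof -
  define V2 where "V2 = {\<theta> \<in> V1. rho2 \<theta> = 0}"
  have fV: "findim V" by (rule findim_subset[OF DA_space(2) V(1)])
  have s1: "subspace V1" unfolding V1_def by (rule subspace_kernel[OF linear_rho(1) V(2)])
  have s2: "subspace V2" unfolding V2_def by (rule subspace_kernel[OF linear_rho(3) s1])
  have f1: "findim V1" by (rule findim_subset[OF fV]) (auto simp: V1_def)
  have f2: "findim V2" by (rule findim_subset[OF f1]) (auto simp: V2_def)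
  have hd: "h2 d (coeff (\<theta> 0) 0)" "h2 d (coeff (\<theta> 1) 0)" "h2 d (coeff (\<theta> 2) 0)" "\<theta> \<in> Dmod A" if "\<theta> \<in> V" for \<theta>
    using that V(1) by (auto simp: DA_def Gr3_iff intro!: homog_coeff0)
  show im0: "rho0 ` V \<subseteq> (*) B ` {q. h2 (d - (int (card A) - int (card C))) q}"
  proof
    fix r assume "r \<in> rho0 ` V"
    then obtain \<theta> where \<theta>: "\<theta> \<in> V" "r = rho0 \<theta>" by blast
    obtain q where q: "r = B * q" using B_dvd_rho0[OF hd(4)[OF \<theta>(1)]] \<theta>(2) by (auto elim: dvdE)
    then have "h2 (d - (int (card A) - int (card C))) q"
      using h2_cancel[OF degrees(2,4)] hd(1)[OF \<theta>(1)] \<theta>(2) by (simp add: rho0_def)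
    then show "r \<in> (*) B ` {q. h2 (d - (int (card A) - int (card C))) q}" using q by blast
  qed
  show im2: "rho2 ` V1 \<subseteq> (*) Q ` {q. h2 (d + 1 - int (card C)) q}"
  proof
    fix r assume "r \<in> rho2 ` V1"
    then obtain \<theta> where \<theta>: "\<theta> \<in> V" "rho0 \<theta> = 0" "r = rho2 \<theta>" by (auto simp: V1_def)
    obtain q where q: "r = Q * q" using Q_dvd_rho2[OF hd(4)[OF \<theta>(1)] \<theta>(2)] \<theta>(3) by (auto elim: dvdE)
    have "h2 (d + 1) (rho2 \<theta>)" unfolding rho2_def
      by (intro g2.h_diff g2.h_mult'[OF h2_X(2) hd(2)[OF \<theta>(1)]] g2.h_mult'[OF h2_X(1) hd(3)[OF \<theta>(1)]]) auto
    then have "h2 (d + 1 - int (card C)) q" using h2_cancel[OF degrees(1,3)] \<theta>(3) q by simp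
    then show "r \<in> (*) Q ` {q. h2 (d + 1 - int (card C)) q}" using q by blast
  qed
  have im1: "rho1 ` V2 \<subseteq> (*) x1 ` {q. h2 (d - 1) q}"
  proof
    fix r assume "r \<in> rho1 ` V2"
    then obtain \<theta> where \<theta>: "\<theta> \<in> V" "rho2 \<theta> = 0" "r = rho1 \<theta>" by (auto simp: V1_def V2_def)
    have "x2 * r = x1 * coeff (\<theta> 2) 0" using \<theta>(2,3) by (simp only: rho2_def rho1_def right_minus_eq)
    then have "x1 dvd x2 * r" by (rule dvdI)
    moreover have "\<not> x1 dvd x2" using poly_eq_0_iff_dvd[of x2 0] by simp
    moreover have "prime_elem x1" using prime_elem_monic_linear[of "0 :: real poly"] by simp
    ultimately obtain q where q: "r = x1 * q" using prime_elem_dvd_multD by (metis dvdE)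
    then have "h2 (d - 1) q" using h2_cancel[OF h2_X(1), of d q] hd(2)[OF \<theta>(1)] \<theta>(3) by (simp add: rho1_def)
    then show "r \<in> (*) x1 ` {q. h2 (d - 1) q}" using q by blast
  qed
  have "{\<theta> \<in> V2. rho1 \<theta> = 0} = {\<theta> \<in> DA A d. rho0 \<theta> = 0 \<and> rho2 \<theta> = 0 \<and> rho1 \<theta> = 0}"
    using V(1) ker by (auto simp: V1_def V2_def)
  also have "dim \<dots> = dim (DA A (d - 1))" unfolding kernel_restriction
  proof (rule dim_image_inj[OF _ DA_space])
    show "linear (\<lambda>\<theta> i. X0 * \<theta> i)" by (rule linearI) (auto simp: fun_eq_iff distrib_left)
    show "x = 0" if "(\<lambda>i. X0 * x i) = 0" for x :: "nat \<Rightarrow> S3"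
      using that X_nonzero(1) by (auto simp: fun_eq_iff)
  qed
  finally have k3: "dim {\<theta> \<in> V2. rho1 \<theta> = 0} = dim (DA A (d - 1))" .
  have "dim V2 \<le> dim (DA A (d - 1)) + nat d"
    using dim_le_ker_im[OF linear_rho(2) s2 f2 dim_multiples(2) im1] dim_multiples(3)[of x1 "d - 1"] k3 by simp
  then show "dim V \<le> dim (DA A (d - 1)) + nat d + dim (rho2 ` V1) + dim (rho0 ` V)"
    using rank_nullity(1)[OF linear_rho(3) s1 f1] rank_nullity(1)[OF linear_rho(1) V(2) fV]
    by (simp add: V1_def[symmetric] V2_def[symmetric])
qed

end

section \<open>Growth of the Hilbert function from restriction to a line\<close>

text \<open>A derivation tangent to the line has \<open>rho0 = 0\<close>, so only the other two
  terms remain.\<close>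

lemma restrict_in_axis:
  assumes sa: "simple_arr A" and rep: "reps (axis 1 1) A C"
  shows "dim (DA (insert (axis 1 1) A) d) \<le> dim (DA A (d - 1)) + nat d + nat (d + 2 - int (card C))"
proof -
  interpret restriction A C using assms by unfold_locales
  let ?V = "DA (insert (axis 1 1) A) d"
  have sub: "?V \<subseteq> DA A d" by (auto simp: DA_def Dmod_def)
  have e1: "lf (axis 1 1) = X0" "dotS (axis 1 1) \<theta> = \<theta> 0" for \<theta>
    by (simp_all add: linear_form_def dotS_def axis_def)
  have X0: "X0 dvd p \<longleftrightarrow> coeff p 0 = 0" for p
    unfolding X0_def using poly_eq_0_iff_dvd[of p 0] by (simp add: poly_0_coeff_0)
  have ker: "{\<theta> \<in> DA A d. rho0 \<theta> = 0 \<and> rho2 \<theta> = 0 \<and> rho1 \<theta> = 0} \<subseteq> ?V"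
    by (auto simp: DA_def Dmod_def e1 X0 rho0_def)
  have z: "rho0 ` ?V \<subseteq> {0}" by (auto simp: DA_def Dmod_def e1 X0 rho0_def)
  note ch = restriction_chain[OF sub DA_space(1) ker]
  have "dim (rho2 ` {\<theta> \<in> ?V. rho0 \<theta> = 0}) \<le> nat (d + 2 - int (card C))"
    using dim_mono_findim[OF dim_multiples(2) ch(1)] dim_multiples(3)[of Q "d + 1 - int (card C)"] by simp
  then show ?thesis using ch(3) dim_zero_set[OF z] by simp
qed

text \<open>At \<open>d = m - n\<close> the bound for the image of \<open>rho0\<close> is 1, and at
  \<open>d = n - 1\<close> the bound for the image of \<open>rho2\<close> is 1, so equality in these
  degrees forces a nonzero restriction.\<close>

lemma restrict_out_axis:
  fixes A C :: "(real^3) set"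
  assumes sa: "simple_arr A" and rep: "reps (axis 1 1) A C"
  defines "n \<equiv> int (card C)" and "m \<equiv> int (card A)"
  shows "dim (DA A d) \<le> dim (DA A (d - 1)) + nat d + nat (d + 2 - n) + nat (d + 1 - (m - n))" (is ?le)
    and "dim (DA A d) = dim (DA A (d - 1)) + nat d + nat (d + 2 - n) + nat (d + 1 - (m - n)) \<Longrightarrow> d = m - n \<Longrightarrow>
      \<exists>t\<in>DA A d. rho0 t \<noteq> 0"
    and "dim (DA A d) = dim (DA A (d - 1)) + nat d + nat (d + 2 - n) + nat (d + 1 - (m - n)) \<Longrightarrow> d = n - 1 \<Longrightarrow>
      \<exists>s\<in>DA A d. rho0 s = 0 \<and> rho2 s \<noteq> 0"
proof -
  interpret restriction A C using assms by unfold_locales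
  let ?V = "DA A d"
  note ch = restriction_chain[OF order_refl DA_space(1), of d, OF Collect_restrict]
  have 2: "dim (rho2 ` {\<theta> \<in> ?V. rho0 \<theta> = 0}) \<le> nat (d + 2 - n)"
    using dim_mono_findim[OF dim_multiples(2) ch(1)] dim_multiples(3)[of Q "d + 1 - int (card C)"] by (simp add: n_def)
  have 0: "dim (rho0 ` ?V) \<le> nat (d + 1 - (m - n))"
    using dim_mono_findim[OF dim_multiples(2) ch(2)] dim_multiples(3)[of B "d - (m - n)"] by (simp add: n_def m_def algebra_simps)
  show ?le using ch(3) 0 2 by linarith
  assume eq: "dim (DA A d) = dim (DA A (d - 1)) + nat d + nat (d + 2 - n) + nat (d + 1 - (m - n))"
  show "\<exists>t\<in>DA A d. rho0 t \<noteq> 0" if "d = m - n"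
  proof (rule ccontr)
    assume "\<not> ?thesis"
    then have "rho0 ` ?V \<subseteq> {0}" by auto
    then show False using dim_zero_set[of "rho0 ` ?V"] ch(3) 2 eq that by simp
  qed
  show "\<exists>s\<in>DA A d. rho0 s = 0 \<and> rho2 s \<noteq> 0" if "d = n - 1"
  proof (rule ccontr)
    assume "\<not> ?thesis"
    then have "rho2 ` {\<theta> \<in> ?V. rho0 \<theta> = 0} \<subseteq> {0}" by auto
    then show False using dim_zero_set[of "rho2 ` {\<theta> \<in> ?V. rho0 \<theta> = 0}"] ch(3) 0 eq that by simp
  qed
qed

section \<open>Determinants of derivations, and rotation of an arbitrary line to X0 = 0\<close>

definition detS :: "(nat \<Rightarrow> S3) \<Rightarrow> (nat \<Rightarrow> S3) \<Rightarrow> (nat \<Rightarrow> S3) \<Rightarrow> S3" where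
  "detS u v w = u 0 * (v 1 * w 2 - v 2 * w 1) - u 1 * (v 0 * w 2 - v 2 * w 0) + u 2 * (v 0 * w 1 - v 1 * w 0)"

definition Eul :: "nat \<Rightarrow> S3" where
  "Eul i = (if i = 0 then X0 else if i = 1 then X1 else if i = 2 then X2 else 0)"

text \<open>On \<open>X0 = 0\<close> the first components of \<open>Eul\<close> and \<open>s\<close>
  vanish, and the determinant becomes \<open>rho0 t * rho2 s\<close> up to sign.\<close>

lemma detS_restrict:
  assumes "rho0 s = 0" "rho2 s \<noteq> 0" "rho0 t \<noteq> 0"
  shows "detS Eul s t \<noteq> 0"
proof
  assume z: "detS Eul s t = 0"
  have "coeff (detS Eul s t) 0 = - (rho0 t * rho2 s)"
    using assms(1) by (simp add: detS_def Eul_def coeff0_mult X0_def X1_def X2_def rho0_def rho2_def algebra_simps)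
  then show False using z assms by simp
qed

lemma dotS_axis: "dotS (axis 1 1) \<eta> = \<eta> 0" "dotS (axis 2 1) \<eta> = \<eta> 1" "dotS (axis 3 1) \<eta> = \<eta> 2"
  by (simp_all add: dotS_def axis_def)

lemma Tg_Eul: assumes g: "orthogonal_matrix g" shows "Tg g Eul = Eul"
proof -
  have dE: "dotS a Eul = lf a" for a by (simp add: dotS_def Eul_def linear_form_def)
  have D: "dotS b (Tg g Eul) = lf b" for b
    using dotS_Tg[OF g, of "b v* transpose g" Eul] vmul_orth(2)[OF g, of b] by (simp add: dE sg_lf)
  have D': "dotS b (Tg g Eul) = dotS b Eul" for b by (simp add: D dE)
  show ?thesis
  proof
    fix i :: nat
    consider "i = 0" | "i = 1" | "i = 2" | "i \<ge> 3" by linarith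
    then show "Tg g Eul i = Eul i"
      using D'[of "axis 1 1"] D'[of "axis 2 1"] D'[of "axis 3 1"] unfolding dotS_axis by cases (auto simp: Tg_def Eul_def)
  qed
qed

definition matS :: "(nat \<Rightarrow> S3) \<Rightarrow> (nat \<Rightarrow> S3) \<Rightarrow> (nat \<Rightarrow> S3) \<Rightarrow> S3^3^3" where
  "matS u v w = (\<chi> i j. (if j = 1 then u else if j = 2 then v else w) (if i = 1 then 0 else if i = 2 then 1 else 2))"

lemma det_matS: "det (matS u v w) = detS u v w"
  by (simp add: det_3 matS_def detS_def algebra_simps)

lemma sg_detS: "sg g (detS u v w) = detS (sg g \<circ> u) (sg g \<circ> v) (sg g \<circ> w)"
  by (simp add: detS_def sg_simps sg_diff)

lemma detS_Tg: "detS (Tg g u) (Tg g v) (Tg g w) = det (\<chi> i j. cst ((g $ j) $ i) :: S3^3^3) * sg g (detS u v w)"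
proof -
  have "matS (Tg g u) (Tg g v) (Tg g w) = (\<chi> i j. cst ((g $ j) $ i)) ** matS (sg g \<circ> u) (sg g \<circ> v) (sg g \<circ> w)"
    by (simp add: vec_eq_iff forall_3 matS_def matrix_matrix_mult_def sum_3 Tg_def dotS_def transpose_def)
  then show ?thesis by (simp add: det_matS[symmetric] det_mul sg_detS[folded det_matS])
qed

lemma detS_Tg_nonzero:
  assumes g: "orthogonal_matrix g" and nz: "detS u v w \<noteq> 0"
  shows "detS (Tg g u) (Tg g v) (Tg g w) \<noteq> 0"
proof -
  have "det (\<chi> i j. cst ((g $ j) $ i) :: S3^3^3) = cst (det (transpose g))"
    by (simp add: det_3 transpose_def)
  moreover have "det (transpose g) \<noteq> 0" using det_orthogonal_matrix[of "transpose g"] g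
    by (auto simp: orthogonal_matrix_transpose)
  moreover have "sg g (detS u v w) \<noteq> 0" using sg_inverse[OF g, of "detS u v w"] nz sg_simps(4) by metis
  ultimately show ?thesis unfolding detS_Tg by simp
qed

lemma rotate_to_axis:
  fixes h :: "real^3"
  assumes "h \<noteq> 0"
  obtains g r where "orthogonal_matrix g" "r \<noteq> 0" "h v* g = r *\<^sub>R axis 1 1"
proof -
  obtain g where g: "orthogonal_matrix g" "g *v axis 1 1 = (1 / norm h) *\<^sub>R h"
    using orthogonal_matrix_exists_basis[of "(1 / norm h) *\<^sub>R h" 1] assms by auto
  have "transpose g *v (g *v axis 1 1) = axis 1 1"
    using g(1) by (simp add: matrix_vector_mul_assoc orthogonal_matrix_def)
  then have "(1 / norm h) *\<^sub>R (h v* g) = axis 1 1"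
    using g(2) by (simp add: matrix_vector_mult_scaleR)
  then have "norm h *\<^sub>R ((1 / norm h) *\<^sub>R (h v* g)) = norm h *\<^sub>R axis 1 1" by simp
  then have "h v* g = norm h *\<^sub>R axis 1 1" using assms by simp
  then show thesis using that[OF g(1), of "norm h"] assms by simp
qed

lemma vmul_scale: "(c *\<^sub>R (a :: real^3)) v* g = c *\<^sub>R (a v* g)"
  by (simp add: vec_eq_iff vector_matrix_mult_def sum_distrib_left algebra_simps)

lemma simple_arr_orth:
  assumes g: "orthogonal_matrix g" and A: "simple_arr A"
  shows "simple_arr ((\<lambda>a. a v* g) ` A)" "inj_on (\<lambda>a. a v* g) A"
proof -
  have inj: "a v* g = b v* g \<Longrightarrow> a = b" for a b using vmul_orth(1)[OF g] by metis
  then show "inj_on (\<lambda>a. a v* g) A" by (auto intro: inj_onI)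
  have "c *\<^sub>R (a v* g) = (c *\<^sub>R a) v* g" for c a by (simp add: vmul_scale)
  note sc = this
  have z: "(0 :: real^3) v* g = 0" by simp
  show "simple_arr ((\<lambda>a. a v* g) ` A)"
    unfolding simple_arr_def
  proof (intro conjI ballI allI impI)
    show "finite ((\<lambda>a. a v* g) ` A)" using A by (simp add: simple_arr_def)
    fix a assume "a \<in> (\<lambda>a. a v* g) ` A"
    then obtain a' where a: "a' \<in> A" "a = a' v* g" by blast
    then show "a \<noteq> 0" using inj[of a' 0] z A unfolding simple_arr_def by auto
    fix b c assume "b \<in> (\<lambda>a. a v* g) ` A" "a \<noteq> b"
    then obtain b' where b: "b' \<in> A" "b = b' v* g" "a' \<noteq> b'" using a by blast
    show "b \<noteq> c *\<^sub>R a"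
    proof
      assume "b = c *\<^sub>R a"
      then have "b' = c *\<^sub>R a'" using a b sc inj by metis
      then show False using A a b unfolding simple_arr_def by blast
    qed
  qed
qed

lemma reps_orth:
  assumes g: "orthogonal_matrix g" and r: "r \<noteq> 0" "h v* g = r *\<^sub>R axis 1 1" and rep: "reps h A C"
  shows "reps (axis 1 1) ((\<lambda>a. a v* g) ` A) ((\<lambda>a. a v* g) ` C)"
proof -
  have inj: "a v* g = b v* g \<Longrightarrow> a = b" for a b using vmul_orth(1)[OF g] by metis
  have lin: "(s *\<^sub>R c + t *\<^sub>R h) v* g = s *\<^sub>R (c v* g) + (t * r) *\<^sub>R axis 1 1" for s t c
    by (simp add: vector_matrix_left_distrib vmul_scale r(2))
  have tr: "t * r = u" if "t = u / r" for t u using that r(1) by simp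
  show ?thesis
    unfolding reps_def
  proof (intro conjI ballI allI impI)
    show "(\<lambda>a. a v* g) ` C \<subseteq> (\<lambda>a. a v* g) ` A" using rep by (auto simp: reps_def)
    fix a assume "a \<in> (\<lambda>a. a v* g) ` A"
    then obtain b where b: "b \<in> A" "a = b v* g" by blast
    then obtain c s t where c: "c \<in> C" "b = s *\<^sub>R c + t *\<^sub>R h" using rep unfolding reps_def by blast
    then have "a = s *\<^sub>R (c v* g) + (t * r) *\<^sub>R axis 1 1" using b lin by simp
    then show "\<exists>c\<in>(\<lambda>a. a v* g) ` C. \<exists>s t. a = s *\<^sub>R c + t *\<^sub>R axis 1 1" using c(1) by blast
    show "a \<noteq> t *\<^sub>R axis 1 1" for t
    proof
      assume "a = t *\<^sub>R axis 1 1"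
      then have "b v* g = (0 *\<^sub>R h + (t / r) *\<^sub>R h) v* g" unfolding lin using b r by simp
      then have "b = (t / r) *\<^sub>R h" using inj by force
      then show False using rep b unfolding reps_def by blast
    qed
  next
    fix c c' s t assume "c \<in> (\<lambda>a. a v* g) ` C" "c' \<in> (\<lambda>a. a v* g) ` C" "c \<noteq> c'"
    then obtain b b' where b: "b \<in> C" "b' \<in> C" "b \<noteq> b'" "c = b v* g" "c' = b' v* g" by blast
    show "c \<noteq> s *\<^sub>R c' + t *\<^sub>R axis 1 1"
    proof
      assume "c = s *\<^sub>R c' + t *\<^sub>R axis 1 1"
      then have "b v* g = (s *\<^sub>R b' + (t / r) *\<^sub>R h) v* g" unfolding lin using b r by simp
      then have "b = s *\<^sub>R b' + (t / r) *\<^sub>R h" using inj by blast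
      then show False using rep b unfolding reps_def by blast
    qed
  qed
qed

text \<open>Rotation takes \<open>h\<close> only to a multiple of the first axis; the derivations do
  not see the factor.\<close>

lemma DA_cong_scale:
  assumes "r \<noteq> 0"
  shows "DA (insert (r *\<^sub>R a) A) d = DA (insert a A) d"
proof -
  have "lf (r *\<^sub>R a) dvd dotS (r *\<^sub>R a) \<theta> \<longleftrightarrow> lf a dvd dotS a \<theta>" for \<theta>
  proof -
    have "dotS (r *\<^sub>R a) \<theta> = cst r * dotS a \<theta>" by (simp add: dotS_def algebra_simps)
    moreover have "cst r \<noteq> 0" using assms by simp
    ultimately show ?thesis by (simp add: lf_scale)
  qed
  then show ?thesis by (auto simp: DA_def Dmod_def)
qed

theorem restrict_in:
  assumes sa: "simple_arr A" and h: "h \<noteq> 0" and rep: "reps h A C"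
  shows "dim (DA (insert h A) d) \<le> dim (DA A (d - 1)) + nat d + nat (d + 2 - int (card C))"
proof -
  obtain g r where g: "orthogonal_matrix g" "r \<noteq> 0" "h v* g = r *\<^sub>R axis 1 1" using rotate_to_axis[OF h] .
  have CA: "C \<subseteq> A" using rep by (simp add: reps_def)
  have "card ((\<lambda>a. a v* g) ` C) = card C" using simple_arr_orth(2)[OF g(1) sa] CA by (meson card_image inj_on_subset)
  moreover have "(\<lambda>a. a v* g) ` insert h A = insert (r *\<^sub>R axis 1 1) ((\<lambda>a. a v* g) ` A)" using g(3) by simp
  ultimately show ?thesis
    using restrict_in_axis[OF simple_arr_orth(1)[OF g(1) sa] reps_orth[OF g rep], of d]
    by (metis DA_cong_scale[OF g(2)] dim_DA_orth[OF g(1)])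
qed

text \<open>The Euler derivation is invariant under rotation, so the nonzero determinant with
  \<open>Eul\<close> found on \<open>X0 = 0\<close> can be carried back.\<close>

theorem restrict_out:
  assumes sa: "simple_arr A" and h: "h \<noteq> 0" and rep: "reps h A C"
  defines "n \<equiv> int (card C)" and "m \<equiv> int (card A)"
  shows "dim (DA A d) \<le> dim (DA A (d - 1)) + nat d + nat (d + 2 - n) + nat (d + 1 - (m - n))"
    and "(\<And>d. dim (DA A d) = dim (DA A (d - 1)) + nat d + nat (d + 2 - n) + nat (d + 1 - (m - n))) \<Longrightarrow>
      \<exists>s\<in>DA A (n - 1). \<exists>t\<in>DA A (m - n). detS Eul s t \<noteq> 0"
proof -
  obtain g r where g: "orthogonal_matrix g" "r \<noteq> 0" "h v* g = r *\<^sub>R axis 1 1" using rotate_to_axis[OF h] .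
  let ?A = "(\<lambda>a. a v* g) ` A" and ?C = "(\<lambda>a. a v* g) ` C"
  have CA: "C \<subseteq> A" using rep by (simp add: reps_def)
  have cC: "card ?C = card C" using simple_arr_orth(2)[OF g(1) sa] CA by (meson card_image inj_on_subset)
  have cA: "card ?A = card A" using simple_arr_orth(2)[OF g(1) sa] by (rule card_image)
  note R = restrict_out_axis[OF simple_arr_orth(1)[OF g(1) sa] reps_orth[OF g rep], unfolded cC cA dim_DA_orth[OF g(1)], folded n_def m_def]
  show "dim (DA A d) \<le> dim (DA A (d - 1)) + nat d + nat (d + 2 - n) + nat (d + 1 - (m - n))" by (rule R(1))
  assume eq: "\<And>d. dim (DA A d) = dim (DA A (d - 1)) + nat d + nat (d + 2 - n) + nat (d + 1 - (m - n))"
  obtain t where t: "t \<in> DA ?A (m - n)" "rho0 t \<noteq> 0" using R(2)[OF eq refl] by blast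
  obtain s where s: "s \<in> DA ?A (n - 1)" "rho0 s = 0" "rho2 s \<noteq> 0" using R(3)[OF eq refl] by blast
  have g': "orthogonal_matrix (transpose g)" using g(1) by (simp add: orthogonal_matrix_transpose)
  have "(\<lambda>a. a v* transpose g) ` ?A = A" using vmul_orth(1)[OF g(1)] by (simp add: image_image)
  then have "Tg (transpose g) s \<in> DA A (n - 1)" "Tg (transpose g) t \<in> DA A (m - n)"
    using Tg_DA[OF g' s(1)] Tg_DA[OF g' t(1)] by simp_all
  moreover have "detS Eul (Tg (transpose g) s) (Tg (transpose g) t) \<noteq> 0"
    using detS_Tg_nonzero[OF g' detS_restrict[OF s(2,3) t(2)]] by (simp add: Tg_Eul[OF g'])
  ultimately show "\<exists>s\<in>DA A (n - 1). \<exists>t\<in>DA A (m - n). detS Eul s t \<noteq> 0" by blast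
qed

section \<open>Ungar's theorem on the number of directions\<close>

text \<open>A sequence of permutations from an order of \<open>P\<close> to its reverse: \<open>bef i\<close> is the order after
  \<open>i\<close> moves, and \<open>r p q\<close> is the number of the move that exchanges \<open>p\<close> and \<open>q\<close>. A move reverses
  disjoint intervals; it is a crossing if one of them contains the middle.\<close>

locale allowable =
  fixes P :: "'p set" and M D :: nat and bef :: "nat \<Rightarrow> 'p \<Rightarrow> 'p \<Rightarrow> bool" and r :: "'p \<Rightarrow> 'p \<Rightarrow> nat"
  assumes finP: "finite P" and cardP: "card P = 2 * M"
    and irrefl: "\<not> bef i p p"
    and trans: "i \<le> D \<Longrightarrow> p \<in> P \<Longrightarrow> q \<in> P \<Longrightarrow> u \<in> P \<Longrightarrow> bef i p q \<Longrightarrow> bef i q u \<Longrightarrow> bef i p u"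
    and total: "i \<le> D \<Longrightarrow> p \<in> P \<Longrightarrow> q \<in> P \<Longrightarrow> p \<noteq> q \<Longrightarrow> bef i p q \<or> bef i q p"
    and r_sym: "r p q = r q p"
    and r_range: "p \<in> P \<Longrightarrow> q \<in> P \<Longrightarrow> p \<noteq> q \<Longrightarrow> 1 \<le> r p q \<and> r p q \<le> D"
    and flip: "i \<le> D \<Longrightarrow> p \<in> P \<Longrightarrow> q \<in> P \<Longrightarrow> p \<noteq> q \<Longrightarrow> bef i p q \<longleftrightarrow> (bef 0 p q \<longleftrightarrow> i < r p q)"
    and r_trans: "p \<in> P \<Longrightarrow> q \<in> P \<Longrightarrow> u \<in> P \<Longrightarrow> p \<noteq> q \<Longrightarrow> q \<noteq> u \<Longrightarrow> p \<noteq> u \<Longrightarrow> r p q = r q u \<Longrightarrow> r p u = r p q"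
begin

lemma asym: "i \<le> D \<Longrightarrow> p \<in> P \<Longrightarrow> q \<in> P \<Longrightarrow> bef i p q \<Longrightarrow> \<not> bef i q p"
  using trans[of i p q p] irrefl by blast

lemma not_bef: "i \<le> D \<Longrightarrow> p \<in> P \<Longrightarrow> q \<in> P \<Longrightarrow> p \<noteq> q \<Longrightarrow> \<not> bef i p q \<longleftrightarrow> bef i q p"
  using asym total by blast

lemma change: "i \<ge> 1 \<Longrightarrow> i \<le> D \<Longrightarrow> p \<in> P \<Longrightarrow> q \<in> P \<Longrightarrow> p \<noteq> q \<Longrightarrow> (bef (i - 1) p q \<longleftrightarrow> bef i p q) \<longleftrightarrow> r p q \<noteq> i"
  using flip[of i p q] flip[of "i - 1" p q] by auto

definition pos :: "nat \<Rightarrow> 'p \<Rightarrow> nat" where "pos i p = card {q \<in> P. bef i q p}"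

lemma pos_less: "i \<le> D \<Longrightarrow> p \<in> P \<Longrightarrow> q \<in> P \<Longrightarrow> bef i p q \<Longrightarrow> pos i p < pos i q"
proof -
  assume a: "i \<le> D" "p \<in> P" "q \<in> P" "bef i p q"
  have "{u \<in> P. bef i u p} \<subseteq> {u \<in> P. bef i u q}" using trans[OF a(1) _ a(2,3) _ a(4)] by blast
  moreover have "p \<in> {u \<in> P. bef i u q}" "p \<notin> {u \<in> P. bef i u p}" using a irrefl by auto
  ultimately have "{u \<in> P. bef i u p} \<subset> {u \<in> P. bef i u q}" by blast
  then show ?thesis unfolding pos_def using finP by (intro psubset_card_mono) auto
qed

lemma pos_iff: "i \<le> D \<Longrightarrow> p \<in> P \<Longrightarrow> q \<in> P \<Longrightarrow> pos i p < pos i q \<longleftrightarrow> bef i p q"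
  using pos_less total by (metis less_asym less_irrefl)

lemma pos_inj: "i \<le> D \<Longrightarrow> inj_on (pos i) P"
  by (rule inj_onI) (metis less_irrefl pos_less total)

lemma pos_bound: "p \<in> P \<Longrightarrow> pos i p < 2 * M"
proof -
  assume p: "p \<in> P"
  have "{q \<in> P. bef i q p} \<subset> P" using p irrefl by blast
  then show ?thesis unfolding pos_def cardP[symmetric] by (intro psubset_card_mono finP)
qed

lemma pos_bij: "i \<le> D \<Longrightarrow> bij_betw (pos i) P {..<2 * M}"
proof -
  assume i: "i \<le> D"
  have "pos i ` P \<subseteq> {..<2 * M}" using pos_bound by auto
  moreover have "card (pos i ` P) = card {..<2 * M}" using card_image[OF pos_inj[OF i]] cardP by simp
  ultimately have "pos i ` P = {..<2 * M}" by (intro card_subset_eq) auto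
  then show ?thesis using pos_inj[OF i] by (simp add: bij_betw_def)
qed

definition elt :: "nat \<Rightarrow> nat \<Rightarrow> 'p" where "elt i = inv_into P (pos i)"

lemma elt: "i \<le> D \<Longrightarrow> k < 2 * M \<Longrightarrow> elt i k \<in> P \<and> pos i (elt i k) = k"
proof -
  assume i: "i \<le> D" and k: "k < 2 * M"
  then have k': "k \<in> pos i ` P" using pos_bij[OF i] by (simp add: bij_betw_def)
  show ?thesis unfolding elt_def using inv_into_into[OF k'] f_inv_into_f[OF k'] by blast
qed

lemma elt_pos: "i \<le> D \<Longrightarrow> p \<in> P \<Longrightarrow> elt i (pos i p) = p"
  using pos_inj by (simp add: elt_def)

lemma elt_neq: "i \<le> D \<Longrightarrow> k < 2 * M \<Longrightarrow> l < 2 * M \<Longrightarrow> k \<noteq> l \<Longrightarrow> elt i k \<noteq> elt i l"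
  using elt by metis

text \<open>On the other side of the move \<open>p\<close> and \<open>q\<close> stand in the
  opposite order, so an element between them must be exchanged with one of the two, and by
  \<open>r_trans\<close> with both.\<close>

lemma contiguous:
  assumes i: "1 \<le> i" "i \<le> D" and t: "t = i - 1 \<or> t = i" and P: "p \<in> P" "w \<in> P" "q \<in> P"
    and b: "bef t p w" "bef t w q" and rr: "r p q = i"
  shows "r p w = i \<and> r w q = i"
proof -
  have tD: "t \<le> D" using t i by auto
  have ne: "p \<noteq> w" "w \<noteq> q" "p \<noteq> q"
    using b irrefl asym[OF tD P(1,2)] by auto
  define t' where "t' = (if t = i then i - 1 else i)"
  have t'D: "t' \<le> D" using i by (auto simp: t'_def)
  have ch: "(bef t x y \<longleftrightarrow> bef t' x y) \<longleftrightarrow> r x y \<noteq> i" if "x \<in> P" "y \<in> P" "x \<noteq> y" for x y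
    using change[OF i that] t by (auto simp: t'_def)
  have pq: "bef t p q" using trans[OF tD P(1) P(2) P(3) b] .
  then have qp: "bef t' q p" using ch[OF P(1,3) ne(3)] rr not_bef[OF t'D P(1,3) ne(3)] by blast
  have pw: "r p w = i"
  proof (rule ccontr)
    assume n: "r p w \<noteq> i"
    then have "bef t' p w" using ch[OF P(1,2) ne(1)] b by blast
    then have "bef t' q w" using trans[OF t'D P(3) P(1) P(2) qp] by blast
    then have "r w q = i" using ch[OF P(2,3) ne(2)] b(2) asym[OF t'D P(3,2)] by blast
    then have "r p w = r p q" using r_trans[OF P(1) P(3) P(2)] ne rr r_sym by metis
    then show False using n rr by simp
  qed
  have "r w q = r w p" by (rule r_trans[OF P(2) P(1) P(3)]) (use ne pw rr r_sym in auto)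
  then show ?thesis using pw r_sym by metis
qed

text \<open>By \<open>contiguous\<close>, an element that moves is exchanged with an immediate
  neighbour; this lets the local conditions \<open>Inc\<close> and \<open>Dec\<close> detect
  moves.\<close>

lemma neighbour:
  assumes i: "1 \<le> i" "i \<le> D" and t: "t = i - 1 \<or> t = i" and P: "p \<in> P" "q \<in> P" "p \<noteq> q" and rr: "r p q = i"
  shows "\<exists>k. k < 2 * M \<and> (k = pos t p + 1 \<or> k + 1 = pos t p) \<and> r p (elt t k) = i"
proof -
  have tD: "t \<le> D" using t i by auto
  show ?thesis
  proof (cases "bef t p q")
    case True
    let ?k = "pos t p + 1"
    have pq: "pos t p < pos t q" using pos_less[OF tD P(1,2) True] .
    then have k: "?k < 2 * M" using pos_bound[OF P(2), of t] by simp
    have "r p (elt t ?k) = i"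
    proof (cases "?k = pos t q")
      case True
      then show ?thesis using elt_pos[OF tD P(2)] rr by simp
    next
      case False
      then have "bef t p (elt t ?k)" "bef t (elt t ?k) q"
        using elt[OF tD k] pq pos_iff[OF tD] P by (metis less_add_one, metis (no_types, lifting) Suc_eq_plus1 Suc_lessI)
      then show ?thesis using contiguous[OF i t P(1) _ P(2) _ _ rr] elt[OF tD k] by blast
    qed
    then show ?thesis using k by blast
  next
    case False
    then have qb: "bef t q p" using total[OF tD P] by blast
    let ?k = "pos t p - 1"
    have pq: "pos t q < pos t p" using pos_less[OF tD P(2,1) qb] .
    then have k: "?k < 2 * M" "?k + 1 = pos t p" using pos_bound[OF P(1), of t] by simp_all
    have "r p (elt t ?k) = i"
    proof (cases "?k = pos t q")
      case True
      then show ?thesis using elt_pos[OF tD P(2)] rr by simp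
    next
      case False
      have e: "elt t ?k \<in> P" "pos t (elt t ?k) = ?k" using elt[OF tD k(1)] by auto
      have "pos t q < pos t (elt t ?k)" "pos t (elt t ?k) < pos t p" using False pq k(2) e(2) by linarith+
      then have "bef t q (elt t ?k)" "bef t (elt t ?k) p" using pos_iff[OF tD] P e by blast+
      then show ?thesis using contiguous[OF i t P(2) e(1) P(1)] rr r_sym by metis
    qed
    then show ?thesis using k by blast
  qed
qed

lemma unmoved:
  assumes i: "1 \<le> i" "i \<le> D" and p: "p \<in> P" and no: "\<And>q. q \<in> P \<Longrightarrow> q \<noteq> p \<Longrightarrow> r p q \<noteq> i"
  shows "pos i p = pos (i - 1) p"
proof -
  have "bef i q p \<longleftrightarrow> bef (i - 1) q p" if "q \<in> P" for q
    using change[OF i that p] no[OF that] r_sym irrefl by (cases "q = p") auto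
  then show ?thesis unfolding pos_def by (metis (no_types, lifting))
qed

text \<open>\<open>Inc s i d\<close> and \<open>Dec s i d\<close>: the \<open>2 d\<close> central elements at time \<open>i\<close> appear in the order,
  respectively in the reversed order, that they have at time \<open>s\<close>.\<close>

definition Inc :: "nat \<Rightarrow> nat \<Rightarrow> nat \<Rightarrow> bool" where
  "Inc s i d \<longleftrightarrow> (\<forall>k. M \<le> k + d \<and> k + 1 < M + d \<longrightarrow> bef s (elt i k) (elt i (k + 1)))"

definition Dec :: "nat \<Rightarrow> nat \<Rightarrow> nat \<Rightarrow> bool" where
  "Dec s i d \<longleftrightarrow> (\<forall>k. M \<le> k + d \<and> k + 1 < M + d \<longrightarrow> bef s (elt i (k + 1)) (elt i k))"

lemma Inc_mono: "Inc s i d \<Longrightarrow> d' \<le> d \<Longrightarrow> Inc s i d'" and Dec_mono: "Dec s i d \<Longrightarrow> d' \<le> d \<Longrightarrow> Dec s i d'"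
  by (auto simp: Inc_def Dec_def)

lemma Inc_D: "Inc s i d \<Longrightarrow> M \<le> k + d \<Longrightarrow> k + 1 < M + d \<Longrightarrow> bef s (elt i k) (elt i (k + 1))"
  unfolding Inc_def by blast

lemma Dec_D: "Dec s i d \<Longrightarrow> M \<le> k + d \<Longrightarrow> k + 1 < M + d \<Longrightarrow> bef s (elt i (k + 1)) (elt i k)"
  unfolding Dec_def by blast

lemma Inc_Dec: "Inc s i d \<Longrightarrow> Dec s i d' \<Longrightarrow> 1 \<le> d \<Longrightarrow> 1 \<le> d' \<Longrightarrow> d \<le> M \<Longrightarrow> s \<le> D \<Longrightarrow> i \<le> D \<Longrightarrow> False"
proof -
  assume *: "Inc s i d" "Dec s i d'" "1 \<le> d" "1 \<le> d'" "d \<le> M" "s \<le> D" "i \<le> D"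
  have "bef s (elt i (M - 1)) (elt i (M - 1 + 1))" by (rule Inc_D[OF *(1)]) (use *(3,5) in linarith)+
  moreover have "bef s (elt i (M - 1 + 1)) (elt i (M - 1))" by (rule Dec_D[OF *(2)]) (use *(3,4,5) in linarith)+
  moreover have "elt i (M - 1) \<in> P" "elt i (M - 1 + 1) \<in> P" using elt[OF *(7)] *(3,5) by auto
  ultimately show False using asym[OF *(6)] by blast
qed

text \<open>Each pair is exchanged exactly once, so until its move it stands as at the earlier time
  \<open>s\<close>.\<close>

lemma pair_order:
  assumes i: "s < i" "i \<le> D" and P: "p \<in> P" "q \<in> P" "p \<noteq> q" and rr: "r p q = i"
  shows "bef (i - 1) p q \<longleftrightarrow> bef s p q" "bef i p q \<longleftrightarrow> \<not> bef s p q"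
  using flip[of "i - 1" p q] flip[of i p q] flip[of s p q] i P rr by auto

text \<open>A move after time \<open>s\<close> exchanges only pairs that still have their order at
  \<open>s\<close>. An interior element of a decreasing centre has already been exchanged with both
  neighbours and cannot move; the increasing case is the same, seen from after the move.\<close>

lemma interior_unmoved:
  assumes i: "s < i" "i \<le> D" and t: "t = i - 1 \<and> Dec s t d \<or> t = i \<and> Inc s t d" and d: "d \<le> M"
    and k: "M < k + d" "k + 1 < M + d"
  shows "elt i k = elt (i - 1) k"
proof -
  have i1: "1 \<le> i" using i by simp
  have tD: "t \<le> D" "t = i - 1 \<or> t = i" using t i by auto
  have k2: "k < 2 * M" using k d by linarith
  let ?p = "elt t k"
  have p: "?p \<in> P" "pos t ?p = k" using elt[OF tD(1) k2] by auto
  have "r ?p q \<noteq> i" if q: "q \<in> P" "q \<noteq> ?p" for q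
  proof
    assume "r ?p q = i"
    then obtain l where l: "l < 2 * M" "l = k + 1 \<or> l + 1 = k" "r ?p (elt t l) = i"
      using neighbour[OF i1 i(2) tD(2) p(1) q(1)] q(2) p(2) by auto
    have lP: "elt t l \<in> P" "pos t (elt t l) = l" using elt[OF tD(1) l(1)] by auto
    have ne: "?p \<noteq> elt t l" using p(2) lP(2) l(2) by auto
    have lk: "bef t ?p (elt t l) \<longleftrightarrow> k < l" "bef t (elt t l) ?p \<longleftrightarrow> l < k"
      using pos_iff[OF tD(1)] p lP by metis+
    note po = pair_order[OF i p(1) lP(1) ne l(3)]
    have po': "bef (i - 1) (elt t l) ?p \<longleftrightarrow> bef s (elt t l) ?p" "bef i (elt t l) ?p \<longleftrightarrow> \<not> bef s (elt t l) ?p"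
      using pair_order[OF i lP(1) p(1) ne[symmetric]] l(3) r_sym by metis+
    show False using t
    proof
      assume T: "t = i - 1 \<and> Dec s t d"
      show False using l(2)
      proof
        assume "l = k + 1"
        then have "bef s (elt t l) ?p" using T k d unfolding Dec_def by auto
        moreover have "bef s ?p (elt t l)" using po(1) lk(1) T \<open>l = k + 1\<close> by auto
        ultimately show False using asym[of s ?p "elt t l"] p lP i by auto
      next
        assume l': "l + 1 = k"
        then have "bef s (elt t (l + 1)) (elt t l)" using T k d unfolding Dec_def by auto
        moreover have "bef s (elt t l) ?p" using po'(1) lk(2) T l' by auto
        ultimately show False using asym[of s ?p "elt t l"] p lP i l' by auto
      qed
    next
      assume T: "t = i \<and> Inc s t d"
      show False using l(2)
      proof
        assume "l = k + 1"
        then have "bef s ?p (elt t l)" using T k d unfolding Inc_def by auto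
        then show False using po(2) lk(1) T \<open>l = k + 1\<close> by auto
      next
        assume l': "l + 1 = k"
        then have "bef s (elt t l) (elt t (l + 1))" using T k d unfolding Inc_def by auto
        then show False using po'(2) lk(2) T l' by auto
      qed
    qed
  qed
  then have "pos i ?p = pos (i - 1) ?p" by (rule unmoved[OF i1 i(2) p(1)])
  then have "pos i ?p = k" "pos (i - 1) ?p = k" using p(2) t by auto
  moreover have "i - 1 \<le> D" using i by simp
  ultimately show ?thesis using elt_pos[OF i(2) p(1)] elt_pos[OF _ p(1), of "i - 1"] by simp
qed

text \<open>For \<open>x \<ge> 1\<close> the potential is at least \<open>x\<close> if the centre is decreasing of order \<open>x\<close>, for \<open>x \<le> 0\<close> if it is
  not increasing of order \<open>2 - x\<close>. A single move lowers the potential by at most one.\<close>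

definition pot :: "nat \<Rightarrow> nat \<Rightarrow> int \<Rightarrow> bool" where
  "pot s i x = (if x \<ge> 1 then Dec s i (nat x) else \<not> Inc s i (nat (2 - x)))"

text \<open>By \<open>interior_unmoved\<close> a move disturbs at most the two outermost elements of
  a decreasing centre, and, read backwards, an increasing centre gains at most order 1.
  \<open>x = 1\<close> is the turning point: a decreasing central pair excludes an increasing centre
  of order 2 one move later.\<close>

lemma pot_step:
  assumes i: "s < i" "i \<le> D" and x: "x \<le> int M" "3 - x \<le> int M" and p: "pot s (i - 1) x"
  shows "pot s i (x - 1)"
proof -
  consider "x \<ge> 2" | "x = 1" | "x \<le> 0" by linarith
  then show ?thesis
  proof cases
    case 1
    have D: "Dec s (i - 1) (nat x)" using p 1 by (simp add: pot_def)
    have "Dec s i (nat x - 1)"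
      unfolding Dec_def
    proof (intro allI impI)
      fix k assume k: "M \<le> k + (nat x - 1) \<and> k + 1 < M + (nat x - 1)"
      have "elt i k = elt (i - 1) k" "elt i (k + 1) = elt (i - 1) (k + 1)"
        by (rule interior_unmoved[OF i, where t = "i - 1" and d = "nat x"]; use D x k 1 in linarith)+
      moreover have "bef s (elt (i - 1) (k + 1)) (elt (i - 1) k)" by (rule Dec_D[OF D]) (use k 1 in linarith)+
      ultimately show "bef s (elt i (k + 1)) (elt i k)" by simp
    qed
    then show ?thesis using 1 by (simp add: pot_def nat_diff_distrib)
  next
    case 2
    have D: "Dec s (i - 1) 1" using p 2 by (simp add: pot_def)
    have "\<not> Inc s i 2"
    proof
      assume I: "Inc s i 2"
      have M2: "2 \<le> M" using x 2 by simp
      have "elt i (M - 1) = elt (i - 1) (M - 1)" "elt i (M - 1 + 1) = elt (i - 1) (M - 1 + 1)"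
        by (rule interior_unmoved[OF i, where t = i and d = 2]; use I M2 in simp)+
      moreover have "bef s (elt i (M - 1)) (elt i (M - 1 + 1))" by (rule Inc_D[OF I]) (use M2 in linarith)+
      moreover have "bef s (elt (i - 1) (M - 1 + 1)) (elt (i - 1) (M - 1))" by (rule Dec_D[OF D]) (use M2 in linarith)+
      moreover have "elt i (M - 1) \<in> P" "elt i (M - 1 + 1) \<in> P" using elt[OF i(2)] M2 by auto
      ultimately show False using asym[of s] i by auto
    qed
    then show ?thesis using 2 by (simp add: pot_def)
  next
    case 3
    define y where "y = nat (2 - x)"
    have nI: "\<not> Inc s (i - 1) y" using p 3 by (simp add: pot_def y_def)
    have "\<not> Inc s i (y + 1)"
    proof
      assume I: "Inc s i (y + 1)"
      have yM: "y + 1 \<le> M" using x 3 by (simp add: y_def)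
      have "Inc s (i - 1) y"
        unfolding Inc_def
      proof (intro allI impI)
        fix k assume k: "M \<le> k + y \<and> k + 1 < M + y"
        have "elt i k = elt (i - 1) k" "elt i (k + 1) = elt (i - 1) (k + 1)"
          by (rule interior_unmoved[OF i, where t = i and d = "y + 1"]; use I yM k in simp)+
        moreover have "bef s (elt i k) (elt i (k + 1))" by (rule Inc_D[OF I]) (use k in linarith)+
        ultimately show "bef s (elt (i - 1) k) (elt (i - 1) (k + 1))" by simp
      qed
      then show False using nI by blast
    qed
    moreover have "nat (2 - (x - 1)) = y + 1" using 3 by (simp add: y_def)
    ultimately show ?thesis using 3 by (simp add: pot_def)
  qed
qed

text \<open>The potential is at least \<open>d\<close> at time \<open>i\<close> and at most
  \<open>1 - d'\<close> at time \<open>j\<close>, and each move lowers it by at most 1.\<close>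

lemma window:
  assumes s: "s \<le> i" "i \<le> j" "j \<le> D" and d: "1 \<le> d" "d \<le> M" "1 \<le> d'" "d' \<le> M"
    and dec: "Dec s i d" and inc: "Inc s j d'"
  shows "i + d + d' \<le> j + 1"
proof (rule ccontr)
  assume c: "\<not> ?thesis"
  have "pot s (i + n) (int d - int n)" if "n \<le> j - i" for n
    using that
  proof (induct n)
    case 0
    show ?case using dec d by (simp add: pot_def)
  next
    case (Suc n)
    have "pot s (Suc (i + n)) (int d - int n - 1)"
      by (rule pot_step) (use Suc c s d in auto)
    moreover have "i + Suc n = Suc (i + n)" "int d - int (Suc n) = int d - int n - 1" by simp_all
    ultimately show ?case by metis
  qed
  from this[of "j - i"] have p: "pot s j (int d - int (j - i))" using s by simp
  let ?x = "int d - int (j - i)"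
  have x: "?x \<ge> 2 - int d'" using c s by linarith
  show False
  proof (cases "?x \<ge> 1")
    case True
    then have "Dec s j (nat ?x)" using p by (simp add: pot_def)
    moreover have "1 \<le> nat ?x" using True by linarith
    ultimately show False using Inc_Dec[OF inc _ d(3) _ d(4)] s by (meson le_trans)
  next
    case False
    then have "\<not> Inc s j (nat (2 - ?x))" using p by (simp add: pot_def)
    moreover have "nat (2 - ?x) \<le> d'" using x by linarith
    ultimately show False using Inc_mono[OF inc] by blast
  qed
qed

text \<open>The elements that pass from the left half to the right half in move \<open>i\<close>;
  equally many pass back.\<close>

definition crs :: "nat \<Rightarrow> 'p set" where "crs i = {p \<in> P. pos (i - 1) p < M \<and> M \<le> pos i p}"
definition w :: "nat \<Rightarrow> nat" where "w i = card (crs i)"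

lemma card_left: "i \<le> D \<Longrightarrow> card {p \<in> P. pos i p < M} = M"
proof -
  assume i: "i \<le> D"
  have "bij_betw (pos i) {p \<in> P. pos i p < M} {..<M}"
    using pos_bij[OF i] unfolding bij_betw_def by (auto simp: inj_on_def image_iff)
  then show ?thesis using bij_betw_same_card by fastforce
qed

text \<open>\<open>d\<close> different positions on one side cannot all be among the
  \<open>d - 1\<close> closest to the middle.\<close>

lemma pos_pigeon:
  assumes i: "i \<le> D" and S: "S \<subseteq> P" "card S = d" "1 \<le> d"
  shows "(\<forall>p\<in>S. pos i p < M) \<Longrightarrow> \<exists>p\<in>S. pos i p + d \<le> M" "(\<forall>p\<in>S. M \<le> pos i p) \<Longrightarrow> \<exists>p\<in>S. M + d \<le> pos i p + 1"
proof -
  have fS: "finite S" using S(1) finP finite_subset by blast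
  have cS: "card (pos i ` S) = d" using card_image[OF inj_on_subset[OF pos_inj[OF i] S(1)]] S(2) by simp
  show "\<exists>p\<in>S. pos i p + d \<le> M" if lt: "\<forall>p\<in>S. pos i p < M"
  proof (rule ccontr)
    assume no: "\<not> ?thesis"
    have "pos i ` S \<subseteq> {M + 1 - d..<M}"
    proof
      fix k assume "k \<in> pos i ` S"
      then obtain p where p: "p \<in> S" "k = pos i p" by blast
      then have "\<not> pos i p + d \<le> M" "pos i p < M" using no lt by auto
      then show "k \<in> {M + 1 - d..<M}" unfolding p(2) atLeastLessThan_iff using S(3) by arith
    qed
    then have "d \<le> card {M + 1 - d..<M}" using cS card_mono by (metis finite_atLeastLessThan)
    then show False using S(3) by auto
  qed
  show "\<exists>p\<in>S. M + d \<le> pos i p + 1" if lt: "\<forall>p\<in>S. M \<le> pos i p"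
  proof (rule ccontr)
    assume no: "\<not> ?thesis"
    have "pos i ` S \<subseteq> {M..<M + d - 1}"
    proof
      fix k assume "k \<in> pos i ` S"
      then obtain p where p: "p \<in> S" "k = pos i p" by blast
      then have "\<not> M + d \<le> pos i p + 1" "M \<le> pos i p" using no lt by auto
      then show "k \<in> {M..<M + d - 1}" using p by auto
    qed
    then have "d \<le> card {M..<M + d - 1}" using cS card_mono by (metis finite_atLeastLessThan)
    then show False using S(3) by auto
  qed
qed

text \<open>Every element that crosses to the right is exchanged with every element that crosses to
  the left. By \<open>pos_pigeon\<close> one of each kind, \<open>a\<close> and \<open>b\<close>,
  lies far enough out that the interval reversed with them covers the \<open>2 * w i\<close> central
  positions.\<close>

lemma crossing_block:
  assumes i: "1 \<le> i" "i \<le> D" and w: "1 \<le> w i" and k: "M \<le> k + w i" "k + 1 < M + w i"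
    and t: "t = i - 1 \<or> t = i"
  shows "r (elt t k) (elt t (k + 1)) = i"
proof -
  let ?d = "w i"
  define crs' where "crs' = {p \<in> P. M \<le> pos (i - 1) p \<and> pos i p < M}"
  have i1: "i - 1 \<le> D" using i by simp
  have c': "card crs' = ?d"
  proof -
    let ?L = "{p \<in> P. pos (i - 1) p < M}" and ?L' = "{p \<in> P. pos i p < M}"
    have fin: "finite ?L" "finite ?L'" using finP by auto
    have "crs i = ?L - ?L'" "crs' = ?L' - ?L" by (auto simp: crs_def crs'_def)
    moreover have "card (?L - ?L') = card ?L - card (?L \<inter> ?L')" "card (?L' - ?L) = card ?L' - card (?L' \<inter> ?L)"
      using fin by (simp_all add: card_Diff_subset_Int)
    ultimately show ?thesis using card_left[OF i1] card_left[OF i(2)] by (simp add: w_def Int_commute)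
  qed
  have sub: "crs i \<subseteq> P" "crs' \<subseteq> P" by (auto simp: crs_def crs'_def)
  have flip2: "r p q = i" if "p \<in> crs i" "q \<in> crs'" for p q
  proof -
    have P: "p \<in> P" "q \<in> P" and l: "pos (i - 1) p < pos (i - 1) q" "pos i q < pos i p"
      using that by (auto simp: crs_def crs'_def)
    then have "p \<noteq> q" by auto
    moreover have "bef (i - 1) p q" "\<not> bef i p q" using l pos_iff i1 i(2) P less_asym by metis+
    ultimately show ?thesis using change[OF i P] by blast
  qed
  have tD: "t \<le> D" using t i by auto
  obtain a b where ab: "a \<in> P" "b \<in> P" "r a b = i" "pos t a + ?d \<le> M" "M + ?d \<le> pos t b + 1"
  proof (cases "t = i - 1")
    case True
    obtain a where "a \<in> crs i" "pos t a + ?d \<le> M"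
      using pos_pigeon(1)[OF tD sub(1) _ w] True by (auto simp: w_def crs_def)
    moreover obtain b where "b \<in> crs'" "M + ?d \<le> pos t b + 1"
      using pos_pigeon(2)[OF tD sub(2) c' w] True by (auto simp: crs'_def)
    ultimately show ?thesis using that flip2 sub by blast
  next
    case False
    then have "t = i" using t by simp
    obtain a where "a \<in> crs'" "pos t a + ?d \<le> M"
      using pos_pigeon(1)[OF tD sub(2) c' w] \<open>t = i\<close> by (auto simp: crs'_def)
    moreover obtain b where "b \<in> crs i" "M + ?d \<le> pos t b + 1"
      using pos_pigeon(2)[OF tD sub(1) _ w] \<open>t = i\<close> by (auto simp: w_def crs_def)
    ultimately show ?thesis using that[of a b] flip2[of b a] r_sym sub by (metis subsetD)
  qed
  have dM: "?d \<le> M" using ab(4) by simp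
  have k2: "k < 2 * M" "k + 1 < 2 * M" using k dM by linarith+
  let ?p = "elt t k" and ?q = "elt t (k + 1)"
  have pq: "?p \<in> P" "pos t ?p = k" "?q \<in> P" "pos t ?q = k + 1" using elt[OF tD] k2 by auto
  have a: "pos t a \<le> k" "k + 1 \<le> pos t b" using ab k by linarith+
  have blk: "x = a \<or> r a x = i" if "x \<in> P" "pos t a \<le> pos t x" "pos t x \<le> pos t b" for x
  proof (cases "x = a \<or> x = b")
    case True
    then show ?thesis using ab by auto
  next
    case False
    then have "pos t a < pos t x" "pos t x < pos t b"
      using that ab(1,2) pos_inj[OF tD] by (metis inj_onD le_neq_implies_less)+
    then have "bef t a x" "bef t x b" using pos_iff[OF tD] that(1) ab by blast+
    then show ?thesis using contiguous[OF i t ab(1) that(1) ab(2) _ _ ab(3)] by blast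
  qed
  have "?q \<noteq> a" using a pq by auto
  then have q: "r a ?q = i" using blk[OF pq(3)] a pq by auto
  show ?thesis
  proof (cases "?p = a")
    case True
    then show ?thesis using q by simp
  next
    case False
    then have "r a ?p = i" using blk[OF pq(1)] a pq by auto
    moreover have "?p \<noteq> ?q" using pq by auto
    ultimately show ?thesis using r_trans[of ?p a ?q] pq ab False \<open>?q \<noteq> a\<close> q r_sym by metis
  qed
qed

lemma w_le: "1 \<le> i \<Longrightarrow> i \<le> D \<Longrightarrow> w i \<le> M"
proof -
  assume "1 \<le> i" "i \<le> D"
  then have "card (crs i) \<le> card {p \<in> P. pos (i - 1) p < M}" using finP by (intro card_mono) (auto simp: crs_def)
  then show ?thesis using card_left[of "i - 1"] \<open>i \<le> D\<close> by (simp add: w_def)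
qed

text \<open>The crossing reverses the central block, and each pair of the block moves only this
  once.\<close>

lemma crossing_Inc_Dec:
  assumes i: "s < i" "i \<le> D" and w: "1 \<le> w i"
  shows "Inc s (i - 1) (w i)" "Dec s i (w i)"
proof -
  have wM: "w i \<le> M" using w_le i by simp
  have i1: "1 \<le> i" "i - 1 \<le> D" using i by auto
  show "Inc s (i - 1) (w i)"
    unfolding Inc_def
  proof (intro allI impI)
    fix k assume k: "M \<le> k + w i \<and> k + 1 < M + w i"
    then have k2: "k < 2 * M" "k + 1 < 2 * M" using wM by linarith+
    let ?p = "elt (i - 1) k" and ?q = "elt (i - 1) (k + 1)"
    have P: "?p \<in> P" "?q \<in> P" "pos (i - 1) ?p < pos (i - 1) ?q" using elt[OF i1(2)] k2 by auto
    have "r ?p ?q = i" by (rule crossing_block[OF i1(1) i(2) w]) (use k in auto)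
    moreover have "bef (i - 1) ?p ?q" using P pos_iff[OF i1(2)] by blast
    moreover have "?p \<noteq> ?q" using P(3) by auto
    ultimately show "bef s ?p ?q" using pair_order(1)[OF i P(1,2)] by blast
  qed
  show "Dec s i (w i)"
    unfolding Dec_def
  proof (intro allI impI)
    fix k assume k: "M \<le> k + w i \<and> k + 1 < M + w i"
    then have k2: "k < 2 * M" "k + 1 < 2 * M" using wM by linarith+
    let ?p = "elt i k" and ?q = "elt i (k + 1)"
    have P: "?p \<in> P" "?q \<in> P" "pos i ?p < pos i ?q" using elt[OF i(2)] k2 by auto
    have "r ?p ?q = i" by (rule crossing_block[OF i1(1) i(2) w]) (use k in auto)
    moreover have "bef i ?p ?q" using P pos_iff[OF i(2)] by blast
    moreover have ne: "?p \<noteq> ?q" using P(3) by auto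
    ultimately have "\<not> bef s ?p ?q" using pair_order(2)[OF i P(1,2)] by blast
    moreover have "s \<le> D" using i by simp
    ultimately show "bef s ?q ?p" using not_bef P(1,2) ne by blast
  qed
qed

lemma pos_D: "p \<in> P \<Longrightarrow> pos D p + pos 0 p + 1 = 2 * M"
proof -
  assume p: "p \<in> P"
  have "bef D q p \<longleftrightarrow> bef 0 p q" if "q \<in> P" "q \<noteq> p" for q
    using flip[of D q p] r_range[of q p] not_bef[of 0 q p] that p by auto
  then have "{q \<in> P. bef D q p} = {q \<in> P. bef 0 p q}" using irrefl by auto
  then have "pos D p = card {q \<in> P. bef 0 p q}" by (simp add: pos_def)
  moreover have "P = {q \<in> P. bef 0 p q} \<union> {q \<in> P. bef 0 q p} \<union> {p}" using total[of 0] p by auto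
  then have "card P = card ({q \<in> P. bef 0 p q} \<union> {q \<in> P. bef 0 q p} \<union> {p})" by (rule arg_cong)
  moreover have "\<dots> = card {q \<in> P. bef 0 p q} + card {q \<in> P. bef 0 q p} + 1"
  proof -
    have "{q \<in> P. bef 0 p q} \<inter> {q \<in> P. bef 0 q p} = {}" using asym[of 0] p by auto
    then have "card ({q \<in> P. bef 0 p q} \<union> {q \<in> P. bef 0 q p}) = card {q \<in> P. bef 0 p q} + card {q \<in> P. bef 0 q p}"
      using finP by (intro card_Un_disjoint) auto
    then show ?thesis using finP irrefl by simp
  qed
  ultimately show ?thesis using cardP by (simp add: pos_def)
qed

text \<open>All \<open>M\<close> elements of the left half end in the right half, so each of them
  crosses at some move.\<close>

lemma sum_w: "M \<le> (\<Sum>i=1..D. w i)"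
proof -
  have "{p \<in> P. pos 0 p < M} \<subseteq> (\<Union>i\<in>{1..D}. crs i)"
  proof
    fix p assume p: "p \<in> {p \<in> P. pos 0 p < M}"
    have "pos D p \<ge> M" using pos_D[of p] p by auto
    then have ex: "\<exists>i. M \<le> pos i p \<and> i \<le> D" by blast
    define i where "i = (LEAST i. M \<le> pos i p)"
    have i: "M \<le> pos i p" "i \<le> D" using ex LeastI_ex[of "\<lambda>i. M \<le> pos i p"] Least_le[of "\<lambda>i. M \<le> pos i p"] by (auto simp: i_def intro: order_trans)
    have "i \<noteq> 0" using i(1) p by (auto intro: Nat.gr0I)
    then have "\<not> M \<le> pos (i - 1) p" using not_less_Least[of "i - 1" "\<lambda>i. M \<le> pos i p"] by (simp add: i_def[symmetric])
    then have "p \<in> crs i" using i p by (auto simp: crs_def)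
    then show "p \<in> (\<Union>i\<in>{1..D}. crs i)" using i \<open>i \<noteq> 0\<close> by auto
  qed
  moreover have "finite (\<Union>i\<in>{1..D}. crs i)" using finP by (auto simp: crs_def)
  ultimately have "card {p \<in> P. pos 0 p < M} \<le> card (\<Union>i\<in>{1..D}. crs i)" by (rule card_mono[rotated])
  also have "\<dots> \<le> (\<Sum>i=1..D. w i)" unfolding w_def by (rule card_UN_le) simp
  finally show ?thesis using card_left[of 0] by simp
qed

text \<open>By \<open>window\<close>, two consecutive crossings are at least the sum of their sizes
  apart. Summation counts every size twice except the first and the last.\<close>

lemma crossing_sum:
  assumes w1: "1 \<le> w 1" and i: "1 \<le> i" "i \<le> D" "1 \<le> w i"
  shows "(\<Sum>j=1..i. w j) + (\<Sum>j=1..<i. w j) + 1 \<le> i + w 1"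
  using i
proof (induct i rule: less_induct)
  case (less i)
  show ?case
  proof (cases "i = 1")
    case True
    then show ?thesis by simp
  next
    case False
    let ?S = "{j. 1 \<le> j \<and> j < i \<and> 1 \<le> w j}"
    have S: "finite ?S" "1 \<in> ?S" using False less w1 by auto
    define l where "l = Max ?S"
    have "l \<in> ?S" unfolding l_def by (rule Max_in) (use S in blast)+
    then have l: "1 \<le> l" "l < i" "1 \<le> w l" by auto
    have z: "w j = 0" if "l < j" "j < i" for j
    proof (rule ccontr)
      assume "w j \<noteq> 0"
      then have "j \<in> ?S" using that l by auto
      then have "j \<le> l" unfolding l_def by (rule Max_ge[OF S(1)])
      then show False using that by simp
    qed
    have lD: "l \<le> D" using l less by simp
    have s1: "(\<Sum>j=1..<i. w j) = (\<Sum>j=1..l. w j)"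
      by (rule sum.mono_neutral_right) (use l z in auto)
    have s2: "(\<Sum>j=1..i. w j) = (\<Sum>j=1..<i. w j) + w i" using less(2) by (simp add: sum.last_plus atLeastLessThanSuc_atLeastAtMost[symmetric])
    have s3: "(\<Sum>j=1..l. w j) = (\<Sum>j=1..<l. w j) + w l" using l by (simp add: sum.last_plus atLeastLessThanSuc_atLeastAtMost[symmetric])
    have "l + w l + w i \<le> (i - 1) + 1"
      by (rule window[of 0 l "i - 1"])
         (use l lD less crossing_Inc_Dec[of 0] w_le in auto)
    moreover have "(\<Sum>j=1..l. w j) + (\<Sum>j=1..<l. w j) + 1 \<le> l + w 1" using less(1)[OF l(2) l(1) lD l(3)] .
    ultimately show ?thesis using s1 s2 s3 l(2) by linarith
  qed
qed

text \<open>The final order reverses the initial one, so the first crossing reappears at the end as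
  an increasing centre. The windows thus close up cyclically, every size is counted twice, and
  \<open>sum_w\<close> applies.\<close>

theorem number_of_moves:
  assumes w1: "1 \<le> w 1" and two: "p0 \<in> P" "q0 \<in> P" "p0 \<noteq> q0" "r p0 q0 \<noteq> 1"
  shows "2 * M \<le> D"
proof -
  have D1: "1 \<le> D" using r_range[OF two(1-3)] by linarith
  let ?S = "{j. 1 \<le> j \<and> j \<le> D \<and> 1 \<le> w j}"
  have S: "finite ?S" "1 \<in> ?S" using D1 w1 by auto
  define l where "l = Max ?S"
  have "l \<in> ?S" unfolding l_def by (rule Max_in) (use S in blast)+
  then have l: "1 \<le> l" "l \<le> D" "1 \<le> w l" by auto
  have z: "w j = 0" if "l < j" "j \<le> D" for j
  proof (rule ccontr)
    assume "w j \<noteq> 0"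
    then have "j \<in> ?S" using that l by auto
    then have "j \<le> l" unfolding l_def by (rule Max_ge[OF S(1)])
    then show False using that by simp
  qed
  have s: "(\<Sum>j=1..D. w j) = (\<Sum>j=1..l. w j)" by (rule sum.mono_neutral_right) (use l z in auto)
  have s2: "(\<Sum>j=1..l. w j) = (\<Sum>j=1..<l. w j) + w l" using l by (simp add: sum.last_plus atLeastLessThanSuc_atLeastAtMost[symmetric])
  have w1M: "w 1 \<le> M" using w_le[of 1] D1 by simp
  \<comment> \<open>A single crossing would have size \<open>M\<close> and reverse everything in one
    move, against the pair \<open>p0\<close>, \<open>q0\<close>.\<close>
  have "l \<noteq> 1"
  proof
    assume "l = 1"
    then have "M \<le> w 1" using sum_w s by simp
    then have eq: "w 1 = M" using w1M by simp
    have adj: "r (elt 0 k) (elt 0 (k + 1)) = 1" if "k + 1 < 2 * M" for k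
      using crossing_block[of 1 k 0] D1 w1 that eq by auto
    have "l < 2 * M \<Longrightarrow> k < l \<Longrightarrow> r (elt 0 k) (elt 0 l) = 1" for k l
    proof (induct l)
      case (Suc l)
      show ?case
      proof (cases "k = l")
        case True
        then show ?thesis using adj[of l] Suc by simp
      next
        case False
        have "r (elt 0 k) (elt 0 l) = 1" using Suc False by simp
        moreover have "r (elt 0 l) (elt 0 (Suc l)) = 1" using adj[of l] Suc by simp
        moreover have "elt 0 k \<noteq> elt 0 l" "elt 0 l \<noteq> elt 0 (Suc l)" "elt 0 k \<noteq> elt 0 (Suc l)"
          using elt_neq[of 0] Suc False by auto
        moreover have "elt 0 k \<in> P" "elt 0 l \<in> P" "elt 0 (Suc l) \<in> P" using elt[of 0] Suc by auto
        ultimately show ?thesis using r_trans by metis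
      qed
    qed simp
    then have "r (elt 0 (pos 0 p0)) (elt 0 (pos 0 q0)) = 1"
      using pos_bound two pos_inj[of 0] r_sym by (metis inj_on_contraD linorder_neqE_nat zero_le)
    then show False using two elt_pos[of 0] by simp
  qed
  then have l1: "1 < l" using l by simp
  \<comment> \<open>The reference time is 1 and not 0: the first crossing has just put the central
    elements into the relative order that they keep to the end.\<close>
  have "Inc 1 D (w 1)"
    unfolding Inc_def
  proof (intro allI impI)
    fix k assume k: "M \<le> k + w 1 \<and> k + 1 < M + w 1"
    then have k2: "k + 1 < 2 * M" using w1M by linarith
    \<comment> \<open>By \<open>pos_D\<close> the elements at positions \<open>k\<close> and
      \<open>k + 1\<close> at the end started at \<open>k' + 1\<close> and
      \<open>k'\<close>.\<close>
    define k' where "k' = 2 * M - 2 - k"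
    have k': "k' + 1 < 2 * M" "k' + 1 + k + 1 = 2 * M" "M \<le> k' + w 1" "k' + 1 < M + w 1" using k2 k w1M by (auto simp: k'_def)
    have e0: "elt 0 k' \<in> P" "pos 0 (elt 0 k') = k'" "elt 0 (k' + 1) \<in> P" "pos 0 (elt 0 (k' + 1)) = k' + 1"
      using elt[of 0] k'(1) by auto
    have "pos D (elt 0 k') = k + 1" "pos D (elt 0 (k' + 1)) = k"
      using pos_D[OF e0(1)] pos_D[OF e0(3)] e0 k'(2) by linarith+
    then have eD: "elt D (k + 1) = elt 0 k'" "elt D k = elt 0 (k' + 1)"
      using elt_pos[OF order_refl e0(1)] elt_pos[OF order_refl e0(3)] by auto
    have rr: "r (elt 0 k') (elt 0 (k' + 1)) = 1" using crossing_block[of 1 k' 0] D1 w1 k' by auto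
    have ne: "elt 0 k' \<noteq> elt 0 (k' + 1)" using e0 by auto
    have "bef 0 (elt 0 k') (elt 0 (k' + 1))" using pos_iff[of 0 "elt 0 k'" "elt 0 (k' + 1)"] e0 by simp
    then have "\<not> bef 1 (elt 0 k') (elt 0 (k' + 1))" using flip[OF D1 e0(1,3) ne] rr by simp
    then have "bef 1 (elt 0 (k' + 1)) (elt 0 k')" using not_bef[OF D1 e0(1,3) ne] by blast
    then show "bef 1 (elt D k) (elt D (k + 1))" using eD by simp
  qed
  then have "l + w l + w 1 \<le> D + 1"
    by (intro window[of 1 l D]) (use l l1 crossing_Inc_Dec[of 1 l] w_le w1 w1M in auto)
  moreover have "(\<Sum>j=1..l. w j) + (\<Sum>j=1..<l. w j) + 1 \<le> l + w 1" by (rule crossing_sum[OF w1 l])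
  ultimately show ?thesis using sum_w s s2 by linarith
qed

text \<open>If nothing crossed, the left half would remain the same set, and \<open>p\<close>,
  \<open>q\<close> could not have been exchanged.\<close>

lemma first_crossing:
  assumes D1: "1 \<le> D" and pq: "p \<in> P" "q \<in> P" "r p q = 1" "pos 0 p < M" "M \<le> pos 0 q"
  shows "1 \<le> w 1"
proof (rule ccontr)
  assume "\<not> ?thesis"
  then have e: "crs 1 = {}" using finP by (simp add: w_def crs_def not_le)
  let ?L = "{p \<in> P. pos 0 p < M}" and ?L' = "{p \<in> P. pos 1 p < M}"
  have "?L \<subseteq> ?L'" using e by (auto simp: crs_def)
  moreover have "card ?L = card ?L'" using card_left[of 0] card_left[OF D1] by simp
  ultimately have L: "?L = ?L'" using finP by (intro card_subset_eq) auto
  have "p \<in> ?L'" "q \<notin> ?L'" unfolding L[symmetric] using pq by auto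
  then have "pos 1 p < M" "\<not> pos 1 q < M" using pq by auto
  then have "bef 1 p q" using pos_iff[OF D1 pq(1,2)] by simp
  moreover have "bef 0 p q" using pos_iff[of 0 p q] pq by simp
  moreover have "p \<noteq> q" using pq by auto
  ultimately show False using flip[OF D1 pq(1,2)] pq(3) by simp
qed

text \<open>It supplies the move at which the sequence of directions is restarted in
  \<open>ungar_slopes\<close>.\<close>

lemma exists_crossing:
  assumes "1 \<le> M"
  shows "\<exists>i p q. 1 \<le> i \<and> i \<le> D \<and> p \<in> P \<and> q \<in> P \<and> r p q = i \<and> pos (i - 1) p < M \<and> M \<le> pos (i - 1) q"
proof -
  have "\<exists>i\<in>{1..D}. w i \<noteq> 0" using sum_w assms by (metis le_zero_eq not_one_le_zero sum.neutral)
  then obtain i where i: "1 \<le> i" "i \<le> D" "1 \<le> w i" by auto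
  have wM: "w i \<le> M" using w_le i by simp
  have "r (elt (i - 1) (M - 1)) (elt (i - 1) (M - 1 + 1)) = i"
    by (rule crossing_block[OF i]) (use i wM in auto)
  moreover have "elt (i - 1) (M - 1) \<in> P \<and> pos (i - 1) (elt (i - 1) (M - 1)) = M - 1"
    "elt (i - 1) (M - 1 + 1) \<in> P \<and> pos (i - 1) (elt (i - 1) (M - 1 + 1)) = M - 1 + 1"
    using elt[of "i - 1"] i assms by auto
  ultimately show ?thesis using i assms by (intro exI[of _ i] exI[of _ "elt (i - 1) (M - 1)"] exI[of _ "elt (i - 1) (M - 1 + 1)"]) auto
qed

end

section \<open>Directions of points in the plane as an allowable sequence\<close>

definition slope :: "('p \<Rightarrow> real) \<Rightarrow> ('p \<Rightarrow> real) \<Rightarrow> 'p \<Rightarrow> 'p \<Rightarrow> real" where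
  "slope X Y p q = (Y q - Y p) / (X q - X p)"

definition slopes :: "('p \<Rightarrow> real) \<Rightarrow> ('p \<Rightarrow> real) \<Rightarrow> 'p set \<Rightarrow> real set" where
  "slopes X Y P = {slope X Y p q | p q. p \<in> P \<and> q \<in> P \<and> p \<noteq> q}"

lemma slope_sym: "slope X Y p q = slope X Y q p"
  unfolding slope_def by (metis minus_diff_eq minus_divide_divide)

text \<open>Time \<open>i\<close> of the sequence is realised by a projection whose parameter has
  exactly \<open>i\<close> slopes below it.\<close>

lemma separating_value:
  fixes S :: "real set"
  assumes "finite S" "i \<le> card S"
  shows "\<exists>t. t \<notin> S \<and> card {s \<in> S. s < t} = i"
  using assms
proof (induct "card S" arbitrary: S)
  case 0
  then show ?case by auto
next
  case (Suc n)
  let ?m = "Max S"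
  have ne: "S \<noteq> {}" using Suc by auto
  have m: "?m \<in> S" "\<And>s. s \<in> S \<Longrightarrow> s \<le> ?m" using Suc ne by auto
  show ?case
  proof (cases "i = card S")
    case True
    have "{s \<in> S. s < ?m + 1} = S" using m(2) by force
    moreover have "?m + 1 \<notin> S" using m(2) by force
    ultimately show ?thesis using True by (intro exI[of _ "?m + 1"]) auto
  next
    case False
    let ?T = "S - {?m}"
    have cT: "card ?T = n" "finite ?T" using Suc(2,3) m by auto
    then obtain t where t: "t \<notin> ?T" "card {s \<in> ?T. s < t} = i" using Suc(1)[of ?T] Suc False by auto
    show ?thesis
    proof (cases "t < ?m")
      case True
      then have "{s \<in> S. s < t} = {s \<in> ?T. s < t}" by auto
      then show ?thesis using t True by (intro exI[of _ t]) auto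
    next
      case F: False
      have all: "{s \<in> ?T. s < t} = ?T" using F m(2) t(1) by force
      define u where "u = (if ?T = {} then ?m - 1 else (Max ?T + ?m) / 2)"
      have lt: "s < ?m" if "s \<in> ?T" for s using m(2)[of s] that by auto
      have u: "u < ?m" "\<And>s. s \<in> ?T \<Longrightarrow> s < u"
      proof -
        show "u < ?m" using lt[OF Max_in[OF cT(2)]] by (cases "?T = {}") (simp_all add: u_def)
        fix s assume s: "s \<in> ?T"
        then have "s \<le> Max ?T" "Max ?T < ?m" using Max_ge[OF cT(2) s] lt[OF Max_in[OF cT(2)]] by blast+
        then show "s < u" using s by (auto simp: u_def)
      qed
      have "{s \<in> S. s < u} = ?T" using u by auto
      moreover have "u \<notin> S" using u by auto
      ultimately show ?thesis using t all by (intro exI[of _ u]) auto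
    qed
  qed
qed

lemma finite_slopes: "finite P \<Longrightarrow> finite (slopes X Y P)"
proof -
  assume "finite P"
  moreover have "slopes X Y P \<subseteq> (\<lambda>(p, q). slope X Y p q) ` (P \<times> P)" by (auto simp: slopes_def)
  ultimately show ?thesis by (meson finite_SigmaI finite_imageI finite_subset)
qed

text \<open>The rank of the slope of \<open>p\<close> and \<open>q\<close> among all slopes; it
  serves as the number of the move that exchanges them.\<close>

definition sidx :: "('p \<Rightarrow> real) \<Rightarrow> ('p \<Rightarrow> real) \<Rightarrow> 'p set \<Rightarrow> 'p \<Rightarrow> 'p \<Rightarrow> nat" where
  "sidx X Y P p q = card {s \<in> slopes X Y P. s \<le> slope X Y p q}"

text \<open>The order of the points by \<open>Y - t * X\<close> for any \<open>t\<close> with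
  exactly \<open>i\<close> slopes below it, written without choosing \<open>t\<close>; see
  \<open>sbef_functional\<close>.\<close>

definition sbef :: "('p \<Rightarrow> real) \<Rightarrow> ('p \<Rightarrow> real) \<Rightarrow> 'p set \<Rightarrow> nat \<Rightarrow> 'p \<Rightarrow> 'p \<Rightarrow> bool" where
  "sbef X Y P i p q \<longleftrightarrow> X p < X q \<and> i < sidx X Y P p q \<or> X q < X p \<and> sidx X Y P p q \<le> i"

lemma sidx_less:
  assumes fin: "finite P" and t: "t \<notin> slopes X Y P" "card {s \<in> slopes X Y P. s < t} = i"
    and pq: "p \<in> P" "q \<in> P" "p \<noteq> q"
  shows "i < sidx X Y P p q \<longleftrightarrow> t < slope X Y p q"
proof -
  let ?S = "slopes X Y P" and ?s = "slope X Y p q"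
  have s: "?s \<in> ?S" using pq by (auto simp: slopes_def)
  have fS: "finite ?S" by (rule finite_slopes[OF fin])
  show ?thesis
  proof (cases "t < ?s")
    case True
    have "{s \<in> ?S. s < t} \<subseteq> {s \<in> ?S. s \<le> ?s}" "?s \<in> {s \<in> ?S. s \<le> ?s}" "?s \<notin> {s \<in> ?S. s < t}" using True s by auto
    then have "{s \<in> ?S. s < t} \<subset> {s \<in> ?S. s \<le> ?s}" by blast
    then have "i < sidx X Y P p q" unfolding sidx_def t(2)[symmetric] using fS by (intro psubset_card_mono) auto
    then show ?thesis using True by simp
  next
    case False
    then have "?s < t" using s t(1) by (metis linorder_neqE_linordered_idom)
    then have "{s \<in> ?S. s \<le> ?s} \<subseteq> {s \<in> ?S. s < t}" by auto
    then have "sidx X Y P p q \<le> i" unfolding sidx_def t(2)[symmetric] using fS by (intro card_mono) auto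
    then show ?thesis using False by simp
  qed
qed

lemma sbef_functional:
  assumes fin: "finite P" and inj: "inj_on X P" and t: "t \<notin> slopes X Y P" "card {s \<in> slopes X Y P. s < t} = i"
    and pq: "p \<in> P" "q \<in> P"
  shows "sbef X Y P i p q \<longleftrightarrow> Y p - t * X p < Y q - t * X q"
proof (cases "p = q")
  case True
  then show ?thesis by (simp add: sbef_def)
next
  case False
  have ne: "X p \<noteq> X q" using inj pq False by (auto dest: inj_onD)
  note l = sidx_less[OF fin t pq False]
  have s: "slope X Y p q \<noteq> t" using t(1) pq False by (auto simp: slopes_def)
  show ?thesis
  proof (cases "X p < X q")
    case True
    then have "t < slope X Y p q \<longleftrightarrow> t * (X q - X p) < Y q - Y p" by (simp add: slope_def pos_less_divide_eq)
    then show ?thesis using l True by (auto simp: sbef_def algebra_simps)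
  next
    case F: False
    then have lt: "X q < X p" using ne by simp
    have "\<not> t < slope X Y p q \<longleftrightarrow> slope X Y p q < t" using s by linarith
    also have "\<dots> \<longleftrightarrow> t * (X q - X p) < Y q - Y p" using lt by (simp add: slope_def neg_divide_less_eq)
    finally show ?thesis using l lt by (auto simp: sbef_def algebra_simps)
  qed
qed

lemma sidx_pos:
  assumes "finite P" "p \<in> P" "q \<in> P" "p \<noteq> q"
  shows "1 \<le> sidx X Y P p q"
proof -
  have "{slope X Y p q} \<subseteq> {s \<in> slopes X Y P. s \<le> slope X Y p q}" using assms by (auto simp: slopes_def)
  then have "card {slope X Y p q} \<le> sidx X Y P p q"
    unfolding sidx_def using finite_slopes[OF assms(1)] by (intro card_mono) auto
  then show ?thesis by simp
qed

lemma sidx_strict_mono: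
  assumes "finite P" "p \<in> P" "q \<in> P" "p \<noteq> q" "slope X Y u v < slope X Y p q"
  shows "sidx X Y P u v < sidx X Y P p q"
proof -
  have "{s \<in> slopes X Y P. s \<le> slope X Y u v} \<subseteq> {s \<in> slopes X Y P. s \<le> slope X Y p q}"
    using assms(5) by auto
  moreover have "slope X Y p q \<in> {s \<in> slopes X Y P. s \<le> slope X Y p q}"
    "slope X Y p q \<notin> {s \<in> slopes X Y P. s \<le> slope X Y u v}" using assms by (auto simp: slopes_def)
  ultimately have "{s \<in> slopes X Y P. s \<le> slope X Y u v} \<subset> {s \<in> slopes X Y P. s \<le> slope X Y p q}" by blast
  then show ?thesis unfolding sidx_def using finite_slopes[OF assms(1)] by (intro psubset_card_mono) auto
qed

text \<open>Transitivity is inherited from a linear functional, and \<open>r_trans\<close> says that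
  equal slopes at a common point mean collinearity.\<close>

lemma allowable_slopes:
  assumes fin: "finite P" and card: "card P = 2 * M" and inj: "inj_on X P"
  shows "allowable P M (card (slopes X Y P)) (sbef X Y P) (sidx X Y P)"
proof
  let ?S = "slopes X Y P"
  have fS: "finite ?S" by (rule finite_slopes[OF fin])
  have ex: "\<exists>t. \<forall>p\<in>P. \<forall>q\<in>P. sbef X Y P i p q \<longleftrightarrow> Y p - t * X p < Y q - t * X q" if i: "i \<le> card ?S" for i
  proof -
    obtain t where "t \<notin> ?S" "card {s \<in> ?S. s < t} = i" using separating_value[OF fS i] by blast
    then show ?thesis using sbef_functional[OF fin inj] by blast
  qed
  show "finite P" "card P = 2 * M" by fact+
  show "\<not> sbef X Y P i p p" for i p by (simp add: sbef_def)
  show "sbef X Y P i p u" if "i \<le> card ?S" "p \<in> P" "q \<in> P" "u \<in> P" "sbef X Y P i p q" "sbef X Y P i q u" for i p q u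
  proof -
    have "\<exists>t. \<forall>p\<in>P. \<forall>q\<in>P. sbef X Y P i p q \<longleftrightarrow> Y p - t * X p < Y q - t * X q" by (rule ex[OF that(1)])
    then show ?thesis using that by (meson less_trans)
  qed
  show "sidx X Y P p q = sidx X Y P q p" for p q by (simp add: sidx_def slope_sym[of X Y p q])
  show "1 \<le> sidx X Y P p q \<and> sidx X Y P p q \<le> card ?S" if "p \<in> P" "q \<in> P" "p \<noteq> q" for p q
  proof
    show "1 \<le> sidx X Y P p q" by (rule sidx_pos[OF fin that])
    show "sidx X Y P p q \<le> card ?S" unfolding sidx_def using fS by (intro card_mono) auto
  qed
  show tot: "sbef X Y P i p q \<or> sbef X Y P i q p" if "i \<le> card ?S" "p \<in> P" "q \<in> P" "p \<noteq> q" for i p q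
  proof -
    have "X p \<noteq> X q" using inj that by (auto dest: inj_onD)
    moreover have "sidx X Y P p q = sidx X Y P q p" by (simp add: sidx_def slope_sym[of X Y p q])
    ultimately show ?thesis unfolding sbef_def by linarith
  qed
  show "sbef X Y P i p q \<longleftrightarrow> (sbef X Y P 0 p q \<longleftrightarrow> i < sidx X Y P p q)"
    if "i \<le> card ?S" "p \<in> P" "q \<in> P" "p \<noteq> q" for i p q
  proof -
    have "X p \<noteq> X q" using inj that by (auto dest: inj_onD)
    moreover have "0 < sidx X Y P p q" using sidx_pos[OF fin that(2-4), of X Y] by simp
    ultimately show ?thesis unfolding sbef_def by auto
  qed
  show "sidx X Y P p u = sidx X Y P p q"
    if P: "p \<in> P" "q \<in> P" "u \<in> P" "p \<noteq> q" "q \<noteq> u" "p \<noteq> u" and e: "sidx X Y P p q = sidx X Y P q u" for p q u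
  proof -
    have eqs: "slope X Y p q = slope X Y q u"
      using sidx_strict_mono[OF fin P(1,2,4), of X Y q u] sidx_strict_mono[OF fin P(2,3,5), of X Y p q] e by linarith
    define s where "s = slope X Y p q"
    have ne: "X q - X p \<noteq> 0" "X u - X q \<noteq> 0" "X u - X p \<noteq> 0" using inj P by (auto dest: inj_onD)
    have "Y q - Y p = s * (X q - X p)" "Y u - Y q = s * (X u - X q)"
      using ne eqs by (auto simp: s_def slope_def field_simps)
    then have "Y u - Y p = s * (X u - X p)" by (simp add: algebra_simps)
    then have "slope X Y p u = s" using ne by (simp add: slope_def)
    then show ?thesis by (simp add: sidx_def s_def)
  qed
qed

text \<open>\<open>number_of_moves\<close> wants the first move to be a crossing. For a crossing
  number \<open>i\<close> let \<open>c\<close> lie between the slopes of rank \<open>i - 1\<close>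
  and \<open>i\<close>. In the coordinates \<open>Y - c * X\<close> and \<open>- X\<close> a slope
  \<open>s\<close> becomes \<open>-1 / (s - c)\<close>, which permutes the slopes cyclically and
  starts the sequence at this crossing.\<close>

theorem ungar_slopes:
  assumes fin: "finite P" and card: "card P = 2 * M" and inj: "inj_on X P" and two: "2 \<le> card (slopes X Y P)"
  shows "2 * M \<le> card (slopes X Y P)"
proof (cases "M = 0")
  case False
  let ?S = "slopes X Y P"
  have fS: "finite ?S" by (rule finite_slopes[OF fin])
  interpret a: allowable P M "card ?S" "sbef X Y P" "sidx X Y P" by (rule allowable_slopes[OF fin card inj])
  obtain i u v where iuv: "1 \<le> i" "i \<le> card ?S" "u \<in> P" "v \<in> P" "sidx X Y P u v = i"
    "a.pos (i - 1) u < M" "M \<le> a.pos (i - 1) v" using a.exists_crossing False by auto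
  have uv: "u \<noteq> v" using iuv by auto
  obtain c where c: "c \<notin> ?S" "card {s \<in> ?S. s < c} = i - 1" using separating_value[OF fS, of "i - 1"] iuv(2) by (meson diff_le_self le_trans)
  define X' where "X' p = Y p - c * X p" for p
  define Y' where "Y' p = - X p" for p
  have Xne: "X q \<noteq> X p" if "p \<in> P" "q \<in> P" "p \<noteq> q" for p q using inj that by (auto dest: inj_onD)
  have sc: "slope X Y p q \<noteq> c" if "p \<in> P" "q \<in> P" "p \<noteq> q" for p q using c(1) that by (auto simp: slopes_def)
  have X'd: "X' q - X' p = (slope X Y p q - c) * (X q - X p)" if "p \<in> P" "q \<in> P" "p \<noteq> q" for p q
    using Xne[OF that] by (simp add: X'_def slope_def field_simps)
  have inj': "inj_on X' P"
  proof (rule inj_onI, rule ccontr)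
    fix p q assume "p \<in> P" "q \<in> P" "X' p = X' q" "p \<noteq> q"
    then show False using X'd[of p q] Xne[of p q] sc[of p q] by simp
  qed
  have sl: "slope X' Y' p q = - 1 / (slope X Y p q - c)" if "p \<in> P" "q \<in> P" "p \<noteq> q" for p q
  proof -
    have e: "Y' q - Y' p = - 1 * (X q - X p)" by (simp add: Y'_def)
    show ?thesis unfolding slope_def[of X' Y'] X'd[OF that] e using Xne[OF that] by (subst mult_divide_mult_cancel_right) simp_all
  qed
  have S': "slopes X' Y' P = (\<lambda>s. - 1 / (s - c)) ` ?S"
    using sl unfolding slopes_def by (auto simp: image_iff) metis+
  have injc: "inj_on (\<lambda>s. - 1 / (s - c)) ?S" using c(1) by (auto intro!: inj_onI simp: divide_simps split: if_splits)
  have cS': "card (slopes X' Y' P) = card ?S" unfolding S' by (rule card_image[OF injc])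
  interpret b: allowable P M "card (slopes X' Y' P)" "sbef X' Y' P" "sidx X' Y' P" by (rule allowable_slopes[OF fin card inj'])
  have fS': "finite (slopes X' Y' P)" by (rule finite_slopes[OF fin])
  obtain t0 where t0: "t0 \<notin> slopes X' Y' P" "card {s \<in> slopes X' Y' P. s < t0} = 0" using separating_value[OF fS', of 0] by auto
  have before: "sbef X' Y' P 0 p q \<longleftrightarrow> sbef X Y P (i - 1) p q" if "p \<in> P" "q \<in> P" for p q
  proof (cases "p = q")
    case True
    then show ?thesis by (simp add: sbef_def)
  next
    case F: False
    have "1 \<le> sidx X' Y' P p q" using b.r_range[OF that F] by blast
    then have "sbef X' Y' P 0 p q \<longleftrightarrow> X' p < X' q" by (auto simp: sbef_def)
    also have "\<dots> \<longleftrightarrow> sbef X Y P (i - 1) p q" unfolding sbef_functional[OF fin inj c that] X'_def ..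
    finally show ?thesis .
  qed
  have pos: "b.pos 0 p = a.pos (i - 1) p" if "p \<in> P" for p
    unfolding a.pos_def b.pos_def using before that by (metis (no_types, lifting))
  have su: "c < slope X Y u v" using sidx_less[OF fin c iuv(3,4) uv] iuv(1,5) by simp
  have r1: "sidx X' Y' P u v = 1"
  proof -
    have "{s \<in> slopes X' Y' P. s \<le> slope X' Y' u v} = {slope X' Y' u v}"
    proof
      show "{slope X' Y' u v} \<subseteq> {s \<in> slopes X' Y' P. s \<le> slope X' Y' u v}" using iuv uv by (auto simp: slopes_def)
      show "{s \<in> slopes X' Y' P. s \<le> slope X' Y' u v} \<subseteq> {slope X' Y' u v}"
      proof
        fix s assume "s \<in> {s \<in> slopes X' Y' P. s \<le> slope X' Y' u v}"
        then obtain z where z: "z \<in> ?S" "s = - 1 / (z - c)" "s \<le> - 1 / (slope X Y u v - c)"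
          unfolding S' sl[OF iuv(3,4) uv] by blast
        have "- 1 / (slope X Y u v - c) < 0" using su by (simp add: divide_less_0_iff)
        then have "s < 0" using z(3) by linarith
        then have zc: "c < z" using z(2) by (simp add: zero_less_divide_iff divide_less_0_iff)
        have "z \<le> slope X Y u v"
        proof (rule ccontr)
          assume "\<not> ?thesis"
          then have "1 / (z - c) < 1 / (slope X Y u v - c)" using su by (intro divide_strict_left_mono) auto
          then show False using z by simp
        qed
        moreover have "\<not> z < slope X Y u v"
        proof
          assume lt: "z < slope X Y u v"
          obtain p q where pq: "p \<in> P" "q \<in> P" "p \<noteq> q" "z = slope X Y p q" using z(1) by (auto simp: slopes_def)
          have "i - 1 < sidx X Y P p q" using sidx_less[OF fin c pq(1-3)] zc pq(4) by simp
          moreover have "sidx X Y P p q < i" using sidx_strict_mono[OF fin iuv(3,4) uv, of X Y p q] lt pq(4) iuv(5) by simp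
          ultimately show False by simp
        qed
        ultimately have "z = slope X Y u v" by simp
        then show "s \<in> {slope X' Y' u v}" using z sl[OF iuv(3,4) uv] by simp
      qed
    qed
    then show ?thesis by (simp add: sidx_def)
  qed
  have D1: "1 \<le> card (slopes X' Y' P)" using two cS' by simp
  have w1: "1 \<le> b.w 1" by (rule b.first_crossing[OF D1 iuv(3,4) r1]) (use pos iuv in auto)
  have "\<exists>p\<in>P. \<exists>q\<in>P. p \<noteq> q \<and> sidx X' Y' P p q \<noteq> 1"
  proof (rule ccontr)
    assume no: "\<not> ?thesis"
    have "s = slope X' Y' u v" if s: "s \<in> slopes X' Y' P" for s
    proof -
      obtain p q where pq: "p \<in> P" "q \<in> P" "p \<noteq> q" "s = slope X' Y' p q" using s by (auto simp: slopes_def)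
      have "sidx X' Y' P p q = 1" using no pq by blast
      then show ?thesis
        using sidx_strict_mono[OF fin pq(1-3), of X' Y' u v] sidx_strict_mono[OF fin iuv(3,4) uv, of X' Y' p q] r1 pq(4)
        by linarith
    qed
    then have "slopes X' Y' P \<subseteq> {slope X' Y' u v}" by blast
    then have "card (slopes X' Y' P) \<le> 1" using card_mono[of "{slope X' Y' u v}"] by fastforce
    then show False using two cS' by simp
  qed
  then show ?thesis using b.number_of_moves[OF w1] cS' by auto
qed simp

section \<open>Adding the lines of an arrangement one at a time\<close>

text \<open>\<open>\<tau>\<close> labels a line by its point on \<open>h\<close>; one line chosen
  for each label is a set of representatives.\<close>

lemma reps_of_key:
  assumes key: "\<And>a a'. a \<in> A \<Longrightarrow> a' \<in> A \<Longrightarrow> \<tau> a = \<tau> a' \<longleftrightarrow> (\<exists>s t. a = s *\<^sub>R a' + t *\<^sub>R h)"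
    and no: "\<forall>a\<in>A. \<forall>t. a \<noteq> t *\<^sub>R h"
  shows "\<exists>C. reps h A C \<and> card C = card (\<tau> ` A)"
proof -
  define C where "C = inv_into A \<tau> ` \<tau> ` A"
  have inv: "inv_into A \<tau> (\<tau> a) \<in> A \<and> \<tau> (inv_into A \<tau> (\<tau> a)) = \<tau> a" if a: "a \<in> A" for a
    using inv_into_into[of "\<tau> a" \<tau> A] f_inv_into_f[of "\<tau> a" \<tau> A] a by blast
  have sub: "C \<subseteq> A" using inv by (auto simp: C_def)
  have c: "inv_into A \<tau> (\<tau> c) = c" if c: "c \<in> C" for c using c inv by (auto simp: C_def)
  have "\<exists>c\<in>C. \<exists>s t. a = s *\<^sub>R c + t *\<^sub>R h" if a: "a \<in> A" for a
  proof (rule bexI)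
    show "inv_into A \<tau> (\<tau> a) \<in> C" using a by (simp add: C_def)
    show "\<exists>s t. a = s *\<^sub>R inv_into A \<tau> (\<tau> a) + t *\<^sub>R h" using key[OF a, of "inv_into A \<tau> (\<tau> a)"] inv[OF a] by simp
  qed
  moreover have "c \<noteq> s *\<^sub>R c' + t *\<^sub>R h" if cc: "c \<in> C" "c' \<in> C" "c \<noteq> c'" for c c' s t
  proof
    assume "c = s *\<^sub>R c' + t *\<^sub>R h"
    then have "\<tau> c = \<tau> c'" using key[of c c'] cc sub by blast
    then show False using c[OF cc(1)] c[OF cc(2)] cc(3) by simp
  qed
  ultimately have "reps h A C" using sub no unfolding reps_def by blast
  moreover have "card C = card (\<tau> ` A)" unfolding C_def by (rule card_image) (simp add: inj_on_inv_into)
  ultimately show ?thesis by blast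
qed

lemma reps_relation:
  assumes "a = s *\<^sub>R c + t *\<^sub>R h" "a' = s' *\<^sub>R c + t' *\<^sub>R (h :: real^3)" "s' \<noteq> 0"
  shows "a = (s / s') *\<^sub>R a' + (t - s * t' / s') *\<^sub>R h"
  using assms(3) unfolding assms(1,2) by (simp add: scaleR_add_right algebra_simps)

lemma reps_exist:
  assumes no: "\<forall>a\<in>A. \<forall>t. a \<noteq> t *\<^sub>R (h :: real^3)"
  shows "\<exists>C. reps h A C"
proof -
  \<comment> \<open>Without coordinates the label is a set: all combinations of \<open>a\<close> and
    \<open>h\<close>.\<close>
  define \<tau> where "\<tau> a = {c. \<exists>s t. c = s *\<^sub>R a + t *\<^sub>R h}" for a
  have self: "a \<in> \<tau> a" for a unfolding \<tau>_def by (intro CollectI exI[of _ 1] exI[of _ 0]) simp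
  have tr: "\<tau> a \<subseteq> \<tau> a'" if a: "a = s *\<^sub>R a' + t *\<^sub>R h" for a a' s t
  proof
    fix c assume "c \<in> \<tau> a"
    then obtain p q where "c = p *\<^sub>R a + q *\<^sub>R h" unfolding \<tau>_def by blast
    then have "c = (p * s) *\<^sub>R a' + (p * t + q) *\<^sub>R h" unfolding a by (simp add: algebra_simps)
    then show "c \<in> \<tau> a'" unfolding \<tau>_def by blast
  qed
  have "\<tau> a = \<tau> a' \<longleftrightarrow> (\<exists>s t. a = s *\<^sub>R a' + t *\<^sub>R h)" if A: "a \<in> A" "a' \<in> A" for a a'
  proof
    assume "\<tau> a = \<tau> a'"
    then show "\<exists>s t. a = s *\<^sub>R a' + t *\<^sub>R h" using self[of a] unfolding \<tau>_def by blast
  next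
    assume "\<exists>s t. a = s *\<^sub>R a' + t *\<^sub>R h"
    then obtain s t where st: "a = s *\<^sub>R a' + t *\<^sub>R h" by blast
    have "s \<noteq> 0"
    proof
      assume "s = 0"
      then have "a = t *\<^sub>R h" using st by simp
      then show False using no A by blast
    qed
    then have "a' = (1 / s) *\<^sub>R a + (- t / s) *\<^sub>R h" unfolding st by (simp add: algebra_simps)
    then show "\<tau> a = \<tau> a'" using tr[OF st] tr[of a' "1 / s" a "- t / s"] by blast
  qed
  then show ?thesis using reps_of_key[of A \<tau> h] no by blast
qed

lemma reps_card_ge:
  assumes rep: "reps h A C" and fin: "finite A" and S: "S \<subseteq> A"
    and ne: "\<And>a a' s t. a \<in> S \<Longrightarrow> a' \<in> S \<Longrightarrow> a \<noteq> a' \<Longrightarrow> a \<noteq> s *\<^sub>R a' + t *\<^sub>R h"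
  shows "card S \<le> card C"
proof -
  have ex: "\<forall>a\<in>S. \<exists>c. c \<in> C \<and> (\<exists>s t. a = s *\<^sub>R c + t *\<^sub>R h)" using rep S unfolding reps_def by blast
  obtain \<rho> where \<rho>: "\<forall>a\<in>S. \<rho> a \<in> C \<and> (\<exists>s t. a = s *\<^sub>R \<rho> a + t *\<^sub>R h)" using bchoice[OF ex] by blast
  have "inj_on \<rho> S"
  proof (rule inj_onI, rule ccontr)
    fix a a' assume a: "a \<in> S" "a' \<in> S" "\<rho> a = \<rho> a'" "a \<noteq> a'"
    obtain s t where st: "a = s *\<^sub>R \<rho> a + t *\<^sub>R h" using \<rho> a(1) by blast
    obtain s' t' where st': "a' = s' *\<^sub>R \<rho> a + t' *\<^sub>R h" using \<rho> a(2,3) by metis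
    have "a' \<noteq> t' *\<^sub>R h" using rep S a(2) unfolding reps_def by blast
    then have "s' \<noteq> 0" using st' by auto
    then show False using reps_relation[OF st st'] ne[OF a(1,2,4)] by blast
  qed
  moreover have "finite C" "\<rho> ` S \<subseteq> C" using rep fin \<rho> unfolding reps_def by (auto intro: finite_subset)
  ultimately show ?thesis using card_inj_on_le by blast
qed

text \<open>Twice the Hilbert polynomial of the logarithmic derivations of \<open>m\<close> lines whose sheaf has second Chern class \<open>c\<close>.\<close>

definition hpol :: "int \<Rightarrow> int \<Rightarrow> int \<Rightarrow> int" where
  "hpol m c d = d * (d + 1) + 2 * ((d + 1) * (d + 2)) + (1 - m) * (2 * d + 3) + (1 - m)\<^sup>2 - 2 * c"

text \<open>An upper bound for the Hilbert function, hence a lower bound for the second Chern class,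
  since \<open>hpol\<close> decreases in \<open>c\<close>. It mentions no sheaf, so it can be
  carried through the partial arrangements.\<close>

definition chern_bound :: "(real^3) set \<Rightarrow> int \<Rightarrow> bool" where
  "chern_bound A c \<longleftrightarrow> (\<exists>d0. \<forall>d\<ge>d0. 2 * int (dim (DA A d)) \<le> hpol (int (card A)) c d)"

lemma chern_bound_mono: "chern_bound A c \<Longrightarrow> c' \<le> c \<Longrightarrow> chern_bound A c'"
  unfolding chern_bound_def hpol_def by (meson diff_left_mono mult_left_mono order_trans zero_le_numeral)

text \<open>Without lines all triples are logarithmic, and \<open>3 (d + 1) (d + 2)\<close> is
  \<open>hpol 0 1 d\<close>. The 1 is the second Chern class of the tangent bundle twisted by
  -1.\<close>

lemma chern_bound_empty: "chern_bound {} 1"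
  unfolding chern_bound_def
proof (intro exI allI impI)
  fix d :: int assume d: "0 \<le> d"
  have "DA {} d = Gr [0,0,0] d" by (auto simp: DA_def Dmod_def Gr3_iff)
  moreover have "real (dim (Gr [0,0,0] d)) = 3 * (real_of_int ((d + 1) * (d + 2)) / 2)"
    using dim_Gr[of "[0,0,0]" d] d by simp
  ultimately have "real_of_int (2 * int (dim (DA {} d))) = real_of_int (3 * ((d + 1) * (d + 2)))" by simp
  then have "2 * int (dim (DA {} d)) = 3 * ((d + 1) * (d + 2))" by linarith
  then show "2 * int (dim (DA {} d)) \<le> hpol (int (card ({} :: (real^3) set))) 1 d"
    by (simp add: hpol_def algebra_simps power2_eq_square)
qed

text \<open>In large degrees \<open>restrict_in\<close> adds \<open>d + (d + 2 - n)\<close> to the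
  dimension, which is the change of the polynomial when \<open>m\<close> grows by 1 and
  \<open>c\<close> by \<open>n - 1\<close>.\<close>

lemma chern_bound_insert:
  assumes sa: "simple_arr (insert h A)" and h: "h \<notin> A" and rep: "reps h A C" and ub: "chern_bound A c"
  shows "chern_bound (insert h A) (c + int (card C) - 1)"
proof -
  have fin: "finite A" and sA: "simple_arr A" and h0: "h \<noteq> 0"
    using sa simple_arr_subset[OF sa, of A] by (auto simp: simple_arr_def)
  obtain d0 where d0: "\<And>d. d \<ge> d0 \<Longrightarrow> 2 * int (dim (DA A d)) \<le> hpol (int (card A)) c d"
    using ub unfolding chern_bound_def by blast
  let ?n = "int (card C)" and ?m = "int (card A)"
  have "2 * int (dim (DA (insert h A) d)) \<le> hpol (int (card (insert h A))) (c + ?n - 1) d"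
    if d: "d \<ge> max (d0 + 1) (max 0 ?n)" for d
  proof -
    have "int (dim (DA (insert h A) d)) \<le> int (dim (DA A (d - 1)) + nat d + nat (d + 2 - ?n))"
      using restrict_in[OF sA h0 rep, of d] by linarith
    then have "int (dim (DA (insert h A) d)) \<le> int (dim (DA A (d - 1))) + d + (d + 2 - ?n)" using d by simp
    moreover have "2 * int (dim (DA A (d - 1))) \<le> hpol ?m c (d - 1)" using d0 d by simp
    moreover have "hpol ?m c (d - 1) + 2 * d + 2 * (d + 2 - ?n) = hpol (?m + 1) (c + ?n - 1) d"
      by (simp add: hpol_def algebra_simps power2_eq_square)
    moreover have "int (card (insert h A)) = ?m + 1" using h fin by simp
    ultimately show ?thesis by simp
  qed
  then show ?thesis unfolding chern_bound_def by blast
qed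

lemma chern_bound_le:
  assumes "chern_bound A c" and eq: "\<And>d. d \<ge> d1 \<Longrightarrow> 2 * int (dim (DA A d)) = hpol (int (card A)) c' d"
  shows "c \<le> c'"
proof -
  obtain d0 where "\<And>d. d \<ge> d0 \<Longrightarrow> 2 * int (dim (DA A d)) \<le> hpol (int (card A)) c d"
    using assms(1) unfolding chern_bound_def by blast
  then have "hpol (int (card A)) c' (max d0 d1) \<le> hpol (int (card A)) c (max d0 d1)" using eq[of "max d0 d1"] by (metis max.cobounded1 max.cobounded2)
  then show ?thesis by (simp add: hpol_def)
qed

lemma simple_arr_not_multiple:
  assumes "simple_arr (insert h A)" "h \<notin> A"
  shows "\<forall>a\<in>A. \<forall>t. a \<noteq> t *\<^sub>R h"
  using assms unfolding simple_arr_def by (metis insertCI)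

text \<open>The first line meets no earlier one and lowers the initial 1 to 0; every later line
  carries at least one point, so nothing more is lost.\<close>

lemma chern_bound_nonneg:
  assumes "simple_arr K"
  shows "chern_bound K 0"
proof -
  have "finite K" using assms by (simp add: simple_arr_def)
  then have "simple_arr K \<longrightarrow> chern_bound K (if K = {} then 1 else 0)"
  proof (induct K rule: finite_induct)
    case empty
    then show ?case using chern_bound_empty by simp
  next
    case (insert h K)
    show ?case
    proof
      assume sa: "simple_arr (insert h K)"
      have no: "\<forall>a\<in>K. \<forall>t. a \<noteq> t *\<^sub>R h" by (rule simple_arr_not_multiple[OF sa insert(2)])
      obtain C where C: "reps h K C" using reps_exist[OF no] by blast
      have ub: "chern_bound K (if K = {} then 1 else 0)" using insert(3) simple_arr_subset[OF sa, of K] by blast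
      have "chern_bound (insert h K) ((if K = {} then 1 else 0) + int (card C) - 1)"
        by (rule chern_bound_insert[OF sa insert(2) C ub])
      moreover have "0 \<le> (if K = {} then 1 else 0) + int (card C) - 1"
      proof (cases "K = {}")
        case False
        then obtain a where "a \<in> K" by blast
        then have "C \<noteq> {}" using C unfolding reps_def by blast
        moreover have "finite C" using C insert(1) unfolding reps_def by (auto intro: finite_subset)
        ultimately have "card C \<ge> 1" by (simp add: Suc_le_eq card_gt_0_iff)
        then show ?thesis by simp
      qed simp
      ultimately show "chern_bound (insert h K) (if insert h K = {} then 1 else 0)" using chern_bound_mono by simp
    qed
  qed
  then show ?thesis using assms chern_bound_mono[of K 1 0] by (auto split: if_splits)
qed

section \<open>The lines through a point of the arrangement\<close>

text \<open>\<open>exc sl v xs\<close> is the number of entries of \<open>xs\<close> that have direction \<open>v\<close> from a later entry.\<close>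

fun exc :: "('p \<Rightarrow> 'p \<Rightarrow> 'v) \<Rightarrow> 'v \<Rightarrow> 'p list \<Rightarrow> nat" where
  "exc sl v [] = 0"
| "exc sl v (x # xs) = exc sl v xs + (if v \<in> sl x ` set xs then 1 else 0)"

text \<open>The entries that \<open>exc\<close> does not count; no two of them have direction
  \<open>v\<close> (\<open>unexc_pair\<close>).\<close>

fun unexc :: "('p \<Rightarrow> 'p \<Rightarrow> 'v) \<Rightarrow> 'v \<Rightarrow> 'p list \<Rightarrow> 'p set" where
  "unexc sl v [] = {}"
| "unexc sl v (x # xs) = unexc sl v xs \<union> (if v \<in> sl x ` set xs then {} else {x})"

lemma unexc_subset: "unexc sl v xs \<subseteq> set xs"
  by (induct xs) auto

lemma exc_unexc: "distinct xs \<Longrightarrow> exc sl v xs + card (unexc sl v xs) = length xs"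
proof (induct xs)
  case (Cons x xs)
  have "finite (unexc sl v xs)" "x \<notin> unexc sl v xs" using unexc_subset[of sl v xs] Cons(2) finite_subset by auto
  then show ?case using Cons by simp
qed simp

lemma unexc_pair:
  assumes sym: "\<And>p q. sl p q = sl q p"
  shows "p \<in> unexc sl v xs \<Longrightarrow> q \<in> unexc sl v xs \<Longrightarrow> p \<noteq> q \<Longrightarrow> sl p q \<noteq> v"
proof (induct xs)
  case (Cons x xs)
  have im: "sl y x \<in> sl x ` set xs" "sl x y \<in> sl x ` set xs" if "y \<in> set xs" for y using that sym[of y x] by simp_all
  show ?case using Cons unexc_subset[of sl v xs] im[of p] im[of q] by (auto split: if_splits)
qed simp

lemma exc_pos:
  assumes sym: "\<And>p q. sl p q = sl q p"
  shows "p \<in> set xs \<Longrightarrow> q \<in> set xs \<Longrightarrow> p \<noteq> q \<Longrightarrow> 1 \<le> exc sl (sl p q) xs"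
proof (induct xs)
  case (Cons x xs)
  have im: "sl y x \<in> sl x ` set xs" "sl x y \<in> sl x ` set xs" if "y \<in> set xs" for y using that sym[of y x] by simp_all
  show ?case using Cons im[of p] im[of q] by auto
qed simp

text \<open>Every pair of direction \<open>v\<close> has its earlier member counted, so all such
  pairs contain the one counted entry, and its removal destroys the direction.\<close>

lemma exc_one:
  assumes sym: "\<And>p q. sl p q = sl q p"
  shows "exc sl v xs = 1 \<Longrightarrow> \<exists>x\<in>set xs. \<forall>p\<in>set xs - {x}. \<forall>q\<in>set xs - {x}. p \<noteq> q \<longrightarrow> sl p q \<noteq> v"
proof (induct xs)
  case (Cons x xs)
  show ?case
  proof (cases "v \<in> sl x ` set xs")
    case True
    then have "exc sl v xs = 0" using Cons(2) by simp
    then have "sl p q \<noteq> v" if "p \<in> set xs" "q \<in> set xs" "p \<noteq> q" for p q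
      using exc_pos[where sl = sl, OF sym that] by auto
    then show ?thesis by (intro bexI[of _ x]) auto
  next
    case False
    then have "exc sl v xs = 1" using Cons(2) by simp
    then obtain y where y: "y \<in> set xs" "\<forall>p\<in>set xs - {y}. \<forall>q\<in>set xs - {y}. p \<noteq> q \<longrightarrow> sl p q \<noteq> v"
      using Cons(1) by blast
    have "sl p q \<noteq> v" if pq: "p \<in> set (x # xs) - {y}" "q \<in> set (x # xs) - {y}" "p \<noteq> q" for p q
    proof (cases "p = x \<or> q = x")
      case True
      have im: "sl y x \<in> sl x ` set xs" "sl x y \<in> sl x ` set xs" if "y \<in> set xs" for y using that sym[of y x] by simp_all
      show ?thesis using True False pq im[of p] im[of q] by auto
    next
      case F: False
      then show ?thesis using y pq by auto
    qed
    then show ?thesis using y(1) by (intro bexI[of _ y]) auto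
  qed
qed simp

lemma sum_exc_step:
  "finite V \<Longrightarrow> (\<Sum>v\<in>V. exc sl v (x # xs)) = (\<Sum>v\<in>V. exc sl v xs) + card (V \<inter> sl x ` set xs)"
  by (simp add: sum.distrib sum.If_cases)

section \<open>Cross products, and the pencil at x0 in dual coordinates\<close>

lemma Lagrange_cross: "cross3 z (cross3 x y) = (z \<bullet> y) *\<^sub>R x - (z \<bullet> x) *\<^sub>R y"
  by (simp add: cross3_simps) (simp add: forall_3 algebra_simps)

text \<open>The rest \<open>?z\<close> after projection to the cross product is orthogonal to it and
  also has zero cross product with it.\<close>

lemma orth_cross:
  assumes "cross3 x y \<noteq> 0" "u \<bullet> x = 0" "u \<bullet> y = 0"
  shows "u = ((u \<bullet> cross3 x y) / (cross3 x y \<bullet> cross3 x y)) *\<^sub>R cross3 x y"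
proof -
  let ?w = "cross3 x y"
  let ?z = "u - ((u \<bullet> ?w) / (?w \<bullet> ?w)) *\<^sub>R ?w"
  have ww: "?w \<bullet> ?w \<noteq> 0" using assms(1) by simp
  have wx: "?w \<bullet> x = 0" "?w \<bullet> y = 0" using dot_cross_self[of x y] by (simp_all add: inner_commute)
  have "?z \<bullet> ?w = 0" using ww by (simp add: inner_diff_left)
  moreover have "?z \<bullet> x = 0" "?z \<bullet> y = 0" using wx assms by (simp_all add: inner_diff_left)
  then have "cross3 ?z ?w = 0" unfolding Lagrange_cross by simp
  ultimately have "?z = 0" using norm_and_cross_eq_0[of ?z ?w] assms(1) by blast
  then show ?thesis by simp
qed

lemma orth_pair:
  assumes "cross3 x y \<noteq> 0" "u \<bullet> x = 0" "u \<bullet> y = 0" "v \<bullet> x = 0" "v \<bullet> y = 0" "v \<noteq> 0"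
  shows "\<exists>c. u = c *\<^sub>R v"
proof -
  let ?w = "cross3 x y"
  obtain s t where s: "u = s *\<^sub>R ?w" and t: "v = t *\<^sub>R ?w" using orth_cross[OF assms(1-3)] orth_cross[OF assms(1,4,5)] by blast
  have "t \<noteq> 0" using t assms(6) by auto
  then have "u = (s / t) *\<^sub>R v" using s t by simp
  then show ?thesis by blast
qed

text \<open>The duality made explicit: \<open>p0\<close> spans \<open>x0\<close>, \<open>K\<close>
  holds the lines through it, and \<open>B\<close> the others, scaled into the affine plane of
  vectors with value 1 at \<open>p0\<close>. The vector \<open>e\<close> is chosen so that no
  direction that occurs is vertical.\<close>

locale pencil =
  fixes p0 e :: "real^3" and K B :: "(real^3) set"
  assumes K: "a \<in> K \<Longrightarrow> a \<bullet> p0 = 0" "a \<in> K \<Longrightarrow> a \<bullet> e \<noteq> 0"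
    and B: "b \<in> B \<Longrightarrow> b \<bullet> p0 = 1" "b \<in> B \<Longrightarrow> b' \<in> B \<Longrightarrow> b \<noteq> b' \<Longrightarrow> (b - b') \<bullet> e \<noteq> 0"
    and sa: "simple_arr (K \<union> B)" and ind: "cross3 p0 e \<noteq> 0"
begin

text \<open>The slope, in the coordinates \<open>X\<close> and \<open>Y\<close>, of a vector
  orthogonal to \<open>p0\<close>, that is, of a line through \<open>x0\<close>. The difference
  \<open>b - b'\<close> is the line that joins \<open>x0\<close> to the common point of
  \<open>b\<close> and \<open>b'\<close>.\<close>

definition dir :: "real^3 \<Rightarrow> real" where "dir z = (z \<bullet> cross3 p0 e) / (z \<bullet> e)"

abbreviation "X \<equiv> \<lambda>b. b \<bullet> e"
abbreviation "Y \<equiv> \<lambda>b. b \<bullet> cross3 p0 e"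
abbreviation "sl \<equiv> slope X Y"

lemma dir_eq:
  assumes "z \<bullet> p0 = 0" "z' \<bullet> p0 = 0" "z \<bullet> e \<noteq> 0" "z' \<bullet> e \<noteq> 0"
  shows "dir z = dir z' \<longleftrightarrow> (\<exists>c. z = c *\<^sub>R z')"
proof
  assume d: "dir z = dir z'"
  let ?c = "(z \<bullet> e) / (z' \<bullet> e)"
  let ?y = "z - ?c *\<^sub>R z'"
  have "?y \<bullet> p0 = 0" "?y \<bullet> e = 0" using assms by (simp_all add: inner_diff_left)
  moreover have "?y \<bullet> cross3 p0 e = 0" using d assms by (simp add: dir_def inner_diff_left field_simps)
  ultimately have "?y = 0" using orth_cross[OF ind, of ?y] by simp
  then have "z = ?c *\<^sub>R z'" by simp
  then show "\<exists>c. z = c *\<^sub>R z'" by blast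
next
  assume "\<exists>c. z = c *\<^sub>R z'"
  then obtain c where c: "z = c *\<^sub>R z'" by blast
  then have "c \<noteq> 0" using assms by auto
  then show "dir z = dir z'" unfolding c dir_def by simp
qed

lemma sl_dir: "sl a b = dir (a - b)"
  unfolding slope_sym[of _ _ a b] by (simp add: slope_def dir_def inner_diff_left)

lemma sl_sym: "sl a b = sl b a" by (rule slope_sym)

lemma disj: "K \<inter> B = {}" using K(1) B(1) by fastforce

lemma fin: "finite K" "finite B" using sa by (auto simp: simple_arr_def)

lemma card_dir_K: "card (dir ` K) = card K"
proof (rule card_image, rule inj_onI, rule ccontr)
  fix a a' assume a: "a \<in> K" "a' \<in> K" "dir a = dir a'" "a \<noteq> a'"
  then obtain c where "a = c *\<^sub>R a'" using dir_eq[of a a'] K by blast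
  then show False using sa a unfolding simple_arr_def by (metis UnI1)
qed

text \<open>A point of \<open>b\<close> is labelled by the line that joins it to \<open>x0\<close>;
  the equation \<open>z a\<close> of that line is \<open>a\<close> minus the multiple of
  \<open>b\<close> that cancels its value at \<open>p0\<close>.\<close>

lemma reps_pencil:
  assumes b: "b \<in> B" and E: "E \<subseteq> B" "b \<notin> E"
  shows "\<exists>C. reps b (K \<union> E) C \<and> card C = card (dir ` K \<union> sl b ` E)"
proof -
  define z where "z a = a - (a \<bullet> p0) *\<^sub>R b" for a
  have bp: "b \<bullet> p0 = 1" by (rule B(1)[OF b])
  have z0: "z a \<bullet> p0 = 0" for a by (simp add: z_def inner_diff_left bp)
  have zK: "z a = a" if "a \<in> K" for a using K(1)[OF that] by (simp add: z_def)
  have zE: "z a = a - b" if "a \<in> E" for a using B(1)[of a] E that by (auto simp: z_def)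
  have ze: "z a \<bullet> e \<noteq> 0" if a: "a \<in> K \<union> E" for a
    using a
  proof
    assume "a \<in> K"
    then show ?thesis using zK K(2) by simp
  next
    assume "a \<in> E"
    then show ?thesis using zE B(2)[of a b] E b by auto
  qed
  have zl: "z (s *\<^sub>R a + t *\<^sub>R b) = s *\<^sub>R z a" for s t a
    by (simp add: z_def inner_add_left bp algebra_simps)
  have key: "dir (z a) = dir (z a') \<longleftrightarrow> (\<exists>s t. a = s *\<^sub>R a' + t *\<^sub>R b)" if a: "a \<in> K \<union> E" "a' \<in> K \<union> E" for a a'
  proof -
    have "(\<exists>c. z a = c *\<^sub>R z a') \<longleftrightarrow> (\<exists>s t. a = s *\<^sub>R a' + t *\<^sub>R b)"
    proof
      assume "\<exists>c. z a = c *\<^sub>R z a'"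
      then obtain c where "z a = c *\<^sub>R z a'" by blast
      then have "a = c *\<^sub>R a' + (a \<bullet> p0 - c * (a' \<bullet> p0)) *\<^sub>R b" by (simp add: z_def algebra_simps)
      then show "\<exists>s t. a = s *\<^sub>R a' + t *\<^sub>R b" by blast
    next
      assume "\<exists>s t. a = s *\<^sub>R a' + t *\<^sub>R b"
      then show "\<exists>c. z a = c *\<^sub>R z a'" using zl by blast
    qed
    then show ?thesis using dir_eq[OF z0 z0 ze[OF a(1)] ze[OF a(2)]] by simp
  qed
  have no: "\<forall>a\<in>K \<union> E. \<forall>t. a \<noteq> t *\<^sub>R b"
  proof (intro ballI allI notI)
    fix a t assume "a \<in> K \<union> E" "a = t *\<^sub>R b"
    then have "z a \<bullet> e \<noteq> 0" "z a = 0" using ze[of a] zl[of 0 a t] by simp_all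
    then show False by simp
  qed
  have "(\<lambda>a. dir (z a)) ` (K \<union> E) = dir ` K \<union> sl b ` E"
    unfolding image_Un using zK zE by (intro arg_cong2[of _ _ _ _ "(\<union>)"] image_cong) (simp_all add: sl_sym[of b] sl_dir[symmetric])
  then show ?thesis using reps_of_key[of "K \<union> E" "\<lambda>a. dir (z a)" b] key no by simp
qed

text \<open>\<open>K\<close> alone has bound 0. Each further line meets \<open>K\<close> in
  \<open>card K\<close> points, and every direction of \<open>V\<close> that it forms with a line
  already present is one point more.\<close>

lemma chern_bound_pencil:
  assumes V: "finite V" "V \<inter> dir ` K = {}" "slopes X Y B \<subseteq> V \<union> dir ` K"
  shows "distinct xs \<Longrightarrow> set xs \<subseteq> B \<Longrightarrow>
    chern_bound (K \<union> set xs) (int (length xs) * (int (card K) - 1) + int (\<Sum>v\<in>V. exc sl v xs))"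
proof (induct xs)
  case Nil
  have "chern_bound K 0" by (rule chern_bound_nonneg[OF simple_arr_subset[OF sa]]) simp
  then show ?case by simp
next
  case (Cons x xs)
  have x: "x \<in> B" "set xs \<subseteq> B" "x \<notin> set xs" using Cons(2,3) by auto
  obtain C where C: "reps x (K \<union> set xs) C" "card C = card (dir ` K \<union> sl x ` set xs)" using reps_pencil[OF x] by blast
  have sub: "sl x ` set xs \<subseteq> V \<union> dir ` K"
    using V(3) x unfolding slopes_def by blast
  have "dir ` K \<union> sl x ` set xs = dir ` K \<union> (V \<inter> sl x ` set xs)" using sub by blast
  moreover have "card (dir ` K \<union> (V \<inter> sl x ` set xs)) = card (dir ` K) + card (V \<inter> sl x ` set xs)"
    using V(1,2) fin by (intro card_Un_disjoint) auto
  ultimately have cC: "card C = card K + card (V \<inter> sl x ` set xs)" using C(2) card_dir_K by simp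
  have "chern_bound (insert x (K \<union> set xs)) (int (length xs) * (int (card K) - 1) + int (\<Sum>v\<in>V. exc sl v xs) + int (card C) - 1)"
  proof (rule chern_bound_insert[OF _ _ C(1)])
    show "simple_arr (insert x (K \<union> set xs))" by (rule simple_arr_subset[OF sa]) (use x in auto)
    show "x \<notin> K \<union> set xs" using x disj by auto
    show "chern_bound (K \<union> set xs) (int (length xs) * (int (card K) - 1) + int (\<Sum>v\<in>V. exc sl v xs))" using Cons by auto
  qed
  moreover have "int (length xs) * (int (card K) - 1) + int (\<Sum>v\<in>V. exc sl v xs) + int (card C) - 1 =
    int (length (x # xs)) * (int (card K) - 1) + int (\<Sum>v\<in>V. exc sl v (x # xs))"
    unfolding sum_exc_step[OF V(1)] cC by (simp add: algebra_simps)
  ultimately show ?case by simp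
qed

text \<open>The vector \<open>x\<close> detects that \<open>q\<close> is off the dual line through
  \<open>p\<close> and \<open>p'\<close>, so a second direction occurs.\<close>

lemma two_slopes:
  assumes p: "p \<in> B" "p' \<in> B" "q \<in> B" "p \<noteq> p'" and x: "p \<bullet> x = 0" "p' \<bullet> x = 0" "q \<bullet> x \<noteq> 0" and E: "E \<subseteq> B" "p \<in> E" "p' \<in> E" "q \<in> E"
  shows "2 \<le> card (slopes X Y E)"
proof -
  have pq: "p \<noteq> q" using x by auto
  have "sl p p' \<noteq> sl p q"
  proof
    assume "sl p p' = sl p q"
    then have "dir (p - p') = dir (p - q)" by (simp add: sl_dir)
    moreover have "(p - p') \<bullet> p0 = 0" "(p - q) \<bullet> p0 = 0" using B(1) p by (simp_all add: inner_diff_left)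
    ultimately obtain c where c: "p - p' = c *\<^sub>R (p - q)" using dir_eq[of "p - p'" "p - q"] B(2) p pq by metis
    then have "(p - p') \<bullet> x = c * ((p - q) \<bullet> x)" by simp
    then have "c = 0" using x by (simp add: inner_diff_left)
    then show False using c p by simp
  qed
  moreover have "{sl p p', sl p q} \<subseteq> slopes X Y E" using E p pq unfolding slopes_def by blast
  moreover have "finite (slopes X Y E)" by (rule finite_slopes) (use E fin finite_subset in blast)
  ultimately show ?thesis using card_mono[of "slopes X Y E" "{sl p p', sl p q}"] by simp
qed

lemma inj_X: "E \<subseteq> B \<Longrightarrow> inj_on X E"
proof (rule inj_onI, rule ccontr)
  fix a b assume "E \<subseteq> B" "a \<in> E" "b \<in> E" "a \<bullet> e = b \<bullet> e" "a \<noteq> b"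
  then show False using B(2)[of a b] by (auto simp: inner_diff_left)
qed

text \<open>The bound from adding lines leaves room for \<open>2 r + 4\<close> coincidences in
  directions outside \<open>K\<close>. If \<open>h\<close> has at most \<open>k\<close> points, its
  direction alone takes \<open>r + 3\<close> of them, and the other directions share at most
  \<open>r + 1\<close>.\<close>

theorem points_on_line:
  assumes cK: "card K + 1 = k" and cB: "card B = k + r + 2"
    and h: "h \<bullet> p0 = 0" "h \<bullet> p1 = 0" "h \<bullet> p2 = 0" "h \<bullet> e \<noteq> 0"
    and ind': "cross3 p0 p1 \<noteq> 0" "cross3 p0 p2 \<noteq> 0" "cross3 p1 p2 \<noteq> 0"
    and mult: "2 \<le> card {a \<in> K \<union> B. a \<bullet> p1 = 0}" "2 \<le> card {a \<in> K \<union> B. a \<bullet> p2 = 0}"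
    and rep: "reps h (K \<union> B) C"
    and hilb: "\<And>d. d \<ge> d1 \<Longrightarrow> 2 * int (dim (DA (K \<union> B) d)) = hpol (int (card (K \<union> B))) (int k * int (k + r)) d"
  shows "k + 1 \<le> card C"
proof (rule ccontr)
  assume "\<not> ?thesis"
  then have n: "card C \<le> k" by simp
  have h0: "h \<noteq> 0" using h(4) by auto
  have noh: "a \<noteq> t *\<^sub>R h" if "a \<in> K \<union> B" for a t using rep that unfolding reps_def by blast
  \<comment> \<open>Up to a factor \<open>h\<close> is the only form that vanishes at two of the
    three points, and it is not in the arrangement.\<close>
  have only: "\<not> (a \<bullet> p = 0 \<and> a \<bullet> q = 0)" if "a \<in> K \<union> B" "cross3 p q \<noteq> 0" "h \<bullet> p = 0" "h \<bullet> q = 0" for a p q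
    using orth_pair[of p q a h] that h0 noh by blast
  let ?G1 = "{a \<in> B. a \<bullet> p1 = 0}" and ?G2 = "{a \<in> B. a \<bullet> p2 = 0}"
  have "{a \<in> K \<union> B. a \<bullet> p1 = 0} = ?G1" "{a \<in> K \<union> B. a \<bullet> p2 = 0} = ?G2"
    using only[of _ p0 p1] only[of _ p0 p2] ind' h K(1) by blast+
  then have G: "2 \<le> card ?G1" "2 \<le> card ?G2" using mult by simp_all
  have G12: "a \<bullet> p2 \<noteq> 0" if "a \<in> ?G1" for a using only[of a p1 p2] that ind' h by blast
  have G21: "a \<bullet> p1 \<noteq> 0" if "a \<in> ?G2" for a using only[of a p1 p2] that ind' h by blast
  have finG: "finite ?G1" "finite ?G2" using fin by auto
  have pick2: "\<exists>x y. x \<in> S \<and> y \<in> S \<and> x \<noteq> y" if "2 \<le> card S" for S :: "(real^3) set"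
    using that by (metis card_le_Suc0_iff_eq card.infinite not_less_eq_eq numeral_2_eq_2 zero_le)
  have nonempty: "S - {b} \<noteq> {}" if "2 \<le> card S" for S :: "(real^3) set" and b
    using pick2[OF that] by blast
  \<comment> \<open>The lines through \<open>x1\<close> and those through \<open>x2\<close> are
    points on two dual lines. Whatever \<open>b\<close> is removed, two points of one kind and one
    of the other remain, and these are not collinear.\<close>
  have two: "2 \<le> card (slopes X Y (B - {b}))" for b
  proof (cases "b \<in> ?G1")
    case True
    then have "b \<notin> ?G2" using G12 by blast
    obtain p p' where p: "p \<in> ?G2" "p' \<in> ?G2" "p \<noteq> p'" using pick2[OF G(2)] by blast
    obtain q where q: "q \<in> ?G1" "q \<noteq> b" using nonempty[OF G(1), of b] by blast
    show ?thesis by (rule two_slopes[of p p' q p2]) (use p q G12[OF q(1)] \<open>b \<notin> ?G2\<close> in auto)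
  next
    case False
    obtain p p' where p: "p \<in> ?G1" "p' \<in> ?G1" "p \<noteq> p'" using pick2[OF G(1)] by blast
    obtain q where q: "q \<in> ?G2" "q \<noteq> b" using nonempty[OF G(2), of b] by blast
    show ?thesis by (rule two_slopes[of p p' q p1]) (use p q G21[OF q(1)] False in auto)
  qed
  have fs: "finite (slopes X Y E)" if "E \<subseteq> B" for E using that fin finite_subset finite_slopes by blast
  have smono: "slopes X Y E \<subseteq> slopes X Y E'" if "E \<subseteq> E'" for E E' using that unfolding slopes_def by blast
  have twoB: "2 \<le> card (slopes X Y B)"
    using two[of 0] card_mono[OF fs[OF order_refl] smono[of "B - {0}" B]] by fastforce
  define V where "V = slopes X Y B - dir ` K"
  have fV: "finite V" using fs[of B] by (simp add: V_def)
  obtain bs where bs: "set bs = B" "distinct bs" using finite_distinct_list[OF fin(2)] by blast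
  have len: "length bs = k + r + 2" using bs cB distinct_card by fastforce
  have "chern_bound (K \<union> set bs) (int (length bs) * (int (card K) - 1) + int (\<Sum>v\<in>V. exc sl v bs))"
    by (rule chern_bound_pencil) (use fV bs in \<open>auto simp: V_def\<close>)
  then have "int (length bs) * (int (card K) - 1) + int (\<Sum>v\<in>V. exc sl v bs) \<le> int k * int (k + r)"
    using chern_bound_le[of "K \<union> B", OF _ hilb] bs by simp
  moreover have "int (card K) = int k - 1" using cK by simp
  ultimately have "int (k + r + 2) * (int k - 2) + int (\<Sum>v\<in>V. exc sl v bs) \<le> int k * int (k + r)" using len by simp
  \<comment> \<open>\<open>(k + r + 2) (k - 2) = k (k + r) - (2 r + 4)\<close>.\<close>
  then have "int (\<Sum>v\<in>V. exc sl v bs) \<le> int (2 * r + 4)" by (simp add: algebra_simps)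
  then have W: "(\<Sum>v\<in>V. exc sl v bs) \<le> 2 * r + 4" by (simp only: of_nat_le_iff)
  have pos: "1 \<le> exc sl v bs" if v: "v \<in> V" for v
  proof -
    obtain p q where "p \<in> B" "q \<in> B" "p \<noteq> q" "v = sl p q" using v unfolding V_def slopes_def by blast
    then show ?thesis using exc_pos[where sl = sl, OF sl_sym, of p bs q] bs by simp
  qed
  \<comment> \<open>\<open>H\<close> joins \<open>x0\<close> to \<open>x1\<close>, where two lines
    of \<open>B\<close> meet, so its direction occurs in \<open>B\<close>; as \<open>H\<close> is
    not in the arrangement, it does not occur in \<open>K\<close>.\<close>
  have hV: "dir h \<in> V"
  proof -
    obtain p p' where p: "p \<in> ?G1" "p' \<in> ?G1" "p \<noteq> p'" using pick2[OF G(1)] by blast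
    have "(p - p') \<bullet> p0 = 0" "(p - p') \<bullet> p1 = 0" using p B(1) by (auto simp: inner_diff_left)
    then obtain c where "p - p' = c *\<^sub>R h" using orth_pair[OF ind'(1) _ _ h(1,2) h0] by blast
    then have "dir h = sl p p'" unfolding sl_dir using dir_eq[of "p - p'" h] \<open>(p - p') \<bullet> p0 = 0\<close> h B(2)[of p p'] p by auto
    then have "dir h \<in> slopes X Y B" using p unfolding slopes_def by blast
    moreover have "dir h \<notin> dir ` K"
    proof
      assume "dir h \<in> dir ` K"
      then obtain a where a: "a \<in> K" "dir a = dir h" by auto
      then obtain c where "a = c *\<^sub>R h" using dir_eq[of a h] K h by blast
      then show False using noh a by blast
    qed
    ultimately show ?thesis by (simp add: V_def)
  qed
  \<comment> \<open>For \<open>k = 1\<close> the points \<open>x1\<close> and \<open>x2\<close>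
    already give two representatives, one more than allowed.\<close>
  have "K \<noteq> {}"
  proof
    assume "K = {}"
    then have k1: "k = 1" using cK by simp
    obtain p q where p: "p \<in> ?G1" and q: "q \<in> ?G2" using nonempty[OF G(1)] nonempty[OF G(2)] by blast
    have "card {p, q} \<le> card C"
    proof (rule reps_card_ge[OF rep])
      show "finite (K \<union> B)" using fin by simp
      show "{p, q} \<subseteq> K \<union> B" using p q by auto
      fix a a' s t assume a: "a \<in> {p, q}" "a' \<in> {p, q}" "a \<noteq> a'"
      show "a \<noteq> s *\<^sub>R a' + t *\<^sub>R h"
      proof
        assume eq: "a = s *\<^sub>R a' + t *\<^sub>R h"
        have d: "a \<bullet> p1 = s * (a' \<bullet> p1)" "a \<bullet> p2 = s * (a' \<bullet> p2)" unfolding eq using h by (simp_all add: inner_add_left)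
        have "s = 0"
        proof (cases "a = p")
          case True
          then show ?thesis using d(1) p G21[OF q] a by auto
        next
          case False
          then show ?thesis using d(2) q G12[OF p] a by auto
        qed
        then have "a = t *\<^sub>R h" using eq by simp
        then show False using noh[of a] a p q by auto
      qed
    qed
    moreover have "p \<noteq> q" using p G21[OF q] by auto
    ultimately show False using n k1 by simp
  qed
  then obtain a0 where a0: "a0 \<in> K" by blast
  \<comment> \<open>The lines in \<open>?F\<close> meet \<open>h\<close> in pairwise different
    points other than \<open>x0\<close>, and \<open>a0\<close> contributes \<open>x0\<close>. So
    \<open>?F\<close> has at most \<open>k - 1\<close> members, and the remaining
    \<open>(k + r + 2) - (k - 1) = r + 3\<close> entries at least are counted by
    \<open>exc\<close>.\<close>
  let ?F = "unexc sl (dir h) bs"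
  have F: "?F \<subseteq> B" using unexc_subset[of sl "dir h" bs] bs by simp
  have a0F: "a0 \<notin> ?F" using F a0 disj by blast
  have "card (insert a0 ?F) \<le> card C"
  proof (rule reps_card_ge[OF rep])
    show "finite (K \<union> B)" using fin by simp
    show "insert a0 ?F \<subseteq> K \<union> B" using a0 F by auto
    fix a a' s t assume a: "a \<in> insert a0 ?F" "a' \<in> insert a0 ?F" "a \<noteq> a'"
    show "a \<noteq> s *\<^sub>R a' + t *\<^sub>R h"
    proof
      assume eq: "a = s *\<^sub>R a' + t *\<^sub>R h"
      have d: "a \<bullet> p0 = s * (a' \<bullet> p0)" unfolding eq using h by (simp add: inner_add_left)
      consider "a = a0" "a' \<in> ?F" | "a \<in> ?F" "a' = a0" | "a \<in> ?F" "a' \<in> ?F" using a by blast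
      then show False
      proof cases
        case 1
        then have "s = 0" using d K(1)[OF a0] B(1)[of a'] F by auto
        then show False using eq noh[of a t] a0 1 by simp
      next
        case 2
        then show False using d K(1)[OF a0] B(1)[of a] F by auto
      next
        case 3
        then have B': "a \<in> B" "a' \<in> B" using F by auto
        then have "s = 1" using d B(1) by simp
        then have "a - a' = t *\<^sub>R h" using eq by simp
        then have "dir (a - a') = dir h"
          using dir_eq[of "a - a'" h] B(1) B' B(2)[OF B' a(3)] h by (metis (no_types, lifting) diff_self inner_diff_left)
        then have "sl a a' = dir h" by (simp add: sl_dir)
        then show False using unexc_pair[where sl = sl, OF sl_sym 3 a(3)] by blast
      qed
    qed
  qed
  moreover have "finite ?F" using F fin finite_subset by blast
  ultimately have cF: "card ?F + 1 \<le> k" using a0F n by simp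
  have eh: "r + 3 \<le> exc sl (dir h) bs" using exc_unexc[OF bs(2), of sl "dir h"] len cF by simp
  have split: "(\<Sum>v\<in>V. exc sl v bs) = exc sl (dir h) bs + (\<Sum>v\<in>V - {dir h}. exc sl v bs)"
    by (rule sum.remove[OF fV hV])
  then have W': "(\<Sum>v\<in>V - {dir h}. exc sl v bs) \<le> r + 1" using W eh by linarith
  have "(\<Sum>v\<in>V - {dir h}. 1) \<le> (\<Sum>v\<in>V - {dir h}. exc sl v bs)" by (rule sum_mono) (use pos in auto)
  then have cV': "card (V - {dir h}) \<le> (\<Sum>v\<in>V - {dir h}. exc sl v bs)" by simp
  have cV: "card V = card (V - {dir h}) + 1" using card_Suc_Diff1[OF fV hV] by simp
  \<comment> \<open>As \<open>card V\<close> is at most \<open>r + 2\<close>, this is at most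
    \<open>(k - 1) + (r + 2)\<close>, one less than the number of points.\<close>
  have cS: "card (slopes X Y B) \<le> card K + card V"
  proof -
    have "card (slopes X Y B) \<le> card (dir ` K \<union> V)" by (rule card_mono) (use fin fV in \<open>auto simp: V_def\<close>)
    also have "\<dots> \<le> card K + card V" using card_Un_le[of "dir ` K" V] card_dir_K by simp
    finally show ?thesis .
  qed
  show False
  proof (cases "even (card B)")
    case True
    then obtain M where M: "card B = 2 * M" by blast
    have "2 * M \<le> card (slopes X Y B)" by (rule ungar_slopes[OF fin(2) M inj_X twoB]) simp
    then show False using M cS cV cV' W' cK cB by linarith
  next
    case False
    then obtain M where M: "card B = 2 * M + 1" by (elim oddE)
    have contra: False if b: "b \<in> B" "card (slopes X Y (B - {b})) + 2 \<le> card B" for b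
    proof -
      have "card (B - {b}) = 2 * M" using M b fin by simp
      then have "2 * M \<le> card (slopes X Y (B - {b}))" by (intro ungar_slopes inj_X two) (use fin in auto)
      then show False using b M by linarith
    qed
    show False
    \<comment> \<open>If the room is used up, each of these directions is counted once and
      disappears with a suitable point; otherwise there are at most \<open>k + r\<close> directions
      before any removal.\<close>
    proof (cases "card (V - {dir h}) = r + 1")
      case True
      then obtain v where v: "v \<in> V - {dir h}" by (metis Suc_eq_plus1 card.empty ex_in_conv nat.simps(3))
      have "exc sl v bs = 1"
      proof (rule ccontr)
        assume "exc sl v bs \<noteq> 1"
        then have "1 < exc sl v bs" using pos[of v] v by simp
        then have "(\<Sum>v\<in>V - {dir h}. 1) < (\<Sum>v\<in>V - {dir h}. exc sl v bs)"
          using fV v pos by (intro sum_strict_mono_ex1) auto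
        then show False using True W' by simp
      qed
      then obtain b where b: "b \<in> B" "\<forall>p\<in>B - {b}. \<forall>q\<in>B - {b}. p \<noteq> q \<longrightarrow> sl p q \<noteq> v"
        using exc_one[where sl = sl and v = v and xs = bs, OF sl_sym] bs(1) by blast
      have "v \<notin> slopes X Y (B - {b})" using b(2) unfolding slopes_def by blast
      moreover have "v \<in> slopes X Y B" using v by (simp add: V_def)
      ultimately have "slopes X Y (B - {b}) \<subset> slopes X Y B" using smono[of "B - {b}" B] by blast
      then have "card (slopes X Y (B - {b})) < card (slopes X Y B)" by (rule psubset_card_mono[OF fs[OF order_refl]])
      then show False using contra[OF b(1)] cS cV True cK cB by linarith
    next
      case F: False
      obtain b where b: "b \<in> B" using M by fastforce
      have "card (slopes X Y (B - {b})) \<le> card (slopes X Y B)" by (rule card_mono[OF fs[OF order_refl] smono]) blast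
      then show False using contra[OF b] cS cV cV' W' F cK cB by linarith
    qed
  qed
qed

end

section \<open>Logarithmic derivations and the gradient of the defining polynomial\<close>

definition derivation :: "('a::comm_ring_1 \<Rightarrow> 'a) \<Rightarrow> bool" where
  "derivation \<delta> \<longleftrightarrow> (\<forall>x y. \<delta> (x + y) = \<delta> x + \<delta> y) \<and> (\<forall>x y. \<delta> (x * y) = \<delta> x * y + x * \<delta> y)"

lemma derivation_0: "derivation \<delta> \<Longrightarrow> \<delta> 0 = 0"
  unfolding derivation_def by (metis add_cancel_right_right)

lemma derivation_1: "derivation \<delta> \<Longrightarrow> \<delta> 1 = 0"
  unfolding derivation_def by (metis add_cancel_right_right mult_1 mult_1_right)

lemma derivation_sum: "derivation \<delta> \<Longrightarrow> \<delta> (sum f A) = (\<Sum>x\<in>A. \<delta> (f x))"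
  by (induct A rule: infinite_finite_induct) (auto simp: derivation_0, simp add: derivation_def)

lemma derivation_pderiv: "derivation (pderiv :: 'a::idom poly \<Rightarrow> 'a poly)"
  by (simp add: derivation_def pderiv_add pderiv_mult algebra_simps)

lemma derivation_map_poly:
  assumes "derivation \<delta>"
  shows "derivation (map_poly \<delta>)"
proof -
  have c: "coeff (map_poly \<delta> p) n = \<delta> (coeff p n)" for p n
    by (simp add: coeff_map_poly derivation_0[OF assms])
  have "map_poly \<delta> (p + q) = map_poly \<delta> p + map_poly \<delta> q" for p q
    using assms by (intro poly_eqI) (simp add: c derivation_def)
  moreover have "map_poly \<delta> (p * q) = map_poly \<delta> p * q + p * map_poly \<delta> q" for p q
  proof (rule poly_eqI)
    fix n
    have "\<delta> (coeff p i * coeff q (n - i)) = \<delta> (coeff p i) * coeff q (n - i) + coeff p i * \<delta> (coeff q (n - i))" for i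
      using assms by (simp add: derivation_def)
    then show "coeff (map_poly \<delta> (p * q)) n = coeff (map_poly \<delta> p * q + p * map_poly \<delta> q) n"
      by (simp add: c coeff_mult derivation_sum[OF assms] sum.distrib)
  qed
  ultimately show ?thesis by (simp add: derivation_def)
qed

lemma derivation_prod:
  assumes "derivation \<delta>" "finite A"
  shows "\<delta> (prod f A) = (\<Sum>a\<in>A. \<delta> (f a) * prod f (A - {a}))"
  using assms(2)
proof (induct A rule: finite_induct)
  case empty
  then show ?case by (simp add: derivation_1[OF assms(1)])
next
  case (insert x A)
  have "prod f (insert x A - {a}) = f x * prod f (A - {a})" if "a \<in> A" for a
  proof -
    have "insert x A - {a} = insert x (A - {a})" using insert(2) that by auto
    then show ?thesis using insert(1,2) by simp
  qed
  then have "(\<Sum>a\<in>A. \<delta> (f a) * prod f (insert x A - {a})) = f x * (\<Sum>a\<in>A. \<delta> (f a) * prod f (A - {a}))"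
    unfolding sum_distrib_left by (intro sum.cong) (simp_all add: algebra_simps)
  moreover have "insert x A - {x} = A" using insert(2) by simp
  moreover have "\<delta> (f x * prod f A) = \<delta> (f x) * prod f A + f x * \<delta> (prod f A)" using assms(1) by (simp add: derivation_def)
  ultimately show ?case using insert by simp
qed

lemma derivation_pdiff: "derivation (pdiff i)"
proof -
  consider "i = 0" | "i = 1" | "i \<noteq> 0" "i \<noteq> 1" by blast
  then show ?thesis
  proof cases
    case 1
    then have "pdiff i = pderiv" by (intro ext) (simp add: pdiff_def)
    then show ?thesis using derivation_pderiv by simp
  next
    case 2
    then have "pdiff i = map_poly pderiv" by (intro ext) (simp add: pdiff_def)
    then show ?thesis using derivation_map_poly[OF derivation_pderiv] by simp
  next
    case 3
    then have "pdiff i = map_poly (map_poly pderiv)" by (intro ext) (simp add: pdiff_def)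
    then show ?thesis using derivation_map_poly[OF derivation_map_poly[OF derivation_pderiv]] by simp
  qed
qed

lemma pdiff_lf: "pdiff 0 (lf a) = cst (a $ 1)" "pdiff (Suc 0) (lf a) = cst (a $ 2)" "pdiff (Suc (Suc 0)) (lf a) = cst (a $ 3)"
  by (simp_all add: pdiff_def lf_pCons cst_def pderiv_pCons map_poly_pCons)

definition defpoly :: "(real^3) set \<Rightarrow> S3" where "defpoly A = (\<Prod>a\<in>A. lf a)"

definition grad :: "(real^3) set \<Rightarrow> nat \<Rightarrow> S3" where "grad A i = pdiff i (defpoly A)"

text \<open>The value of the derivation \<open>\<theta>\<close> on the defining polynomial.\<close>

definition app :: "(real^3) set \<Rightarrow> (nat \<Rightarrow> S3) \<Rightarrow> S3" where "app A \<theta> = (\<Sum>i<3. grad A i * \<theta> i)"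

lemma sum_lt3: "(\<Sum>i<3. f i) = f 0 + f 1 + f (2::nat)"
  by (simp add: numeral_3_eq_3 numeral_2_eq_2)

lemma homog_prod: "finite A \<Longrightarrow> (\<And>a. a \<in> A \<Longrightarrow> homog 1 (f a)) \<Longrightarrow> homog (int (card A)) (prod f A)"
proof (induct A rule: finite_induct)
  case (insert x A)
  have "homog (1 + int (card A)) (f x * prod f A)" using insert by (intro g3.h_mult) auto
  then show ?case using insert by (simp add: add.commute)
qed (use g3.h_one in simp)

lemma homog_defpoly: "simple_arr A \<Longrightarrow> homog (int (card A)) (defpoly A)" "simple_arr A \<Longrightarrow> defpoly A \<noteq> 0"
  unfolding defpoly_def by (auto intro!: homog_prod homog_lf simp: simple_arr_def lf_eq_0_iff)

lemma grad_eq: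
  assumes "simple_arr A"
  shows "grad A i = (\<Sum>a\<in>A. pdiff i (lf a) * prod lf (A - {a}))"
  unfolding grad_def defpoly_def by (rule derivation_prod[OF derivation_pdiff]) (use assms in \<open>simp add: simple_arr_def\<close>)

lemma homog_grad:
  assumes "simple_arr A" "i < 3"
  shows "homog (int (card A) - 1) (grad A i)"
  unfolding grad_eq[OF assms(1)]
proof (rule g3.h_sum)
  fix a assume a: "a \<in> A"
  have fin: "finite A" using assms(1) by (simp add: simple_arr_def)
  have c: "int (card (A - {a})) = int (card A) - 1" using a fin card_gt_0_iff[of A] by (auto simp: of_nat_diff Suc_leI)
  have "homog 0 (pdiff i (lf a))"
    using assms(2) pdiff_lf[of a] homog_cst by (auto simp: numeral_3_eq_3 less_Suc_eq)
  moreover have "homog (int (card A) - 1) (prod lf (A - {a}))"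
    using homog_prod[of "A - {a}" lf] homog_lf fin c by simp
  ultimately show "homog (int (card A) - 1) (pdiff i (lf a) * prod lf (A - {a}))" by (rule g3.h_mult') simp
qed

lemma app_eq:
  assumes "simple_arr A"
  shows "app A \<theta> = (\<Sum>a\<in>A. dotS a \<theta> * prod lf (A - {a}))"
proof -
  have "dotS a \<theta> = pdiff 0 (lf a) * \<theta> 0 + pdiff 1 (lf a) * \<theta> 1 + pdiff 2 (lf a) * \<theta> 2" for a
    using pdiff_lf[of a] by (simp add: dotS_def numeral_2_eq_2)
  then show ?thesis
    unfolding app_def sum_lt3 grad_eq[OF assms] sum_distrib_right by (simp add: sum.distrib[symmetric] algebra_simps)
qed

lemma dotS_Eul: "dotS a Eul = lf a"
  by (simp add: dotS_def Eul_def linear_form_def)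

lemma Eul_Dmod: "Eul \<in> Dmod A"
  by (simp add: Dmod_def dotS_Eul) (simp add: Eul_def)

lemma prod_remove: "finite A \<Longrightarrow> a \<in> A \<Longrightarrow> lf a * prod lf (A - {a}) = defpoly A"
  unfolding defpoly_def by (rule prod.remove[symmetric])

lemma app_Eul:
  assumes "simple_arr A"
  shows "app A Eul = cst (real (card A)) * defpoly A"
proof -
  have "app A Eul = (\<Sum>a\<in>A. defpoly A)"
    unfolding app_eq[OF assms] dotS_Eul by (rule sum.cong) (use assms prod_remove in \<open>auto simp: simple_arr_def\<close>)
  moreover have "(of_nat n :: S3) = cst (real n)" for n by (induct n) simp_all
  ultimately show ?thesis by simp
qed

lemma app_add: "app A (\<lambda>i. \<theta> i + \<eta> i) = app A \<theta> + app A \<eta>"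
  and app_scale: "app A (\<lambda>i. p * \<theta> i) = p * app A \<theta>"
  by (simp_all add: app_def algebra_simps sum.distrib sum_distrib_left)

lemma ker_module_app: "ker_module (grad A) = {v. (\<forall>i\<ge>3. v i = 0) \<and> app A v = 0}"
  by (simp add: ker_module_def app_def)

lemma dvd_app:
  assumes sa: "simple_arr A" and \<theta>: "\<theta> \<in> Dmod A"
  shows "defpoly A dvd app A \<theta>"
  unfolding app_eq[OF sa]
proof (rule dvd_sum)
  fix a assume a: "a \<in> A"
  then obtain q where "dotS a \<theta> = lf a * q" using \<theta> unfolding Dmod_def by blast
  then have "dotS a \<theta> * prod lf (A - {a}) = q * (lf a * prod lf (A - {a}))" by (simp only: ac_simps)
  also have "lf a * prod lf (A - {a}) = defpoly A" by (rule prod_remove) (use a sa in \<open>auto simp: simple_arr_def\<close>)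
  finally show "defpoly A dvd dotS a \<theta> * prod lf (A - {a})" by simp
qed

lemma prime_not_dvd_prod:
  fixes f :: "'i \<Rightarrow> 'a::idom"
  assumes "prime_elem p" "finite A" "\<And>a. a \<in> A \<Longrightarrow> \<not> p dvd f a"
  shows "\<not> p dvd prod f A"
  using assms(2,3)
proof (induct A rule: finite_induct)
  case empty
  then show ?case using assms(1) by (simp add: prime_elem_def)
next
  case (insert x A)
  then show ?case using prime_elem_dvd_mult_iff[OF assms(1)] by simp
qed

text \<open>If \<open>\<theta>\<close> annihilates the product, all summands of
  \<open>app_eq\<close> but the one of \<open>a\<close> are divisible by \<open>lf a\<close>, so
  that one is too, and its cofactor is not divisible by the prime \<open>lf a\<close>.\<close>

lemma ker_module_subset_Dmod:
  assumes sa: "simple_arr A"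
  shows "ker_module (grad A) \<subseteq> Dmod A"
proof
  fix \<theta> assume "\<theta> \<in> ker_module (grad A)"
  then have \<theta>: "\<forall>i\<ge>3. \<theta> i = 0" "app A \<theta> = 0" by (auto simp: ker_module_app)
  have fin: "finite A" using sa by (simp add: simple_arr_def)
  have "lf a dvd dotS a \<theta>" if a: "a \<in> A" for a
  proof -
    have nz: "a \<noteq> 0" using sa a by (auto simp: simple_arr_def)
    have rest: "lf a dvd (\<Sum>b\<in>A - {a}. dotS b \<theta> * prod lf (A - {b}))"
    proof (rule dvd_sum)
      fix b assume b: "b \<in> A - {a}"
      have "lf a dvd prod lf (A - {b})" by (rule dvd_prodI) (use fin a b in auto)
      then show "lf a dvd dotS b \<theta> * prod lf (A - {b})" by (rule dvd_mult)
    qed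
    have "app A \<theta> = dotS a \<theta> * prod lf (A - {a}) + (\<Sum>b\<in>A - {a}. dotS b \<theta> * prod lf (A - {b}))"
      unfolding app_eq[OF sa] by (rule sum.remove[OF fin a])
    then have "dotS a \<theta> * prod lf (A - {a}) = - (\<Sum>b\<in>A - {a}. dotS b \<theta> * prod lf (A - {b}))"
      using \<theta>(2) by (simp add: eq_neg_iff_add_eq_0)
    then have "lf a dvd dotS a \<theta> * prod lf (A - {a})" using rest by simp
    moreover have "\<not> lf a dvd prod lf (A - {a})"
    proof (rule prime_not_dvd_prod[OF prime_lf[OF nz]])
      show "finite (A - {a})" using fin by simp
      fix b assume b: "b \<in> A - {a}"
      then have "b \<noteq> c *\<^sub>R a" for c using sa a unfolding simple_arr_def by (metis DiffD1 DiffD2 singletonI)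
      then show "\<not> lf a dvd lf b" using lf_dvd_lf[OF nz, of b] by blast
    qed
    ultimately show ?thesis using prime_elem_dvd_mult_iff[OF prime_lf[OF nz]] by blast
  qed
  then show "\<theta> \<in> Dmod A" using \<theta>(1) by (simp add: Dmod_def)
qed

lemma homog_app:
  assumes "simple_arr A" "\<theta> \<in> Gr [0,0,0] d"
  shows "homog (int (card A) - 1 + d) (app A \<theta>)"
  unfolding app_def
proof (rule g3.h_sum, rule g3.h_mult)
  fix i :: nat assume i: "i \<in> {..<3}"
  then show "homog (int (card A) - 1) (grad A i)" using homog_grad[OF assms(1)] by simp
  have "i = 0 \<or> i = 1 \<or> i = 2" using i unfolding lessThan_iff by linarith
  then show "homog d (\<theta> i)" using assms(2) unfolding Gr3_iff by blast
qed

lemma app_quotient: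
  assumes sa: "simple_arr A" and \<theta>: "\<theta> \<in> DA A d"
  shows "\<exists>q. homog (d - 1) q \<and> app A \<theta> = defpoly A * q"
proof -
  obtain q where q: "app A \<theta> = defpoly A * q" using dvd_app[OF sa, of \<theta>] \<theta> unfolding DA_def by blast
  have "homog (int (card A) - 1 + d) (app A \<theta>)" using homog_app[OF sa] \<theta> by (simp add: DA_def)
  then have "homog ((d - 1) + int (card A)) (q * defpoly A)" unfolding q by (simp add: algebra_simps)
  then have "homog (d - 1) q" by (rule homog_cancel[OF homog_defpoly(1)[OF sa] homog_defpoly(2)[OF sa]])
  then show ?thesis using q by blast
qed

lemma Eul_multiple: "homog (d - 1) q \<Longrightarrow> (\<lambda>i. q * Eul i) \<in> DA A d"
proof -
  assume q: "homog (d - 1) q"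
  have "(\<lambda>i. q * Eul i) \<in> Dmod A" by (rule vec_subspace_scale[OF subspace_Dmod Eul_Dmod])
  moreover have "homog d (q * X)" if "X \<in> {X0, X1, X2}" for X
    by (rule g3.h_mult'[OF q, of 1]) (use that homog_X in auto)
  then have "(\<lambda>i. q * Eul i) \<in> Gr [0,0,0] d" unfolding Gr3_iff by (simp add: Eul_def)
  ultimately show ?thesis by (simp add: DA_def)
qed

lemma linear_app: "linear (app A)"
  by (rule linearI) (simp_all add: app_def algebra_simps sum.distrib scaleR_sum_right)

lemma linear_times: "linear ((*) (f :: S3))"
  by (rule linearI) (simp_all add: algebra_simps)

text \<open>By Euler's formula the multiples of \<open>Eul\<close> already reach all multiples of
  \<open>f\<close>, the number of lines being invertible. So \<open>D\<close> is the kernel module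
  plus a copy of the ring shifted by 1.\<close>

lemma dim_DA_ker:
  assumes sa: "simple_arr A" and ne: "A \<noteq> {}"
  shows "dim (DA A d) = dim (ker_module (grad A) \<inter> Gr [0,0,0] d) + dim {p. homog (d - 1) p}"
proof -
  have ker: "{\<theta> \<in> DA A d. app A \<theta> = 0} = ker_module (grad A) \<inter> Gr [0,0,0] d"
    using ker_module_subset_Dmod[OF sa] unfolding DA_def ker_module_app by (auto simp: Dmod_def)
  have c: "real (card A) \<noteq> 0" using ne sa by (simp add: simple_arr_def)
  have im: "app A ` DA A d = (*) (defpoly A) ` {p. homog (d - 1) p}"
  proof
    show "app A ` DA A d \<subseteq> (*) (defpoly A) ` {p. homog (d - 1) p}" using app_quotient[OF sa] by blast
    show "(*) (defpoly A) ` {p. homog (d - 1) p} \<subseteq> app A ` DA A d"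
    proof
      fix x assume "x \<in> (*) (defpoly A) ` {p. homog (d - 1) p}"
      then obtain q where q: "homog (d - 1) q" "x = defpoly A * q" by blast
      let ?q = "cst (1 / real (card A)) * q"
      have "homog (d - 1) ?q" by (rule g3.h_mult'[OF homog_cst q(1)]) simp
      then have "(\<lambda>i. ?q * Eul i) \<in> DA A d" by (rule Eul_multiple)
      moreover have "app A (\<lambda>i. ?q * Eul i) = x"
      proof -
        have "app A (\<lambda>i. ?q * Eul i) = (cst (1 / real (card A)) * cst (real (card A))) * (defpoly A * q)"
          unfolding app_scale app_Eul[OF sa] by (simp only: ac_simps)
        also have "cst (1 / real (card A)) * cst (real (card A)) = 1" using c by (simp flip: cst_simps(4))
        finally show ?thesis using q(2) by simp
      qed
      ultimately show "x \<in> app A ` DA A d" by blast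
    qed
  qed
  have "dim (app A ` DA A d) = dim {p. homog (d - 1) p}" unfolding im
    by (rule dim_image_inj[OF linear_times homog_space(1,2)]) (use homog_defpoly(2)[OF sa] in auto)
  then show ?thesis using rank_nullity(1)[OF linear_app[of A] DA_space[of A d]] unfolding ker by simp
qed

text \<open>The second difference at \<open>d\<close>, \<open>2 d\<close>, \<open>3 d\<close>
  isolates \<open>a\<close>; the difference at \<open>d\<close>, \<open>2 d\<close> then isolates
  \<open>b\<close>.\<close>

lemma bounded_quadratic:
  fixes a b c N d0 :: int
  assumes bd: "\<And>d. d \<ge> d0 \<Longrightarrow> \<bar>a * d\<^sup>2 + b * d + c\<bar> \<le> N"
  shows "a = 0 \<and> b = 0"
proof -
  define d where "d = max (max d0 1) (4 * N + 1)"
  have d: "d \<ge> d0" "d \<ge> 1" "d > 4 * N" by (auto simp: d_def)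
  define f where "f d = a * d\<^sup>2 + b * d + c" for d
  have f: "\<bar>f d\<bar> \<le> N" "\<bar>f (2 * d)\<bar> \<le> N" "\<bar>f (3 * d)\<bar> \<le> N" using bd[of d] bd[of "2 * d"] bd[of "3 * d"] d by (auto simp: f_def)
  have "2 * (a * d\<^sup>2) = f (3 * d) - 2 * f (2 * d) + f d" by (simp add: f_def algebra_simps power2_eq_square)
  then have "\<bar>2 * (a * d\<^sup>2)\<bar> \<le> 4 * N" using f by linarith
  moreover have "\<bar>2 * (a * d\<^sup>2)\<bar> = 2 * (\<bar>a\<bar> * d\<^sup>2)" by (simp add: abs_mult)
  ultimately have "\<bar>a\<bar> * d\<^sup>2 \<le> 4 * N" using f(1) by linarith
  moreover have "d \<le> d\<^sup>2" using d(2) by (simp add: power2_eq_square)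
  ultimately have a: "a = 0"
    using d(3) mult_right_mono[of 1 "\<bar>a\<bar>" "d\<^sup>2"] zero_le_power2[of d] by (cases "a = 0") linarith+
  have "b * d = f (2 * d) - f d" by (simp add: f_def a algebra_simps)
  then have "\<bar>b * d\<bar> \<le> 2 * N" using f by linarith
  then have "\<bar>b\<bar> * d \<le> 2 * N" using d(2) by (simp add: abs_mult)
  moreover have "N \<ge> 0" using f(1) by linarith
  ultimately have "b = 0" using d mult_right_mono[of 1 "\<bar>b\<bar>" d] by (cases "b = 0") linarith+
  then show ?thesis using a by blast
qed

text \<open>\<open>chern_hilbert\<close> leaves rank and \<open>c1\<close> open. The kernel is large
  because the gradient maps into forms of degree \<open>m - 1 + d\<close>, and it is small by
  \<open>chern_bound_nonneg\<close>; the two bounds differ by a constant, which forces rank 2 and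
  \<open>c1 = 1 - m\<close>.\<close>

theorem hilbert_log:
  assumes sa: "simple_arr A" and ne: "A \<noteq> {}" and ch: "has_chern_classes (ker_sheaf (grad A)) c1 c2"
  shows "\<exists>d1. \<forall>d\<ge>d1. 2 * int (dim (DA A d)) = hpol (int (card A)) c2 d"
proof -
  define M where "M d = ker_module (grad A) \<inter> Gr [0,0,0] d" for d
  let ?m = "int (card A)"
  obtain \<rho> d0 where H: "\<And>d. d \<ge> d0 \<Longrightarrow> 2 * real (dim (M d)) =
      real_of_int (\<rho> * ((d + 1) * (d + 2)) + c1 * (2 * d + 3) + c1\<^sup>2 - 2 * c2)"
    unfolding M_def using chern_hilbert[OF homog_grad[OF sa] ch] by blast
  define F where "F d = \<rho> * ((d + 1) * (d + 2)) + c1 * (2 * d + 3) + c1\<^sup>2 - 2 * c2" for d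
  have F: "2 * int (dim (M d)) = F d" if "d \<ge> d0" for d
  proof -
    have "real_of_int (2 * int (dim (M d))) = real_of_int (F d)" using H[OF that] by (simp add: F_def)
    then show ?thesis by (simp only: of_int_eq_iff)
  qed
  have S: "2 * int (dim {p. homog d p}) = (d + 1) * (d + 2)" if "d \<ge> -2" for d
  proof -
    have "real_of_int (2 * int (dim {p. homog d p})) = real_of_int ((d + 1) * (d + 2))" using homog_space(3)[OF that] by simp
    then show ?thesis by (simp only: of_int_eq_iff)
  qed
  have DM: "2 * int (dim (DA A d)) = 2 * int (dim (M d)) + d * (d + 1)" if "d \<ge> 0" for d
    using dim_DA_ker[OF sa ne, of d] S[of "d - 1"] that by (simp add: M_def algebra_simps)
  have low: "3 * ((d + 1) * (d + 2)) \<le> 2 * int (dim (M d)) + (?m + d) * (?m + d + 1)" if d: "d \<ge> 0" for d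
  proof -
    have "app A ` Gr [0,0,0] d \<subseteq> {p. homog (?m - 1 + d) p}" using homog_app[OF sa] by blast
    then have "dim (Gr [0,0,0] d) \<le> dim {x \<in> Gr [0,0,0] d. app A x = 0} + dim {p. homog (?m - 1 + d) p}"
      by (rule dim_le_ker_im[OF linear_app Gr_space(1,2) homog_space(2)])
    moreover have "{x \<in> Gr [0,0,0] d. app A x = 0} = M d" unfolding M_def ker_module_app by (auto simp: Gr_def)
    moreover have "dim (Gr [0,0,0] d) = 3 * dim {p. homog d p}" unfolding Gr_space(3) by simp
    ultimately have "3 * (2 * int (dim {p. homog d p})) \<le> 2 * int (dim (M d)) + 2 * int (dim {p. homog (?m - 1 + d) p})" by simp
    moreover have "2 * int (dim {p. homog d p}) = (d + 1) * (d + 2)" "2 * int (dim {p. homog (?m - 1 + d) p}) = (?m + d) * (?m + d + 1)"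
      using S[of d] S[of "?m - 1 + d"] d by (simp_all add: algebra_simps)
    ultimately show ?thesis by linarith
  qed
  obtain d0' where up: "\<And>d. d \<ge> d0' \<Longrightarrow> 2 * int (dim (DA A d)) \<le> hpol ?m 0 d"
    using chern_bound_nonneg[OF sa] unfolding chern_bound_def by blast
  define c where "c = 2 * (\<rho> - 2) + 3 * (c1 - 1 + ?m) + c1\<^sup>2 - 2 * c2"
  have "\<bar>(\<rho> - 2) * d\<^sup>2 + (3 * (\<rho> - 2) + 2 * (c1 - 1 + ?m)) * d + c\<bar> \<le> (1 - ?m)\<^sup>2"
    if d: "d \<ge> max (max d0 d0') 0" for d
  proof -
    have eq: "(\<rho> - 2) * d\<^sup>2 + (3 * (\<rho> - 2) + 2 * (c1 - 1 + ?m)) * d + c = F d - 2 * ((d + 1) * (d + 2)) - (1 - ?m) * (2 * d + 3)"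
      by (simp add: F_def c_def algebra_simps power2_eq_square)
    have "F d + d * (d + 1) \<le> hpol ?m 0 d" using up[of d] F[of d] DM[of d] d by linarith
    then have "F d - 2 * ((d + 1) * (d + 2)) - (1 - ?m) * (2 * d + 3) \<le> (1 - ?m)\<^sup>2" by (simp add: hpol_def)
    moreover have "3 * ((d + 1) * (d + 2)) - (?m + d) * (?m + d + 1) \<le> F d" using low[of d] F[of d] d by linarith
    then have "- (1 - ?m)\<^sup>2 \<le> F d - 2 * ((d + 1) * (d + 2)) - (1 - ?m) * (2 * d + 3)"
      by (simp add: algebra_simps power2_eq_square)
    ultimately show ?thesis unfolding eq by linarith
  qed
  then have "\<rho> - 2 = 0 \<and> 3 * (\<rho> - 2) + 2 * (c1 - 1 + ?m) = 0" by (rule bounded_quadratic)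
  then have \<rho>: "\<rho> = 2" "c1 = 1 - ?m" by auto
  have "2 * int (dim (DA A d)) = hpol ?m c2 d" if "d \<ge> max d0 0" for d
    using DM[of d] F[of d] that unfolding F_def hpol_def \<rho> by simp
  then show ?thesis by blast
qed

section \<open>Saito's criterion\<close>

text \<open>Expansion after one row is replaced by the combination of rows with coefficients
  \<open>a\<close>; its entries are divisible by \<open>lf a\<close> for logarithmic
  derivations.\<close>

lemma detS_expand:
  "cst (a $ 1) * detS u v w = dotS a u * (v 1 * w 2 - v 2 * w 1) - dotS a v * (u 1 * w 2 - u 2 * w 1) + dotS a w * (u 1 * v 2 - u 2 * v 1)"
  "cst (a $ 2) * detS u v w = - dotS a u * (v 0 * w 2 - v 2 * w 0) + dotS a v * (u 0 * w 2 - u 2 * w 0) - dotS a w * (u 0 * v 2 - u 2 * v 0)"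
  "cst (a $ 3) * detS u v w = dotS a u * (v 0 * w 1 - v 1 * w 0) - dotS a v * (u 0 * w 1 - u 1 * w 0) + dotS a w * (u 0 * v 1 - u 1 * v 0)"
  by (simp_all add: detS_def dotS_def algebra_simps)

lemma dvd_detS:
  assumes sa: "simple_arr A" and D: "u \<in> Dmod A" "v \<in> Dmod A" "w \<in> Dmod A"
  shows "defpoly A dvd detS u v w"
  unfolding defpoly_def
proof (rule simple_arr_prod_dvd[OF sa])
  fix a assume a: "a \<in> A"
  have d: "lf a dvd dotS a u" "lf a dvd dotS a v" "lf a dvd dotS a w" using D a by (auto simp: Dmod_def)
  have "lf a dvd cst (a $ 1) * detS u v w" "lf a dvd cst (a $ 2) * detS u v w" "lf a dvd cst (a $ 3) * detS u v w"
    unfolding detS_expand by (intro dvd_add dvd_diff dvd_mult2; use d in simp)+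
  moreover have "lf a dvd detS u v w" if "c \<noteq> 0" "lf a dvd cst c * detS u v w" for c
  proof -
    have "lf a dvd cst (1 / c) * (cst c * detS u v w)" using that(2) by (rule dvd_mult)
    moreover have "cst (1 / c) * (cst c * detS u v w) = cst (1 / c * c) * detS u v w" unfolding cst_simps(4) by (rule mult.assoc[symmetric])
    ultimately show ?thesis using that(1) by simp
  qed
  moreover have "a \<noteq> 0" using sa a by (auto simp: simple_arr_def)
  then have "a $ 1 \<noteq> 0 \<or> a $ 2 \<noteq> 0 \<or> a $ 3 \<noteq> 0" by (simp add: vec_eq_iff forall_3)
  ultimately show "lf a dvd detS u v w" by blast
qed

lemma cramer:
  assumes "i < 3"
  shows "detS u v w * \<theta> i = detS \<theta> v w * u i + detS u \<theta> w * v i + detS u v \<theta> * w i"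
proof -
  have "i = 0 \<or> i = 1 \<or> i = 2" using assms by linarith
  then show ?thesis by (auto simp: detS_def algebra_simps)
qed

lemma detS_homog:
  assumes "u \<in> Gr [0,0,0] a" "v \<in> Gr [0,0,0] b" "w \<in> Gr [0,0,0] c"
  shows "homog (a + b + c) (detS u v w)"
proof -
  have h: "homog a (u 0)" "homog a (u 1)" "homog a (u 2)" "homog b (v 0)" "homog b (v 1)" "homog b (v 2)"
    "homog c (w 0)" "homog c (w 1)" "homog c (w 2)" using assms by (auto simp: Gr3_iff)
  have "homog (a + b + c) (p * (q * r - q' * r'))" if "homog a p" "homog b q" "homog c r" "homog b q'" "homog c r'" for p q r q' r'
    by (rule g3.h_mult'[OF that(1) g3.h_diff[OF g3.h_mult[OF that(2,3)] g3.h_mult[OF that(4,5)]]]) simp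
  then show ?thesis unfolding detS_def using h by (intro g3.h_add g3.h_diff) auto
qed

lemma detS_col:
  "detS u (\<lambda>i. v i - q * u i) w = detS u v w" "detS u v (\<lambda>i. w i - q * u i) = detS u v w"
  by (simp_all add: detS_def algebra_simps)

text \<open>Subtracting a multiple of \<open>Eul\<close> with the same value on \<open>f\<close>
  leads into the kernel module, and by \<open>detS_col\<close> it does not change determinants with
  \<open>Eul\<close>.\<close>

lemma project_ker:
  assumes sa: "simple_arr A" and ne: "A \<noteq> {}" and s: "s \<in> DA A d"
  shows "\<exists>q. (\<lambda>i. s i - q * Eul i) \<in> ker_module (grad A) \<inter> Gr [0,0,0] d"
proof -
  obtain q where q: "homog (d - 1) q" "app A s = defpoly A * q" using app_quotient[OF sa s] by blast
  let ?q = "cst (1 / real (card A)) * q"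
  have c: "real (card A) \<noteq> 0" using ne sa by (simp add: simple_arr_def)
  have hq: "homog (d - 1) ?q" by (rule g3.h_mult'[OF homog_cst q(1)]) simp
  have E: "(\<lambda>i. ?q * Eul i) \<in> DA A d" by (rule Eul_multiple[OF hq])
  have "app A (\<lambda>i. ?q * Eul i) = (cst (1 / real (card A)) * cst (real (card A))) * (defpoly A * q)"
    unfolding app_scale app_Eul[OF sa] by (simp only: ac_simps)
  also have "cst (1 / real (card A)) * cst (real (card A)) = 1" using c by (simp flip: cst_simps(4))
  finally have a: "app A (\<lambda>i. ?q * Eul i) = app A s" using q(2) by simp
  let ?v = "s - (\<lambda>i. ?q * Eul i)"
  have "app A ?v = 0" using a linear_diff[OF linear_app, of A s "\<lambda>i. ?q * Eul i"] by simp
  moreover have "?v \<in> DA A d" by (rule real_vector.subspace_diff[OF DA_space(1) s E])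
  moreover have "?v = (\<lambda>i. s i - ?q * Eul i)" by (simp add: fun_eq_iff)
  ultimately have "(\<lambda>i. s i - ?q * Eul i) \<in> ker_module (grad A) \<inter> Gr [0,0,0] d"
    unfolding ker_module_app DA_def Dmod_def by auto
  then show ?thesis by blast
qed

lemma sheaf_iso_sym:
  assumes iso: "sheaf_iso F G"
    and add: "\<And>U s t. U \<in> opens \<Longrightarrow> s \<in> F U \<Longrightarrow> t \<in> F U \<Longrightarrow> (\<lambda>i. s i + t i) \<in> F U"
    and scale: "\<And>U a s. U \<in> opens \<Longrightarrow> a \<in> O_twist 0 U \<Longrightarrow> s \<in> F U \<Longrightarrow> (\<lambda>i. a * s i) \<in> F U"
    and restrict: "\<And>U V s. U \<in> opens \<Longrightarrow> V \<in> opens \<Longrightarrow> V \<subseteq> U \<Longrightarrow> s \<in> F U \<Longrightarrow> s \<in> F V"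
  shows "sheaf_iso G F"
proof -
  obtain \<phi> where hom: "sheaf_hom F G \<phi>" and bij: "\<And>U. U \<in> opens \<Longrightarrow> bij_betw (\<phi> U) (F U) (G U)"
    using iso unfolding sheaf_iso_def by blast
  define \<psi> where "\<psi> U = inv_into (F U) (\<phi> U)" for U
  have \<psi>: "\<psi> U s \<in> F U" "\<phi> U (\<psi> U s) = s" if "U \<in> opens" "s \<in> G U" for U s
    using bij[OF that(1)] that(2) unfolding \<psi>_def bij_betw_def by (metis inv_into_into, metis f_inv_into_f)
  have uniq: "\<psi> U s = t" if "U \<in> opens" "t \<in> F U" "\<phi> U t = s" for U s t
    using bij[OF that(1)] that(2,3) unfolding \<psi>_def bij_betw_def by (metis inv_into_f_f)
  have "sheaf_hom G F \<psi>"
    unfolding sheaf_hom_def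
  proof (intro ballI conjI impI)
    fix U assume U: "U \<in> opens"
    show "\<psi> U s \<in> F U" if "s \<in> G U" for s by (rule \<psi>(1)[OF U that])
    show "\<psi> U (\<lambda>i. s i + t i) = (\<lambda>i. \<psi> U s i + \<psi> U t i)" if st: "s \<in> G U" "t \<in> G U" for s t
    proof (rule uniq[OF U add[OF U \<psi>(1)[OF U st(1)] \<psi>(1)[OF U st(2)]]])
      have "\<phi> U (\<lambda>i. \<psi> U s i + \<psi> U t i) = (\<lambda>i. \<phi> U (\<psi> U s) i + \<phi> U (\<psi> U t) i)"
        using hom U \<psi>(1)[OF U st(1)] \<psi>(1)[OF U st(2)] unfolding sheaf_hom_def by blast
      then show "\<phi> U (\<lambda>i. \<psi> U s i + \<psi> U t i) = (\<lambda>i. s i + t i)" unfolding \<psi>(2)[OF U st(1)] \<psi>(2)[OF U st(2)] .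
    qed
    show "\<psi> U (\<lambda>i. a * s i) = (\<lambda>i. a * \<psi> U s i)" if a: "a \<in> O_twist 0 U" and s: "s \<in> G U" for a s
    proof (rule uniq[OF U scale[OF U a \<psi>(1)[OF U s]]])
      have "\<phi> U (\<lambda>i. a * \<psi> U s i) = (\<lambda>i. a * \<phi> U (\<psi> U s) i)"
        using hom U \<psi>(1)[OF U s] a unfolding sheaf_hom_def by blast
      then show "\<phi> U (\<lambda>i. a * \<psi> U s i) = (\<lambda>i. a * s i)" unfolding \<psi>(2)[OF U s] .
    qed
    show "\<psi> V s = \<psi> U s" if V: "V \<in> opens" "V \<subseteq> U" and s: "s \<in> G U" for V s
    proof (rule uniq[OF V(1) restrict[OF U V \<psi>(1)[OF U s]]])
      have "\<phi> V (\<psi> U s) = \<phi> U (\<psi> U s)" using hom U V \<psi>(1)[OF U s] unfolding sheaf_hom_def by blast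
      then show "\<phi> V (\<psi> U s) = s" unfolding \<psi>(2)[OF U s] .
    qed
  qed
  moreover have "bij_betw (\<psi> U) (G U) (F U)" if "U \<in> opens" for U
    unfolding \<psi>_def by (rule bij_betw_inv_into[OF bij[OF that]])
  ultimately show ?thesis unfolding sheaf_iso_def by blast
qed

text \<open>The coefficients of a section are found at the generic point. Near each \<open>P\<close>
  the section has local coefficients, which agree with these by independence over the fraction
  field, so the coefficients are sections.\<close>

lemma ker_sheaf_free:
  assumes gen: "\<And>v d. v \<in> ker_module g \<Longrightarrow> hv homog (\<lambda>_. 0) d v \<Longrightarrow>
      \<exists>w. v = comb {..<2} B w \<and> (\<forall>j<2. homog (d + ds ! j) (w j))"
    and len: "length ds = 2" and B: "\<And>j. j < 2 \<Longrightarrow> B j \<in> ker_module g \<inter> Gr [0,0,0] (- (ds ! j))"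
    and inj: "\<And>x. (\<And>i. x 0 * emb (B 0 i) + x 1 * emb (B 1 i) = 0) \<Longrightarrow> x 0 = 0 \<and> x (1::nat) = 0"
  shows "sheaf_iso (O_sum ds) (ker_sheaf g)"
proof -
  define \<phi> where "\<phi> = mat_hom 2 B"
  have \<phi>: "\<phi> x i = x 0 * emb (B 0 i) + x 1 * emb (B 1 i)" for x i by (simp add: \<phi>_def mat_hom_def numeral_2_eq_2)
  have Bk: "(\<Sum>i<3. g i * B j i) = 0" "\<And>i. i \<ge> 3 \<Longrightarrow> B j i = 0" if "j < 2" for j using B[OF that] by (auto simp: ker_module_def)
  have into: "\<phi> x \<in> ker_sheaf g U" if U: "U \<in> opens" and x: "x \<in> O_sum ds U" for U x
  proof -
    have "mat_hom (length ds) B x \<in> O_sum [0,0,0] U"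
    proof (rule mat_hom_O_sum[OF U x])
      fix j i :: nat assume j: "j < length ds"
      have "B j \<in> Gr [0,0,0] (- (ds ! j))" using B j len by simp
      then show "i < length [0,0,0::int] \<Longrightarrow> homog ([0,0,0] ! i - ds ! j) (B j i)" unfolding Gr_def by fastforce
      show "i \<ge> length [0,0,0::int] \<Longrightarrow> B j i = 0" using Bk(2) j len by simp
    qed
    moreover have "(\<Sum>i<3. emb (g i) * \<phi> x i) = x 0 * emb (\<Sum>i<3. g i * B 0 i) + x 1 * emb (\<Sum>i<3. g i * B 1 i)"
      by (simp add: \<phi> emb_sum sum_lt3 algebra_simps)
    ultimately show ?thesis using Bk(1)[of 0] Bk(1)[of 1] len by (simp add: ker_sheaf_def \<phi>_def)
  qed
  have eq0: "x 0 = y 0 \<and> x 1 = y (1::nat)" if "\<And>i. \<phi> x i = \<phi> y i" for x y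
    using inj[of "\<lambda>j. x j - y j"] that unfolding \<phi> by (simp add: algebra_simps)
  have ext: "x = y" if "U \<in> opens" "x \<in> O_sum ds U" "y \<in> O_sum ds U" "\<phi> x = \<phi> y" for U x y
  proof (rule ext)
    fix i :: nat
    have "i = 0 \<or> i = 1 \<or> i \<ge> 2" by linarith
    then show "x i = y i" using that eq0[of x y] len unfolding O_sum_def by auto
  qed
  have local: "\<exists>b e w. homog e b \<and> b \<notin> P \<and> b \<noteq> 0 \<and> (\<forall>j<2. homog (e + ds ! j) (w j)) \<and> (\<forall>i. emb b * s i = \<phi> (\<lambda>j. emb (w j)) i)"
    if U: "U \<in> opens" and s: "s \<in> ker_sheaf g U" and P: "P \<in> U" for U s P
  proof -
    have "s j \<in> O_twist 0 U" if "j < 3" for j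
      using s that unfolding ker_sheaf_def O_sum_def by (auto simp: numeral_3_eq_3 less_Suc_eq)
    then obtain b c e where b: "homog e b" "b \<notin> P" "b \<noteq> 0" "\<forall>j<3. homog (0 + e) (c j) \<and> emb b * s j = emb (c j)"
      using common_denominator[OF U _ P, of 3 s "\<lambda>_. 0"] by blast
    define v where "v i = (if i < 3 then c i else 0)" for i
    have "emb (\<Sum>i<3. g i * v i) = (\<Sum>i<3. emb (g i) * emb (c i))" by (simp add: emb_sum v_def)
    also have "\<dots> = (\<Sum>i<3. emb (g i) * (emb b * s i))" by (rule sum.cong) (use b in auto)
    also have "\<dots> = emb b * (\<Sum>i<3. emb (g i) * s i)" by (simp add: sum_distrib_left ac_simps)
    also have "\<dots> = 0" using s by (simp add: ker_sheaf_def)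
    finally have "v \<in> ker_module g" by (simp add: ker_module_def v_def)
    moreover have "hv homog (\<lambda>_. 0) e v" using b(4) by (auto simp: hv_def v_def)
    ultimately obtain w where w: "v = comb {..<2} B w" "\<forall>j<2. homog (e + ds ! j) (w j)" using gen by blast
    have "emb b * s i = emb (v i)" for i
      using b(4) s by (cases "i < 3") (auto simp: v_def ker_sheaf_def O_sum_def)
    moreover have "emb (v i) = \<phi> (\<lambda>j. emb (w j)) i" for i
      by (simp add: w(1) comb_def \<phi> numeral_2_eq_2)
    ultimately show ?thesis using b w(2) by metis
  qed
  have onto: "\<exists>x\<in>O_sum ds U. \<phi> x = s" if U: "U \<in> opens" and s: "s \<in> ker_sheaf g U" for U s
  proof -
    obtain b0 e0 w0 where 0: "b0 \<noteq> 0" "\<And>i. emb b0 * s i = \<phi> (\<lambda>j. emb (w0 j)) i"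
      using local[OF U s generic_in_opens[OF U]] by blast
    define x where "x j = (if j < 2 then emb (w0 j) / emb b0 else 0)" for j :: nat
    have nz: "emb b0 \<noteq> 0" using 0(1) by simp
    have xs: "\<phi> x i = s i" for i
    proof -
      have "emb b0 * \<phi> x i = \<phi> (\<lambda>j. emb (w0 j)) i" using nz by (simp add: \<phi> x_def field_simps)
      then have "emb b0 * \<phi> x i = emb b0 * s i" using 0(2) by simp
      then show ?thesis using nz by simp
    qed
    have "x j \<in> O_twist (ds ! j) U" if j: "j < 2" for j
    proof (rule O_twistI[OF U])
      fix P assume P: "P \<in> U"
      obtain b e w where b: "homog e b" "b \<notin> P" "\<forall>j<2. homog (e + ds ! j) (w j)" "\<And>i. emb b * s i = \<phi> (\<lambda>j. emb (w j)) i"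
        using local[OF U s P] by blast
      have "\<phi> (\<lambda>j. emb b * x j) i = \<phi> (\<lambda>j. emb (w j)) i" for i
      proof -
        have "\<phi> (\<lambda>j. emb b * x j) i = emb b * \<phi> x i" by (simp add: \<phi> algebra_simps)
        then show ?thesis using b(4)[of i] xs[of i] by simp
      qed
      then have "emb b * x 0 = emb (w 0) \<and> emb b * x 1 = emb (w 1)" using eq0[of "\<lambda>j. emb b * x j" "\<lambda>j. emb (w j)"] by blast
      then have "emb b * x j = emb (w j)" using j by (auto simp: numeral_2_eq_2 less_Suc_eq)
      moreover have "homog (ds ! j + e) (w j)" using b(3) j by (simp add: add.commute)
      ultimately show "\<exists>a b e. homog (ds ! j + e) a \<and> homog e b \<and> b \<notin> P \<and> emb b * x j = emb a" using b(1,2) by blast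
    qed
    then have "x \<in> O_sum ds U" unfolding O_sum_def len by (auto simp: x_def)
    then show ?thesis using xs by (intro bexI[of _ x]) auto
  qed
  have bij: "bij_betw \<phi> (O_sum ds U) (ker_sheaf g U)" if U: "U \<in> opens" for U
    unfolding bij_betw_def
  proof
    show "inj_on \<phi> (O_sum ds U)" using ext[OF U] by (auto intro: inj_onI)
    show "\<phi> ` O_sum ds U = ker_sheaf g U" using into[OF U] onto[OF U] by (auto simp: image_iff)
  qed
  have hom: "sheaf_hom (O_sum ds) (ker_sheaf g) (\<lambda>_. \<phi>)" unfolding \<phi>_def
    by (rule mat_hom_sheaf_hom) (use into in \<open>simp add: \<phi>_def\<close>)
  show ?thesis unfolding sheaf_iso_def using hom bij by blast
qed

text \<open>The determinant with \<open>Eul\<close> is divisible by \<open>f\<close> and has degree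
  \<open>1 + a + b = m\<close>, so it is a nonzero constant times \<open>f\<close>. In Cramer's rule
  all determinants are divisible by \<open>f\<close>, hence the coefficients are polynomials; on the
  kernel module the one of \<open>Eul\<close> vanishes, as seen by applying the derivation to
  \<open>f\<close>.\<close>

theorem saito:
  assumes sa: "simple_arr A" and ne: "A \<noteq> {}" and s: "s \<in> DA A a" and t: "t \<in> DA A b"
    and ab: "a + b + 1 = int (card A)" and det: "detS Eul s t \<noteq> 0"
  shows "sheaf_iso (ker_sheaf (grad A)) (O_sum [- a, - b])"
proof -
  obtain q q' where s': "(\<lambda>i. s i - q * Eul i) \<in> ker_module (grad A) \<inter> Gr [0,0,0] a"
    and t': "(\<lambda>i. t i - q' * Eul i) \<in> ker_module (grad A) \<inter> Gr [0,0,0] b"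
    using project_ker[OF sa ne s] project_ker[OF sa ne t] by blast
  define S where "S = (\<lambda>i. s i - q * Eul i)"
  define T where "T = (\<lambda>i. t i - q' * Eul i)"
  have det': "detS Eul S T \<noteq> 0" unfolding S_def T_def detS_col by (rule det)
  have SM: "S \<in> ker_module (grad A)" "T \<in> ker_module (grad A)" and SG: "S \<in> Gr [0,0,0] a" "T \<in> Gr [0,0,0] b"
    using s' t' by (auto simp: S_def T_def)
  have SD: "S \<in> Dmod A" "T \<in> Dmod A" using SM ker_module_subset_Dmod[OF sa] by auto
  have EG: "Eul \<in> Gr [0,0,0] 1" using homog_X by (simp add: Gr3_iff Eul_def)
  obtain p where p: "detS Eul S T = defpoly A * p" using dvd_detS[OF sa Eul_Dmod SD] by blast
  have "homog (0 + int (card A)) (p * defpoly A)" using detS_homog[OF EG SG] ab p by (simp add: algebra_simps)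
  then have "homog 0 p" by (rule homog_cancel[OF homog_defpoly(1)[OF sa] homog_defpoly(2)[OF sa]])
  then obtain c where c: "p = cst c" using homog_0_cst by blast
  then have c0: "c \<noteq> 0" using det' p by auto
  define B where "B j = (if j = 0 then S else T)" for j :: nat
  have fnz: "defpoly A \<noteq> 0" by (rule homog_defpoly(2)[OF sa])
  have cc: "cst (1 / c) * cst c = 1" using c0 by (simp flip: cst_simps(4))
  have h: "hv homog (\<lambda>_. 0) (- ([- a, - b] ! j)) (B j)" if "j \<in> {..<2}" for j
    using SG Gr_iff[of S "[0,0,0]" a] Gr_iff[of T "[0,0,0]" b] that by (auto simp: B_def wt_zeros numeral_2_eq_2 less_Suc_eq)
  have gens: "\<exists>w. v = comb {..<2} B w" if v: "v \<in> ker_module (grad A)" for v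
  proof -
    have vD: "v \<in> Dmod A" using v ker_module_subset_Dmod[OF sa] by blast
    obtain x0 x1 x2 where x: "detS v S T = defpoly A * x0" "detS Eul v T = defpoly A * x1" "detS Eul S v = defpoly A * x2"
      using dvd_detS[OF sa vD SD] dvd_detS[OF sa Eul_Dmod vD SD(2)] dvd_detS[OF sa Eul_Dmod SD(1) vD] by blast
    define y where "y z = cst (1 / c) * z" for z
    have v3: "v i = y x0 * Eul i + y x1 * S i + y x2 * T i" if "i < 3" for i
    proof -
      have "defpoly A * (cst c * v i) = defpoly A * (x0 * Eul i + x1 * S i + x2 * T i)"
        using cramer[OF that, of Eul S T v] unfolding x p c by (simp add: algebra_simps)
      then have "cst c * v i = x0 * Eul i + x1 * S i + x2 * T i" using fnz by simp
      then have "cst (1 / c) * (cst c * v i) = y x0 * Eul i + y x1 * S i + y x2 * T i" by (simp add: y_def algebra_simps)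
      moreover have "cst (1 / c) * (cst c * v i) = v i" unfolding mult.assoc[symmetric] cc by simp
      ultimately show ?thesis by simp
    qed
    have z: "v i = 0" "Eul i = 0" "S i = 0" "T i = 0" if "\<not> i < 3" for i
      using that v SM by (auto simp: ker_module_def Eul_def)
    have veq: "v = (\<lambda>i. y x0 * Eul i + (y x1 * S i + y x2 * T i))"
    proof
      fix i show "v i = y x0 * Eul i + (y x1 * S i + y x2 * T i)" using v3[of i] z[of i] by (cases "i < 3") (auto simp: add.assoc)
    qed
    have "app A v = y x0 * app A Eul"
    proof -
      have "app A S = 0" "app A T = 0" using SM by (auto simp: ker_module_app)
      then show ?thesis by (subst veq) (simp only: app_add app_scale mult_zero_right add_0_right)
    qed
    moreover have "app A v = 0" using v by (simp add: ker_module_app)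
    ultimately have "y x0 * (cst (real (card A)) * defpoly A) = 0" by (simp add: app_Eul[OF sa])
    then have "y x0 = 0" using fnz ne sa by (auto simp: simple_arr_def)
    then have "v = comb {..<2} B (\<lambda>j. if j = 0 then y x1 else y x2)"
      by (subst veq) (simp add: comb_def B_def numeral_2_eq_2)
    then show ?thesis by blast
  qed
  have BM: "B j \<in> ker_module (grad A) \<inter> Gr [0,0,0] (- ([- a, - b] ! j))" if "j < 2" for j
    using SM SG that by (auto simp: B_def numeral_2_eq_2 less_Suc_eq)
  have gen: "generates {..<2} B (ker_module (grad A))" unfolding generates_def using gens BM by auto
  have iso: "sheaf_iso (O_sum [- a, - b]) (ker_sheaf (grad A))"
  proof (rule ker_sheaf_free[where B = B])
    fix v d assume v: "v \<in> ker_module (grad A)" "hv homog (\<lambda>_. 0) d v"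
    obtain w where w: "v = comb {..<2} B w" "\<And>j. homog (d - (- ([- a, - b] ! j))) (w j)"
      using g3.generates_homogeneous[OF gen h v] by blast
    then show "\<exists>w. v = comb {..<2} B w \<and> (\<forall>j<2. homog (d + [- a, - b] ! j) (w j))" by auto
  next
    show "length [- a, - b] = 2" by simp
    show "B j \<in> ker_module (grad A) \<inter> Gr [0,0,0] (- ([- a, - b] ! j))" if "j < 2" for j by (rule BM[OF that])
    fix x :: tup assume "\<And>i. x 0 * emb (B 0 i) + x 1 * emb (B 1 i) = 0"
    then have x: "x 0 * emb (S i) + x 1 * emb (T i) = 0" for i by (simp add: B_def)
    \<comment> \<open>Substituted into the determinant, the relation makes two columns
      proportional.\<close>
    have x0: "x 0 * emb (S i) = - (x 1 * emb (T i))" and x1: "x 1 * emb (T i) = - (x 0 * emb (S i))" for i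
      using x[of i] by (simp_all add: eq_neg_iff_add_eq_0 add.commute)
    have "x 0 * emb (detS Eul S T) = emb (Eul 0) * ((x 0 * emb (S 1)) * emb (T 2) - (x 0 * emb (S 2)) * emb (T 1))
       - emb (Eul 1) * ((x 0 * emb (S 0)) * emb (T 2) - (x 0 * emb (S 2)) * emb (T 0))
       + emb (Eul 2) * ((x 0 * emb (S 0)) * emb (T 1) - (x 0 * emb (S 1)) * emb (T 0))"
      by (simp add: detS_def algebra_simps)
    also have "\<dots> = 0" unfolding x0 by (simp add: algebra_simps)
    finally have "x 0 = 0" using det' by simp
    have "x 1 * emb (detS Eul S T) = emb (Eul 0) * (emb (S 1) * (x 1 * emb (T 2)) - emb (S 2) * (x 1 * emb (T 1)))
       - emb (Eul 1) * (emb (S 0) * (x 1 * emb (T 2)) - emb (S 2) * (x 1 * emb (T 0)))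
       + emb (Eul 2) * (emb (S 0) * (x 1 * emb (T 1)) - emb (S 1) * (x 1 * emb (T 0)))"
      by (simp add: detS_def algebra_simps)
    also have "\<dots> = 0" unfolding x1 by (simp add: algebra_simps)
    finally have "x 1 = 0" using det' by simp
    then show "x 0 = 0 \<and> x 1 = 0" using \<open>x 0 = 0\<close> by simp
  qed
  show ?thesis
    by (rule sheaf_iso_sym[OF iso]) (auto intro: O_sum_add O_sum_scale O_sum_restrict)
qed

section \<open>A line with many points\<close>

text \<open>Twice the sum of the positive integers up to \<open>x\<close>: the primitive of the
  terms \<open>nat _\<close> in \<open>restrict_out\<close>, here with factor 2.\<close>

definition tri :: "int \<Rightarrow> int" where "tri x = (if x \<le> 0 then 0 else x * (x + 1))"

lemma tri_step: "tri x = tri (x - 1) + 2 * int (nat x)"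
proof (cases "x \<ge> 2")
  case True
  then show ?thesis by (simp add: tri_def algebra_simps)
next
  case False
  then have "x = 1 \<or> x \<le> 0" by linarith
  then show ?thesis by (auto simp: tri_def)
qed

lemma int_mono:
  fixes E :: "int \<Rightarrow> int"
  assumes "\<And>d. E (d - 1) \<le> E d" "x \<le> y"
  shows "E x \<le> E y"
  using assms(2)
proof (induct y rule: int_ge_induct)
  case (step i)
  then show ?case using assms(1)[of "i + 1"] by simp
qed simp

text \<open>\<open>E d\<close> is twice the deficit accumulated in the restriction bounds up to
  degree \<open>d\<close>. It starts at 0, never decreases, and equals \<open>2 (c2 - a b)\<close>
  in large degrees; so \<open>c2 <= a b\<close> makes it vanish throughout, and every bound is
  attained.\<close>

theorem independent_derivations:
  assumes sa: "simple_arr A" and h: "h \<noteq> 0" and rep: "reps h A C"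
    and a: "a = int (card C) - 1" "0 \<le> a" and b: "b = int (card A) - int (card C)" "0 \<le> b"
    and hilb: "\<And>d. d \<ge> d1 \<Longrightarrow> 2 * int (dim (DA A d)) = hpol (int (card A)) c2 d" and c2: "c2 \<le> a * b"
  shows "c2 = a * b \<and> (\<exists>s\<in>DA A a. \<exists>t\<in>DA A b. detS Eul s t \<noteq> 0)"
proof -
  define E where "E d = tri d + tri (d + 1 - a) + tri (d + 1 - b) - 2 * int (dim (DA A d))" for d
  define u where "u d = nat d + nat (d + 2 - int (card C)) + nat (d + 1 - (int (card A) - int (card C)))" for d
  have tu: "tri d + tri (d + 1 - a) + tri (d + 1 - b) = tri (d - 1) + tri (d - 1 + 1 - a) + tri (d - 1 + 1 - b) + 2 * int (u d)" for d
    using tri_step[of d] tri_step[of "d + 1 - a"] tri_step[of "d + 1 - b"] unfolding u_def a(1) b(1) by (simp add: algebra_simps)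
  have step: "dim (DA A d) \<le> dim (DA A (d - 1)) + u d" for d
    using restrict_out(1)[OF sa h rep, of d] by (simp add: u_def)
  have mono: "E (d - 1) \<le> E d" for d unfolding E_def using tu[of d] step[of d] by linarith
  have neg: "E d = 0" if "d < 0" for d
  proof -
    have "dim (DA A d) \<le> dim (Gr [0,0,0] d)" by (rule dim_mono_findim[OF Gr_space(2)]) (auto simp: DA_def)
    also have "\<dots> = 0" unfolding Gr_space(3) using homog_space(4)[OF that] by simp
    finally show ?thesis using that a(2) b(2) by (simp add: E_def tri_def)
  qed
  have large: "E d = 2 * (c2 - a * b)" if d: "d \<ge> max (max d1 0) (a + b + 1)" for d
  proof -
    have t: "tri d = d * (d + 1)" "tri (d + 1 - a) = (d + 1 - a) * (d + 2 - a)" "tri (d + 1 - b) = (d + 1 - b) * (d + 2 - b)"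
      using d a(2) b(2) by (auto simp: tri_def)
    have m: "int (card A) = a + b + 1" using a b by simp
    show ?thesis unfolding E_def t using hilb[of d] d unfolding hpol_def m by (simp add: algebra_simps power2_eq_square)
  qed
  let ?D = "max (max d1 0) (a + b + 1)"
  have ge: "0 \<le> E d" for d using int_mono[of E, OF mono, of "min d (-1)" d] neg[of "min d (-1)"] by simp
  have le: "E d \<le> 0" for d using int_mono[of E, OF mono, of d "max d ?D"] large[of "max d ?D"] c2 by simp
  have E0: "E d = 0" for d using ge[of d] le[of d] by simp
  have c2eq: "c2 = a * b" using large[of ?D] E0[of ?D] by simp
  have "dim (DA A d) = dim (DA A (d - 1)) + u d" for d
  proof -
    have "2 * int (dim (DA A d)) = 2 * int (dim (DA A (d - 1))) + 2 * int (u d)"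
      using E0[of d] E0[of "d - 1"] tu[of d] unfolding E_def by linarith
    then show ?thesis by linarith
  qed
  then have ex: "\<exists>s\<in>DA A (int (card C) - 1). \<exists>t\<in>DA A (int (card A) - int (card C)). detS Eul s t \<noteq> 0"
    unfolding u_def add.assoc[symmetric] by (rule restrict_out(2)[OF sa h rep])
  from c2eq ex[folded a(1) b(1)] show ?thesis by (rule conjI)
qed

section \<open>Chern classes of a split bundle\<close>

lemma ker_sheaf_closed:
  shows "U \<in> opens \<Longrightarrow> s \<in> ker_sheaf g U \<Longrightarrow> t \<in> ker_sheaf g U \<Longrightarrow> (\<lambda>i. s i + t i) \<in> ker_sheaf g U"
    and "U \<in> opens \<Longrightarrow> a \<in> O_twist 0 U \<Longrightarrow> s \<in> ker_sheaf g U \<Longrightarrow> (\<lambda>i. a * s i) \<in> ker_sheaf g U"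
    and "V \<subseteq> U \<Longrightarrow> s \<in> ker_sheaf g U \<Longrightarrow> s \<in> ker_sheaf g V"
proof -
  show "(\<lambda>i. s i + t i) \<in> ker_sheaf g U" if "U \<in> opens" "s \<in> ker_sheaf g U" "t \<in> ker_sheaf g U"
    using that O_sum_add[of U s "[0,0,0]" t] by (simp add: ker_sheaf_def distrib_left sum.distrib)
  show "(\<lambda>i. a * s i) \<in> ker_sheaf g U" if "U \<in> opens" "a \<in> O_twist 0 U" "s \<in> ker_sheaf g U"
    using that O_sum_scale[of U a s "[0,0,0]"] by (simp add: ker_sheaf_def mult.left_commute[of _ a] sum_distrib_left[symmetric])
  show "s \<in> ker_sheaf g V" if "V \<subseteq> U" "s \<in> ker_sheaf g U"
    using that O_sum_restrict[of s "[0,0,0]" U V] by (simp add: ker_sheaf_def)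
qed

lemma zero_in_O_sum: "U \<in> opens \<Longrightarrow> (\<lambda>_. 0) \<in> O_sum ds U"
  by (simp add: O_sum_def O_zero)

text \<open>An isomorphism is a resolution of length 0, with zero sheaves in all further
  places.\<close>

lemma split_resolution:
  assumes iso: "sheaf_iso (O_sum ds) E"
  shows "is_resolution E [ds]"
proof -
  obtain \<phi> where hom: "sheaf_hom (O_sum ds) E \<phi>" and bij: "\<And>U. U \<in> opens \<Longrightarrow> bij_betw (\<phi> U) (O_sum ds U) (E U)"
    using iso unfolding sheaf_iso_def by blast
  have z: "\<phi> U (\<lambda>_. 0) = (\<lambda>_. 0)" if U: "U \<in> opens" for U
  proof -
    have "\<forall>s\<in>O_sum ds U. \<forall>t\<in>O_sum ds U. \<phi> U (\<lambda>i. s i + t i) = (\<lambda>i. \<phi> U s i + \<phi> U t i)"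
      using hom U unfolding sheaf_hom_def by blast
    from bspec[OF bspec[OF this zero_in_O_sum[OF U]] zero_in_O_sum[OF U]]
    have "\<phi> U (\<lambda>_. 0) = (\<lambda>i. \<phi> U (\<lambda>_. 0) i + \<phi> U (\<lambda>_. 0) i)" by simp
    then have "\<phi> U (\<lambda>_. 0) i = \<phi> U (\<lambda>_. 0) i + \<phi> U (\<lambda>_. 0) i" for i by (rule fun_cong)
    then show ?thesis by (intro ext) simp
  qed
  have r0: "res_term [ds] 0 = O_sum ds" and rS: "res_term [ds] (Suc j) = O_sum []" for j by (simp_all add: res_term_def)
  have nil: "s = (\<lambda>_. 0)" if "s \<in> O_sum [] U" for s U using that by (auto simp: O_sum_def)
  have im: "in_image_sheaf (O_sum []) (\<lambda>_ _ _. 0) U s \<longleftrightarrow> s = (\<lambda>_. 0)" if U: "U \<in> opens" for U s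
  proof
    assume "in_image_sheaf (O_sum []) (\<lambda>_ _ _. 0) U s"
    then obtain V where "\<exists>t\<in>O_sum [] V. (\<lambda>_. 0) = s" unfolding in_image_sheaf_def using generic_in_opens[OF U] by meson
    then show "s = (\<lambda>_. 0)" by blast
  next
    assume s: "s = (\<lambda>_. 0)"
    show "in_image_sheaf (O_sum []) (\<lambda>_ _ _. 0) U s"
      unfolding in_image_sheaf_def s
      by (intro ballI bexI[of _ U] conjI bexI[of _ "\<lambda>_. 0"]) (use U zero_in_O_sum[OF U, of "[]"] in auto)
  qed
  have zero_hom: "sheaf_hom (O_sum []) (O_sum ds') (\<lambda>_ _ _. 0)" for ds'
    unfolding sheaf_hom_def by (simp add: zero_in_O_sum)
  show ?thesis
    unfolding is_resolution_def
  proof (intro exI[of _ \<phi>] exI[of _ "\<lambda>_ _ _ _. 0"] conjI allI ballI)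
    show "sheaf_hom (res_term [ds] 0) E \<phi>" unfolding r0 by (rule hom)
    show "sheaf_hom (res_term [ds] (Suc j)) (res_term [ds] j) (\<lambda>_ _ _. 0)" for j
      unfolding rS unfolding res_term_def by (rule zero_hom)
    fix U assume U: "U \<in> opens"
    show "in_image_sheaf (res_term [ds] 0) \<phi> U s" if "s \<in> E U" for s
    proof -
      have "s \<in> \<phi> U ` O_sum ds U" using bij[OF U] that by (simp add: bij_betw_def)
      then obtain t where t: "t \<in> O_sum ds U" "\<phi> U t = s" by blast
      show ?thesis unfolding in_image_sheaf_def r0
        by (intro ballI bexI[of _ U] conjI bexI[of _ t]) (use U t in auto)
    qed
    show "\<phi> U s = (\<lambda>_. 0) \<longleftrightarrow> in_image_sheaf (res_term [ds] 1) (\<lambda>_ _ _. 0) U s" if s: "s \<in> res_term [ds] 0 U" for s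
    proof -
      have "\<phi> U s = (\<lambda>_. 0) \<longleftrightarrow> s = (\<lambda>_. 0)"
        using bij[OF U] z[OF U] s zero_in_O_sum[OF U, of ds] unfolding r0 bij_betw_def by (metis inj_onD)
      then show ?thesis using im[OF U] rS[of 0] by simp
    qed
    show "(\<lambda>_. 0) = (\<lambda>_. 0) \<longleftrightarrow> in_image_sheaf (res_term [ds] (Suc (Suc j))) (\<lambda>_ _ _. 0) U s"
      if "s \<in> res_term [ds] (Suc j) U" for j s
      using that nil[of s U] im[OF U, of s] unfolding rS by simp
  qed
qed

lemma split_chern:
  assumes "sheaf_iso (O_sum [- a, - b]) E"
  shows "has_chern_classes E (- (a + b)) (a * b)"
proof -
  have j: "{j. j < length [[- a, - b]] \<and> odd j} = {}" "{j. j < length [[- a, - b]] \<and> even j} = {0}"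
    by (auto simp: odd_pos)
  have "[:1, - (a + b), a * b:] * (\<Prod>j | j < length [[- a, - b]] \<and> odd j. chern_sum ([[- a, - b]] ! j)) -
       (\<Prod>j | j < length [[- a, - b]] \<and> even j. chern_sum ([[- a, - b]] ! j)) = 0"
    unfolding j by (simp add: chern_sum_def)
  then have "monom 1 3 dvd [:1, - (a + b), a * b:] * (\<Prod>j | j < length [[- a, - b]] \<and> odd j. chern_sum ([[- a, - b]] ! j)) -
       (\<Prod>j | j < length [[- a, - b]] \<and> even j. chern_sum ([[- a, - b]] ! j))"
    by (simp only: dvd_0_right)
  then show ?thesis unfolding has_chern_classes_def using split_resolution[OF assms] by blast
qed

lemma chern2_eq:
  assumes "\<And>i. i < 3 \<Longrightarrow> homog D (g i)" "has_chern_classes (ker_sheaf g) c1 c2"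
  shows "chern2 (ker_sheaf g) = c2"
  unfolding chern2_def
proof (rule the_equality)
  show "\<exists>c1. has_chern_classes (ker_sheaf g) c1 c2" using assms(2) by blast
  show "c = c2" if "\<exists>c1. has_chern_classes (ker_sheaf g) c1 c" for c
    using that chern_unique[OF assms(1) _ assms(2)] by blast
qed

section \<open>Points and lines\<close>

lemma in_plane:
  assumes w: "cross3 x y \<noteq> 0" and z: "z \<bullet> cross3 x y = 0"
  shows "\<exists>s t. z = s *\<^sub>R x + t *\<^sub>R y"
proof -
  let ?w = "cross3 x y"
  have wx: "cross3 ?w x = (x \<bullet> x) *\<^sub>R y - (x \<bullet> y) *\<^sub>R x" and wy: "cross3 ?w y = (y \<bullet> x) *\<^sub>R y - (y \<bullet> y) *\<^sub>R x"
    unfolding cross_skew[of ?w x] cross_skew[of ?w y] Lagrange_cross by simp_all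
  have "(?w \<bullet> ?w) *\<^sub>R z = cross3 ?w (cross3 z ?w)"
    using Lagrange_cross[of ?w z ?w] z by (simp add: inner_commute[of ?w z])
  also have "\<dots> = (z \<bullet> y) *\<^sub>R cross3 ?w x - (z \<bullet> x) *\<^sub>R cross3 ?w y"
    unfolding Lagrange_cross[of z x y] by (simp only: Cross3.right_diff_distrib cross_mult_right)
  also have "\<dots> = ((z \<bullet> x) * (y \<bullet> y) - (z \<bullet> y) * (x \<bullet> y)) *\<^sub>R x + ((z \<bullet> y) * (x \<bullet> x) - (z \<bullet> x) * (y \<bullet> x)) *\<^sub>R y"
    unfolding wx wy by (simp add: algebra_simps)
  finally have e: "(?w \<bullet> ?w) *\<^sub>R z =
      ((z \<bullet> x) * (y \<bullet> y) - (z \<bullet> y) * (x \<bullet> y)) *\<^sub>R x + ((z \<bullet> y) * (x \<bullet> x) - (z \<bullet> x) * (y \<bullet> x)) *\<^sub>R y" .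
  have "?w \<bullet> ?w \<noteq> 0" using w by simp
  then have "z = (1 / (?w \<bullet> ?w)) *\<^sub>R ((?w \<bullet> ?w) *\<^sub>R z)" by simp
  then have "z = (1 / (?w \<bullet> ?w) * ((z \<bullet> x) * (y \<bullet> y) - (z \<bullet> y) * (x \<bullet> y))) *\<^sub>R x
      + (1 / (?w \<bullet> ?w) * ((z \<bullet> y) * (x \<bullet> x) - (z \<bullet> x) * (y \<bullet> x))) *\<^sub>R y"
    unfolding e scaleR_add_right scaleR_scaleR .
  then show ?thesis by (intro exI)
qed

lemma cross3_eq_0_imp:
  assumes "cross3 x y = 0" "x \<noteq> 0"
  shows "\<exists>c. y = c *\<^sub>R x"
  using assms collinear_lemma[of x y] unfolding cross_eq_0 by (metis scaleR_zero_left)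

text \<open>Of the lines through each of the three points at most one is a representative. At least
  \<open>k - 2\<close>, 1 and 1 others are left, and they are distinct because a line through two of
  the points would be \<open>h\<close>.\<close>

lemma card_reps_le:
  assumes sa: "simple_arr A" and h: "h \<noteq> 0" and rep: "reps h A C"
    and hp: "h \<bullet> p0 = 0" "h \<bullet> p1 = 0" "h \<bullet> p2 = 0"
    and ind: "cross3 p0 p1 \<noteq> 0" "cross3 p0 p2 \<noteq> 0" "cross3 p1 p2 \<noteq> 0"
    and mult: "card {a \<in> A. a \<bullet> p0 = 0} + 1 = k" "2 \<le> card {a \<in> A. a \<bullet> p1 = 0}" "2 \<le> card {a \<in> A. a \<bullet> p2 = 0}"
  shows "card C + k \<le> card A"
proof -
  define G where "G p = {a \<in> A. a \<bullet> p = 0}" for p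
  have fin: "finite A" "finite (G p)" "finite C" and CA: "C \<subseteq> A" for p
    using sa rep by (auto simp: simple_arr_def G_def reps_def intro: finite_subset)
  have noh: "a \<noteq> t *\<^sub>R h" if "a \<in> A" for a t using rep that unfolding reps_def by blast
  have one: "card (G p) \<le> card (G p - C) + 1" if p: "p \<noteq> 0" "h \<bullet> p = 0" for p
  proof -
    have "c = c'" if c: "c \<in> G p \<inter> C" "c' \<in> G p \<inter> C" for c c'
    proof (rule ccontr)
      assume ne: "c \<noteq> c'"
      have cA: "c' \<in> A" using c CA by blast
      have w: "cross3 c' h \<noteq> 0"
      proof
        assume "cross3 c' h = 0"
        then have "cross3 h c' = 0" using cross_skew[of h c'] by simp
        then show False using cross3_eq_0_imp[of h c'] h noh[OF cA] by blast
      qed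
      have "p \<bullet> c' = 0" "p \<bullet> h = 0" using c p by (simp_all add: G_def inner_commute)
      then obtain l where l: "p = l *\<^sub>R cross3 c' h" using orth_cross[OF w, of p] by blast
      then have "c \<bullet> cross3 c' h = 0" using c(1) p(1) by (auto simp: G_def)
      then show False using in_plane[OF w] rep c ne unfolding reps_def by blast
    qed
    then have "card (G p \<inter> C) \<le> 1" by (metis card_le_Suc0_iff_eq One_nat_def fin(2) finite_Int)
    moreover have "card (G p) = card (G p - C) + card (G p \<inter> C)"
      using card_Int_Diff[OF fin(2), of p C] by simp
    ultimately show ?thesis by linarith
  qed
  have disj: "G p \<inter> G q = {}" if "cross3 p q \<noteq> 0" "h \<bullet> p = 0" "h \<bullet> q = 0" for p q
    using orth_pair[OF that(1) _ _ that(2,3) h] noh unfolding G_def by blast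
  have nz: "p0 \<noteq> 0" "p1 \<noteq> 0" "p2 \<noteq> 0" using ind by auto
  have "card (G p0 - C \<union> (G p1 - C) \<union> (G p2 - C)) = card (G p0 - C) + card (G p1 - C) + card (G p2 - C)"
    using disj[OF ind(1) hp(1,2)] disj[OF ind(2) hp(1,3)] disj[OF ind(3) hp(2,3)] fin(2)
    by (subst card_Un_disjoint, (auto)[3], subst card_Un_disjoint) auto
  moreover have "card (G p0 - C \<union> (G p1 - C) \<union> (G p2 - C)) \<le> card (A - C)"
    by (rule card_mono) (use fin in \<open>auto simp: G_def\<close>)
  moreover have "card (A - C) = card A - card C" by (rule card_Diff_subset[OF fin(3) CA])
  moreover have "card C \<le> card A" by (rule card_mono[OF fin(1) CA])
  ultimately show ?thesis using one[OF nz(1) hp(1)] one[OF nz(2) hp(2)] one[OF nz(3) hp(3)] mult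
    unfolding G_def[symmetric] by linarith
qed

text \<open>A plane through the origin contains only finitely many points of the moment curve
  \<open>(1, t, t^2)\<close>.\<close>

lemma generic_vector:
  assumes "finite Z" "0 \<notin> (Z :: (real^3) set)"
  shows "\<exists>e. \<forall>z\<in>Z. z \<bullet> e \<noteq> 0"
proof -
  define q where "q z = [:z $ 1, z $ 2, z $ 3:]" for z :: "real^3"
  define e :: "real \<Rightarrow> real^3" where "e t = (\<chi> i. if i = 1 then 1 else if i = 2 then t else t\<^sup>2)" for t
  have pe: "poly (q z) t = z \<bullet> e t" for z t
    by (simp add: q_def e_def inner_vec_def sum_3 algebra_simps power2_eq_square)
  have "q z \<noteq> 0" if "z \<in> Z" for z
  proof
    assume "q z = 0"
    then have "z = 0" by (simp add: q_def vec_eq_iff forall_3)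
    then show False using that assms(2) by simp
  qed
  then have "finite {t. poly (q z) t = 0}" if "z \<in> Z" for z using that by (simp add: poly_roots_finite)
  then have "finite (\<Union>z\<in>Z. {t. poly (q z) t = 0})" using assms(1) by blast
  then obtain t where "t \<notin> (\<Union>z\<in>Z. {t. poly (q z) t = 0})" using ex_new_if_finite[OF infinite_UNIV_char_0] by blast
  then have "\<forall>z\<in>Z. z \<bullet> e t \<noteq> 0" using pe by auto
  then show ?thesis by blast
qed

text \<open>The forms that do not vanish at \<open>p0\<close> are rescaled to have value 1 there, so that the dual points lie in an affine plane.\<close>

lemma normalise:
  assumes sa: "simple_arr A"
  shows "\<exists>K B. simple_arr (K \<union> B) \<and> (\<forall>a\<in>K. a \<bullet> p0 = 0) \<and> (\<forall>b\<in>B. b \<bullet> p0 = 1) \<and> card (K \<union> B) = card A \<and>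
    card K = card {a \<in> A. a \<bullet> p0 = 0} \<and> (\<forall>d. DA (K \<union> B) d = DA A d) \<and>
    (\<forall>p. card {a \<in> K \<union> B. a \<bullet> p = 0} = card {a \<in> A. a \<bullet> p = 0}) \<and> (\<forall>b\<in>K \<union> B. \<exists>c. \<exists>a\<in>A. c \<noteq> 0 \<and> b = c *\<^sub>R a)"
proof -
  define u where "u a = (if a \<bullet> p0 = 0 then 1 else 1 / (a \<bullet> p0))" for a
  define \<phi> where "\<phi> a = u a *\<^sub>R a" for a
  have u: "u a \<noteq> 0" for a by (simp add: u_def)
  define K where "K = \<phi> ` {a \<in> A. a \<bullet> p0 = 0}"
  define B where "B = \<phi> ` {a \<in> A. a \<bullet> p0 \<noteq> 0}"
  have KB: "K \<union> B = \<phi> ` A" by (auto simp: K_def B_def)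
  have fin: "finite A" using sa by (simp add: simple_arr_def)
  have rel: "a' = (c * u a / u a') *\<^sub>R a" if "\<phi> a' = c *\<^sub>R \<phi> a" for a a' c
  proof -
    have "(1 / u a') *\<^sub>R (u a' *\<^sub>R a') = (1 / u a') *\<^sub>R (c *\<^sub>R (u a *\<^sub>R a))" using that by (simp add: \<phi>_def)
    then show ?thesis using u[of a'] by simp
  qed
  have inj: "inj_on \<phi> A"
  proof (rule inj_onI, rule ccontr)
    fix a a' assume a: "a \<in> A" "a' \<in> A" "\<phi> a = \<phi> a'" "a \<noteq> a'"
    then show False using rel[of a' 1 a] sa unfolding simple_arr_def by (metis scaleR_one)
  qed
  have sKB: "simple_arr (K \<union> B)"
    unfolding KB simple_arr_def
  proof (intro conjI ballI allI impI)
    show "finite (\<phi> ` A)" using fin by simp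
    show "b \<noteq> 0" if "b \<in> \<phi> ` A" for b using that u sa by (auto simp: \<phi>_def simple_arr_def)
    fix b b' c assume b: "b \<in> \<phi> ` A" "b' \<in> \<phi> ` A" "b \<noteq> b'"
    then obtain a a' where a: "a \<in> A" "a' \<in> A" "b = \<phi> a" "b' = \<phi> a'" by blast
    then have "a \<noteq> a'" using b(3) by auto
    then show "b' \<noteq> c *\<^sub>R b" using rel[of a' c a] a sa unfolding simple_arr_def by metis
  qed
  have cK: "card K = card {a \<in> A. a \<bullet> p0 = 0}" unfolding K_def by (rule card_image) (use inj in \<open>auto intro: inj_on_subset\<close>)
  have cKB: "card (K \<union> B) = card A" unfolding KB by (rule card_image[OF inj])
  have zp: "\<phi> a \<bullet> p = 0 \<longleftrightarrow> a \<bullet> p = 0" for a p using u by (simp add: \<phi>_def)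
  have mult: "card {a \<in> K \<union> B. a \<bullet> p = 0} = card {a \<in> A. a \<bullet> p = 0}" for p
  proof -
    have "{a \<in> K \<union> B. a \<bullet> p = 0} = \<phi> ` {a \<in> A. a \<bullet> p = 0}" unfolding KB using zp by auto
    then show ?thesis using card_image[OF inj_on_subset[OF inj, of "{a \<in> A. a \<bullet> p = 0}"]] by simp
  qed
  have "lf (\<phi> a) dvd dotS (\<phi> a) \<theta> \<longleftrightarrow> lf a dvd dotS a \<theta>" for a \<theta>
  proof -
    have ds: "dotS (c *\<^sub>R v) \<theta> = cst c * dotS v \<theta>" for c v by (simp add: dotS_def algebra_simps)
    have im: "lf (c *\<^sub>R v) dvd dotS (c *\<^sub>R v) \<theta>" if "lf v dvd dotS v \<theta>" for c v
      unfolding lf_scale ds using that by (rule mult_dvd_mono[OF dvd_refl])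
    show ?thesis using im[of a "u a"] im[of "\<phi> a" "1 / u a"] u[of a] by (auto simp: \<phi>_def)
  qed
  then have "Dmod (K \<union> B) = Dmod A" unfolding KB Dmod_def by simp
  then have DA: "DA (K \<union> B) d = DA A d" for d by (simp add: DA_def)
  have "\<forall>a\<in>K. a \<bullet> p0 = 0" using zp by (auto simp: K_def)
  moreover have "\<forall>b\<in>B. b \<bullet> p0 = 1" by (auto simp: B_def \<phi>_def u_def)
  moreover have "\<forall>b\<in>K \<union> B. \<exists>c. \<exists>a\<in>A. c \<noteq> 0 \<and> b = c *\<^sub>R a" unfolding KB \<phi>_def using u by blast
  ultimately show ?thesis using sKB cK cKB mult DA by blast
qed

text \<open>For \<open>a = n - 1\<close> and \<open>b = m - n\<close> one has
  \<open>a + b = 2 k + r\<close>, hence \<open>a b - k (k + r) = (a - k) (b - k)\<close>. Both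
  factors are nonnegative, and equality makes one of them 0, which fixes the exponents.\<close>

lemma free_of_chern:
  assumes sa: "simple_arr A" and cA: "card A = 2 * k + r + 1"
    and h: "h \<noteq> 0" "\<And>a t. a \<in> A \<Longrightarrow> a \<noteq> t *\<^sub>R h"
    and hp: "h \<bullet> p0 = 0" "h \<bullet> p1 = 0" "h \<bullet> p2 = 0"
    and ind: "cross3 p0 p1 \<noteq> 0" "cross3 p0 p2 \<noteq> 0" "cross3 p1 p2 \<noteq> 0"
    and mult: "card {a \<in> A. a \<bullet> p0 = 0} + 1 = k" "2 \<le> card {a \<in> A. a \<bullet> p1 = 0}" "2 \<le> card {a \<in> A. a \<bullet> p2 = 0}"
    and ch: "has_chern_classes (ker_sheaf (grad A)) c1 (int k * int (k + r))"
  shows "sheaf_iso (ker_sheaf (grad A)) (O_sum [- int k, - int (k + r)])"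
proof -
  have ne: "A \<noteq> {}" using cA by auto
  obtain K B where KB: "simple_arr (K \<union> B)" "\<forall>a\<in>K. a \<bullet> p0 = 0" "\<forall>b\<in>B. b \<bullet> p0 = 1" "card (K \<union> B) = card A"
    "card K = card {a \<in> A. a \<bullet> p0 = 0}" "\<And>d. DA (K \<union> B) d = DA A d"
    "\<And>p. card {a \<in> K \<union> B. a \<bullet> p = 0} = card {a \<in> A. a \<bullet> p = 0}" "\<forall>b\<in>K \<union> B. \<exists>c. \<exists>a\<in>A. c \<noteq> 0 \<and> b = c *\<^sub>R a"
    using normalise[OF sa, of p0] by blast
  obtain d1 where "\<forall>d\<ge>d1. 2 * int (dim (DA A d)) = hpol (int (card A)) (int k * int (k + r)) d"
    using hilbert_log[OF sa ne ch] by blast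
  then have hilb: "2 * int (dim (DA (K \<union> B) d)) = hpol (int (card (K \<union> B))) (int k * int (k + r)) d" if "d \<ge> d1" for d
    using that KB(4,6) by simp
  have noh: "\<forall>b\<in>K \<union> B. \<forall>t. b \<noteq> t *\<^sub>R h"
  proof (intro ballI allI notI)
    fix b t assume b: "b \<in> K \<union> B" "b = t *\<^sub>R h"
    then obtain c a where a: "a \<in> A" "c \<noteq> 0" "b = c *\<^sub>R a" using KB(8) by blast
    then have "a = (1 / c) *\<^sub>R (c *\<^sub>R a)" by simp
    also have "c *\<^sub>R a = t *\<^sub>R h" using a(3) b(2) by simp
    finally have "a = (t / c) *\<^sub>R h" by simp
    then show False using h(2)[OF a(1)] by blast
  qed
  obtain C where C: "reps h (K \<union> B) C" using reps_exist[OF noh] by blast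
  have fin: "finite K" "finite B" using KB(1) by (auto simp: simple_arr_def)
  have disj: "K \<inter> B = {}" using KB(2,3) by force
  have cB: "card B = k + r + 2" using card_Un_disjoint[OF fin disj] KB(4,5) cA mult(1) by linarith
  \<comment> \<open>These are the vectors that need a finite slope in the locale
    \<open>pencil\<close>. That \<open>h\<close> is among them also keeps \<open>e\<close> from
    being a multiple of \<open>p0\<close>.\<close>
  define Z where "Z = insert h (K \<union> (\<lambda>(b, b'). b - b') ` {(b, b') \<in> B \<times> B. b \<noteq> b'})"
  have "finite {(b, b') \<in> B \<times> B. b \<noteq> b'}" by (rule finite_subset[of _ "B \<times> B"]) (use fin in auto)
  then have "finite Z" using fin by (simp add: Z_def)
  moreover have "0 \<notin> Z" using h(1) KB(1) by (auto simp: Z_def simple_arr_def)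
  ultimately obtain e where e: "\<forall>z\<in>Z. z \<bullet> e \<noteq> 0" using generic_vector by blast
  have he: "h \<bullet> e \<noteq> 0" using e by (simp add: Z_def)
  have "cross3 p0 e \<noteq> 0"
  proof
    assume "cross3 p0 e = 0"
    moreover have "p0 \<noteq> 0" using ind(1) by auto
    ultimately obtain c where "e = c *\<^sub>R p0" using cross3_eq_0_imp by blast
    then show False using he hp(1) by simp
  qed
  then interpret pencil: pencil p0 e K B
    by unfold_locales (use e KB(1,2,3) in \<open>auto simp: Z_def\<close>)
  have n1: "k + 1 \<le> card C"
    by (rule pencil.points_on_line[OF _ cB hp he ind _ _ C hilb]) (use mult KB(5,7) in auto)
  have n2: "card C + k \<le> card (K \<union> B)"
    by (rule card_reps_le[OF KB(1) h(1) C hp ind]) (use mult KB(7) in auto)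
  define a where "a = int (card C) - 1"
  define b where "b = int (card (K \<union> B)) - int (card C)"
  have ab: "a \<ge> int k" "b \<ge> int k" "a + b = 2 * int k + int r" using n1 n2 KB(4) cA by (auto simp: a_def b_def)
  have prod: "a * b - int k * int (k + r) = (a - int k) * (b - int k)"
  proof -
    have "(a - int k) * (b - int k) = a * b - int k * (a + b) + int k * int k" by (simp add: algebra_simps)
    then show ?thesis unfolding ab(3) by (simp add: algebra_simps)
  qed
  have "0 \<le> (a - int k) * (b - int k)" using ab by simp
  then have le: "int k * int (k + r) \<le> a * b" using prod by linarith
  have nn: "0 \<le> a" "0 \<le> b" using ab by linarith+
  obtain s t where st: "int k * int (k + r) = a * b" "s \<in> DA (K \<union> B) a" "t \<in> DA (K \<union> B) b" "detS Eul s t \<noteq> 0"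
    using independent_derivations[OF KB(1) h(1) C a_def nn(1) b_def nn(2) hilb le] by blast
  have st': "s \<in> DA A a" "t \<in> DA A b" using st KB(6) by simp_all
  have m: "a + b + 1 = int (card A)" "b + a + 1 = int (card A)" using ab(3) cA by simp_all
  have "(a - int k) * (b - int k) = 0" using prod st(1) by simp
  then consider "a = int k" | "b = int k" by auto
  then show ?thesis
  proof cases
    case 1
    then have "b = int (k + r)" using ab(3) by simp
    then show ?thesis using saito[OF sa ne st' m(1) st(4)] 1 by simp
  next
    case 2
    then have "a = int (k + r)" using ab(3) by simp
    moreover have "detS Eul t s = - detS Eul s t" by (simp add: detS_def algebra_simps)
    then have "detS Eul t s \<noteq> 0" using st(4) by simp
    ultimately show ?thesis using saito[OF sa ne st'(2,1) m(2)] 2 by simp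
  qed
qed

lemma proj_point_span:
  assumes "proj_point p"
  obtains v where "v \<noteq> 0" "p = span {v}"
proof -
  have p: "subspace p" "dim p = 1" using assms by (auto simp: proj_point_def)
  obtain b where b: "b \<subseteq> p" "independent b" "p \<subseteq> span b" "card b = dim p" using basis_exists[of p] by blast
  then obtain v where v: "b = {v}" using p(2) card_1_singletonE[of b] by auto
  then have "v \<noteq> 0" using b(2) dependent_zero by blast
  moreover have "p = span {v}" using b v span_minimal[OF b(1) p(1)] by blast
  ultimately show ?thesis using that by blast
qed

text \<open>A plane through the origin has a nonzero normal vector, so the choice operator does
  return an equation of the line.\<close>

lemma line_coeffs:
  assumes "proj_line L"
  shows "line_coeffs L \<noteq> 0 \<and> L = {x. line_coeffs L \<bullet> x = 0}"
proof -
  have L: "subspace L" "dim L = 2" using assms by (auto simp: proj_line_def)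
  then obtain v :: "real^3" where v: "v \<noteq> 0" "span L \<subseteq> {x. v \<bullet> x = 0}" using lowdim_subset_hyperplane[of L] by auto
  have "L = {x. v \<bullet> x = 0}"
    by (rule subspace_dim_equal) (use L v dim_hyperplane[OF v(1)] subspace_hyperplane span_superset[of L] in auto)
  then have "\<exists>v. v \<noteq> 0 \<and> L = {x. v \<bullet> x = 0}" using v(1) by blast
  then show ?thesis unfolding line_coeffs_def by (rule someI_ex)
qed

lemma span_subset_line: "span {v} \<subseteq> {x. a \<bullet> x = 0} \<longleftrightarrow> a \<bullet> v = (0::real)"
proof
  assume "span {v} \<subseteq> {x. a \<bullet> x = 0}"
  moreover have "v \<in> span {v}" by (rule span_base) simp
  ultimately show "a \<bullet> v = 0" by blast
next
  assume "a \<bullet> v = 0"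
  then have "{v} \<subseteq> {x. a \<bullet> x = 0}" by simp
  then show "span {v} \<subseteq> {x. a \<bullet> x = 0}" by (rule span_minimal[OF _ subspace_hyperplane])
qed

lemma distinct_points_cross:
  fixes v w :: "real^3"
  assumes "v \<noteq> 0" "w \<noteq> 0" "span {v} \<noteq> span {w}"
  shows "cross3 v w \<noteq> 0"
proof
  assume "cross3 v w = 0"
  then obtain c where c: "w = c *\<^sub>R v" using cross3_eq_0_imp assms(1) by blast
  then have "c \<noteq> 0" using assms(2) by auto
  then have "v = (1 / c) *\<^sub>R w" using c by simp
  then have "v \<in> span {w}" "w \<in> span {v}" using c by (metis span_base span_scale singletonI)+
  then have "span {v} = span {w}" by (simp add: span_eq)
  then show False using assms(3) by simp
qed

lemma line_coeffs_multiple: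
  assumes "proj_line L" "proj_line L'" "line_coeffs L = c *\<^sub>R line_coeffs L'"
  shows "L = L'"
proof -
  have "c \<noteq> 0" using line_coeffs[OF assms(1)] assms(3) by auto
  then have "{x. line_coeffs L \<bullet> x = 0} = {x. line_coeffs L' \<bullet> x = 0}" unfolding assms(3) by simp
  then show ?thesis using line_coeffs[OF assms(1)] line_coeffs[OF assms(2)] by simp
qed

text \<open>The bridge from lines as subspaces, in which the theorem is stated, to the equations in
  which everything above is proved.\<close>

lemma arrangement_forms:
  assumes A: "line_arrangement A"
  shows "simple_arr (line_coeffs ` A)" "card (line_coeffs ` A) = card A"
    "log_sheaf A = ker_sheaf (grad (line_coeffs ` A))"
    "point_mult A (span {v}) = card {a \<in> line_coeffs ` A. a \<bullet> v = 0}"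
proof -
  have fin: "finite A" and L: "\<And>L. L \<in> A \<Longrightarrow> proj_line L" using A by (auto simp: line_arrangement_def)
  have inj: "inj_on line_coeffs A"
  proof (rule inj_onI)
    fix L L' assume "L \<in> A" "L' \<in> A" "line_coeffs L = line_coeffs L'"
    then show "L = L'" using line_coeffs_multiple[of L L' 1] L by simp
  qed
  show "simple_arr (line_coeffs ` A)"
    unfolding simple_arr_def
  proof (intro conjI ballI allI impI)
    show "finite (line_coeffs ` A)" using fin by simp
    show "a \<noteq> 0" if a: "a \<in> line_coeffs ` A" for a
    proof -
      obtain L' where "L' \<in> A" "a = line_coeffs L'" using a by blast
      then show ?thesis using line_coeffs[OF L, of L'] by simp
    qed
    fix a b c assume ab: "a \<in> line_coeffs ` A" "b \<in> line_coeffs ` A" "a \<noteq> b"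
    then obtain L1 L2 where L12: "L1 \<in> A" "L2 \<in> A" "a = line_coeffs L1" "b = line_coeffs L2" by blast
    show "b \<noteq> c *\<^sub>R a"
    proof
      assume "b = c *\<^sub>R a"
      then have "line_coeffs L2 = c *\<^sub>R line_coeffs L1" using L12(3,4) by simp
      then have "L2 = L1" by (rule line_coeffs_multiple[OF L[OF L12(2)] L[OF L12(1)]])
      then show False using ab(3) L12 by simp
    qed
  qed
  show "card (line_coeffs ` A) = card A" by (rule card_image[OF inj])
  have "arr_poly A = defpoly (line_coeffs ` A)"
    unfolding arr_poly_def defpoly_def by (simp add: prod.reindex[OF inj])
  then show "log_sheaf A = ker_sheaf (grad (line_coeffs ` A))"
    by (intro ext) (simp add: log_sheaf_def ker_sheaf_def grad_def emb_def)
  have "span {v} \<subseteq> L \<longleftrightarrow> line_coeffs L \<bullet> v = 0" if "L \<in> A" for L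
    using line_coeffs[OF L[OF that]] span_subset_line[of v "line_coeffs L"] by metis
  then have "{a \<in> line_coeffs ` A. a \<bullet> v = 0} = line_coeffs ` {L \<in> A. span {v} \<subseteq> L}" by auto
  then show "point_mult A (span {v}) = card {a \<in> line_coeffs ` A. a \<bullet> v = 0}"
    using card_image[OF inj_on_subset[OF inj, of "{L \<in> A. span {v} \<subseteq> L}"]] by (simp add: point_mult_def)
qed

theorem theorem4:
  fixes k r m :: nat and A :: "(real ^ 3) set set" and x0 x1 x2 H :: "(real ^ 3) set"
  assumes "k \<ge> 1"
    and "m = 2 * k + r + 1"
    and "line_arrangement A" and "card A = m"
    and "proj_point x0" and "proj_point x1" and "proj_point x2"
    and "x0 \<noteq> x1" and "x0 \<noteq> x2" and "x1 \<noteq> x2"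
    and "point_mult A x0 = k - 1"
    and "point_mult A x1 \<ge> 2" and "point_mult A x2 \<ge> 2"
    and "proj_line H" and "H \<notin> A"
    and "x0 \<subseteq> H" and "x1 \<subseteq> H" and "x2 \<subseteq> H"
  shows "free_with_exponents A k (k + r) \<longleftrightarrow>
         chern2 (log_sheaf A) = int k * int (k + r)"
proof -
  let ?A = "line_coeffs ` A"
  note A = arrangement_forms[OF \<open>line_arrangement A\<close>]
  note log = A(3)
  have ne: "?A \<noteq> {}" using A(2) assms(2,4) by auto
  have hg: "homog (int (card ?A) - 1) (grad ?A i)" if "i < 3" for i by (rule homog_grad[OF A(1) that])
  obtain p0 where p0: "p0 \<noteq> 0" "x0 = span {p0}" using proj_point_span[OF \<open>proj_point x0\<close>] by blast
  obtain p1 where p1: "p1 \<noteq> 0" "x1 = span {p1}" using proj_point_span[OF \<open>proj_point x1\<close>] by blast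
  obtain p2 where p2: "p2 \<noteq> 0" "x2 = span {p2}" using proj_point_span[OF \<open>proj_point x2\<close>] by blast
  let ?h = "line_coeffs H"
  have h: "?h \<noteq> 0" "H = {x. ?h \<bullet> x = 0}" using line_coeffs[OF \<open>proj_line H\<close>] by auto
  have hp: "?h \<bullet> p0 = 0" "?h \<bullet> p1 = 0" "?h \<bullet> p2 = 0"
    using \<open>x0 \<subseteq> H\<close> \<open>x1 \<subseteq> H\<close> \<open>x2 \<subseteq> H\<close> h(2) span_subset_line[of _ ?h] unfolding p0(2) p1(2) p2(2) by metis+
  have ind: "cross3 p0 p1 \<noteq> 0" "cross3 p0 p2 \<noteq> 0" "cross3 p1 p2 \<noteq> 0"
    using distinct_points_cross p0 p1 p2 \<open>x0 \<noteq> x1\<close> \<open>x0 \<noteq> x2\<close> \<open>x1 \<noteq> x2\<close> by blast+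
  have noh: "a \<noteq> t *\<^sub>R ?h" if "a \<in> ?A" for a t
  proof
    assume e: "a = t *\<^sub>R ?h"
    obtain L where L: "L \<in> A" "a = line_coeffs L" using \<open>a \<in> ?A\<close> by blast
    then have "L = H" using line_coeffs_multiple[of L H t] e \<open>line_arrangement A\<close> \<open>proj_line H\<close>
      by (simp add: line_arrangement_def)
    then show False using L(1) \<open>H \<notin> A\<close> by simp
  qed
  show ?thesis
  proof
    \<comment> \<open>A splitting is itself a resolution, from which the classes can be read
      off.\<close>
    assume "free_with_exponents A k (k + r)"
    then have "sheaf_iso (ker_sheaf (grad ?A)) (O_sum [- int k, - int (k + r)])" by (simp add: free_with_exponents_def log)
    then have "sheaf_iso (O_sum [- int k, - int (k + r)]) (ker_sheaf (grad ?A))"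
      by (rule sheaf_iso_sym) (auto intro: ker_sheaf_closed)
    then have "has_chern_classes (ker_sheaf (grad ?A)) (- (int k + int (k + r))) (int k * int (k + r))" by (rule split_chern)
    then show "chern2 (log_sheaf A) = int k * int (k + r)" unfolding log
      using chern2_eq[where g = "grad ?A" and D = "int (card ?A) - 1", OF hg] by blast
  next
    assume c2: "chern2 (log_sheaf A) = int k * int (k + r)"
    \<comment> \<open>Only the second class is prescribed; \<open>c1\<close> is whatever some
      resolution supplies, and \<open>hilbert_log\<close> determines it.\<close>
    obtain c1 c where c: "has_chern_classes (ker_sheaf (grad ?A)) c1 c" using chern_exists[where g = "grad ?A" and D = "int (card ?A) - 1", OF hg] by blast
    have "c = int k * int (k + r)" using chern2_eq[where g = "grad ?A" and D = "int (card ?A) - 1", OF hg c] c2 log by simp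
    then have "has_chern_classes (ker_sheaf (grad ?A)) c1 (int k * int (k + r))" using c by simp
    moreover have "card {a \<in> ?A. a \<bullet> p0 = 0} + 1 = k" "2 \<le> card {a \<in> ?A. a \<bullet> p1 = 0}" "2 \<le> card {a \<in> ?A. a \<bullet> p2 = 0}"
      using A(4)[of p0] A(4)[of p1] A(4)[of p2] assms p0(2) p1(2) p2(2) by simp_all
    moreover have "card ?A = 2 * k + r + 1" using A(2) assms(2,4) by simp
    ultimately have "sheaf_iso (ker_sheaf (grad ?A)) (O_sum [- int k, - int (k + r)])"
      using free_of_chern[OF A(1) _ h(1) noh hp ind] by blast
    then show "free_with_exponents A k (k + r)" by (simp add: free_with_exponents_def log)
  qed
qed

end
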